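(* Let $(Q_n)_{n\ge1}$ be a sequence of convex polyhedra in $\mathbb{R}^3$ such that: (1) $m(Q_n)\to\inf\{m(Q):Q\text{ a convex polyhedron}\}$; (2) for every $n$, if $Q_n\neq Q_{n+1}$ (up to scaling), then $Q_n$ has fewer faces than $Q_{n+1}$; (3) for every $n$, $Q_n$ minimizes $m$ among convex polyhedra with the same number of faces as $Q_n$. Suppose that the number of quadrilateral faces of $Q_n$ with good protruding wedges is unbounded in $n$. Let $P'$ be a limit of normalized good protruding wedges $P'_i$ at quadrilateral faces $F_i$ of polyhedra $P_i$, where $(P_i)$ is a subsequence of $(Q_n)$ along which the number of quadrilateral faces with good protruding wedges increases, the $P_i$ being normalized to unit volume and the $F_i$ being chosen so that their size and associated curvature tend to $0$. Then: (i) $P'$ is degenerate and of height $0$ (it is contained in the plane of its base). (ii) For every edge $L=H_aH_b$ of the base of $P'$, $$\|v_{H_a}\|-\langle v_{H_a},u_{1,H_a}+u_{2,H_a}\rangle+\|v_{H_b}\|-\langle v_{H_b},u_{1,H_b}+u_{2,H_b}\rangle=0 .$$ (iii) $P'$ is a pyramid, i.e. its two top vertices coincide: $H'_1=H'_2$.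
   Context: A convex polyhedron is a compact convex polyhedron in $\mathbb{R}^3$ with nonempty interior; $e$ denotes total edge length, $v$ volume, and $m(P)=e(P)^3/v(P)$ is the Melzak ratio. Protruding wedges: write a convex polyhedron as the irredundant intersection $P=\bigcap_i S_i$ of closed halfspaces, one for each face. For a quadrilateral face $F_j$ (defined by $S_j$) put $P^*_j=\bigcap_{i\ne j}S_i$; the protruding polyhedron at $F_j$ is the closure of $P^*_j\setminus P$, lying on top of its base $F_j$. A wedge is a convex polyhedron with a quadrilateral base with vertices $H_1,H_2,H_3,H_4$, two further (top) vertices $H'_1,H'_2$ joined by an edge, and four further faces through the base edges (two triangles and two quadrilaterals), so that each base vertex $H_k$ is joined to exactly one top vertex by a non-base edge. A wedge is good if all its dihedral angles along the base edges are acute. A quadrilateral face has a good protruding wedge if its protruding polyhedron is a good wedge with that face as base. A normalized wedge is one rescaled so that the longest base edge has length $1$. The height of a wedge is the maximal distance of a top vertex from the plane of the base. The size of a face is its diameter. The associated curvature of a face is the sum of the angle deficits of the polyhedron at the vertices of that face, the angle deficit at a vertex being $2\pi$ minus the sum of the face angles there. Limits: convergence of normalized wedges means convergence, up to rigid motions, of the labelled vertices $(H_1,H_2,H_3,H_4,H'_1,H'_2)$ (the labelling recording the combinatorial structure); the limit may be a degenerate wedge, in which vertices may coincide or all lie in one plane. For a (possibly degenerate) wedge and a base vertex $H_k$, $v_{H_k}$ is the vector from $H_k$ to the top vertex to which it is joined by the non-base edge, and $u_{1,H_k},u_{2,H_k}$ are the unit vectors at $H_k$ along the two base edges at $H_k$,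 directed from $H_k$ towards the neighbouring base vertices (if a base edge degenerates in the limit, the limit of the corresponding unit vectors along the convergent sequence, which is chosen so that these converge). *)

theory Defs
  imports "HOL-Analysis.Analysis"
begin

section \<open>Convex polyhedra and the Melzak ratio\<close>

type_synonym pt = "real^3"

definition convex_polyhedron :: "pt set \<Rightarrow> bool" where
  "convex_polyhedron P \<longleftrightarrow> polytope P \<and> interior P \<noteq> {}"

definition vertices :: "pt set \<Rightarrow> pt set" where
  "vertices S = {x. x extreme_point_of S}"

definition total_edge_length :: "pt set \<Rightarrow> real" where
  "total_edge_length P = (\<Sum>L | L edge_of P. diameter L)"

definition melzak :: "pt set \<Rightarrow> real" where
  "melzak P = total_edge_length P ^ 3 / measure lebesgue P"

definition num_faces :: "pt set \<Rightarrow> nat" where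
  "num_faces P = card {F. F facet_of P}"

definition rigid_motion :: "(pt \<Rightarrow> pt) \<Rightarrow> bool" where
  "rigid_motion g \<longleftrightarrow> (\<exists>a f. orthogonal_transformation f \<and> g = (\<lambda>x. a + f x))"

text \<open>Polyhedra are compared up to scaling and position in space.\<close>

definition same_up_to_scaling :: "pt set \<Rightarrow> pt set \<Rightarrow> bool" where
  "same_up_to_scaling P P' \<longleftrightarrow>
     (\<exists>c g. c > 0 \<and> rigid_motion g \<and> P' = (\<lambda>x. c *\<^sub>R g x) ` P)"


section \<open>Angles and curvature\<close>

definition vec_angle :: "pt \<Rightarrow> pt \<Rightarrow> real" where
  "vec_angle u w = arccos (u \<bullet> w / (norm u * norm w))"

text \<open>The angle of a polygonal face \<open>G\<close> at its vertex \<open>v\<close>: the angle between the two edges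
  of \<open>G\<close> that end in \<open>v\<close>.\<close>

definition face_angle :: "pt set \<Rightarrow> pt \<Rightarrow> real" where
  "face_angle G v = (THE \<theta>. \<exists>x y. x \<noteq> y \<and> closed_segment v x edge_of G \<and>
      closed_segment v y edge_of G \<and> \<theta> = vec_angle (x - v) (y - v))"

definition angle_deficit :: "pt set \<Rightarrow> pt \<Rightarrow> real" where
  "angle_deficit P v = 2 * pi - (\<Sum>G | G facet_of P \<and> v \<in> G. face_angle G v)"

definition associated_curvature :: "pt set \<Rightarrow> pt set \<Rightarrow> real" where
  "associated_curvature P F = (\<Sum>v\<in>vertices F. angle_deficit P v)"

definition orth_part :: "pt \<Rightarrow> pt \<Rightarrow> pt" where
  "orth_part d x = x - (x \<bullet> d / (d \<bullet> d)) *\<^sub>R d"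

text \<open>The angle between the half-planes that are bounded by the line \<open>AB\<close> and contain
  \<open>C\<close> and \<open>D\<close>, respectively.\<close>

definition dihedral_angle :: "pt \<Rightarrow> pt \<Rightarrow> pt \<Rightarrow> pt \<Rightarrow> real" where
  "dihedral_angle A B C D = vec_angle (orth_part (B - A) (C - A)) (orth_part (B - A) (D - A))"


section \<open>Wedges\<close>

text \<open>A labelled wedge is given by its base vertices \<open>H 1, H 2, H 3, H 4\<close> and its top vertices
  \<open>T 1, T 2\<close>.  The index types \<open>4\<close> and \<open>2\<close> are the integers modulo 4 and 2 (so \<open>4 = 0\<close> in the
  first and \<open>2 = 0\<close> in the second); in particular \<open>H k\<close> and \<open>H (k + 1)\<close> are neighbours on the
  base for every \<open>k\<close>.  Every wedge can be labelled such that \<open>H 1, H 2\<close> are joined to \<open>T 1\<close> and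
  \<open>H 3, H 4\<close> are joined to \<open>T 2\<close>.\<close>

definition top_at :: "4 \<Rightarrow> 2" where
  "top_at k = (if k = 1 \<or> k = 2 then 1 else 2)"

definition wedge_body :: "(4 \<Rightarrow> pt) \<Rightarrow> (2 \<Rightarrow> pt) \<Rightarrow> pt set" where
  "wedge_body H T = convex hull (range H \<union> range T)"

definition distinct_labels :: "(4 \<Rightarrow> pt) \<Rightarrow> (2 \<Rightarrow> pt) \<Rightarrow> bool" where
  "distinct_labels H T \<longleftrightarrow> inj H \<and> inj T \<and> range H \<inter> range T = {}"

definition wedge :: "(4 \<Rightarrow> pt) \<Rightarrow> (2 \<Rightarrow> pt) \<Rightarrow> bool" where
  "wedge H T \<longleftrightarrow>
     convex_polyhedron (wedge_body H T) \<and>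
     distinct_labels H T \<and>
     vertices (wedge_body H T) = range H \<union> range T \<and>
     {F. F facet_of wedge_body H T} =
       {convex hull (range H),
        convex hull {H 1, H 2, T 1},
        convex hull {H 2, H 3, T 2, T 1},
        convex hull {H 3, H 4, T 2},
        convex hull {H 4, H 1, T 1, T 2}} \<and>
     (\<forall>k. closed_segment (H k) (H (k + 1)) edge_of wedge_body H T) \<and>
     closed_segment (T 1) (T 2) edge_of wedge_body H T \<and>
     (\<forall>k t. closed_segment (H k) (T t) edge_of wedge_body H T \<longleftrightarrow> t = top_at k)"

text \<open>The non-base face through the base edge from \<open>H k\<close> to \<open>H (k + 1)\<close> contains \<open>T (top_at k)\<close>,
  and the base contains \<open>H (k + 2)\<close>.\<close>

definition good_wedge :: "(4 \<Rightarrow> pt) \<Rightarrow> (2 \<Rightarrow> pt) \<Rightarrow> bool" where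
  "good_wedge H T \<longleftrightarrow> wedge H T \<and>
     (\<forall>k. dihedral_angle (H k) (H (k + 1)) (H (k + 2)) (T (top_at k)) < pi / 2)"

definition longest_base_edge :: "(4 \<Rightarrow> pt) \<Rightarrow> real" where
  "longest_base_edge H = Max (range (\<lambda>k. dist (H k) (H (k + 1))))"

text \<open>If the points \<open>H k\<close> are collinear, the affine hull below is smaller than a plane, and
  \<open>wedge_height\<close> dominates the distance to every plane containing the base.\<close>

definition wedge_height :: "(4 \<Rightarrow> pt) \<Rightarrow> (2 \<Rightarrow> pt) \<Rightarrow> real" where
  "wedge_height H T = Max (range (\<lambda>t. infdist (T t) (affine hull (range H))))"

definition degenerate_wedge :: "(4 \<Rightarrow> pt) \<Rightarrow> (2 \<Rightarrow> pt) \<Rightarrow> bool" where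
  "degenerate_wedge H T \<longleftrightarrow> \<not> distinct_labels H T \<or> coplanar (range H \<union> range T)"

definition side_vec :: "(4 \<Rightarrow> pt) \<Rightarrow> (2 \<Rightarrow> pt) \<Rightarrow> 4 \<Rightarrow> pt" where
  "side_vec H T k = T (top_at k) - H k"


section \<open>Protruding wedges\<close>

definition quadrilateral_face :: "pt set \<Rightarrow> pt set \<Rightarrow> bool" where
  "quadrilateral_face P F \<longleftrightarrow> F facet_of P \<and> card (vertices F) = 4"

text \<open>The intersection of the supporting halfspaces of \<open>P\<close> at all faces other than \<open>F\<close>.\<close>

definition drop_face :: "pt set \<Rightarrow> pt set \<Rightarrow> pt set" where
  "drop_face P F = \<Inter> {{x. a \<bullet> x \<le> b} | a b.
      a \<noteq> 0 \<and> P \<subseteq> {x. a \<bullet> x \<le> b} \<and>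
      (P \<inter> {x. a \<bullet> x = b}) facet_of P \<and> P \<inter> {x. a \<bullet> x = b} \<noteq> F}"

definition protruding_polyhedron :: "pt set \<Rightarrow> pt set \<Rightarrow> pt set" where
  "protruding_polyhedron P F = closure (drop_face P F - P)"

definition good_protruding_wedge ::
    "pt set \<Rightarrow> pt set \<Rightarrow> (4 \<Rightarrow> pt) \<Rightarrow> (2 \<Rightarrow> pt) \<Rightarrow> bool" where
  "good_protruding_wedge P F H T \<longleftrightarrow>
     quadrilateral_face P F \<and> good_wedge H T \<and>
     convex hull (range H) = F \<and> wedge_body H T = protruding_polyhedron P F"

definition num_good_faces :: "pt set \<Rightarrow> nat" where
  "num_good_faces P = card {F. \<exists>H T. good_protruding_wedge P F H T}"

text \<open>\<open>(H, T)\<close>, together with the unit vectors \<open>u1 k, u2 k\<close> at \<open>H k\<close>, is the limit, up to rigid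
  motions, of the labelled wedges \<open>(Hs i, Ts i)\<close> rescaled to longest base edge 1.  Note that
  \<open>sgn x = x /\<^sub>R norm x\<close> for vectors.\<close>

definition normalized_limit ::
    "(nat \<Rightarrow> 4 \<Rightarrow> pt) \<Rightarrow> (nat \<Rightarrow> 2 \<Rightarrow> pt) \<Rightarrow>
     (4 \<Rightarrow> pt) \<Rightarrow> (2 \<Rightarrow> pt) \<Rightarrow> (4 \<Rightarrow> pt) \<Rightarrow> (4 \<Rightarrow> pt) \<Rightarrow> bool" where
  "normalized_limit Hs Ts H T u1 u2 \<longleftrightarrow> (\<exists>g Hn Tn.
     (\<forall>i. rigid_motion (g i)) \<and>
     (\<forall>i k. Hn i k = g i (Hs i k /\<^sub>R longest_base_edge (Hs i))) \<and>
     (\<forall>i t. Tn i t = g i (Ts i t /\<^sub>R longest_base_edge (Hs i))) \<and>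
     (\<forall>k. (\<lambda>i. Hn i k) \<longlonglongrightarrow> H k) \<and>
     (\<forall>t. (\<lambda>i. Tn i t) \<longlonglongrightarrow> T t) \<and>
     (\<forall>k. (\<lambda>i. sgn (Hn i (k + 1) - Hn i k)) \<longlonglongrightarrow> u1 k) \<and>
     (\<forall>k. (\<lambda>i. sgn (Hn i (k - 1) - Hn i k)) \<longlonglongrightarrow> u2 k))"

end

theory Submission
  imports Defs
begin

text \<open>The assumptions of the theorem cannot hold together: a polyhedron that minimizes the Melzak ratio among the
  polyhedra with a given number of faces has no good protruding wedge that is small compared with a constant
  depending only on its total edge length at unit volume.  Along a sequence with bounded Melzak ratios and
  good wedges that shrink to a point this is violated eventually
  (\<open>minimizer_has_no_small_wedges\<close>), so that the claims about the limit hold.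

  The proof regards the total edge length as a concave functional.  The breadth of a convex set, averaged over all
  directions, is proportional to the length of a segment and to the perimeter of a planar set.  The resulting
  \<open>girth\<close> is monotone, a valuation, and superadditive for Minkowski combinations; twice the total edge length of a
  polyhedron is the sum of the girths of its facets (\<open>total_edge_length_girth\<close>).  When the normals of the
  facets are kept and only the support numbers vary, the total girth is therefore a concave function,
  whatever happens to the combinatorial type.

  Let \<open>F\<close> be a face with a good protruding wedge, and let \<open>g\<close> be the gain in total edge
  length when \<open>F\<close> is dropped, so that the wedge is added.  Minimality gives \<open>g \<ge> 0\<close>, and two variations give
  more.  In the first one, let \<open>k\<close> be the vector along the top edge.  The polyhedron is eroded along \<open>k\<close> by a small
  amount with \<open>F\<close> kept, and expanded along \<open>k\<close> by \<open>t\<close> with \<open>F\<close> dropped.  By concavity the polyhedron without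
  \<open>F\<close> has at least the weighted mean of both girths, while the volumes cancel to first order; this gives
  \<open>t * \<eta> - C * (t * norm k)\<^sup>2 \<le> g\<close>, where \<open>\<eta>\<close> is the rate at which the gain changes under the erosion
  (\<open>variation_inequality\<close>, \<open>wedge_variation\<close>).  In the second one, \<open>F\<close> is moved inwards
  a little.  By concavity in the level of \<open>F\<close> this saves edge length in proportion to \<open>g\<close>, while only a
  thin slab is lost; this bounds \<open>g\<close> by the volume of the tetrahedron between the base plane and the three
  planes of the faces at the higher top vertex (\<open>gain_le_volume\<close>).

  It remains to compare \<open>\<eta>\<close>, \<open>g\<close> and this volume.  If the line of the top edge is parallel to the base, or meets
  its plane in a point \<open>J\<close> that is far away compared with the base edge at the lower top vertex, then \<open>\<eta>\<close> is at least half the length of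
  \<open>k\<close>, and a suitable \<open>t\<close> makes \<open>g\<close> larger than the size of the wedge
  allows.  Otherwise Euler's and Ptolemy's inequalities for the quadrilateral formed by \<open>J\<close>, the lower top vertex
  and its two base vertices show that \<open>\<eta>\<close> controls the height of the wedge.  As the wedge is good, the foot of
  the higher top vertex lies in the triangle spanned by \<open>J\<close> and the other two base vertices; hence \<open>g \<ge> 0\<close>
  forces the shortest side of this triangle to be of the order of \<open>\<eta>\<close> as well.  So the volume of the tetrahedron
  is at most a constant times \<open>\<eta>\<^sup>2\<close> and a positive power of the size of the wedge, whereas the
  first variation bounds \<open>g\<close> from below by a constant times \<open>\<eta>\<^sup>2\<close>.  For small wedges this is a
  contradiction (\<open>extended_wedge_bounds\<close>, \<open>wedge_not_small\<close>).\<close>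

section \<open>Breadth and girth\<close>

definition breadth :: "pt set \<Rightarrow> pt \<Rightarrow> real" where
  "breadth S u = (SUP p\<in>S \<times> S. u \<bullet> (fst p - snd p))"

lemma breadth_attained:
  assumes "compact S" "S \<noteq> {}"
  obtains x y where "x \<in> S" "y \<in> S" "breadth S u = u \<bullet> x - u \<bullet> y"
    "\<And>z. z \<in> S \<Longrightarrow> u \<bullet> y \<le> u \<bullet> z \<and> u \<bullet> z \<le> u \<bullet> x"
proof -
  have c: "continuous_on S (\<lambda>z. u \<bullet> z)" by (intro continuous_intros)
  obtain x where x: "x \<in> S" "\<And>z. z \<in> S \<Longrightarrow> u \<bullet> z \<le> u \<bullet> x"
    using continuous_attains_sup[OF assms c] by blast
  obtain y where y: "y \<in> S" "\<And>z. z \<in> S \<Longrightarrow> u \<bullet> y \<le> u \<bullet> z"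
    using continuous_attains_inf[OF assms c] by blast
  have "breadth S u = u \<bullet> x - u \<bullet> y"
    unfolding breadth_def
  proof (rule cSup_eq_maximum)
    show "u \<bullet> x - u \<bullet> y \<in> (\<lambda>p. u \<bullet> (fst p - snd p)) ` (S \<times> S)"
      using x(1) y(1) by (force simp: inner_diff_right)
    fix w assume "w \<in> (\<lambda>p. u \<bullet> (fst p - snd p)) ` (S \<times> S)"
    then obtain a b where "a \<in> S" "b \<in> S" "w = u \<bullet> a - u \<bullet> b" by (auto simp: inner_diff_right)
    with x(2)[of a] y(2)[of b] show "w \<le> u \<bullet> x - u \<bullet> y" by simp
  qed
  with x y that show thesis by blast
qed

lemma breadth_ge:
  assumes "compact S" "x \<in> S" "y \<in> S"
  shows "u \<bullet> x - u \<bullet> y \<le> breadth S u"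
proof -
  have "S \<noteq> {}" using assms by auto
  then obtain a b where "breadth S u = u \<bullet> a - u \<bullet> b"
    "\<And>z. z \<in> S \<Longrightarrow> u \<bullet> b \<le> u \<bullet> z \<and> u \<bullet> z \<le> u \<bullet> a"
    using breadth_attained[OF assms(1)] by metis
  then show ?thesis using assms(2,3) by (smt (verit))
qed

lemma breadth_eqI:
  assumes "compact S" "x \<in> S" "y \<in> S" "\<And>z. z \<in> S \<Longrightarrow> u \<bullet> y \<le> u \<bullet> z \<and> u \<bullet> z \<le> u \<bullet> x"
  shows "breadth S u = u \<bullet> x - u \<bullet> y"
proof -
  have "S \<noteq> {}" using assms by auto
  then obtain a b where "a \<in> S" "b \<in> S" "breadth S u = u \<bullet> a - u \<bullet> b"
    "\<And>z. z \<in> S \<Longrightarrow> u \<bullet> b \<le> u \<bullet> z \<and> u \<bullet> z \<le> u \<bullet> a"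
    using breadth_attained[OF assms(1)] by metis
  then show ?thesis using assms(2-4) by (smt (verit))
qed

lemma breadth_nonneg: "compact S \<Longrightarrow> S \<noteq> {} \<Longrightarrow> 0 \<le> breadth S u"
  using breadth_ge by fastforce

lemma breadth_concave:
  assumes "compact S" "compact A" "compact B" "A \<noteq> {}" "B \<noteq> {}" "0 \<le> \<mu>" "0 \<le> \<nu>"
    and sub: "\<And>x y. x \<in> A \<Longrightarrow> y \<in> B \<Longrightarrow> \<mu> *\<^sub>R x + \<nu> *\<^sub>R y \<in> S"
  shows "\<mu> * breadth A u + \<nu> * breadth B u \<le> breadth S u"
proof -
  obtain a a' where a: "a \<in> A" "a' \<in> A" "breadth A u = u \<bullet> a - u \<bullet> a'"
    using breadth_attained[OF assms(2,4)] by metis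
  obtain b b' where b: "b \<in> B" "b' \<in> B" "breadth B u = u \<bullet> b - u \<bullet> b'"
    using breadth_attained[OF assms(3,5)] by metis
  show ?thesis
    using breadth_ge[OF assms(1) sub[OF a(1) b(1)] sub[OF a(2) b(2)], of u]
    unfolding a(3) b(3) by (simp add: inner_add_right algebra_simps)
qed

lemma inner_max_on_cut:
  fixes u a :: pt
  assumes "convex S" "x \<in> S" "y \<in> S" "a \<bullet> x \<le> c" "c \<le> a \<bullet> y"
  obtains z where "z \<in> S" "a \<bullet> z = c" "min (u \<bullet> x) (u \<bullet> y) \<le> u \<bullet> z"
proof (cases "a \<bullet> x = a \<bullet> y")
  case True
  then show ?thesis using assms that[of x] by simp
next
  case False
  define t where "t = (c - a \<bullet> x) / (a \<bullet> y - a \<bullet> x)"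
  have t: "0 \<le> t" "t \<le> 1" using assms False by (auto simp: t_def divide_simps)
  define z where "z = (1 - t) *\<^sub>R x + t *\<^sub>R y"
  have "z \<in> S" using convexD_alt[OF assms(1-3) t] by (simp add: z_def)
  moreover have "a \<bullet> z = a \<bullet> x + t * (a \<bullet> y - a \<bullet> x)"
    by (simp add: z_def inner_add_right algebra_simps)
  then have "a \<bullet> z = c" using False by (simp add: t_def)
  moreover have "u \<bullet> z = (1 - t) * (u \<bullet> x) + t * (u \<bullet> y)" by (simp add: z_def inner_add_right)
  then have "min (u \<bullet> x) (u \<bullet> y) \<le> u \<bullet> z"
    using convex_bound_le[of "- (u \<bullet> x)" "- min (u \<bullet> x) (u \<bullet> y)" "- (u \<bullet> y)" "1 - t" t] t by simp
  ultimately show ?thesis using that by blast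
qed

lemma compact_cut:
  fixes a :: pt
  assumes "compact S"
  shows "compact (S \<inter> {x. a \<bullet> x \<le> c})" "compact (S \<inter> {x. c \<le> a \<bullet> x})" "compact (S \<inter> {x. a \<bullet> x = c})"
  using compact_Int_closed[OF assms closed_halfspace_le] compact_Int_closed[OF assms closed_halfspace_ge]
    compact_Int_closed[OF assms closed_hyperplane] by auto

text \<open>The maximum of \<open>u\<close> over \<open>S\<close> is attained in one of the two parts into which the hyperplane cuts \<open>S\<close>, and the segment joining the
  maximal points of the two parts crosses the cut, so that the smaller of the two maxima is attained on the cut as well.  The same holds for the minimum.\<close>

lemma breadth_valuation:
  fixes u a :: pt
  assumes "compact S" "convex S" "S \<inter> {x. a \<bullet> x = c} \<noteq> {}"
  shows "breadth (S \<inter> {x. a \<bullet> x \<le> c}) u + breadth (S \<inter> {x. c \<le> a \<bullet> x}) u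
       = breadth S u + breadth (S \<inter> {x. a \<bullet> x = c}) u"
proof -
  let ?L = "S \<inter> {x. a \<bullet> x \<le> c}" and ?R = "S \<inter> {x. c \<le> a \<bullet> x}" and ?M = "S \<inter> {x. a \<bullet> x = c}"
  have comp: "compact ?L" "compact ?R" "compact ?M"
    using assms(1) by (simp_all add: compact_cut)
  have ne: "?L \<noteq> {}" "?R \<noteq> {}" "?M \<noteq> {}" "S \<noteq> {}" using assms(3) by auto
  obtain l l' where l: "l \<in> ?L" "l' \<in> ?L" "breadth ?L u = u \<bullet> l - u \<bullet> l'"
    "\<And>z. z \<in> ?L \<Longrightarrow> u \<bullet> l' \<le> u \<bullet> z \<and> u \<bullet> z \<le> u \<bullet> l" using breadth_attained[OF comp(1) ne(1)] by metis
  obtain r r' where r: "r \<in> ?R" "r' \<in> ?R" "breadth ?R u = u \<bullet> r - u \<bullet> r'"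
    "\<And>z. z \<in> ?R \<Longrightarrow> u \<bullet> r' \<le> u \<bullet> z \<and> u \<bullet> z \<le> u \<bullet> r" using breadth_attained[OF comp(2) ne(2)] by metis
  obtain m where m: "m \<in> ?M" "min (u \<bullet> l) (u \<bullet> r) \<le> u \<bullet> m"
    using inner_max_on_cut[OF assms(2), of l r a c u] l(1) r(1) by auto
  obtain m' where m': "m' \<in> ?M" "min (- u \<bullet> l') (- u \<bullet> r') \<le> - u \<bullet> m'"
    using inner_max_on_cut[OF assms(2), of l' r' a c "- u"] l(2) r(2) by auto
  have M: "breadth ?M u = u \<bullet> m - u \<bullet> m'"
  proof (rule breadth_eqI[OF comp(3) m(1) m'(1)])
    fix z assume "z \<in> ?M"
    then have "z \<in> ?L" "z \<in> ?R" by auto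
    with l(4) r(4) m(2) m'(2) show "u \<bullet> m' \<le> u \<bullet> z \<and> u \<bullet> z \<le> u \<bullet> m"
      by (smt (verit) inner_minus_left)
  qed
  have mm: "u \<bullet> m = min (u \<bullet> l) (u \<bullet> r)" "u \<bullet> m' = max (u \<bullet> l') (u \<bullet> r')"
    using l(4)[of m] r(4)[of m] l(4)[of m'] r(4)[of m'] m m' by auto
  have S: "breadth S u = max (u \<bullet> l) (u \<bullet> r) - min (u \<bullet> l') (u \<bullet> r')"
  proof -
    obtain x where x: "x \<in> S" "u \<bullet> x = max (u \<bullet> l) (u \<bullet> r)" using l(1) r(1) by (metis IntE max_def)
    obtain y where y: "y \<in> S" "u \<bullet> y = min (u \<bullet> l') (u \<bullet> r')" using l(2) r(2) by (metis IntE min_def)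
    have "breadth S u = u \<bullet> x - u \<bullet> y"
    proof (rule breadth_eqI[OF assms(1) x(1) y(1)])
      fix z assume "z \<in> S"
      then have "z \<in> ?L \<or> z \<in> ?R" by auto
      with l(4)[of z] r(4)[of z] x y show "u \<bullet> y \<le> u \<bullet> z \<and> u \<bullet> z \<le> u \<bullet> x" by auto
    qed
    with x y show ?thesis by simp
  qed
  show ?thesis unfolding S M l(3) r(3) mm by (simp add: max_def min_def)
qed

lemma breadth_hull_eqI:
  assumes "finite A" "x \<in> A" "y \<in> A" "\<And>z. z \<in> A \<Longrightarrow> u \<bullet> y \<le> u \<bullet> z \<and> u \<bullet> z \<le> u \<bullet> x"
  shows "breadth (convex hull A) u = u \<bullet> x - u \<bullet> y"
proof (rule breadth_eqI)
  show "compact (convex hull A)" using assms(1) by (simp add: finite_imp_compact_convex_hull)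
  show "x \<in> convex hull A" "y \<in> convex hull A" using assms by (auto intro: hull_inc)
  fix z assume z: "z \<in> convex hull A"
  have "convex hull A \<subseteq> {z. u \<bullet> y \<le> u \<bullet> z} \<inter> {z. u \<bullet> z \<le> u \<bullet> x}"
    using assms(4) by (intro hull_minimal convex_Int convex_halfspace_le convex_halfspace_ge) auto
  with z show "u \<bullet> y \<le> u \<bullet> z \<and> u \<bullet> z \<le> u \<bullet> x" by auto
qed

lemma breadth_hull:
  assumes "finite A" "A \<noteq> {}"
  shows "breadth (convex hull A) u = Max ((\<bullet>) u ` A) - Min ((\<bullet>) u ` A)"
proof -
  have fin: "finite ((\<bullet>) u ` A)" "(\<bullet>) u ` A \<noteq> {}" using assms by auto
  obtain x where x: "x \<in> A" "Max ((\<bullet>) u ` A) = u \<bullet> x" using Max_in[OF fin] by auto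
  obtain y where y: "y \<in> A" "Min ((\<bullet>) u ` A) = u \<bullet> y" using Min_in[OF fin] by auto
  have "breadth (convex hull A) u = u \<bullet> x - u \<bullet> y"
  proof (rule breadth_hull_eqI[OF assms(1) x(1) y(1)])
    fix z assume "z \<in> A"
    then show "u \<bullet> y \<le> u \<bullet> z \<and> u \<bullet> z \<le> u \<bullet> x"
      unfolding x(2)[symmetric] y(2)[symmetric] using fin(1) by simp
  qed
  with x y show ?thesis by simp
qed

lemma breadth_segment: "breadth (closed_segment a b) u = \<bar>u \<bullet> (b - a)\<bar>"
proof -
  have "max p q - min p q = \<bar>q - p\<bar>" for p q :: real by linarith
  from this[of "u \<bullet> a" "u \<bullet> b"] show ?thesis
    by (simp add: segment_convex_hull breadth_hull inner_diff_right)
qed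

lemma breadth_triangle:
  "2 * breadth (convex hull {a, b, c}) u = \<bar>u \<bullet> (b - a)\<bar> + \<bar>u \<bullet> (c - b)\<bar> + \<bar>u \<bullet> (a - c)\<bar>"
proof -
  have "2 * (max p (max q r) - min p (min q r)) = \<bar>q - p\<bar> + \<bar>r - q\<bar> + \<bar>p - r\<bar>" for p q r :: real
    by (cases "p \<le> q"; cases "q \<le> r"; cases "p \<le> r") simp_all
  from this[of "u \<bullet> a" "u \<bullet> b" "u \<bullet> c"] show ?thesis
    by (simp add: breadth_hull inner_diff_right)
qed

lemma cyclic_variation_unimodal:
  fixes p q r s m :: real
  assumes "min p r \<le> m" "m \<le> max p r" "min q s \<le> m" "m \<le> max q s"
  shows "2 * (max p (max q (max r s)) - min p (min q (min r s)))
     = \<bar>q - p\<bar> + \<bar>r - q\<bar> + \<bar>s - r\<bar> + \<bar>p - s\<bar>"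
proof (cases "p \<le> r"; cases "q \<le> s")
qed (use assms in \<open>simp_all add: max_def min_def abs_if split: if_splits\<close>)

text \<open>The values of \<open>u\<close> at the four vertices, taken in cyclic order, rise and fall only once, because both diagonals take
  the value of \<open>u\<close> at their common point.\<close>

lemma breadth_quadrilateral:
  assumes "closed_segment a c \<inter> closed_segment b d \<noteq> {}"
  shows "2 * breadth (convex hull {a, b, c, d}) u
     = \<bar>u \<bullet> (b - a)\<bar> + \<bar>u \<bullet> (c - b)\<bar> + \<bar>u \<bullet> (d - c)\<bar> + \<bar>u \<bullet> (a - d)\<bar>"
proof -
  obtain m where m: "m \<in> closed_segment a c" "m \<in> closed_segment b d" using assms by auto
  have seg: "min (u \<bullet> p) (u \<bullet> q) \<le> u \<bullet> m \<and> u \<bullet> m \<le> max (u \<bullet> p) (u \<bullet> q)"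
    if "m \<in> closed_segment p q" for p q
  proof -
    have "closed_segment p q \<subseteq> {z. min (u \<bullet> p) (u \<bullet> q) \<le> u \<bullet> z} \<inter> {z. u \<bullet> z \<le> max (u \<bullet> p) (u \<bullet> q)}"
      unfolding segment_convex_hull
      by (intro hull_minimal convex_Int convex_halfspace_le convex_halfspace_ge) auto
    with that show ?thesis by auto
  qed
  show ?thesis
    using cyclic_variation_unimodal[of "u \<bullet> a" "u \<bullet> c" "u \<bullet> m" "u \<bullet> b" "u \<bullet> d"] seg[OF m(1)] seg[OF m(2)]
    by (simp add: breadth_hull inner_diff_right)
qed

text \<open>The breadth depends continuously on the direction, so that it can be averaged.\<close>

lemma breadth_lipschitz:
  assumes "compact S" "S \<noteq> {}" "\<And>x y. x \<in> S \<Longrightarrow> y \<in> S \<Longrightarrow> norm (x - y) \<le> B"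
  shows "breadth S u \<le> breadth S v + norm (u - v) * B"
proof -
  obtain x y where xy: "x \<in> S" "y \<in> S" "breadth S u = u \<bullet> x - u \<bullet> y"
    using breadth_attained[OF assms(1,2)] by metis
  have "u \<bullet> x - u \<bullet> y = (v \<bullet> x - v \<bullet> y) + (u - v) \<bullet> (x - y)" by (simp add: algebra_simps)
  moreover have "v \<bullet> x - v \<bullet> y \<le> breadth S v" using breadth_ge[OF assms(1)] xy by auto
  moreover have "(u - v) \<bullet> (x - y) \<le> norm (u - v) * B"
    using norm_cauchy_schwarz[of "u - v" "x - y"] mult_left_mono[OF assms(3)[OF xy(1,2)], of "norm (u - v)"]
    by simp
  ultimately show ?thesis using xy by simp
qed

lemma breadth_continuous:
  assumes "compact S" "S \<noteq> {}"
  shows "continuous_on U (breadth S)"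
proof -
  obtain B where B: "\<And>x y. x \<in> S \<Longrightarrow> y \<in> S \<Longrightarrow> norm (x - y) \<le> B"
    using compact_imp_bounded[OF assms(1)] by (metis bounded_two_points dist_norm)
  have "0 \<le> B" using B assms(2) by (metis ex_in_conv norm_ge_zero order_trans)
  have L: "\<bar>breadth S u - breadth S v\<bar> \<le> B * norm (u - v)" for u v
    using breadth_lipschitz[OF assms B, of u v] breadth_lipschitz[OF assms B, of v u]
    by (simp add: norm_minus_commute mult.commute abs_le_iff)
  have "B-lipschitz_on U (breadth S)"
    using \<open>0 \<le> B\<close> L by (intro lipschitz_onI) (auto simp: dist_norm)
  then show ?thesis by (rule lipschitz_on_continuous_on)
qed

text \<open>The breadth is averaged over the directions in the unit ball.  As the average of
  \<open>\<bar>u \<bullet> w\<bar>\<close> is proportional to \<open>norm w\<close>, this recovers Euclidean lengths.\<close>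

definition mean_breadth :: "pt set \<Rightarrow> real" where
  "mean_breadth S = integral (cball 0 1) (breadth S)"

lemma continuous_integrable_on_ball:
  assumes "continuous_on UNIV f"
  shows "(f :: pt \<Rightarrow> real) integrable_on cball 0 1"
proof -
  have "set_integrable lborel (cball 0 1) f"
    unfolding set_integrable_def
    by (rule borel_integrable_compact) (use assms continuous_on_subset in \<open>auto\<close>)
  then show ?thesis by (rule set_borel_integral_eq_integral)
qed

lemma breadth_integrable:
  "compact S \<Longrightarrow> S \<noteq> {} \<Longrightarrow> breadth S integrable_on cball 0 1"
  by (rule continuous_integrable_on_ball[OF breadth_continuous])

definition unit_mean :: real where
  "unit_mean = integral (cball 0 1) (\<lambda>u :: pt. \<bar>u \<bullet> axis 1 1\<bar>)"

lemma abs_inner_integrable: "(\<lambda>u :: pt. \<bar>u \<bullet> w\<bar>) integrable_on cball 0 1"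
  by (intro continuous_integrable_on_ball continuous_intros)

text \<open>An orthogonal transformation takes a multiple of the first unit vector to \<open>w\<close> and preserves the ball.\<close>

lemma integral_abs_inner: "integral (cball 0 1) (\<lambda>u :: pt. \<bar>u \<bullet> w\<bar>) = norm w * unit_mean"
proof -
  have "norm (norm w *\<^sub>R (axis 1 1 :: pt)) = norm w" by simp
  then obtain f :: "pt \<Rightarrow> pt" where f: "orthogonal_transformation f" "f (norm w *\<^sub>R axis 1 1) = w"
    using orthogonal_transformation_exists by metis
  have lin: "linear f" using f(1) by (simp add: orthogonal_transformation_def)
  have ball: "f ` cball 0 1 = cball 0 1"
  proof -
    have "f 0 = 0" using lin by (simp add: linear_0)
    then show ?thesis using image_orthogonal_transformation_cball[OF f(1), of 0 1] by simp
  qed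
  have det: "\<bar>det (matrix f)\<bar> = 1"
    using f(1) det_orthogonal_matrix orthogonal_transformation_matrix by (metis abs_minus_cancel abs_one)
  define h where "h = (\<lambda>u :: pt. \<bar>u \<bullet> w\<bar> *\<^sub>R (axis 1 1 :: pt))"
  have h_abs: "h absolutely_integrable_on cball 0 1"
  proof -
    have "set_integrable lborel (cball 0 1) h"
      unfolding set_integrable_def h_def
      by (rule borel_integrable_compact) (auto intro!: continuous_intros)
    then show ?thesis unfolding set_integrable_def
      by (subst integrable_completion) auto
  qed
  have "integral (f ` cball 0 1) h = \<bar>det (matrix f)\<bar> *\<^sub>R integral (cball 0 1) (h \<circ> f)"
    by (rule integral_change_of_variables_linear[OF lin]) (use h_abs ball in auto)
  then have eq: "integral (cball 0 1) h = integral (cball 0 1) (h \<circ> f)" using ball det by simp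
  have hf: "h \<circ> f = (\<lambda>u. (norm w * \<bar>u \<bullet> axis 1 1\<bar>) *\<^sub>R axis 1 1)"
  proof
    fix u
    have "f u \<bullet> w = u \<bullet> (norm w *\<^sub>R axis 1 1)"
      using f by (metis orthogonal_transformation_def)
    then show "(h \<circ> f) u = (norm w * \<bar>u \<bullet> axis 1 1\<bar>) *\<^sub>R axis 1 1"
      by (simp add: h_def abs_mult)
  qed
  have scal: "integral (cball 0 1) (\<lambda>u. g u *\<^sub>R (axis 1 1 :: pt)) = integral (cball 0 1) g *\<^sub>R axis 1 1"
    if "g integrable_on cball 0 1" for g :: "pt \<Rightarrow> real"
    using has_integral_scaleR_left[OF integrable_integral[OF that]] by (rule integral_unique)
  have "integral (cball 0 1) h = integral (cball 0 1) (\<lambda>u :: pt. \<bar>u \<bullet> w\<bar>) *\<^sub>R axis 1 1"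
    unfolding h_def by (rule scal[OF abs_inner_integrable])
  moreover have "integral (cball 0 1) (h \<circ> f)
      = integral (cball 0 1) (\<lambda>u :: pt. norm w * \<bar>u \<bullet> axis 1 1\<bar>) *\<^sub>R axis 1 1"
    unfolding hf by (rule scal) (intro integrable_on_mult_right abs_inner_integrable)
  ultimately have "integral (cball 0 1) (\<lambda>u :: pt. \<bar>u \<bullet> w\<bar>)
      = integral (cball 0 1) (\<lambda>u :: pt. norm w * \<bar>u \<bullet> axis 1 1\<bar>)"
    using eq by (simp add: axis_eq_0_iff)
  then show ?thesis by (simp add: unit_mean_def)
qed

lemma unit_mean_pos: "0 < unit_mean"
proof -
  define a b :: pt where "a = (\<chi> i. 1/4)" and "b = (\<chi> i. 1/2)"
  have sub: "cbox a b \<subseteq> cball 0 1"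
  proof
    fix x assume x: "x \<in> cbox a b"
    have "norm x \<le> (\<Sum>i\<in>UNIV. \<bar>x $ i\<bar>)" by (rule norm_le_l1_cart)
    have "(norm x)\<^sup>2 = (\<Sum>i\<in>UNIV. (x $ i)\<^sup>2)"
      by (simp add: norm_vec_def L2_set_def sum_nonneg)
    also have "\<dots> \<le> (\<Sum>i\<in>(UNIV::3 set). 1/4)"
    proof (rule sum_mono)
      fix i :: 3
      have "0 \<le> x $ i" "x $ i \<le> 1/2" using x by (auto simp: mem_box_cart a_def b_def intro: order_trans[of 0 "1/4"])
      then have "(x $ i)\<^sup>2 \<le> (1/2)\<^sup>2" by (intro power_mono)
      then show "(x $ i)\<^sup>2 \<le> 1/4" by (simp add: power2_eq_square)
    qed
    also have "\<dots> \<le> 1" by simp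
    finally have "norm x \<le> 1" using power2_le_imp_le[of "norm x" 1] by simp
    then show "x \<in> cball 0 1" by simp
  qed
  have "0 < measure lborel (cbox a b)"
    by (subst content_pos_lt_eq) (auto simp: Basis_vec_def a_def b_def inner_axis)
  moreover have "integral (cbox a b) (\<lambda>u. 1/4 :: real) \<le> integral (cbox a b) (\<lambda>u. \<bar>u \<bullet> axis 1 1\<bar>)"
    by (rule integral_le)
       (auto intro!: integrable_continuous continuous_intros
         simp: inner_axis mem_box_cart a_def b_def dest!: spec[of _ 1])
  moreover have "integral (cbox a b) (\<lambda>u. \<bar>u \<bullet> axis 1 1\<bar>) \<le> unit_mean"
    unfolding unit_mean_def
    by (rule integral_subset_le[OF sub])
       (auto intro!: integrable_continuous continuous_intros abs_inner_integrable)
  ultimately show ?thesis by (simp add: ac_simps)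
qed

text \<open>The girth of a planar convex set is its perimeter, where a segment counts twice.\<close>

definition girth :: "pt set \<Rightarrow> real" where
  "girth S = 2 * mean_breadth S / unit_mean"

text \<open>If the breadth is a combination of functions \<open>\<bar>u \<bullet> w\<bar>\<close>, then averaging replaces each of them by \<open>norm w\<close>.\<close>

lemma girth_eqI:
  assumes "compact S" "S \<noteq> {}"
    and "\<And>u. 2 * breadth S u = (\<Sum>w\<leftarrow>ws. \<bar>u \<bullet> w\<bar>)"
  shows "girth S = (\<Sum>w\<leftarrow>ws. norm w)"
proof -
  have "((\<lambda>u. \<Sum>w\<leftarrow>ws. \<bar>u \<bullet> w\<bar>) has_integral (\<Sum>w\<leftarrow>ws. norm w * unit_mean)) (cball 0 1)"
  proof (induction ws)
    case (Cons w ws)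
    have "((\<lambda>u. \<bar>u \<bullet> w\<bar>) has_integral norm w * unit_mean) (cball 0 1)"
      using integrable_integral[OF abs_inner_integrable[of w]] by (simp add: integral_abs_inner)
    from has_integral_add[OF this Cons] show ?case by simp
  qed auto
  moreover have "(\<lambda>u. \<Sum>w\<leftarrow>ws. \<bar>u \<bullet> w\<bar>) = (\<lambda>u. 2 * breadth S u)" using assms(3) by auto
  ultimately have "((\<lambda>u. 2 * breadth S u) has_integral (\<Sum>w\<leftarrow>ws. norm w * unit_mean)) (cball 0 1)" by simp
  then have "2 * mean_breadth S = (\<Sum>w\<leftarrow>ws. norm w * unit_mean)"
    unfolding mean_breadth_def
    by (metis integral_mult_right integral_unique)
  then show ?thesis using unit_mean_pos by (simp add: girth_def sum_list_mult_const)
qed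

lemma girth_segment: "girth (closed_segment a b) = 2 * dist a b"
proof -
  have "girth (closed_segment a b) = (\<Sum>w\<leftarrow>[b - a, b - a]. norm w)"
    by (rule girth_eqI) (auto simp: breadth_segment)
  then show ?thesis by (simp add: dist_norm norm_minus_commute)
qed

lemma girth_triangle: "girth (convex hull {a, b, c}) = dist a b + dist b c + dist c a"
proof -
  have "girth (convex hull {a,b,c}) = (\<Sum>w\<leftarrow>[b - a, c - b, a - c]. norm w)"
    by (rule girth_eqI) (auto simp del: inner_diff_right simp: breadth_triangle finite_imp_compact_convex_hull)
  then show ?thesis by (simp add: dist_norm norm_minus_commute)
qed

lemma girth_quadrilateral:
  assumes "closed_segment a c \<inter> closed_segment b d \<noteq> {}"
  shows "girth (convex hull {a, b, c, d}) = dist a b + dist b c + dist c d + dist d a"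
proof -
  have "girth (convex hull {a,b,c,d}) = (\<Sum>w\<leftarrow>[b - a, c - b, d - c, a - d]. norm w)"
    by (rule girth_eqI) (simp_all add: breadth_quadrilateral[OF assms] finite_imp_compact_convex_hull)
  then show ?thesis by (simp add: dist_norm norm_minus_commute)
qed

lemma girth_nonneg: "compact S \<Longrightarrow> S \<noteq> {} \<Longrightarrow> 0 \<le> girth S"
  unfolding girth_def mean_breadth_def
  using unit_mean_pos
  by (intro divide_nonneg_nonneg mult_nonneg_nonneg integral_nonneg breadth_integrable)
     (auto intro: breadth_nonneg)

text \<open>The difference \<open>u \<bullet> x - u \<bullet> y\<close> is linear in the pair of points at which the breadth is attained.\<close>

lemma girth_concave:
  assumes "compact S" "compact A" "compact B" "A \<noteq> {}" "B \<noteq> {}" "0 \<le> \<mu>" "0 \<le> \<nu>"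
    and sub: "\<And>x y. x \<in> A \<Longrightarrow> y \<in> B \<Longrightarrow> \<mu> *\<^sub>R x + \<nu> *\<^sub>R y \<in> S"
  shows "\<mu> * girth A + \<nu> * girth B \<le> girth S"
proof -
  have ne: "S \<noteq> {}" using assms by (metis equals0I empty_iff ex_in_conv)
  note int = breadth_integrable[OF assms(2,4)] breadth_integrable[OF assms(3,5)] breadth_integrable[OF assms(1) ne]
  have "integral (cball 0 1) (\<lambda>u. \<mu> * breadth A u + \<nu> * breadth B u) \<le> mean_breadth S"
    unfolding mean_breadth_def
    by (rule integral_le) (use int breadth_concave[OF assms] in \<open>auto intro!: integrable_add integrable_on_mult_right\<close>)
  moreover have "integral (cball 0 1) (\<lambda>u. \<mu> * breadth A u + \<nu> * breadth B u)
      = \<mu> * mean_breadth A + \<nu> * mean_breadth B"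
    unfolding mean_breadth_def
    by (subst integral_add) (use int in \<open>auto intro!: integrable_on_mult_right\<close>)
  ultimately have "(\<mu> * mean_breadth A + \<nu> * mean_breadth B) * (2 / unit_mean) \<le> mean_breadth S * (2 / unit_mean)"
    using unit_mean_pos by (intro mult_right_mono) auto
  then show ?thesis by (simp add: girth_def algebra_simps)
qed

lemma girth_mono:
  assumes "compact S" "compact T" "S \<noteq> {}" "S \<subseteq> T"
  shows "girth S \<le> girth T"
  using girth_concave[of T S S 1 0] assms by auto

lemma girth_valuation:
  fixes a :: pt
  assumes "compact S" "convex S" "S \<inter> {x. a \<bullet> x = c} \<noteq> {}"
  shows "girth (S \<inter> {x. a \<bullet> x \<le> c}) + girth (S \<inter> {x. c \<le> a \<bullet> x})
       = girth S + girth (S \<inter> {x. a \<bullet> x = c})"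
proof -
  let ?L = "S \<inter> {x. a \<bullet> x \<le> c}" and ?R = "S \<inter> {x. c \<le> a \<bullet> x}" and ?M = "S \<inter> {x. a \<bullet> x = c}"
  have comp: "compact ?L" "compact ?R" "compact ?M"
    using assms(1) by (simp_all add: compact_cut)
  have ne: "?L \<noteq> {}" "?R \<noteq> {}" "?M \<noteq> {}" "S \<noteq> {}" using assms(3) by auto
  note int = breadth_integrable[OF comp(1) ne(1)] breadth_integrable[OF comp(2) ne(2)]
    breadth_integrable[OF comp(3) ne(3)] breadth_integrable[OF assms(1) ne(4)]
  have "mean_breadth ?L + mean_breadth ?R = integral (cball 0 1) (\<lambda>u. breadth ?L u + breadth ?R u)"
    unfolding mean_breadth_def by (rule integral_add[symmetric]) (use int in auto)
  also have "\<dots> = integral (cball 0 1) (\<lambda>u. breadth S u + breadth ?M u)"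
    using breadth_valuation[OF assms] by simp
  also have "\<dots> = mean_breadth S + mean_breadth ?M"
    unfolding mean_breadth_def by (rule integral_add) (use int in auto)
  finally show ?thesis by (simp only: girth_def add_divide_distrib[symmetric] distrib_left[symmetric])
qed

section \<open>The total edge length as a sum over the facets\<close>

lemma edge_segment:
  assumes "L edge_of S" "polytope S"
  shows "\<exists>a b. a \<noteq> b \<and> L = closed_segment a b"
proof -
  have "polytope L" "aff_dim L = 1"
    using assms face_of_polytope_polytope by (auto simp: edge_of_def)
  moreover have "collinear L" using \<open>aff_dim L = 1\<close> by (simp add: collinear_aff_dim)
  moreover have "L \<noteq> {}" using \<open>aff_dim L = 1\<close> by auto
  ultimately obtain a b where ab: "L = closed_segment a b"
    using compact_convex_collinear_segment[of L] polytope_imp_compact[of L] polytope_imp_convex[of L] by metis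
  have "a \<noteq> b"
  proof
    assume "a = b"
    then have "L = {a}" using ab by simp
    then show False using \<open>aff_dim L = 1\<close> by simp
  qed
  with ab show ?thesis by blast
qed

lemma diameter_closed_segment: "diameter (closed_segment a b) = dist a (b :: pt)"
proof (rule antisym)
  show "diameter (closed_segment a b) \<le> dist a b"
  proof (rule diameter_le)
    fix x y assume xy: "x \<in> closed_segment a b" "y \<in> closed_segment a b"
    have "norm (y - a) \<le> dist a b" "norm (y - b) \<le> dist a b"
      using segment_bound[OF xy(2)] by (simp_all add: dist_norm norm_minus_commute)
    then show "norm (x - y) \<le> dist a b"
      using dist_decreases_closed_segment[OF xy(1), of y] by (auto simp: dist_norm norm_minus_commute)
  qed simp
  have "bounded (closed_segment a b)" by (simp add: compact_imp_bounded)
  then show "dist a b \<le> diameter (closed_segment a b)"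
    by (rule diameter_bounded_bound) simp_all
qed

lemma girth_edge: "L edge_of S \<Longrightarrow> polytope S \<Longrightarrow> girth L = 2 * diameter (L :: pt set)"
proof -
  assume "L edge_of S" "polytope S"
  then obtain a b where "L = closed_segment a b" using edge_segment[of L S] by blast
  then show ?thesis by (simp add: girth_segment diameter_closed_segment)
qed

text \<open>The line meets the polygon in a segment whose relative interior is relatively interior to the polygon.  Each of its two
  ends lies on the boundary, hence on an edge, and on only one edge because two edges meet in vertices.\<close>

lemma polygon_level_edges:
  fixes X :: "pt set"
  assumes X: "polytope X" "aff_dim X = 2"
    and xy: "x \<in> X" "y \<in> X" "u \<bullet> y < c" "c < u \<bullet> x"
    and nv: "\<And>v. v extreme_point_of X \<Longrightarrow> u \<bullet> v \<noteq> c"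
  shows "card {L. L edge_of X \<and> c \<in> (\<bullet>) u ` L} = 2"
proof -
  have conv: "convex X" and comp: "compact X" and phX: "polyhedron X"
    using X by (simp_all add: polytope_imp_convex polytope_imp_compact polytope_imp_polyhedron)
  have "X \<noteq> {}" using xy by auto
  then obtain r0 where r0: "r0 \<in> rel_interior X" using conv rel_interior_eq_empty by blast
  obtain m where m: "m \<in> rel_interior X" "u \<bullet> m = c"
  proof -
    have *: "\<exists>m. m \<in> rel_interior X \<and> u \<bullet> m = c"
      if z: "z \<in> X" "(u \<bullet> r0 < c \<and> c < u \<bullet> z) \<or> (u \<bullet> z < c \<and> c < u \<bullet> r0)" for z
    proof -
      define t where "t = (c - u \<bullet> r0) / (u \<bullet> z - u \<bullet> r0)"
      have t: "0 < t" "t < 1" using z(2) by (auto simp: t_def divide_simps)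
      define w where "w = (1 - t) *\<^sub>R r0 + t *\<^sub>R z"
      have "r0 \<noteq> z" using z(2) by auto
      then have "w \<in> open_segment r0 z" using t by (auto simp: in_segment w_def)
      then have "w \<in> rel_interior X"
        using rel_interior_closure_convex_segment[OF conv r0] z(1) closure_subset by blast
      moreover have "u \<bullet> w = u \<bullet> r0 + t * (u \<bullet> z - u \<bullet> r0)" by (simp add: w_def inner_add_right algebra_simps)
      then have "u \<bullet> w = c" using z(2) by (auto simp: t_def)
      ultimately show ?thesis by blast
    qed
    consider "u \<bullet> r0 = c" | "u \<bullet> r0 < c" | "c < u \<bullet> r0" by linarith
    then show thesis
    proof cases
      case 1
      then show ?thesis using that r0 by blast
    next
      case 2
      then show ?thesis using *[of x] that xy by blast
    next
      case 3
      then show ?thesis using *[of y] that xy by blast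
    qed
  qed
  let ?T = "{z. u \<bullet> z = c}"
  have affT: "affine ?T" by (rule affine_hyperplane)
  have mT: "rel_interior X \<inter> ?T \<noteq> {}" using m by auto
  have dimA: "aff_dim (affine hull X \<inter> ?T) = 1"
  proof -
    have "m \<in> affine hull X" using m(1) rel_interior_subset[of X] hull_subset[of X affine] by blast
    then have "affine hull X \<inter> ?T \<noteq> {}" using m by auto
    moreover have "\<not> affine hull X \<subseteq> ?T" using xy(1,4) hull_inc[of x X affine] by auto
    ultimately show ?thesis using aff_dim_affine_Int_hyperplane[OF affine_affine_hull, of X u c] X(2) by simp
  qed
  have "X \<inter> ?T \<subseteq> affine hull X \<inter> ?T" using hull_subset[of X affine] by blast
  then have "aff_dim (X \<inter> ?T) \<le> 1" using aff_dim_subset[of "X \<inter> ?T"] dimA by metis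
  then have "collinear (X \<inter> ?T)" by (simp add: collinear_aff_dim)
  moreover have "compact (X \<inter> ?T)" by (rule compact_cut(3)[OF comp])
  moreover have "convex (X \<inter> ?T)" by (intro convex_Int conv convex_hyperplane)
  moreover have "X \<inter> ?T \<noteq> {}" using m rel_interior_subset[of X] by blast
  ultimately obtain p q where pq: "X \<inter> ?T = closed_segment p q"
    using compact_convex_collinear_segment[of "X \<inter> ?T"] by metis
  have "p \<noteq> q"
  proof
    assume "p = q"
    then have single: "X \<inter> ?T = {p}" using pq by simp
    have mX: "m \<in> X" using m(1) rel_interior_subset[of X] by blast
    then have "m = p" using single m by auto
    have "affine hull X \<inter> ?T \<noteq> {m}" using dimA by auto
    moreover have "m \<in> affine hull X \<inter> ?T" using mX m(2) hull_subset[of X affine] by blast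
    ultimately obtain m' where m': "m' \<in> affine hull X" "u \<bullet> m' = c" "m' \<noteq> m" by blast
    obtain e where e: "0 < e" "ball m e \<inter> affine hull X \<subseteq> X" using m(1) by (auto simp: mem_rel_interior_ball)
    define t where "t = e / (2 * norm (m' - m))"
    have tpos: "0 < t" using e m' by (simp add: t_def)
    define w where "w = (1 - t) *\<^sub>R m + t *\<^sub>R m'"
    have "w \<in> affine hull X" unfolding w_def
      by (rule mem_affine[OF affine_affine_hull]) (use mX m' hull_inc in \<open>auto\<close>)
    moreover have "w - m = t *\<^sub>R (m' - m)" by (simp add: w_def algebra_simps)
    then have wm: "norm (w - m) = e / 2" using tpos m' e by (simp add: t_def)
    then have "w \<in> ball m e" using e by (simp add: dist_norm norm_minus_commute)
    ultimately have "w \<in> X" using e by auto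
    moreover have "u \<bullet> w = c" using m m' by (simp add: w_def inner_add_right algebra_simps)
    ultimately have "w = m" using single \<open>m = p\<close> by auto
    then show False using wm e by simp
  qed
  have frontier: "z \<in> {p, q}" if "z \<in> X" "u \<bullet> z = c" "z \<notin> rel_interior X" for z
  proof -
    have "z \<in> closed_segment p q" using that pq by auto
    moreover have "rel_interior (closed_segment p q) = rel_interior X \<inter> ?T"
      using convex_affine_rel_interior_Int[OF conv affT mT] pq by simp
    then have "z \<notin> open_segment p q" using that \<open>p \<noteq> q\<close> by (auto simp: rel_interior_closed_segment)
    ultimately show ?thesis by (auto simp: open_segment_def)
  qed
  have ends: "z \<in> X" "u \<bullet> z = c" "z \<notin> rel_interior X" if "z \<in> {p, q}" for z
  proof -
    show "z \<in> X" "u \<bullet> z = c" using that pq by auto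
    have "rel_interior (closed_segment p q) = rel_interior X \<inter> ?T"
      using convex_affine_rel_interior_Int[OF conv affT mT] pq by simp
    then show "z \<notin> rel_interior X" using that \<open>p \<noteq> q\<close> \<open>u \<bullet> z = c\<close>
      by (auto simp: rel_interior_closed_segment open_segment_def)
  qed
  have facet_edge: "L facet_of X \<longleftrightarrow> L edge_of X" for L
    using X(2) by (auto simp: facet_of_def edge_of_def)
  have edges_off: "z \<notin> rel_interior X" if "L edge_of X" "z \<in> L" for L z
  proof -
    have "L \<noteq> X" "L face_of X" using that(1) X(2) by (auto simp: edge_of_def)
    then show ?thesis using face_of_disjoint_rel_interior[of L X] that(2) by blast
  qed
  have ex1: "\<exists>!L. L edge_of X \<and> z \<in> L" if z: "z \<in> {p, q}" for z
  proof -
    have "z \<in> X - rel_interior X" using ends z by auto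
    then obtain L where L: "L edge_of X" "z \<in> L"
      using rel_boundary_of_polyhedron[OF phX] facet_edge by auto
    moreover have "L' = L" if L': "L' edge_of X" "z \<in> L'" for L'
    proof (rule ccontr)
      assume ne: "L' \<noteq> L"
      have faces: "L face_of X" "L' face_of X" "aff_dim L = 1" "aff_dim L' = 1"
        using L L' by (auto simp: edge_of_def)
      have int: "L \<inter> L' face_of X" using faces by (simp add: face_of_Int)
      have "L \<inter> L' \<noteq> L \<or> L \<inter> L' \<noteq> L'" using ne by auto
      then have "aff_dim (L \<inter> L') < 1"
      proof
        assume "L \<inter> L' \<noteq> L"
        moreover have "L \<inter> L' face_of L" using face_of_subset[OF int] face_of_imp_subset[OF faces(1)] by auto
        ultimately show ?thesis using face_of_aff_dim_lt[of L "L \<inter> L'"] face_of_imp_convex[OF faces(1)] faces by simp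
      next
        assume "L \<inter> L' \<noteq> L'"
        moreover have "L \<inter> L' face_of L'" using face_of_subset[OF int] face_of_imp_subset[OF faces(2)] by auto
        ultimately show ?thesis using face_of_aff_dim_lt[of L' "L \<inter> L'"] face_of_imp_convex[OF faces(2)] faces by simp
      qed
      moreover have "z \<in> L \<inter> L'" using L L' by auto
      ultimately have "aff_dim (L \<inter> L') = 0"
      proof -
        assume "aff_dim (L \<inter> L') < 1" "z \<in> L \<inter> L'"
        then have "L \<inter> L' \<noteq> {}" by blast
        then have "aff_dim (L \<inter> L') \<noteq> -1" by (simp add: aff_dim_empty)
        with \<open>aff_dim (L \<inter> L') < 1\<close> show ?thesis using aff_dim_geq[of "L \<inter> L'"] by linarith
      qed
      then obtain d where d: "L \<inter> L' = {d}" unfolding aff_dim_eq_0 by blast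
      with \<open>z \<in> L \<inter> L'\<close> have "z = d" by (simp only: singleton_iff)
      with d have "L \<inter> L' = {z}" by simp
      then have "z extreme_point_of X" using int by (simp add: face_of_singleton)
      then show False using nv ends(2)[OF z] by blast
    qed
    ultimately show ?thesis by blast
  qed
  obtain Lp where Lp: "Lp edge_of X" "p \<in> Lp" "\<And>L. L edge_of X \<Longrightarrow> p \<in> L \<Longrightarrow> L = Lp" using ex1[of p] by blast
  obtain Lq where Lq: "Lq edge_of X" "q \<in> Lq" "\<And>L. L edge_of X \<Longrightarrow> q \<in> L \<Longrightarrow> L = Lq" using ex1[of q] by blast
  have "Lp \<noteq> Lq"
  proof
    assume "Lp = Lq"
    then have "closed_segment p q \<subseteq> Lp"
      using Lp(1,2) Lq(2) by (intro closed_segment_subset) (auto simp: edge_of_def face_of_imp_convex)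
    then have "m \<in> Lp" using pq m rel_interior_subset[of X] by blast
    then show False using edges_off Lp m by blast
  qed
  moreover have "{L. L edge_of X \<and> c \<in> (\<bullet>) u ` L} = {Lp, Lq}"
  proof (intro equalityI subsetI)
    fix L assume "L \<in> {L. L edge_of X \<and> c \<in> (\<bullet>) u ` L}"
    then obtain z where z: "L edge_of X" "z \<in> L" "u \<bullet> z = c" by auto
    then have "z \<in> {p,q}" using frontier edges_off edge_of_imp_subset by blast
    then show "L \<in> {Lp, Lq}" using z(1,2) Lp(3)[OF z(1)] Lq(3)[OF z(1)] by blast
  next
    fix L assume "L \<in> {Lp, Lq}"
    moreover have "c \<in> (\<bullet>) u ` Lp" "c \<in> (\<bullet>) u ` Lq"
      using Lp(2) Lq(2) ends(2)[of p] ends(2)[of q] by (auto intro: rev_image_eqI)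
    ultimately show "L \<in> {L. L edge_of X \<and> c \<in> (\<bullet>) u ` L}" using Lp(1) Lq(1) by blast
  qed
  ultimately show ?thesis by simp
qed

text \<open>The projection of a convex set in direction \<open>u\<close> is an interval, whose length is the breadth.\<close>

lemma breadth_has_integral:
  assumes "compact S" "convex S" "S \<noteq> {}"
  shows "(indicat_real ((\<bullet>) u ` S) has_integral breadth S u) UNIV"
proof -
  obtain x y where xy: "x \<in> S" "y \<in> S" "breadth S u = u \<bullet> x - u \<bullet> y"
    "\<And>z. z \<in> S \<Longrightarrow> u \<bullet> y \<le> u \<bullet> z \<and> u \<bullet> z \<le> u \<bullet> x" using breadth_attained[OF assms(1,3)] by metis
  have image: "(\<bullet>) u ` S = {u \<bullet> y..u \<bullet> x}"
  proof (intro equalityI subsetI)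
    fix c assume c: "c \<in> {u \<bullet> y..u \<bullet> x}"
    then obtain z where "z \<in> S" "u \<bullet> z = c" using inner_max_on_cut[OF assms(2) xy(2,1), of u c u] by auto
    then show "c \<in> (\<bullet>) u ` S" by blast
  qed (use xy in auto)
  have "((\<lambda>c. 1 :: real) has_integral (u \<bullet> x - u \<bullet> y)) {u \<bullet> y..u \<bullet> x}"
    using has_integral_const_real[of "1 :: real" "u \<bullet> y" "u \<bullet> x"] xy(4)[OF xy(1)] by simp
  then have "((\<lambda>c. if c \<in> {u \<bullet> y..u \<bullet> x} then 1 :: real else 0) has_integral (u \<bullet> x - u \<bullet> y)) UNIV"
    by (simp only: has_integral_restrict_UNIV)
  moreover have "indicat_real ((\<bullet>) u ` S) = (\<lambda>c. if c \<in> {u \<bullet> y..u \<bullet> x} then 1 else 0)"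
    unfolding image by (auto simp: indicator_def)
  ultimately show ?thesis by (simp only: xy(3))
qed

text \<open>A Cauchy--Crofton argument: for almost every \<open>c\<close> the line at level \<open>c\<close> misses the polygon or meets
  exactly two of its edges.  Integration over \<open>c\<close> yields the breadths.\<close>

lemma polygon_breadth:
  fixes X :: "pt set"
  assumes "polytope X" "aff_dim X = 2"
  shows "(\<Sum>L | L edge_of X. breadth L u) = 2 * breadth X u"
proof -
  let ?E = "{L. L edge_of X}"
  have fin: "finite ?E" using finite_polytope_faces[OF assms(1)] by (rule rev_finite_subset) (auto simp: edge_of_def)
  have ne: "X \<noteq> {}" using assms(2) by auto
  note cX = polytope_imp_compact[OF assms(1)] polytope_imp_convex[OF assms(1)]
  define g where "g = (\<lambda>c. \<Sum>L\<in>?E. indicat_real ((\<bullet>) u ` L) c)"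
  have g1: "(g has_integral (\<Sum>L\<in>?E. breadth L u)) UNIV"
    unfolding g_def
  proof (rule has_integral_sum[OF fin])
    fix L assume "L \<in> ?E"
    then obtain a b where "L = closed_segment a b" using edge_segment[of L X] assms(1) by auto
    then show "(indicat_real ((\<bullet>) u ` L) has_integral breadth L u) UNIV"
      by (intro breadth_has_integral) auto
  qed
  obtain x y where xy: "x \<in> X" "y \<in> X" "breadth X u = u \<bullet> x - u \<bullet> y"
    "\<And>z. z \<in> X \<Longrightarrow> u \<bullet> y \<le> u \<bullet> z \<and> u \<bullet> z \<le> u \<bullet> x" using breadth_attained[OF cX(1) ne] by metis
  let ?N = "insert (u \<bullet> x) (insert (u \<bullet> y) ((\<bullet>) u ` {v. v extreme_point_of X}))"
  have "finite ?N"
    using finite_polyhedron_extreme_points[OF polytope_imp_polyhedron[OF assms(1)]] by simp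
  moreover have "g c = 2 * indicat_real ((\<bullet>) u ` X) c" if "c \<in> UNIV - ?N" for c
  proof -
    have gc: "g c = card {L. L edge_of X \<and> c \<in> (\<bullet>) u ` L}"
      unfolding g_def using fin by (simp add: indicator_def sum.If_cases Int_def)
    show ?thesis
    proof (cases "c \<in> (\<bullet>) u ` X")
      case True
      then obtain z where "z \<in> X" "u \<bullet> z = c" by auto
      then have "u \<bullet> y < c" "c < u \<bullet> x" using that xy(4)[of z] by auto
      then have "card {L. L edge_of X \<and> c \<in> (\<bullet>) u ` L} = 2"
        using that by (intro polygon_level_edges[OF assms xy(1,2)]) auto
      with gc True show ?thesis by simp
    next
      case False
      then have "{L. L edge_of X \<and> c \<in> (\<bullet>) u ` L} = {}" using edge_of_imp_subset by blast
      with gc False show ?thesis by simp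
    qed
  qed
  moreover have "((\<lambda>c. 2 * indicat_real ((\<bullet>) u ` X) c) has_integral 2 * breadth X u) UNIV"
    using breadth_has_integral[OF cX ne] by (rule has_integral_mult_right)
  ultimately have "(g has_integral 2 * breadth X u) UNIV" by (rule has_integral_spike_finite)
  with g1 show ?thesis by (rule has_integral_unique)
qed

lemma polygon_girth:
  fixes X :: "pt set"
  assumes "polytope X" "aff_dim X = 2"
  shows "girth X = (\<Sum>L | L edge_of X. diameter L)"
proof -
  let ?E = "{L. L edge_of X}"
  have fin: "finite ?E" using finite_polytope_faces[OF assms(1)] by (rule rev_finite_subset) (auto simp: edge_of_def)
  have ne: "X \<noteq> {}" using assms(2) by auto
  have "2 * mean_breadth X = integral (cball 0 1) (\<lambda>u. 2 * breadth X u)"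
    unfolding mean_breadth_def by simp
  also have "\<dots> = integral (cball 0 1) (\<lambda>u. \<Sum>L\<in>?E. breadth L u)"
    using polygon_breadth[OF assms] by simp
  also have "\<dots> = (\<Sum>L\<in>?E. mean_breadth L)"
    unfolding mean_breadth_def
  proof (rule integral_sum[OF fin])
    fix L assume "L \<in> ?E"
    then obtain a b where "L = closed_segment a b" using edge_segment[of L X] assms(1) by auto
    then show "breadth L integrable_on cball 0 1" by (intro breadth_integrable) auto
  qed
  finally have "2 * girth X = (\<Sum>L\<in>?E. girth L)"
    by (simp add: girth_def sum_distrib_left sum_divide_distrib[symmetric])
  also have "\<dots> = (\<Sum>L\<in>?E. 2 * diameter L)" using girth_edge assms(1) by (intro sum.cong) auto
  finally show ?thesis by (simp add: sum_distrib_left[symmetric])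
qed

text \<open>Three facets cannot share an edge: their normals are orthogonal to the edge, hence
  linearly dependent; two of the three coefficients have the same sign, and evaluating the
  dependency at an inner point of the third facet shows that these two vanish.\<close>

lemma edge_in_two_facets:
  fixes P :: "pt set"
  assumes P: "convex_polyhedron P" and L: "L edge_of P"
  shows "card {X. X facet_of P \<and> L \<subseteq> X} = 2"
proof -
  have pP: "polytope P" and dim: "aff_dim P = 3"
    using P aff_dim_nonempty_interior[of P] by (auto simp: convex_polyhedron_def)
  have phP: "polyhedron P" using pP by (rule polytope_imp_polyhedron)
  define FF where "FF = {X. X facet_of P \<and> L \<subseteq> X}"
  have FF: "X facet_of P" "L \<subseteq> X" if "X \<in> FF" for X using that by (auto simp: FF_def)
  have fin: "finite FF" using finite_polytope_facets[OF pP] by (rule rev_finite_subset) (auto simp: FF_def)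
  have dL: "aff_dim L = 1" "L face_of P" using L by (auto simp: edge_of_def)
  have "L \<noteq> {}" "L \<noteq> P" using dL dim by auto
  then have Leq: "L = \<Inter>FF" using face_of_polyhedron[OF phP dL(2)] by (auto simp: FF_def)
  have facet_dim: "aff_dim X = 2" if "X \<in> FF" for X using FF(1)[OF that] dim by (auto simp: facet_of_def)
  have "card FF \<noteq> 0"
  proof
    assume "card FF = 0"
    then have "FF = {}" using fin by simp
    then have "L = UNIV" using Leq by (metis Inf_empty)
    then show False using dL by simp
  qed
  moreover have "card FF \<noteq> 1"
  proof
    assume "card FF = 1"
    then obtain X where "FF = {X}" by (auto simp: card_1_singleton_iff)
    then have "L = X" "X \<in> FF" using Leq by auto
    then show False using dL facet_dim by auto
  qed
  moreover have "\<not> 3 \<le> card FF"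
  proof
    assume "3 \<le> card FF"
    then obtain T where "T \<subseteq> FF" "card T = 3" by (rule obtain_subset_with_card_n)
    obtain X1 X2 X3 where T3: "T = {X1, X2, X3}" and X: "X1 \<noteq> X2" "X1 \<noteq> X3" "X2 \<noteq> X3"
      using \<open>card T = 3\<close> card_3_iff[of T] by metis
    have "X1 \<in> FF" "X2 \<in> FF" "X3 \<in> FF" using \<open>T \<subseteq> FF\<close> unfolding T3 by (simp_all only: insert_subset)
    note X = this X
    obtain v w where vw: "v \<noteq> w" "L = closed_segment v w" using edge_segment[OF L pP] by blast
    have "\<exists>a b. a \<noteq> 0 \<and> P \<subseteq> {x. a \<bullet> x \<le> b} \<and> X = P \<inter> {x. a \<bullet> x = b}" if "X \<in> FF" for X
    proof -
      have "X facet_of P" using FF that by simp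
      from facet_of_polyhedron[OF phP this] show ?thesis by metis
    qed
    then have "\<exists>p. fst p \<noteq> 0 \<and> P \<subseteq> {x. fst p \<bullet> x \<le> snd p} \<and> X = P \<inter> {x. fst p \<bullet> x = snd p}" if "X \<in> FF" for X
      using that by auto
    then obtain p where "\<And>X. X \<in> FF \<Longrightarrow> fst (p X) \<noteq> 0 \<and> P \<subseteq> {x. fst (p X) \<bullet> x \<le> snd (p X)} \<and> X = P \<inter> {x. fst (p X) \<bullet> x = snd (p X)}"
      by metis
    then obtain a b where ab: "\<And>X. X \<in> FF \<Longrightarrow> a X \<noteq> 0 \<and> P \<subseteq> {x. a X \<bullet> x \<le> b X} \<and> X = P \<inter> {x. a X \<bullet> x = b X}"
      by (rule that[of "\<lambda>X. fst (p X)" "\<lambda>X. snd (p X)"])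
    have orth: "a X \<bullet> (w - v) = 0" if "X \<in> FF" for X
    proof -
      have "v \<in> X" "w \<in> X" using FF(2)[OF that] vw by auto
      then have "v \<in> P \<inter> {x. a X \<bullet> x = b X}" "w \<in> P \<inter> {x. a X \<bullet> x = b X}" using ab[OF that] by blast+
      then show ?thesis by (simp add: inner_diff_right)
    qed
    have "\<exists>y. y \<in> X \<and> (\<forall>X'\<in>FF. X' \<noteq> X \<longrightarrow> y \<notin> X')" if XS: "X \<in> FF" for X
    proof -
      have "X \<noteq> {}" "convex X" using facet_dim[OF XS] FF(1)[OF XS] by (auto simp: facet_of_def face_of_imp_convex)
      then obtain y where y: "y \<in> rel_interior X" using rel_interior_eq_empty by blast
      have "y \<notin> X'" if X': "X' \<in> FF" "X' \<noteq> X" for X'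
      proof
        assume "y \<in> X'"
        then have "X \<subseteq> X'" using subset_of_face_of[of X' P X] y FF(1)[OF XS] FF(1)[OF X'(1)]
          by (auto simp: facet_of_def face_of_imp_subset)
        then have "X face_of X'" using face_of_subset[of X P X'] FF(1)[OF XS] FF(1)[OF X'(1)]
          by (auto simp: facet_of_def face_of_imp_subset)
        then show False using face_of_aff_dim_lt[of X' X] X'(2) FF(1)[OF X'(1)] facet_dim[OF XS] facet_dim[OF X'(1)]
          by (auto simp: facet_of_def face_of_imp_convex)
      qed
      then show ?thesis using y rel_interior_subset[of X] by blast
    qed
    then obtain y where y: "\<And>X. X \<in> FF \<Longrightarrow> y X \<in> X \<and> (\<forall>X'\<in>FF. X' \<noteq> X \<longrightarrow> y X \<notin> X')" by metis
    have zero: "a X \<bullet> (y X - v) = 0" if "X \<in> FF" for X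
    proof -
      have "v \<in> X" using FF(2)[OF that] vw by auto
      then have "v \<in> P \<inter> {x. a X \<bullet> x = b X}" "y X \<in> P \<inter> {x. a X \<bullet> x = b X}"
        using ab[OF that] y[OF that] by blast+
      then show ?thesis by (simp add: inner_diff_right)
    qed
    have neg: "a X' \<bullet> (y X - v) < 0" if "X \<in> FF" "X' \<in> FF" "X' \<noteq> X" for X X'
    proof -
      have "y X \<in> P" using ab[OF that(1)] y[OF that(1)] by blast
      moreover have "y X \<notin> P \<inter> {x. a X' \<bullet> x = b X'}" using y[OF that(1)] ab[OF that(2)] that(2,3) by blast
      ultimately have "a X' \<bullet> y X < b X'" using ab[OF that(2)] by (auto simp: less_le)
      moreover have "v \<in> X'" using FF(2)[OF that(2)] vw by auto
      then have "v \<in> P \<inter> {x. a X' \<bullet> x = b X'}" using ab[OF that(2)] by blast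
      then have "a X' \<bullet> v = b X'" by simp
      ultimately show ?thesis by (simp add: inner_diff_right)
    qed
    obtain c1 c2 c3 :: real where c: "\<not> (c1 = 0 \<and> c2 = 0 \<and> c3 = 0)"
      "c1 *\<^sub>R a X1 + c2 *\<^sub>R a X2 + c3 *\<^sub>R a X3 = 0"
    proof -
      let ?B = "{a X1, a X2, a X3}"
      have sub: "span ?B \<subseteq> {x. (w - v) \<bullet> x = 0}"
      proof (rule span_minimal)
        show "?B \<subseteq> {x. (w - v) \<bullet> x = 0}"
          using orth[OF X(1)] orth[OF X(2)] orth[OF X(3)] by (simp add: inner_commute)
        show "subspace {x. (w - v) \<bullet> x = 0}" by (rule subspace_hyperplane)
      qed
      then have "dim ?B \<le> 2"
        using dim_subset[OF sub] dim_hyperplane[of "w - v"] vw(1) by (simp add: dim_span)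
      show thesis
      proof (cases "card ?B = 3")
        case True
        then have "dependent ?B" using \<open>dim ?B \<le> 2\<close>
          using dim_eq_card_independent[of ?B] by auto
        then obtain f where f: "\<exists>x\<in>?B. f x \<noteq> 0" "(\<Sum>x\<in>?B. f x *\<^sub>R x) = 0"
          using dependent_finite[of ?B] by auto
        have ne: "a X1 \<noteq> a X2" "a X1 \<noteq> a X3" "a X2 \<noteq> a X3" using True by (auto simp: card_insert_if split: if_splits)
        show thesis
        proof (rule that[of "f (a X1)" "f (a X2)" "f (a X3)"])
          show "\<not> (f (a X1) = 0 \<and> f (a X2) = 0 \<and> f (a X3) = 0)" using f(1) by auto
          show "f (a X1) *\<^sub>R a X1 + f (a X2) *\<^sub>R a X2 + f (a X3) *\<^sub>R a X3 = 0"
            using f(2) ne by (simp add: add.assoc)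
        qed
      next
        case False
        then consider "a X1 = a X2" | "a X1 = a X3" | "a X2 = a X3" by (auto simp: card_insert_if split: if_splits)
        then show thesis
          by cases (use that[of 1 "-1" 0] that[of 1 0 "-1"] that[of 0 1 "-1"] in auto)
      qed
    qed
    have eq: "c1 * (a X1 \<bullet> z) + c2 * (a X2 \<bullet> z) + c3 * (a X3 \<bullet> z) = 0" for z
      using arg_cong[OF c(2), of "\<lambda>t. t \<bullet> z"] by (simp add: inner_add_left)
    have key: "d1 = 0 \<and> d2 = 0 \<and> d3 = 0"
      if "0 \<le> d1 * d2" and Y: "Y1 \<in> FF" "Y2 \<in> FF" "Y3 \<in> FF" "Y1 \<noteq> Y3" "Y2 \<noteq> Y3"
        and e: "\<And>z. d1 * (a Y1 \<bullet> z) + d2 * (a Y2 \<bullet> z) + d3 * (a Y3 \<bullet> z) = 0" for d1 d2 d3 Y1 Y2 Y3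
    proof -
      let ?z = "y Y3 - v"
      have n: "a Y1 \<bullet> ?z < 0" "a Y2 \<bullet> ?z < 0" using neg Y by blast+
      have "d1 * (a Y1 \<bullet> ?z) + d2 * (a Y2 \<bullet> ?z) = 0" using e[of ?z] zero[OF Y(3)] by simp
      moreover have "0 \<le> d1 \<and> 0 \<le> d2 \<or> d1 \<le> 0 \<and> d2 \<le> 0" using that(1) by (simp add: zero_le_mult_iff)
      then have "(d1 * (a Y1 \<bullet> ?z) \<le> 0 \<and> d2 * (a Y2 \<bullet> ?z) \<le> 0) \<or>
          (0 \<le> d1 * (a Y1 \<bullet> ?z) \<and> 0 \<le> d2 * (a Y2 \<bullet> ?z))"
        using n by (auto intro: mult_nonneg_nonpos mult_nonpos_nonpos)
      ultimately have "d1 * (a Y1 \<bullet> ?z) = 0" "d2 * (a Y2 \<bullet> ?z) = 0" by linarith+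
      then have d: "d1 = 0" "d2 = 0" using n by auto
      have "d3 * (a Y3 \<bullet> a Y3) = 0" using e[of "a Y3"] d by simp
      then show ?thesis using ab[OF Y(3)] d by auto
    qed
    have "0 \<le> c1 * c2 \<or> 0 \<le> c1 * c3 \<or> 0 \<le> c2 * c3"
      by (auto simp: zero_le_mult_iff)
    moreover have "c1 * (a X1 \<bullet> z) + c3 * (a X3 \<bullet> z) + c2 * (a X2 \<bullet> z) = 0"
      "c2 * (a X2 \<bullet> z) + c3 * (a X3 \<bullet> z) + c1 * (a X1 \<bullet> z) = 0" for z using eq[of z] by linarith+
    ultimately show False
      using key[of c1 c2 X1 X2 X3 c3, OF _ X(1,2,3) X(5,6) eq] key[of c1 c3 X1 X3 X2 c2] key[of c2 c3 X2 X3 X1 c1]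
        X c(1) by metis
  qed
  ultimately show ?thesis unfolding FF_def by linarith
qed

text \<open>Every edge belongs to the perimeters of exactly two facets.\<close>

lemma total_edge_length_girth:
  assumes P: "convex_polyhedron P"
  shows "2 * total_edge_length P = (\<Sum>X | X facet_of P. girth X)"
proof -
  have pP: "polytope P" and dim: "aff_dim P = 3"
    using P aff_dim_nonempty_interior[of P] by (auto simp: convex_polyhedron_def)
  let ?F = "{X. X facet_of P}" and ?E = "{L. L edge_of P}"
  have finF: "finite ?F" by (rule finite_polytope_facets[OF pP])
  have finE: "finite ?E" using finite_polytope_faces[OF pP] by (rule rev_finite_subset) (auto simp: edge_of_def)
  have "(\<Sum>X\<in>?F. girth X) = (\<Sum>X\<in>?F. \<Sum>L\<in>?E. if L \<subseteq> X then diameter L else 0)"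
  proof (rule sum.cong)
    fix X assume "X \<in> ?F"
    then have X: "X face_of P" "aff_dim X = 2" using dim by (auto simp: facet_of_def)
    have "girth X = (\<Sum>L | L edge_of X. diameter L)"
      by (rule polygon_girth) (use X pP face_of_polytope_polytope in auto)
    also have "{L. L edge_of X} = {L \<in> ?E. L \<subseteq> X}"
      using face_of_face[OF X(1)] by (auto simp: edge_of_def)
    also have "(\<Sum>L\<in>\<dots>. diameter L) = (\<Sum>L\<in>?E. if L \<subseteq> X then diameter L else 0)"
      by (rule sum.inter_filter[OF finE])
    finally show "girth X = \<dots>" .
  qed simp
  also have "\<dots> = (\<Sum>L\<in>?E. \<Sum>X\<in>?F. if L \<subseteq> X then diameter L else 0)" by (rule sum.swap)
  also have "\<dots> = (\<Sum>L\<in>?E. 2 * diameter L)"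
  proof (rule sum.cong)
    fix L assume "L \<in> ?E"
    then have "card {X. X facet_of P \<and> L \<subseteq> X} = 2" using edge_in_two_facets[OF P] by auto
    then show "(\<Sum>X\<in>?F. if L \<subseteq> X then diameter L else 0) = 2 * diameter L"
      using finF by (simp add: sum.inter_filter[symmetric])
  qed simp
  finally show ?thesis by (simp add: total_edge_length_def sum_distrib_left)
qed

section \<open>Polyhedra given by halfspaces\<close>

lemma convex_polyhedronD:
  assumes "convex_polyhedron P"
  shows "polytope P" "polyhedron P" "convex P" "compact P" "bounded P" "closed P" "aff_dim P = 3"
    "interior P \<noteq> {}" "P \<noteq> {}" "affine hull P = UNIV" "finite {X. X facet_of P}"
proof -
  show P: "polytope P" and i: "interior P \<noteq> {}" using assms by (auto simp: convex_polyhedron_def)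
  show "polyhedron P" "convex P" "compact P" "bounded P" "closed P" "finite {X. X facet_of P}"
    using P by (auto simp: polytope_imp_polyhedron polytope_imp_convex polytope_imp_compact
      polytope_imp_bounded polytope_imp_closed intro: finite_polytope_facets)
  show "aff_dim P = 3" using aff_dim_nonempty_interior[OF i] by simp
  show "P \<noteq> {}" using i by auto
  show "affine hull P = UNIV" using affine_hull_nonempty_interior[OF i] .
qed

lemma facet_dim: "convex_polyhedron P \<Longrightarrow> X facet_of P \<Longrightarrow> aff_dim X = 2"
  using convex_polyhedronD(7)[of P] by (simp add: facet_of_def)

lemma facet_halfspaces:
  assumes "convex_polyhedron P"
  shows "\<exists>a b. \<forall>X. X facet_of P \<longrightarrow> a X \<noteq> 0 \<and> P \<subseteq> {x. a X \<bullet> x \<le> b X} \<and> X = P \<inter> {x. a X \<bullet> x = b X}"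
proof -
  have "\<exists>p. X facet_of P \<longrightarrow> fst p \<noteq> 0 \<and> P \<subseteq> {x. fst p \<bullet> x \<le> snd p} \<and> X = P \<inter> {x. fst p \<bullet> x = snd p}" for X
  proof (cases "X facet_of P")
    case True
    obtain c d where "c \<noteq> 0" "P \<subseteq> {x. c \<bullet> x \<le> d}" "X = P \<inter> {x. c \<bullet> x = d}"
      using facet_of_polyhedron[OF convex_polyhedronD(2)[OF assms] True] by metis
    then show ?thesis by (intro exI[of _ "(c, d)"]) auto
  qed auto
  then obtain p where p: "\<And>X. X facet_of P \<longrightarrow> fst (p X) \<noteq> 0 \<and> P \<subseteq> {x. fst (p X) \<bullet> x \<le> snd (p X)} \<and> X = P \<inter> {x. fst (p X) \<bullet> x = snd (p X)}"
    by metis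
  show ?thesis
    by (rule exI[of _ "\<lambda>X. fst (p X)"], rule exI[of _ "\<lambda>X. snd (p X)"]) (use p in blast)
qed

lemma interior_strict:
  assumes "z \<in> interior P" "P \<subseteq> {x. a \<bullet> x \<le> b}" "a \<noteq> 0"
  shows "a \<bullet> z < (b :: real)"
  using interior_mono[OF assms(2)] assms(1,3) by (auto simp: interior_halfspace_le)

text \<open>A segment that leaves \<open>P\<close> from an interior point crosses a facet.\<close>

lemma polyhedron_eq_facet_halfspaces:
  assumes P: "convex_polyhedron P"
    and ab: "\<And>X. X facet_of P \<Longrightarrow> a X \<noteq> 0" "\<And>X. X facet_of P \<Longrightarrow> P \<subseteq> {x. a X \<bullet> x \<le> b X}"
      "\<And>X. X facet_of P \<Longrightarrow> X = P \<inter> {x. a X \<bullet> x = b X}"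
    and x: "\<And>X. X facet_of P \<Longrightarrow> a X \<bullet> x \<le> b X"
  shows "x \<in> P"
proof (rule ccontr)
  assume "x \<notin> P"
  obtain z where z: "z \<in> interior P" using convex_polyhedronD(8)[OF P] by auto
  have "z \<in> P" using z interior_subset[of P] by blast
  have "closed_segment z x \<inter> frontier P \<noteq> {}"
    by (rule connected_Int_frontier) (use \<open>z \<in> P\<close> \<open>x \<notin> P\<close> in auto)
  then obtain y where y: "y \<in> closed_segment z x" "y \<in> frontier P" by blast
  have "frontier P = rel_frontier P"
    using convex_polyhedronD(8)[OF P] by (simp add: rel_frontier_nonempty_interior)
  then obtain X where X: "X facet_of P" "y \<in> X"
    using y(2) rel_frontier_of_polyhedron[OF convex_polyhedronD(2)[OF P]] by auto
  obtain t where t: "0 \<le> t" "t \<le> 1" "y = (1 - t) *\<^sub>R z + t *\<^sub>R x" using y(1) by (auto simp: closed_segment_def)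
  have "a X \<bullet> y = b X" using ab(3)[OF X(1)] X(2) by blast
  moreover have "a X \<bullet> z < b X" using interior_strict[OF z ab(2)[OF X(1)] ab(1)[OF X(1)]] .
  moreover have "y \<noteq> x" using \<open>x \<notin> P\<close> X facet_of_imp_subset by blast
  then have "t < 1" using t by (cases "t = 1") auto
  moreover have "a X \<bullet> y = (1 - t) * (a X \<bullet> z) + t * (a X \<bullet> x)" using t(3) by (simp add: inner_add_right)
  moreover have "(1 - t) * (a X \<bullet> z) < (1 - t) * b X" using \<open>t < 1\<close> \<open>a X \<bullet> z < b X\<close> by simp
  moreover have "t * (a X \<bullet> x) \<le> t * b X" using t(1) x[OF X(1)] by (rule mult_left_mono[rotated])
  ultimately show False by (simp add: algebra_simps)
qed

text \<open>A relatively inner point of the facet is a boundary point of \<open>R\<close>, hence lies on one of the planes.  The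
  face cut out by this plane contains the facet and has the same dimension.\<close>

lemma facet_of_halfspaces:
  fixes a :: "'i \<Rightarrow> pt"
  assumes fin: "finite I" and R: "R = {x. \<forall>i\<in>I. a i \<bullet> x \<le> b i}" and a: "\<And>i. i \<in> I \<Longrightarrow> a i \<noteq> 0"
    and int: "interior R \<noteq> {}" and X: "X facet_of R"
  shows "\<exists>i\<in>I. X = R \<inter> {x. a i \<bullet> x = b i}"
proof -
  have Rdim: "aff_dim R = 3" using aff_dim_nonempty_interior[OF int] by simp
  have convR: "convex R"
  proof -
    have "R = (\<Inter>i\<in>I. {x. a i \<bullet> x \<le> b i})" using R by auto
    then show ?thesis by (simp add: convex_INT convex_halfspace_le)
  qed
  have Xf: "X face_of R" "X \<noteq> {}" "aff_dim X = 2" using X Rdim by (auto simp: facet_of_def)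
  then obtain z where z: "z \<in> rel_interior X" using rel_interior_eq_empty face_of_imp_convex by blast
  have zR: "z \<in> R" using z rel_interior_subset[of X] face_of_imp_subset[OF Xf(1)] by blast
  have "X \<noteq> R" using Xf Rdim by auto
  have "z \<notin> interior R"
    using face_of_disjoint_interior[OF Xf(1) \<open>X \<noteq> R\<close>] z rel_interior_subset[of X] by blast
  have "\<exists>i\<in>I. a i \<bullet> z = b i"
  proof (rule ccontr)
    assume "\<not> ?thesis"
    then have strict: "\<And>i. i \<in> I \<Longrightarrow> a i \<bullet> z < b i" using zR R by force
    have "open (\<Inter>i\<in>I. {x. a i \<bullet> x < b i})" using fin by (intro open_INT) (auto simp: open_halfspace_lt)
    moreover have "(\<Inter>i\<in>I. {x. a i \<bullet> x < b i}) \<subseteq> R" using R by (auto intro: less_imp_le)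
    ultimately have "z \<in> interior R" using strict by (intro interiorI[of "\<Inter>i\<in>I. {x. a i \<bullet> x < b i}"]) auto
    with \<open>z \<notin> interior R\<close> show False by blast
  qed
  then obtain i where i: "i \<in> I" "a i \<bullet> z = b i" by blast
  let ?Y = "R \<inter> {x. a i \<bullet> x = b i}"
  have Y: "?Y face_of R" by (rule face_of_Int_supporting_hyperplane_le[OF convR]) (use R i in auto)
  have "X \<subseteq> ?Y" using subset_of_face_of[OF Y face_of_imp_subset[OF Xf(1)]] z i zR by blast
  obtain w where w: "w \<in> interior R" using int by blast
  have "a i \<bullet> w < b i" by (rule interior_strict[OF w]) (use R a i in auto)
  then have "w \<notin> ?Y" by simp
  moreover have "w \<in> R" using w interior_subset[of R] by blast
  ultimately have "?Y \<noteq> R" by metis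
  then have "aff_dim ?Y < 3" using face_of_aff_dim_lt[OF convR Y] Rdim by simp
  moreover have "X face_of ?Y" using face_of_subset[OF Xf(1) \<open>X \<subseteq> ?Y\<close>] by auto
  ultimately have "X = ?Y" using face_of_aff_dim_lt[OF face_of_imp_convex[OF Y], of X] Xf(3) by force
  with i show ?thesis by blast
qed

lemma num_faces_halfspaces:
  fixes a :: "'i \<Rightarrow> pt"
  assumes fin: "finite I" and R: "R = {x. \<forall>i\<in>I. a i \<bullet> x \<le> b i}" and a: "\<And>i. i \<in> I \<Longrightarrow> a i \<noteq> 0"
    and P: "convex_polyhedron R"
  shows "num_faces R \<le> card I"
proof -
  let ?f = "\<lambda>i. R \<inter> {x. a i \<bullet> x = b i}"
  have sub: "{X. X facet_of R} \<subseteq> ?f ` I"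
  proof
    fix X assume "X \<in> {X. X facet_of R}"
    then obtain i where "i \<in> I" "X = ?f i"
      using facet_of_halfspaces[OF fin R a convex_polyhedronD(8)[OF P], of X] by auto
    then show "X \<in> ?f ` I" by blast
  qed
  show ?thesis
    unfolding num_faces_def using card_mono[OF finite_imageI[OF fin] sub] card_image_le[OF fin, of ?f] by linarith
qed

text \<open>Several indices may describe the same facet, and some planes may touch \<open>R\<close> in less than a facet.  Both can only
  enlarge the sum, since girths are nonnegative.\<close>

lemma girth_sum_le:
  fixes a :: "'i \<Rightarrow> pt"
  assumes fin: "finite I" and R: "R = {x. \<forall>i\<in>I. a i \<bullet> x \<le> b i}" and a: "\<And>i. i \<in> I \<Longrightarrow> a i \<noteq> 0"
    and P: "convex_polyhedron R" and ne: "\<And>i. i \<in> I \<Longrightarrow> R \<inter> {x. a i \<bullet> x = b i} \<noteq> {}"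
  shows "2 * total_edge_length R \<le> (\<Sum>i\<in>I. girth (R \<inter> {x. a i \<bullet> x = b i}))"
proof -
  let ?f = "\<lambda>i. R \<inter> {x. a i \<bullet> x = b i}"
  have sub: "{X. X facet_of R} \<subseteq> ?f ` I"
  proof
    fix X assume "X \<in> {X. X facet_of R}"
    then obtain i where "i \<in> I" "X = ?f i"
      using facet_of_halfspaces[OF fin R a convex_polyhedronD(8)[OF P], of X] by auto
    then show "X \<in> ?f ` I" by blast
  qed
  have nn: "0 \<le> girth (?f i)" if "i \<in> I" for i
    using girth_nonneg[OF compact_cut(3)[OF convex_polyhedronD(4)[OF P]] ne[OF that]] .
  have "2 * total_edge_length R \<le> sum girth (?f ` I)"
    unfolding total_edge_length_girth[OF P]
    by (rule sum_mono2) (use fin sub nn in auto)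
  also have "\<dots> \<le> (\<Sum>i\<in>I. girth (?f i))"
    using sum_image_le[OF fin, of girth ?f] nn by (simp add: o_def)
  finally show "2 * total_edge_length R \<le> (\<Sum>i\<in>I. girth (?f i))" .
qed

lemma convex_polyhedron_halfspaces:
  assumes "finite I" "R = {x. \<forall>i\<in>I. a i \<bullet> x \<le> b i}" "bounded R" "interior R \<noteq> {}"
  shows "convex_polyhedron (R :: pt set)"
proof -
  have "R = \<Inter>((\<lambda>i. {x. a i \<bullet> x \<le> b i}) ` I)" using assms(2) by auto
  moreover have "polyhedron (\<Inter>((\<lambda>i. {x. a i \<bullet> x \<le> b i}) ` I))"
    using assms(1) by (intro polyhedron_Inter) (auto simp: polyhedron_halfspace_le)
  ultimately show ?thesis using assms(3,4) polytope_eq_bounded_polyhedron by (auto simp: convex_polyhedron_def)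
qed

lemma girth_le_diameter:
  assumes "compact S" "S \<noteq> {}" "\<And>x y. x \<in> S \<Longrightarrow> y \<in> S \<Longrightarrow> norm (x - y) \<le> d"
  shows "girth S \<le> d * (2 * measure lebesgue (cball (0 :: pt) 1) / unit_mean)"
proof -
  have "0 \<le> d" using assms(2,3) by (metis ex_in_conv norm_ge_zero order_trans)
  have "breadth S u \<le> d" if "u \<in> cball 0 1" for u
  proof -
    obtain x y where xy: "x \<in> S" "y \<in> S" "breadth S u = u \<bullet> x - u \<bullet> y"
      using breadth_attained[OF assms(1,2)] by metis
    have "u \<bullet> x - u \<bullet> y \<le> norm u * norm (x - y)" using norm_cauchy_schwarz[of u "x - y"] by (simp add: inner_diff_right)
    also have "\<dots> \<le> 1 * d" using that assms(3)[OF xy(1,2)] \<open>0 \<le> d\<close> by (intro mult_mono) auto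
    finally show ?thesis using xy(3) by simp
  qed
  then have "mean_breadth S \<le> integral (cball 0 1) (\<lambda>u :: pt. d)"
    unfolding mean_breadth_def
    by (intro integral_le breadth_integrable[OF assms(1,2)] continuous_integrable_on_ball) auto
  also have "\<dots> = d * measure lebesgue (cball (0 :: pt) 1)"
  proof -
    have "integral (cball 0 1) (\<lambda>u :: pt. d * 1) = d * integral (cball 0 1) (\<lambda>u :: pt. 1)"
      by (rule integral_mult_right)
    then show ?thesis using lmeasure_integral[OF lmeasurable_cball[of "0 :: pt" 1]] by simp
  qed
  finally have "mean_breadth S * (2 / unit_mean) \<le> d * measure lebesgue (cball (0 :: pt) 1) * (2 / unit_mean)"
    using unit_mean_pos by (intro mult_right_mono) auto
  then show ?thesis by (simp add: girth_def ac_simps)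
qed

text \<open>Every plane orthogonal to \<open>u\<close> that meets \<open>P\<close> also meets the boundary of \<open>P\<close>, so the breadth of \<open>P\<close> is at most the sum of
  the breadths of the facets.  Averaging over \<open>u\<close> gives the claim.\<close>

lemma diameter_le_total_edge_length:
  assumes P: "convex_polyhedron P" and xy: "x \<in> P" "y \<in> P"
  shows "norm (x - y) \<le> total_edge_length P"
proof -
  let ?F = "{X. X facet_of P}"
  note D = convex_polyhedronD[OF P]
  have fc: "compact X" "X \<noteq> {}" "convex X" if "X \<in> ?F" for X
    using that face_of_imp_compact[of P X] face_of_imp_convex[of X P] D by (auto simp: facet_of_def)
  have cover: "\<bar>u \<bullet> (x - y)\<bar> \<le> (\<Sum>X\<in>?F. breadth X u)" for u
  proof (cases "u = 0")
    case True
    then show ?thesis using fc breadth_nonneg by (auto intro: sum_nonneg)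
  next
    case False
    have iv: "(indicat_real ((\<bullet>) u ` P) has_integral breadth P u) UNIV"
      by (rule breadth_has_integral[OF D(4,3,9)])
    have ivF: "((\<lambda>c. \<Sum>X\<in>?F. indicat_real ((\<bullet>) u ` X) c) has_integral (\<Sum>X\<in>?F. breadth X u)) UNIV"
      by (intro has_integral_sum D(11) breadth_has_integral fc)
    have "indicat_real ((\<bullet>) u ` P) c \<le> (\<Sum>X\<in>?F. indicat_real ((\<bullet>) u ` X) c)" for c
    proof (cases "c \<in> (\<bullet>) u ` P")
      case True
      then obtain p where p: "p \<in> P" "u \<bullet> p = c" by auto
      have "\<not> {z. u \<bullet> z = c} \<subseteq> P"
      proof
        assume "{z. u \<bullet> z = c} \<subseteq> P"
        then have "bounded {z. u \<bullet> z = c}" using D(5) bounded_subset by blast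
        then have "{z. u \<bullet> z = c} = {} \<or> (\<exists>a. {z. u \<bullet> z = c} = {a})"
          using affine_bounded_eq_trivial[OF affine_hyperplane] by blast
        then have "aff_dim {z. u \<bullet> z = c} \<le> 0"
        proof
          assume "{z. u \<bullet> z = c} = {}"
          then show ?thesis by (simp only: aff_dim_empty_eq)
        next
          assume "\<exists>a. {z. u \<bullet> z = c} = {a}"
          then obtain d where "{z. u \<bullet> z = c} = {d}" by blast
          then show ?thesis by (simp only: aff_dim_sing)
        qed
        then show False using aff_dim_hyperplane[OF False, of c] by simp
      qed
      then obtain q where q: "u \<bullet> q = c" "q \<notin> P" by blast
      have "closed_segment p q \<inter> frontier P \<noteq> {}"
        by (rule connected_Int_frontier) (use p q in auto)
      then obtain w where w: "w \<in> closed_segment p q" "w \<in> frontier P" by blast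
      have "closed_segment p q \<subseteq> {z. u \<bullet> z = c}"
        using p q by (intro closed_segment_subset convex_hyperplane) auto
      then have "u \<bullet> w = c" using w(1) by blast
      moreover have "frontier P = rel_frontier P" using D(8) by (simp add: rel_frontier_nonempty_interior)
      then obtain X where X: "X \<in> ?F" "w \<in> X" using w(2) rel_frontier_of_polyhedron[OF D(2)] by auto
      ultimately have "1 \<le> indicat_real ((\<bullet>) u ` X) c" by (auto simp: indicator_def)
      also have "\<dots> \<le> (\<Sum>X\<in>?F. indicat_real ((\<bullet>) u ` X) c)"
        by (rule member_le_sum[OF X(1) _ D(11)]) auto
      finally show ?thesis by (simp add: indicator_def)
    qed (simp add: sum_nonneg)
    then have "breadth P u \<le> (\<Sum>X\<in>?F. breadth X u)" using has_integral_le[OF iv ivF] by blast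
    then show ?thesis using breadth_ge[OF D(4) xy, of u] breadth_ge[OF D(4) xy(2,1), of u]
      by (simp add: inner_diff_right abs_le_iff)
  qed
  have "norm (x - y) * unit_mean = integral (cball 0 1) (\<lambda>u :: pt. \<bar>u \<bullet> (x - y)\<bar>)" by (simp add: integral_abs_inner)
  also have "\<dots> \<le> integral (cball 0 1) (\<lambda>u. \<Sum>X\<in>?F. breadth X u)"
    using D(11) fc cover by (intro integral_le abs_inner_integrable integrable_sum breadth_integrable) auto
  also have "\<dots> = (\<Sum>X\<in>?F. mean_breadth X)"
    unfolding mean_breadth_def using fc by (intro integral_sum D(11) breadth_integrable) auto
  finally have "norm (x - y) * unit_mean \<le> (\<Sum>X\<in>?F. mean_breadth X)" .
  moreover have "2 * total_edge_length P = (\<Sum>X\<in>?F. mean_breadth X) * (2 / unit_mean)"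
  proof -
    have "sum girth ?F = (\<Sum>X\<in>?F. mean_breadth X * (2 / unit_mean))" by (rule sum.cong) (simp_all add: girth_def)
    then show ?thesis unfolding total_edge_length_girth[OF P] by (simp only: sum_distrib_right)
  qed
  ultimately have "norm (x - y) * unit_mean \<le> total_edge_length P * unit_mean"
    using unit_mean_pos by (simp add: field_simps)
  then show ?thesis using unit_mean_pos by simp
qed

section \<open>Polyhedra with fewer faces\<close>

text \<open>The maximum of \<open>u\<close> over the part of \<open>P\<close> outside the ball is less than \<open>b\<close>.\<close>

lemma compact_min_slack:
  fixes P :: "pt set"
  assumes "compact P" "P \<subseteq> {x. u \<bullet> x \<le> b}" "P \<inter> {x. u \<bullet> x = b} = {z}" "0 < \<epsilon>"
  obtains c where "c < b" "P \<inter> {x. c \<le> u \<bullet> x} \<subseteq> ball z \<epsilon>"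
proof (cases "P - ball z \<epsilon> = {}")
  case True
  then have "P \<inter> {x. b - 1 \<le> u \<bullet> x} \<subseteq> ball z \<epsilon>" by auto
  then show thesis using that[of "b - 1"] by auto
next
  case False
  have "compact (P - ball z \<epsilon>)" by (intro compact_diff assms(1)) simp
  moreover have "continuous_on (P - ball z \<epsilon>) (\<lambda>x. u \<bullet> x)" by (intro continuous_intros)
  ultimately obtain y where y: "y \<in> P - ball z \<epsilon>" "\<And>x. x \<in> P - ball z \<epsilon> \<Longrightarrow> u \<bullet> x \<le> u \<bullet> y"
    using continuous_attains_sup[of "P - ball z \<epsilon>" "\<lambda>x. u \<bullet> x"] False by blast
  have "y \<noteq> z" using y(1) assms(4) by auto
  moreover have "u \<bullet> y \<le> b" using y(1) assms(2) by blast
  ultimately have "u \<bullet> y < b" using assms(3) y(1) by (metis (mono_tags, lifting) DiffD1 IntI less_le mem_Collect_eq singletonD)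
  then have "u \<bullet> y < (u \<bullet> y + b) / 2" "(u \<bullet> y + b) / 2 < b" by auto
  moreover have "P \<inter> {x. (u \<bullet> y + b) / 2 \<le> u \<bullet> x} \<subseteq> ball z \<epsilon>"
  proof (rule ccontr)
    assume "\<not> ?thesis"
    then obtain x where "x \<in> P - ball z \<epsilon>" "(u \<bullet> y + b) / 2 \<le> u \<bullet> x" by blast
    then show False using y(2)[of x] \<open>u \<bullet> y < (u \<bullet> y + b) / 2\<close> by linarith
  qed
  ultimately show thesis using that by blast
qed

lemma exposed_vertex:
  assumes P: "convex_polyhedron P"
  obtains z u b where "u \<noteq> 0" "P \<subseteq> {x. u \<bullet> x \<le> b}" "P \<inter> {x. u \<bullet> x = b} = {z}"
proof -
  note D = convex_polyhedronD[OF P]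
  obtain z where z: "z extreme_point_of P"
    using extreme_point_exists_convex[OF D(4,3,9)] by metis
  then have f: "{z} face_of P" by (simp add: face_of_singleton)
  then have "{z} exposed_face_of P" using exposed_face_of_polyhedron[OF D(2)] by blast
  moreover have "{z} \<noteq> P" using D(7) by auto
  ultimately show thesis unfolding exposed_face_of using that by (metis insert_not_empty)
qed

text \<open>A plane close to an exposed vertex \<open>z\<close> meets \<open>P\<close> in a new facet inside the ball around \<open>z\<close>.  All old facets survive in
  smaller shape, so that the girths grow by no more than the girth of the new facet.\<close>

lemma cut_off_corner:
  assumes P: "convex_polyhedron P" and \<epsilon>: "0 < \<epsilon>"
  shows "\<exists>z R. convex_polyhedron R \<and> num_faces R = Suc (num_faces P) \<and> R \<subseteq> P \<and> P \<subseteq> R \<union> ball z \<epsilon> \<and>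
    total_edge_length R \<le> total_edge_length P + \<epsilon> * (2 * measure lebesgue (cball (0 :: pt) 1) / unit_mean)"
proof -
  note D = convex_polyhedronD[OF P]
  let ?F = "{X. X facet_of P}"
  obtain z u b where u: "u \<noteq> 0" "P \<subseteq> {x. u \<bullet> x \<le> b}" "P \<inter> {x. u \<bullet> x = b} = {z}"
    by (rule exposed_vertex[OF P])
  obtain c1 where c1: "c1 < b" "P \<inter> {x. c1 \<le> u \<bullet> x} \<subseteq> ball z \<epsilon>"
    by (rule compact_min_slack[OF D(4) u(2,3) \<epsilon>])
  have low: "\<exists>x. x \<in> X \<and> u \<bullet> x < b" if "X \<in> ?F" for X
  proof (rule ccontr)
    assume neg: "\<not> ?thesis"
    have "X \<subseteq> P" using that facet_of_imp_subset by blast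
    have "X \<subseteq> P \<inter> {x. u \<bullet> x = b}"
    proof
      fix x assume x: "x \<in> X"
      then have "u \<bullet> x \<le> b" using u(2) \<open>X \<subseteq> P\<close> by blast
      moreover have "\<not> u \<bullet> x < b" using neg x by blast
      ultimately show "x \<in> P \<inter> {x. u \<bullet> x = b}" using x \<open>X \<subseteq> P\<close> by auto
    qed
    then have "X \<subseteq> {z}" unfolding u(3) .
    then have "aff_dim X \<le> 0" using aff_dim_subset[of X "{z}"] by simp
    then show False using facet_dim[OF P] that by simp
  qed
  then obtain y where y: "\<And>X. X \<in> ?F \<Longrightarrow> y X \<in> X \<and> u \<bullet> y X < b" by metis
  obtain w where w: "w \<in> interior P" using D(8) by blast
  have wP: "w \<in> P" using w interior_subset[of P] by blast
  have wb: "u \<bullet> w < b" by (rule interior_strict[OF w u(2,1)])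
  \<comment> \<open>Above \<open>c1\<close>, the levels of an interior point and of a point of every facet, so that all facets survive the cut.\<close>
  define c where "c = Max (insert (u \<bullet> w) (insert c1 ((\<lambda>X. u \<bullet> y X) ` ?F))) / 2 + b / 2"
  let ?M = "insert (u \<bullet> w) (insert c1 ((\<lambda>X. u \<bullet> y X) ` ?F))"
  have finM: "finite ?M" using D(11) by simp
  have "Max ?M < b" using finM wb c1(1) y by (subst Max_less_iff) auto
  then have cb: "c < b" and Mc: "Max ?M < c" by (auto simp: c_def)
  have cM: "t < c" if "t \<in> ?M" for t using Max_ge[OF finM that] Mc by linarith
  have wc: "u \<bullet> w < c" and c1c: "c1 < c" and yc: "\<And>X. X \<in> ?F \<Longrightarrow> u \<bullet> y X < c" using cM by auto
  define R where "R = P \<inter> {x. u \<bullet> x \<le> c}"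
  have intR: "w \<in> interior R"
    using w wc u(1) unfolding R_def by (simp add: interior_Int interior_halfspace_le)
  have polyR: "polytope R" unfolding R_def
    by (intro polytope_Int_polyhedron D(1) polyhedron_halfspace_le)
  have R: "convex_polyhedron R" using polyR intR by (auto simp: convex_polyhedron_def)
  note DR = convex_polyhedronD[OF R]
  obtain a d where ad0: "\<forall>X. X facet_of P \<longrightarrow> a X \<noteq> 0 \<and> P \<subseteq> {x. a X \<bullet> x \<le> d X} \<and> X = P \<inter> {x. a X \<bullet> x = d X}"
    using facet_halfspaces[OF P] by (elim exE)
  note ad = ad0[rule_format, THEN conjunct1] ad0[rule_format, THEN conjunct2, THEN conjunct1]
    ad0[rule_format, THEN conjunct2, THEN conjunct2]
  let ?cut = "\<lambda>X. X \<inter> {x. u \<bullet> x \<le> c}" and ?S = "P \<inter> {x. u \<bullet> x = c}"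
  have zc: "u \<bullet> z = b" "z \<in> P" using u(3) by blast+
  have cut_dim: "aff_dim (X \<inter> {x. u \<bullet> x < c}) = 2" if "X \<in> ?F" for X
  proof -
    have "convex X" using that face_of_imp_convex by (auto simp: facet_of_def)
    moreover have "X \<inter> {x. u \<bullet> x < c} \<noteq> {}" using y[OF that] yc[OF that] by blast
    ultimately show ?thesis using aff_dim_convex_Int_open[of X "{x. u \<bullet> x < c}"] facet_dim[OF P] that
      by (simp add: open_halfspace_lt)
  qed
  have cut_facet: "?cut X facet_of R" if "X \<in> ?F" for X
  proof -
    have "?cut X face_of R" unfolding R_def
      using that face_of_slice[of X P] convex_halfspace_le by (auto simp: facet_of_def)
    moreover have "aff_dim (?cut X) = 2"
    proof (rule antisym)
      show "aff_dim (?cut X) \<le> 2" using aff_dim_subset[of "?cut X" X] facet_dim[OF P] that by simp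
      have "X \<inter> {x. u \<bullet> x < c} \<subseteq> ?cut X" by (auto intro: less_imp_le)
      then show "2 \<le> aff_dim (?cut X)" using aff_dim_subset[of "X \<inter> {x. u \<bullet> x < c}" "?cut X"] cut_dim[OF that] by simp
    qed
    ultimately show ?thesis using DR(7) by (auto simp: facet_of_def)
  qed
  have SR: "?S = R \<inter> {x. u \<bullet> x = c}" by (auto simp: R_def)
  have S_facet: "?S facet_of R"
  proof -
    have face: "?S face_of R" unfolding SR
      by (rule face_of_Int_supporting_hyperplane_le[OF DR(3)]) (auto simp: R_def)
    define t where "t = (c - u \<bullet> w) / (b - u \<bullet> w)"
    have t: "0 < t" "t < 1" using wc cb wb by (auto simp: t_def divide_simps)
    define m where "m = (1 - t) *\<^sub>R w + t *\<^sub>R z"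
    have "m \<in> interior P"
    proof -
      have "w \<noteq> z" using wb zc by auto
      then have "m \<in> open_segment w z" using t by (auto simp: in_segment m_def)
      then show ?thesis
        using rel_interior_closure_convex_segment[OF D(3), of w z] w zc(2) closure_subset[of P]
          rel_interior_nonempty_interior[OF D(8)] by blast
    qed
    moreover have "u \<bullet> m = u \<bullet> w + t * (b - u \<bullet> w)" by (simp add: m_def inner_add_right zc algebra_simps)
    then have "u \<bullet> m = c" using wb by (simp add: t_def)
    ultimately have ne: "{x. u \<bullet> x = c} \<inter> interior P \<noteq> {}" by blast
    have "aff_dim ({x. u \<bullet> x = c} \<inter> interior P) = 2"
      using aff_dim_convex_Int_open[OF convex_hyperplane open_interior ne] aff_dim_hyperplane[OF u(1), of c] by simp
    moreover have "{x. u \<bullet> x = c} \<inter> interior P \<subseteq> ?S" using interior_subset[of P] by blast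
    ultimately have "2 \<le> aff_dim ?S" using aff_dim_subset[of "{x. u \<bullet> x = c} \<inter> interior P" ?S] by simp
    moreover have "aff_dim ?S \<le> 2" using aff_dim_subset[of ?S "{x. u \<bullet> x = c}"] aff_dim_hyperplane[OF u(1), of c] by simp
    ultimately show ?thesis using face DR(7) by (auto simp: facet_of_def)
  qed
  define I where "I = insert None (Some ` ?F)"
  define a' where "a' = (\<lambda>i. case i of None \<Rightarrow> u | Some X \<Rightarrow> a X)"
  define d' where "d' = (\<lambda>i. case i of None \<Rightarrow> c | Some X \<Rightarrow> d X)"
  have R_eq: "R = {x. \<forall>i\<in>I. a' i \<bullet> x \<le> d' i}"
  proof (intro equalityI subsetI)
    fix x assume "x \<in> R"
    then show "x \<in> {x. \<forall>i\<in>I. a' i \<bullet> x \<le> d' i}" using ad(2) by (auto simp: R_def I_def a'_def d'_def)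
  next
    fix x assume x: "x \<in> {x. \<forall>i\<in>I. a' i \<bullet> x \<le> d' i}"
    then have "u \<bullet> x \<le> c" "\<And>X. X facet_of P \<Longrightarrow> a X \<bullet> x \<le> d X" by (auto simp: I_def a'_def d'_def)
    then show "x \<in> R" using polyhedron_eq_facet_halfspaces[OF P ad, of x] by (simp add: R_def)
  qed
  have facets_R: "{Y. Y facet_of R} = insert ?S (?cut ` ?F)"
  proof (intro equalityI subsetI)
    fix Y assume "Y \<in> {Y. Y facet_of R}"
    then obtain i where i: "i \<in> I" "Y = R \<inter> {x. a' i \<bullet> x = d' i}"
    proof -
      have "finite I" using D(11) by (simp add: I_def)
      moreover have "a' i \<noteq> 0" if "i \<in> I" for i using that ad(1) u(1) by (auto simp: I_def a'_def)
      ultimately have "\<exists>i\<in>I. Y = R \<inter> {x. a' i \<bullet> x = d' i}"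
        using facet_of_halfspaces[OF _ R_eq _ DR(8)] \<open>Y \<in> {Y. Y facet_of R}\<close> by blast
      then show thesis using that by blast
    qed
    show "Y \<in> insert ?S (?cut ` ?F)"
    proof (cases i)
      case None
      then show ?thesis using i(2) SR by (simp add: a'_def d'_def)
    next
      case (Some X)
      then have X: "X \<in> ?F" using i(1) by (auto simp: I_def)
      have "Y = ?cut X" using i(2) Some ad(3)[of X] X by (auto simp: a'_def d'_def R_def)
      then show ?thesis using X by blast
    qed
  next
    fix Y assume "Y \<in> insert ?S (?cut ` ?F)"
    then show "Y \<in> {Y. Y facet_of R}" using cut_facet S_facet by blast
  qed
  have inj: "inj_on ?cut ?F"
  proof (rule inj_onI, rule ccontr)
    fix X Y assume XY: "X \<in> ?F" "Y \<in> ?F" "?cut X = ?cut Y" "X \<noteq> Y"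
    have Xf: "X face_of P" "Y face_of P" using XY by (auto simp: facet_of_def)
    have int: "X \<inter> Y face_of X" using face_of_subset[OF face_of_Int[OF Xf]] face_of_imp_subset[OF Xf(1)] by blast
    have int': "X \<inter> Y face_of Y" using face_of_subset[OF face_of_Int[OF Xf]] face_of_imp_subset[OF Xf(2)] by blast
    have "X \<inter> {x. u \<bullet> x < c} \<subseteq> X \<inter> Y" using XY(3) by (auto intro: less_imp_le)
    then have "2 \<le> aff_dim (X \<inter> Y)" using cut_dim[OF XY(1)] aff_dim_subset by metis
    then have "X \<inter> Y = X" "X \<inter> Y = Y"
      using face_of_aff_dim_lt[OF face_of_imp_convex[OF Xf(1)] int] face_of_aff_dim_lt[OF face_of_imp_convex[OF Xf(2)] int']
        facet_dim[OF P] XY(1,2) by force+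
    then show False using XY(4) by blast
  qed
  have notin: "?S \<notin> ?cut ` ?F"
  proof
    assume "?S \<in> ?cut ` ?F"
    then obtain X where X: "X \<in> ?F" "?S = ?cut X" by blast
    have "y X \<in> ?cut X" using y[OF X(1)] yc[OF X(1)] by auto
    then have "y X \<in> ?S" using X(2) by blast
    then show False using yc[OF X(1)] by simp
  qed
  have nf: "num_faces R = Suc (num_faces P)"
    unfolding num_faces_def facets_R using notin D(11) inj by (simp add: card_image)
  have g: "2 * total_edge_length R \<le> 2 * total_edge_length P + girth ?S"
  proof -
    have "2 * total_edge_length R = girth ?S + (\<Sum>X\<in>?F. girth (?cut X))"
      unfolding total_edge_length_girth[OF R] facets_R using notin D(11) inj by (simp add: sum.reindex)
    also have "\<dots> \<le> girth ?S + (\<Sum>X\<in>?F. girth X)"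
    proof (intro add_left_mono sum_mono)
      fix X assume X: "X \<in> ?F"
      then have "compact X" using face_of_imp_compact[OF D(3,4)] by (auto simp: facet_of_def)
      moreover have "?cut X \<noteq> {}" using cut_facet[OF X] by (simp add: facet_of_def)
      ultimately show "girth (?cut X) \<le> girth X" by (intro girth_mono compact_cut) auto
    qed
    finally show ?thesis using total_edge_length_girth[OF P] by simp
  qed
  have sub: "P \<inter> {x. c1 \<le> u \<bullet> x} \<subseteq> ball z \<epsilon>" by (rule c1(2))
  have "girth ?S \<le> 2 * \<epsilon> * (2 * measure lebesgue (cball (0 :: pt) 1) / unit_mean)"
  proof (rule girth_le_diameter)
    show "compact ?S" by (rule compact_cut[OF D(4)])
    show "?S \<noteq> {}" using S_facet by (simp add: facet_of_def)
    fix x y assume "x \<in> ?S" "y \<in> ?S"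
    then have "x \<in> ball z \<epsilon>" "y \<in> ball z \<epsilon>" using sub c1c by auto
    then have "dist x y < 2 * \<epsilon>" using dist_triangle2[of x y z] by (simp add: dist_commute)
    then show "norm (x - y) \<le> 2 * \<epsilon>" by (simp add: dist_norm)
  qed
  then have "total_edge_length R \<le> total_edge_length P + \<epsilon> * (2 * measure lebesgue (cball (0 :: pt) 1) / unit_mean)"
    using g by simp
  moreover have "P \<subseteq> R \<union> ball z \<epsilon>" using sub c1c by (auto simp: R_def)
  moreover have "R \<subseteq> P" by (auto simp: R_def)
  ultimately show ?thesis using R nf by blast
qed

lemma measure_polyhedron_pos: "convex_polyhedron P \<Longrightarrow> 0 < measure lebesgue P"
proof -
  assume P: "convex_polyhedron P"
  note D = convex_polyhedronD[OF P]
  obtain z where "z \<in> interior P" using D(8) by blast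
  then obtain e where e: "0 < e" "ball z e \<subseteq> P" by (meson mem_interior)
  have "0 < measure lborel (ball z e)" using content_ball_pos[OF e(1)] .
  also have "\<dots> = measure lebesgue (ball z e)" by simp
  also have "\<dots> \<le> measure lebesgue P"
    by (rule measure_mono_fmeasurable[OF e(2)]) (auto intro: lmeasurable_compact D(4))
  finally show ?thesis .
qed

lemma add_face_approx:
  assumes P: "convex_polyhedron P" and \<delta>: "0 < \<delta>"
  shows "\<exists>R. convex_polyhedron R \<and> num_faces R = Suc (num_faces P) \<and> melzak R < melzak P + \<delta>"
proof -
  note D = convex_polyhedronD[OF P]
  define K where "K = 2 * measure lebesgue (cball (0 :: pt) 1) / unit_mean"
  define B where "B = measure lebesgue (ball (0 :: pt) 1)"
  define e where "e = total_edge_length P"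
  define v where "v = measure lebesgue P"
  have v: "0 < v" using measure_polyhedron_pos[OF P] by (simp add: v_def)
  define f where "f = (\<lambda>\<epsilon>. (e + \<epsilon> * K) ^ 3 / (v - \<epsilon> ^ 3 * B))"
  have "(f \<longlongrightarrow> (e + 0 * K) ^ 3 / (v - 0 ^ 3 * B)) (at_right 0)"
    unfolding f_def by (intro tendsto_intros) (use v in auto)
  then have lim: "(f \<longlongrightarrow> e ^ 3 / v) (at_right 0)" by simp
  have "((\<lambda>\<epsilon>. v - \<epsilon> ^ 3 * B) \<longlongrightarrow> v - 0 ^ 3 * B) (at_right 0)" by (intro tendsto_intros)
  then have lim2: "((\<lambda>\<epsilon>. v - \<epsilon> ^ 3 * B) \<longlongrightarrow> v) (at_right 0)" by simp
  have "\<forall>\<^sub>F \<epsilon> in at_right 0. f \<epsilon> < e ^ 3 / v + \<delta> \<and> 0 < v - \<epsilon> ^ 3 * B \<and> (0 :: real) < \<epsilon>"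
    using order_tendstoD(2)[OF lim, of "e ^ 3 / v + \<delta>"] \<delta> order_tendstoD(1)[OF lim2 v] eventually_at_right_less[of "0::real"]
    by (auto elim: eventually_elim2 intro: eventually_conj)
  then obtain \<epsilon> where \<epsilon>: "f \<epsilon> < e ^ 3 / v + \<delta>" "0 < v - \<epsilon> ^ 3 * B" "0 < \<epsilon>"
    using eventually_happens'[OF trivial_limit_at_right_real] by blast
  obtain z R where R: "convex_polyhedron R" "num_faces R = Suc (num_faces P)" "R \<subseteq> P" "P \<subseteq> R \<union> ball z \<epsilon>"
    "total_edge_length R \<le> e + \<epsilon> * K"
    using cut_off_corner[OF P \<epsilon>(3)] unfolding e_def K_def by blast
  have "v \<le> measure lebesgue (R \<union> ball z \<epsilon>)"
    unfolding v_def by (rule measure_mono_fmeasurable[OF R(4)])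
      (intro fmeasurable.Un lmeasurable_compact D(4) convex_polyhedronD(4)[OF R(1)] fmeasurableD lmeasurable_ball)+
  also have "\<dots> \<le> measure lebesgue R + measure lebesgue (ball z \<epsilon>)"
    by (rule measure_Un_le) (auto intro!: fmeasurableD lmeasurable_compact convex_polyhedronD(4)[OF R(1)])
  also have "measure lebesgue (ball z \<epsilon>) = \<epsilon> ^ 3 * B"
    using content_ball_conv_unit_ball[of \<epsilon> z] \<epsilon>(3) by (simp add: B_def)
  finally have vR: "v - \<epsilon> ^ 3 * B \<le> measure lebesgue R" by simp
  have "0 \<le> total_edge_length R"
  proof -
    obtain x where "x \<in> R" using convex_polyhedronD(9)[OF R(1)] by blast
    from diameter_le_total_edge_length[OF R(1) this this] show ?thesis by simp
  qed
  then have "melzak R \<le> f \<epsilon>"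
    unfolding melzak_def f_def using R(5) vR \<epsilon>(2) by (intro frac_le power_mono) auto
  also have "\<dots> < melzak P + \<delta>" using \<epsilon>(1) by (simp add: melzak_def e_def v_def)
  finally show ?thesis using R by blast
qed

text \<open>Faces can be added one at a time at an arbitrarily small cost, by cutting off corners.\<close>

lemma minimizer_fewer_faces:
  assumes min: "\<And>R. convex_polyhedron R \<Longrightarrow> num_faces R = N \<Longrightarrow> m \<le> melzak R"
    and R: "convex_polyhedron R" "num_faces R \<le> N"
  shows "m \<le> melzak R"
  using R
proof (induction "N - num_faces R" arbitrary: R)
  case 0
  then show ?case using min by simp
next
  case (Suc k)
  show ?case
  proof (rule field_le_epsilon)
    fix \<delta> :: real assume "0 < \<delta>"
    then obtain R' where R': "convex_polyhedron R'" "num_faces R' = Suc (num_faces R)" "melzak R' < melzak R + \<delta>"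
      using add_face_approx[OF Suc.prems(1)] by blast
    then have "m \<le> melzak R'" using Suc by simp
    with R'(3) show "m \<le> melzak R + \<delta>" by simp
  qed
qed

section \<open>Translating a polyhedron against itself\<close>

text \<open>Each translate contributes at least the volume of \<open>P\<close> minus its overlap with the previous translate: a point that it
  shares with any earlier translate lies, by convexity, in the previous one.\<close>

lemma stack_measure:
  fixes P :: "pt set"
  assumes "convex P" "compact P"
  shows "measure lebesgue P + real N * (measure lebesgue P - measure lebesgue (P \<inter> {x. x + d \<in> P}))
    \<le> measure lebesgue (\<Union>j\<le>N. (+) (real j *\<^sub>R d) ` P)"
proof (induction N)
  case 0
  have "(+) 0 ` P = P" by auto
  then show ?case by simp
next
  case (Suc N)
  let ?v = "measure lebesgue P" and ?Q = "P \<inter> {x. x + d \<in> P}"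
  let ?T = "\<lambda>j. (+) (real j *\<^sub>R d) ` P"
  let ?U = "\<Union>j\<le>N. ?T j"
  have cT: "compact (?T j)" for j by (rule compact_translation[OF assms(2)])
  then have lT: "?T j \<in> lmeasurable" for j by (rule lmeasurable_compact)
  have lU: "?U \<in> lmeasurable" by (intro fmeasurable.finite_UN lT) auto
  have lQ: "?Q \<in> lmeasurable"
  proof -
    have "?Q = P \<inter> (+) (- d) ` P"
      by (auto simp: image_iff) (metis add.commute add_diff_cancel_right' diff_conv_add_uminus)
    moreover have "P \<inter> (+) (- d) ` P \<in> lmeasurable"
      by (intro lmeasurable_compact compact_Int compact_translation assms(2))
    ultimately show ?thesis by simp
  qed
  have overlap: "?U \<inter> ?T (Suc N) \<subseteq> ?T N"
  proof
    fix x assume x: "x \<in> ?U \<inter> ?T (Suc N)"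
    then obtain j p where j: "j \<le> N" "p \<in> P" "x = real j *\<^sub>R d + p" by auto
    obtain q where q: "q \<in> P" "x = real (Suc N) *\<^sub>R d + q" using x by auto
    have "p = (real (Suc N) - real j) *\<^sub>R d + q" using j(3) q(2) by (simp add: algebra_simps)
    define m where "m = real (Suc N) - real j"
    have m: "1 \<le> m" using j(1) by (simp add: m_def)
    have p: "p = m *\<^sub>R d + q" using \<open>p = _\<close> by (simp add: m_def)
    \<comment> \<open>The point \<open>q + d\<close> lies between \<open>q\<close> and \<open>p = q + m d\<close>, as \<open>m \<ge> 1\<close>.\<close>
    have "(1 - 1 / m) *\<^sub>R q + (1 / m) *\<^sub>R p \<in> P"
      by (rule convexD_alt[OF assms(1) q(1) j(2)]) (use m in auto)
    moreover have "(1 - 1 / m) *\<^sub>R q + (1 / m) *\<^sub>R p = q + d" using m by (simp add: p algebra_simps)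
    ultimately have "q + d \<in> P" by simp
    moreover have "x = real N *\<^sub>R d + (q + d)" using q(2) by (simp add: algebra_simps)
    ultimately show "x \<in> ?T N" by blast
  qed
  have top: "?v - measure lebesgue ?Q \<le> measure lebesgue (?T (Suc N) - ?U)"
  proof -
    have sub: "?T (Suc N) \<inter> ?U \<subseteq> (+) (real (Suc N) *\<^sub>R d) ` ?Q"
    proof
      fix x assume "x \<in> ?T (Suc N) \<inter> ?U"
      then have "x \<in> ?T N" "x \<in> ?T (Suc N)" using overlap by auto
      then obtain p q where pq: "p \<in> P" "x = real N *\<^sub>R d + p" "q \<in> P" "x = real (Suc N) *\<^sub>R d + q" by auto
      then have "p = q + d" by (simp add: algebra_simps)
      then show "x \<in> (+) (real (Suc N) *\<^sub>R d) ` ?Q" using pq by blast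
    qed
    have "measure lebesgue (?T (Suc N) \<inter> ?U) \<le> measure lebesgue ((+) (real (Suc N) *\<^sub>R d) ` ?Q)"
    proof (rule measure_mono_fmeasurable[OF sub])
      show "?T (Suc N) \<inter> ?U \<in> sets lebesgue" using fmeasurableD[OF lT] fmeasurableD[OF lU] by (rule sets.Int)
      show "(+) (real (Suc N) *\<^sub>R d) ` ?Q \<in> lmeasurable" by (rule measurable_translation[OF lQ])
    qed
    then have "measure lebesgue (?T (Suc N) \<inter> ?U) \<le> measure lebesgue ?Q" by (simp add: measure_translation)
    moreover have "measure lebesgue (?T (Suc N) - ?U) = measure lebesgue (?T (Suc N)) - measure lebesgue (?T (Suc N) \<inter> ?U)"
    proof -
      have "?T (Suc N) \<inter> ?U \<in> lmeasurable" by (rule fmeasurable_Int_fmeasurable[OF lT fmeasurableD[OF lU]])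
      from measure_Un2[OF this lT[of "Suc N"]]
      have "measure lebesgue (?T (Suc N) \<inter> ?U \<union> ?T (Suc N))
          = measure lebesgue (?T (Suc N) \<inter> ?U) + measure lebesgue (?T (Suc N) - ?T (Suc N) \<inter> ?U)" .
      moreover have "?T (Suc N) \<inter> ?U \<union> ?T (Suc N) = ?T (Suc N)" by blast
      moreover have "?T (Suc N) - ?T (Suc N) \<inter> ?U = ?T (Suc N) - ?U" by blast
      ultimately show ?thesis by simp
    qed
    ultimately show ?thesis by (simp add: measure_translation)
  qed
  have "(\<Union>j\<le>Suc N. ?T j) = ?U \<union> ?T (Suc N)" by (simp only: atMost_Suc UN_insert Un_commute)
  then have "measure lebesgue (\<Union>j\<le>Suc N. ?T j) = measure lebesgue ?U + measure lebesgue (?T (Suc N) - ?U)"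
    using measure_Un2[OF lU lT[of "Suc N"]] by simp
  then show ?case using Suc top by (simp add: algebra_simps)
qed

lemma stack_measure_subset:
  fixes P :: "pt set"
  assumes "convex P" "compact P" "Z \<in> lmeasurable" "\<And>j x. j \<le> N \<Longrightarrow> x \<in> P \<Longrightarrow> x + real j *\<^sub>R d \<in> Z"
  shows "measure lebesgue P + real N * (measure lebesgue P - measure lebesgue (P \<inter> {x. x + d \<in> P})) \<le> measure lebesgue Z"
proof -
  have "measure lebesgue (\<Union>j\<le>N. (+) (real j *\<^sub>R d) ` P) \<le> measure lebesgue Z"
  proof (rule measure_mono_fmeasurable)
    show "(\<Union>j\<le>N. (+) (real j *\<^sub>R d) ` P) \<subseteq> Z" using assms(4) by (auto simp: add.commute)
    show "(\<Union>j\<le>N. (+) (real j *\<^sub>R d) ` P) \<in> sets lebesgue"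
      by (intro sets.finite_UN fmeasurableD lmeasurable_compact compact_translation assms(2)) auto
  qed (rule assms(3))
  then show ?thesis using stack_measure[OF assms(1,2), of N d] by linarith
qed

text \<open>As many translates of \<open>P\<close> by multiples of \<open>d\<close> as fit into the larger ball are stacked; each one adds the volume on the left.\<close>

lemma erosion_measure:
  fixes P :: "pt set"
  assumes "convex P" "compact P" "P \<subseteq> cball p D" "d \<noteq> 0" "norm d \<le> 1/2"
  shows "measure lebesgue P - measure lebesgue (P \<inter> {x. x + d \<in> P}) \<le> 2 * norm d * measure lebesgue (cball p (D + 1))"
proof -
  define N where "N = nat \<lfloor>1 / norm d\<rfloor>"
  have nd: "0 < norm d" using assms(4) by simp
  have "2 \<le> 1 / norm d" using nd assms(5) by (simp add: field_simps)
  then have N: "real N \<le> 1 / norm d" "1 / norm d - 1 < real N" by (auto simp: N_def)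
  have inb: "x + real j *\<^sub>R d \<in> cball p (D + 1)" if "j \<le> N" "x \<in> P" for j x
  proof -
    have "real j * norm d \<le> real N * norm d" using that nd by simp
    also have "\<dots> \<le> 1" using N(1) nd by (simp add: field_simps)
    finally have "norm (real j *\<^sub>R d) \<le> 1" by simp
    moreover have "dist p x \<le> D" using that assms(3) by auto
    ultimately show ?thesis using norm_triangle_ineq[of "x - p" "real j *\<^sub>R d"]
      by (simp add: dist_norm norm_minus_commute algebra_simps)
  qed
  have "measure lebesgue P + real N * (measure lebesgue P - measure lebesgue (P \<inter> {x. x + d \<in> P}))
      \<le> measure lebesgue (cball p (D + 1))"
    by (rule stack_measure_subset[OF assms(1,2) lmeasurable_cball]) (use inb in auto)
  then have le: "real N * (measure lebesgue P - measure lebesgue (P \<inter> {x. x + d \<in> P})) \<le> measure lebesgue (cball p (D + 1))"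
    using measure_nonneg[of lebesgue P] by linarith
  have "1 / norm d \<le> 2 * real N" using N(2) \<open>2 \<le> 1 / norm d\<close> by linarith
  then have dN: "1 \<le> 2 * norm d * real N" using nd by (simp add: field_simps)
  let ?x = "measure lebesgue P - measure lebesgue (P \<inter> {x. x + d \<in> P})"
  show ?thesis
  proof (cases "0 \<le> ?x")
    case True
    then have "?x \<le> 2 * norm d * real N * ?x" using mult_right_mono[OF dN True] by simp
    also have "\<dots> \<le> 2 * norm d * measure lebesgue (cball p (D + 1))"
      using mult_left_mono[OF le, of "2 * norm d"] by (simp add: mult.assoc)
    finally show ?thesis .
  next
    case False
    moreover have "0 \<le> 2 * norm d * measure lebesgue (cball p (D + 1))" by simp
    ultimately show ?thesis by linarith
  qed
qed

section \<open>Varying support numbers\<close>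

text \<open>The lower estimates for \<open>(1 + y) powr (1/3)\<close> and \<open>(1 - y) powr (1/3)\<close> that are exact to first order turn a bound for volumes
  into a bound for edge lengths.\<close>

lemma cube_root_lower:
  fixes e x y :: real
  assumes "0 \<le> e" "0 \<le> x" "0 \<le> y" "e ^ 3 * (1 + y) \<le> x ^ 3"
  shows "e * (1 + y / 3 - y\<^sup>2 / 9) \<le> x"
proof (cases "0 \<le> 1 + y / 3 - y\<^sup>2 / 9")
  case True
  define u where "u = y / 3"
  have u: "0 \<le> u" "y = 3 * u" using assms by (auto simp: u_def)
  have "(1 + u - u\<^sup>2) ^ 3 = 1 + 3 * u - u ^ 3 * (5 - 3 * u\<^sup>2 + u ^ 3)" by algebra
  moreover have "0 \<le> (u - 2)\<^sup>2 * (u + 1)" using u by simp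
  then have "0 \<le> 5 - 3 * u\<^sup>2 + u ^ 3" by (simp add: power2_eq_square power3_eq_cube algebra_simps)
  then have "0 \<le> u ^ 3 * (5 - 3 * u\<^sup>2 + u ^ 3)" using u by simp
  ultimately have "(1 + u - u\<^sup>2) ^ 3 \<le> 1 + 3 * u" by simp
  then have "(1 + y / 3 - y\<^sup>2 / 9) ^ 3 \<le> 1 + y" using u by (simp add: power2_eq_square)
  then have "(e * (1 + y / 3 - y\<^sup>2 / 9)) ^ 3 \<le> e ^ 3 * (1 + y)"
    using assms(1) by (simp add: power_mult_distrib mult_left_mono)
  then have "(e * (1 + y / 3 - y\<^sup>2 / 9)) ^ 3 \<le> x ^ 3" using assms(4) by linarith
  then show ?thesis using power_le_imp_le_base[of _ 2 x] assms(2) by (simp add: numeral_3_eq_3)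
next
  case False
  then have "e * (1 + y / 3 - y\<^sup>2 / 9) \<le> 0" using assms(1) by (simp add: mult_nonneg_nonpos)
  then show ?thesis using assms(2) by linarith
qed

lemma cube_root_lower':
  fixes e x y :: real
  assumes "0 \<le> e" "0 \<le> x" "0 \<le> y" "y \<le> 1/2" "e ^ 3 * (1 - y) \<le> x ^ 3"
  shows "e * (1 - y / 3 - y\<^sup>2) \<le> x"
proof -
  define r where "r = y / 3 + y\<^sup>2"
  have "y * y \<le> (1/2) * y" using assms by (intro mult_right_mono) auto
  then have r: "0 \<le> r" "r \<le> y" using assms by (auto simp: r_def power2_eq_square)
  then have r2: "r\<^sup>2 \<le> y\<^sup>2" by (intro power_mono)
  have "(1 - r) ^ 3 = 1 - 3 * r + 3 * r\<^sup>2 - r ^ 3" by algebra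
  also have "\<dots> \<le> 1 - y"
  proof -
    have "3 * r = y + 3 * y\<^sup>2" by (simp add: r_def)
    then show ?thesis using r2 zero_le_power[OF r(1), of 3] by linarith
  qed
  finally have "e ^ 3 * (1 - r) ^ 3 \<le> e ^ 3 * (1 - y)" using assms(1) by (intro mult_left_mono) auto
  then have "(e * (1 - r)) ^ 3 \<le> x ^ 3" using assms(5) by (simp add: power_mult_distrib)
  then have "e * (1 - r) \<le> x" using power_le_imp_le_base[of _ 2 x] assms(2) by (simp add: numeral_3_eq_3)
  then show ?thesis by (simp add: r_def diff_diff_eq)
qed

definition cap :: "'i set \<Rightarrow> ('i \<Rightarrow> pt) \<Rightarrow> ('i \<Rightarrow> real) \<Rightarrow> pt set" where
  "cap I a h = {x. \<forall>i\<in>I. a i \<bullet> x \<le> h i}"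

definition side :: "'i set \<Rightarrow> ('i \<Rightarrow> pt) \<Rightarrow> ('i \<Rightarrow> real) \<Rightarrow> 'i \<Rightarrow> pt set" where
  "side I a h i = cap I a h \<inter> {x. a i \<bullet> x = h i}"

definition side_girth :: "'i set \<Rightarrow> ('i \<Rightarrow> pt) \<Rightarrow> ('i \<Rightarrow> real) \<Rightarrow> real" where
  "side_girth I a h = (\<Sum>i\<in>I. girth (side I a h i))"

text \<open>The planes whose outer normal makes an acute angle with \<open>k\<close> are moved so as to follow a translation by \<open>\<tau> *\<^sub>R k\<close>, the others stay.
  For \<open>\<tau> \<ge> 0\<close> the polyhedron grows by at least the sweep along \<open>k\<close>, for negative \<open>\<tau>\<close> it is intersected with a translate of itself.\<close>

definition shifted :: "('i \<Rightarrow> pt) \<Rightarrow> ('i \<Rightarrow> real) \<Rightarrow> pt \<Rightarrow> real \<Rightarrow> 'i \<Rightarrow> real" where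
  "shifted a h k \<tau> i = h i + \<tau> * max 0 (a i \<bullet> k)"

lemma closed_cap: "closed (cap I a h)"
proof -
  have "cap I a h = (\<Inter>i\<in>I. {x. a i \<bullet> x \<le> h i})" by (auto simp: cap_def)
  then show ?thesis by (simp add: closed_INT closed_halfspace_le)
qed

lemma convex_cap: "convex (cap I a h)"
proof -
  have "cap I a h = (\<Inter>i\<in>I. {x. a i \<bullet> x \<le> h i})" by (auto simp: cap_def)
  then show ?thesis by (simp add: convex_INT convex_halfspace_le)
qed

lemma compact_cap: "bounded (cap I a h) \<Longrightarrow> compact (cap I a h)"
  by (simp add: compact_eq_bounded_closed closed_cap)

text \<open>With fixed normals, every face of a convex combination contains the combination of the
  corresponding faces.  Every halfspace has to touch both polyhedra, as an empty face has no girth.\<close>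

lemma side_girth_concave:
  assumes comp: "compact (cap I a h)" "compact (cap I a h1)" "compact (cap I a h2)"
    and ne: "\<And>i. i \<in> I \<Longrightarrow> side I a h1 i \<noteq> {}" "\<And>i. i \<in> I \<Longrightarrow> side I a h2 i \<noteq> {}"
    and pos: "0 \<le> \<mu>" "0 \<le> \<nu>" and h: "\<And>i. i \<in> I \<Longrightarrow> h i = \<mu> * h1 i + \<nu> * h2 i"
  shows "\<mu> * side_girth I a h1 + \<nu> * side_girth I a h2 \<le> side_girth I a h"
  unfolding side_girth_def sum_distrib_left sum.distrib[symmetric]
proof (rule sum_mono)
  fix i assume i: "i \<in> I"
  show "\<mu> * girth (side I a h1 i) + \<nu> * girth (side I a h2 i) \<le> girth (side I a h i)"
  proof (rule girth_concave[OF _ _ _ ne[OF i] pos])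
    show "compact (side I a h i)" "compact (side I a h1 i)" "compact (side I a h2 i)"
      unfolding side_def by (intro compact_cut comp)+
    fix x y assume x: "x \<in> side I a h1 i" and y: "y \<in> side I a h2 i"
    have "a j \<bullet> (\<mu> *\<^sub>R x + \<nu> *\<^sub>R y) \<le> h j" if "j \<in> I" for j
      using x y that pos unfolding h[OF that] by (auto simp: side_def cap_def inner_add_right intro!: add_mono mult_left_mono)
    moreover have "a i \<bullet> (\<mu> *\<^sub>R x + \<nu> *\<^sub>R y) = h i"
      using x y h[OF i] by (simp add: side_def inner_add_right)
    ultimately show "\<mu> *\<^sub>R x + \<nu> *\<^sub>R y \<in> side I a h i" by (simp add: side_def cap_def)
  qed
qed

lemma cap_shifted_erosion:
  assumes "0 \<le> s"
  shows "cap I a (shifted a h k (- s)) = cap I a h \<inter> {x. x + s *\<^sub>R k \<in> cap I a h}"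
proof -
  have "a i \<bullet> x \<le> h i - s * max 0 (a i \<bullet> k) \<longleftrightarrow> a i \<bullet> x \<le> h i \<and> a i \<bullet> (x + s *\<^sub>R k) \<le> h i" for i x
  proof (cases "0 \<le> a i \<bullet> k")
    case True
    then have "0 \<le> s * (a i \<bullet> k)" using assms by simp
    then show ?thesis using True by (auto simp: inner_add_right)
  next
    case False
    then have "s * (a i \<bullet> k) \<le> 0" using assms by (simp add: mult_nonneg_nonpos)
    then show ?thesis using False by (auto simp: inner_add_right)
  qed
  then show ?thesis by (auto simp: cap_def shifted_def)
qed

lemma cap_shifted_translate:
  assumes "x \<in> cap I a h" "0 \<le> r" "r \<le> t"
  shows "x + r *\<^sub>R k \<in> cap I a (shifted a h k t)"
  unfolding cap_def
proof (clarify)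
  fix i assume i: "i \<in> I"
  have "r * (a i \<bullet> k) \<le> t * max 0 (a i \<bullet> k)"
  proof (cases "0 \<le> a i \<bullet> k")
    case True
    then show ?thesis using assms by (simp add: mult_right_mono)
  next
    case False
    then show ?thesis using assms by (simp add: mult_nonneg_nonpos)
  qed
  then show "a i \<bullet> (x + r *\<^sub>R k) \<le> shifted a h k t i"
    using assms(1) i by (auto simp: cap_def shifted_def inner_add_right intro!: add_mono)
qed

lemma side_shifted_nonempty:
  assumes "side I a h i \<noteq> {}" "0 \<le> t" "i \<in> I"
  shows "side I a (shifted a h k t) i \<noteq> {}"
proof -
  obtain x where x: "x \<in> cap I a h" "a i \<bullet> x = h i" using assms(1) by (auto simp: side_def)
  define r where "r = (if 0 \<le> a i \<bullet> k then t else 0)"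
  have "x + r *\<^sub>R k \<in> cap I a (shifted a h k t)"
    by (rule cap_shifted_translate[OF x(1)]) (use assms(2) in \<open>auto simp: r_def\<close>)
  moreover have "a i \<bullet> (x + r *\<^sub>R k) = shifted a h k t i"
    using x(2) by (simp add: r_def shifted_def inner_add_right)
  ultimately show ?thesis by (auto simp: side_def)
qed

text \<open>A homothety with an interior centre maps the enlarged polyhedron into the given one.\<close>

lemma bounded_cap_shifted:
  assumes fin: "finite I" and bd: "bounded (cap I a h)" and z: "\<And>i. i \<in> I \<Longrightarrow> a i \<bullet> z < h i" and t: "0 \<le> t"
  shows "bounded (cap I a (shifted a h k t))"
proof (cases "I = {}")
  case True
  then show ?thesis using bd by (simp add: cap_def)
next
  case False
  define \<sigma> where "\<sigma> = Min ((\<lambda>i. h i - a i \<bullet> z) ` I)"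
  define m where "m = t * Max ((\<lambda>i. max 0 (a i \<bullet> k)) ` I)"
  have s: "0 < \<sigma>" using fin False z by (simp add: \<sigma>_def)
  have si: "\<sigma> \<le> h i - a i \<bullet> z" if "i \<in> I" for i unfolding \<sigma>_def using fin that by (intro Min_le) auto
  have mi: "t * max 0 (a i \<bullet> k) \<le> m" if "i \<in> I" for i
    unfolding m_def using fin that t by (intro mult_left_mono Max_ge) auto
  have m: "0 \<le> m" using mi False t by (metis ex_in_conv max.cobounded1 mult_nonneg_nonneg order_trans)
  define \<theta> where "\<theta> = \<sigma> / (\<sigma> + m)"
  have th: "0 < \<theta>" "\<theta> \<le> 1" using s m by (auto simp: \<theta>_def divide_simps)
  have "z + \<theta> *\<^sub>R (x - z) \<in> cap I a h" if x: "x \<in> cap I a (shifted a h k t)" for x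
    unfolding cap_def
  proof (clarify)
    fix i assume i: "i \<in> I"
    have ax: "a i \<bullet> x \<le> h i + m" using x i mi[OF i] by (force simp: cap_def shifted_def)
    have "a i \<bullet> (z + \<theta> *\<^sub>R (x - z)) = (1 - \<theta>) * (a i \<bullet> z) + \<theta> * (a i \<bullet> x)"
      by (simp add: inner_add_right inner_diff_right algebra_simps)
    also have "\<dots> \<le> (1 - \<theta>) * (h i - \<sigma>) + \<theta> * (h i + m)"
      using th ax si[OF i] by (intro add_mono mult_left_mono) auto
    also have "\<dots> = h i + (\<theta> * (\<sigma> + m) - \<sigma>)" by (simp add: algebra_simps)
    also have "\<dots> = h i" using s m by (simp add: \<theta>_def)
    finally show "a i \<bullet> (z + \<theta> *\<^sub>R (x - z)) \<le> h i" .
  qed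
  then have "cap I a (shifted a h k t) \<subseteq> (\<lambda>y. z + (1 / \<theta>) *\<^sub>R (y - z)) ` cap I a h"
    using th by (auto intro!: image_eqI[where x = "z + \<theta> *\<^sub>R (_ - z)"])
  moreover have "bounded ((\<lambda>y. z + (1 / \<theta>) *\<^sub>R (y - z)) ` cap I a h)"
  proof -
    have "bounded ((\<lambda>y. (z - (1 / \<theta>) *\<^sub>R z) + y) ` ((\<lambda>y. (1 / \<theta>) *\<^sub>R y) ` cap I a h))"
      by (intro bounded_translation bounded_scaling bd)
    then show ?thesis by (simp add: image_image algebra_simps)
  qed
  ultimately show ?thesis using bounded_subset by blast
qed

text \<open>The halfspace \<open>n \<bullet> x \<le> l\<close> is one more halfspace, with index \<open>None\<close>.\<close>

lemma cap_cut_by_plane: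
  fixes a :: "'i \<Rightarrow> pt"
  assumes fin: "finite I" and a: "\<And>i. i \<in> I \<Longrightarrow> a i \<noteq> 0" "n \<noteq> 0"
    and P: "convex_polyhedron (cap I a h \<inter> {x. n \<bullet> x \<le> l})"
  shows "num_faces (cap I a h \<inter> {x. n \<bullet> x \<le> l}) \<le> Suc (card I)"
    and "(\<And>i. i \<in> I \<Longrightarrow> side I a h i \<inter> {x. n \<bullet> x \<le> l} \<noteq> {}) \<Longrightarrow> cap I a h \<inter> {x. n \<bullet> x = l} \<noteq> {} \<Longrightarrow>
      2 * total_edge_length (cap I a h \<inter> {x. n \<bullet> x \<le> l})
        \<le> (\<Sum>i\<in>I. girth (side I a h i \<inter> {x. n \<bullet> x \<le> l})) + girth (cap I a h \<inter> {x. n \<bullet> x = l})"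
proof -
  let ?R = "cap I a h \<inter> {x. n \<bullet> x \<le> l}"
  let ?J = "insert None (Some ` I)"
  define a' where "a' = (\<lambda>j. case j of None \<Rightarrow> n | Some i \<Rightarrow> a i)"
  define h' where "h' = (\<lambda>j. case j of None \<Rightarrow> l | Some i \<Rightarrow> h i)"
  have finJ: "finite ?J" using fin by simp
  have R: "?R = {x. \<forall>j\<in>?J. a' j \<bullet> x \<le> h' j}" by (auto simp: cap_def a'_def h'_def)
  have a': "a' j \<noteq> 0" if "j \<in> ?J" for j using that a by (auto simp: a'_def)
  have card: "card ?J = Suc (card I)" using fin by (subst card_insert_disjoint) (auto simp: card_image)
  show "num_faces ?R \<le> Suc (card I)" using num_faces_halfspaces[OF finJ R a' P] card by simp
  assume ne: "\<And>i. i \<in> I \<Longrightarrow> side I a h i \<inter> {x. n \<bullet> x \<le> l} \<noteq> {}" "cap I a h \<inter> {x. n \<bullet> x = l} \<noteq> {}"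
  have S: "?R \<inter> {x. a' (Some i) \<bullet> x = h' (Some i)} = side I a h i \<inter> {x. n \<bullet> x \<le> l}" for i
    by (auto simp: side_def a'_def h'_def)
  have N: "?R \<inter> {x. a' None \<bullet> x = h' None} = cap I a h \<inter> {x. n \<bullet> x = l}"
    by (auto simp: a'_def h'_def)
  have "?R \<inter> {x. a' j \<bullet> x = h' j} \<noteq> {}" if "j \<in> ?J" for j
    using that ne S N by (cases j) auto
  from girth_sum_le[OF finJ R a' P this]
  have "2 * total_edge_length ?R \<le> (\<Sum>j\<in>?J. girth (?R \<inter> {x. a' j \<bullet> x = h' j}))" .
  also have "\<dots> = girth (cap I a h \<inter> {x. n \<bullet> x = l}) + (\<Sum>i\<in>I. girth (side I a h i \<inter> {x. n \<bullet> x \<le> l}))"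
    using fin by (subst sum.insert) (auto simp: S N sum.reindex)
  finally show "2 * total_edge_length ?R
      \<le> (\<Sum>i\<in>I. girth (side I a h i \<inter> {x. n \<bullet> x \<le> l})) + girth (cap I a h \<inter> {x. n \<bullet> x = l})" by simp
qed

text \<open>The shift by \<open>-s\<close> with the face \<open>n \<bullet> x = d\<close> kept is the intersection of two translates of \<open>P\<close>, and the shift by
  \<open>t\<close> without that face contains all translates of \<open>P\<close> by \<open>r k\<close>, \<open>0 \<le> r \<le> t\<close>.
  For \<open>s = t/N\<close>, the original support numbers are the mean of these two shifts with weights \<open>N/(N+1)\<close> and \<open>1/(N+1)\<close>.
  The volume lost by the small shift is at most \<open>1/N\<close> times the volume won by the large one, so that the first order
  terms of the edge lengths cancel when the minimality of \<open>P\<close> is applied to both.  The assumption \<open>loc\<close> provides the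
  gain \<open>g + s * \<eta>\<close> of dropping the face after the small shift.\<close>

lemma variation_inequality:
  assumes fin: "finite I" and a: "\<And>i. i \<in> I \<Longrightarrow> a i \<noteq> 0"
    and bd: "bounded (cap I a b)" and P: "P = cap I a b \<inter> {x. n \<bullet> x \<le> d}" "convex_polyhedron P"
    and n: "n \<noteq> 0" "n \<bullet> k \<le> 0" and k: "k \<noteq> 0"
    and vol: "measure lebesgue P = 1"
    and min: "\<And>R. convex_polyhedron R \<Longrightarrow> num_faces R \<le> Suc (card I) \<Longrightarrow> melzak P \<le> melzak R"
    and e: "e = total_edge_length P"
    and inner: "\<And>i. i \<in> I \<Longrightarrow> side I a b i \<noteq> {}"
    and G: "side_girth I a b = 2 * (e + g)"
    and loc: "\<forall>\<^sub>F s in at_right 0. (\<forall>i\<in>I. side I a (shifted a b k (- s)) i \<noteq> {}) \<and>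
        (convex_polyhedron (cap I a (shifted a b k (- s)) \<inter> {x. n \<bullet> x \<le> d}) \<longrightarrow>
        2 * (total_edge_length (cap I a (shifted a b k (- s)) \<inter> {x. n \<bullet> x \<le> d}) + g + s * \<eta>)
          \<le> side_girth I a (shifted a b k (- s)))"
    and ball: "P \<subseteq> cball p D" and t: "0 < t"
  shows "t * \<eta> - 8 * e * (measure lebesgue (cball p (D + 1)))\<^sup>2 * (t * norm k)\<^sup>2 \<le> g"
proof -
  let ?V = "measure lebesgue (cball p (D + 1))"
  let ?C = "\<lambda>\<tau>. cap I a (shifted a b k \<tau>)" and ?v = "\<lambda>S. measure lebesgue (S :: pt set)"
  let ?P = "\<lambda>s. ?C (- s) \<inter> {x. n \<bullet> x \<le> d}"
  note DP = convex_polyhedronD[OF P(2)]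
  obtain z where z: "z \<in> interior P" using DP(8) by blast
  have az: "a i \<bullet> z < b i" if "i \<in> I" for i
    by (rule interior_strict[OF z _ a[OF that]]) (use P(1) that in \<open>auto simp: cap_def\<close>)
  have eros: "?P s = P \<inter> {x. x + s *\<^sub>R k \<in> P}" if "0 \<le> s" for s
  proof -
    have "n \<bullet> (x + s *\<^sub>R k) \<le> d" if "n \<bullet> x \<le> d" for x
      using that n(2) \<open>0 \<le> s\<close> mult_nonneg_nonpos[of s "n \<bullet> k"] by (simp add: inner_add_right)
    then show ?thesis unfolding cap_shifted_erosion[OF that] P(1) by auto
  qed
  define \<delta> where "\<delta> = (\<lambda>s. 1 - ?v (?P s))"
  have del: "\<delta> s \<le> 2 * (s * norm k) * ?V" if "0 < s" "s * norm k \<le> 1/2" for s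
    using erosion_measure[OF DP(3,4) ball, of "s *\<^sub>R k"] that k vol eros[of s] by (simp add: \<delta>_def)
  have del0: "0 \<le> \<delta> s" if "0 \<le> s" for s
  proof -
    have "?v (?P s) \<le> ?v P"
    proof (rule measure_mono_fmeasurable)
      show "?P s \<subseteq> P" using eros[OF that] by auto
      have "compact (?P s)"
        unfolding cap_shifted_erosion[OF that]
        using compact_cut(1)[OF compact_Int_closed[OF compact_cap[OF bd], of "{x. x + s *\<^sub>R k \<in> cap I a b}"], of n d]
        using closed_vimage[OF closed_cap, of "\<lambda>x. x + s *\<^sub>R k" I a b]
        by (simp add: vimage_def continuous_intros)
      then show "?P s \<in> sets lebesgue" by (simp add: lmeasurable_compact fmeasurableD)
      show "P \<in> lmeasurable" by (rule lmeasurable_compact[OF DP(4)])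
    qed
    then show ?thesis using vol by (simp add: \<delta>_def)
  qed
  have e0: "0 \<le> e"
  proof -
    obtain x where "x \<in> P" using DP(9) by blast
    from diameter_le_total_edge_length[OF P(2) this this] show ?thesis by (simp add: e)
  qed
  have pm: "e ^ 3 \<le> melzak P" by (simp add: melzak_def e vol)
  have mel: "e ^ 3 * ?v R \<le> total_edge_length R ^ 3 \<and> 0 \<le> total_edge_length R"
    if R: "convex_polyhedron R" "num_faces R \<le> Suc (card I)" for R
  proof -
    have "e ^ 3 \<le> total_edge_length R ^ 3 / ?v R"
      using min[OF R] pm by (simp add: melzak_def)
    moreover have "0 < ?v R" by (rule measure_polyhedron_pos[OF R(1)])
    moreover obtain x where "x \<in> R" using convex_polyhedronD(9)[OF R(1)] by blast
    then have "0 \<le> total_edge_length R" using diameter_le_total_edge_length[OF R(1), of x x] by simp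
    ultimately show ?thesis by (simp add: field_simps)
  qed
  have bdt: "bounded (?C t)" using bounded_cap_shifted[OF fin bd az] t by simp
  have sub_t: "cap I a b \<subseteq> ?C t" using cap_shifted_translate[of _ I a b 0 t k] t by auto
  have "interior (cap I a b) \<noteq> {}" using z P(1) interior_mono[of P "cap I a b"] by blast
  then have intt: "interior (?C t) \<noteq> {}" using interior_mono[OF sub_t] by blast
  have Ct: "convex_polyhedron (?C t)"
    by (rule convex_polyhedron_halfspaces[OF fin _ bdt intt]) (simp add: cap_def)
  have side_t: "side I a (shifted a b k t) i \<noteq> {}" if "i \<in> I" for i
    using side_shifted_nonempty[OF inner[OF that]] t that by simp
  have len_t: "2 * total_edge_length (?C t) \<le> side_girth I a (shifted a b k t)"
    using girth_sum_le[OF fin cap_def a Ct] side_t by (simp add: side_def side_girth_def)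
  have nf_t: "num_faces (?C t) \<le> Suc (card I)" using num_faces_halfspaces[OF fin cap_def a Ct] by simp
  \<comment> \<open>The volume that \<open>N\<close> steps of length \<open>t/N\<close> win at least; \<open>\<delta> s\<close> is the volume lost by the shift by \<open>-s\<close>.\<close>
  define y where "y = (\<lambda>N :: nat. real N * \<delta> (t / real N))"
  have vt: "1 + y N \<le> ?v (?C t)" if "0 < N" for N
  proof -
    have "?v P + real N * (?v P - ?v (P \<inter> {x. x + (t / real N) *\<^sub>R k \<in> P})) \<le> ?v (?C t)"
    proof (rule stack_measure_subset[OF DP(3,4)])
      show "?C t \<in> lmeasurable" by (intro lmeasurable_compact compact_cap bdt)
      fix j x assume j: "j \<le> N" "x \<in> P"
      have "x + (real j * (t / real N)) *\<^sub>R k \<in> ?C t"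
        by (rule cap_shifted_translate) (use j P(1) that t in \<open>auto simp: field_simps mult_left_mono\<close>)
      then show "x + real j *\<^sub>R (t / real N) *\<^sub>R k \<in> ?C t" by simp
    qed
    then show ?thesis using vol eros[of "t / real N"] t that by (simp add: y_def \<delta>_def)
  qed
  have "((\<lambda>N. t / real N) \<longlongrightarrow> 0) sequentially" by (rule lim_const_over_n)
  then have "filterlim (\<lambda>N. t / real N) (at_right 0) sequentially"
    using t by (auto simp: filterlim_at intro!: eventually_sequentiallyI[of 1])
  note ev = eventually_compose_filterlim[OF loc this]
  have "(\<lambda>N. t / real N * norm k) \<longlonglongrightarrow> 0 * norm k" by (intro tendsto_intros lim_const_over_n)
  then have small1: "\<forall>\<^sub>F N in sequentially. t / real N * norm k < 1/2"
    using order_tendstoD(2)[of _ _ _ "1/2"] by fastforce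
  have "(\<lambda>N. 2 * (t / real N * norm k) * ?V) \<longlonglongrightarrow> 2 * (0 * norm k) * ?V" by (intro tendsto_intros lim_const_over_n)
  then have small2: "\<forall>\<^sub>F N in sequentially. 2 * (t / real N * norm k) * ?V < 1/2"
    using order_tendstoD(2)[of _ _ _ "1/2"] by fastforce
  have "\<forall>\<^sub>F N :: nat in sequentially. 1 \<le> N" by (rule eventually_ge_at_top)
  with ev small1 small2 have "\<forall>\<^sub>F N in sequentially. t * \<eta> - 2 * e * (y N)\<^sup>2 \<le> g \<and> 0 \<le> y N \<and> y N \<le> 2 * (t * norm k) * ?V"
  proof eventually_elim
    case (elim N)
    define s where "s = t / real N"
    have N: "0 < real N" using elim by simp
    have s: "0 < s" "real N * s = t" using t N by (auto simp: s_def)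
    have sk: "s * norm k \<le> 1/2" using elim(2) by (simp add: s_def)
    have d: "\<delta> s \<le> 2 * (s * norm k) * ?V" "0 \<le> \<delta> s" using del[OF s(1) sk] del0 s by auto
    then have d2: "\<delta> s \<le> 1/2" using elim(3) by (simp add: s_def)
    have yN: "y N = real N * \<delta> s" by (simp add: y_def s_def)
    have y0: "0 \<le> y N" using yN d N by simp
    have "y N \<le> real N * (2 * (s * norm k) * ?V)" unfolding yN using d(1) N by (intro mult_left_mono) auto
    also have "\<dots> = 2 * ((real N * s) * norm k) * ?V" by (simp only: ac_simps)
    also have "\<dots> = 2 * (t * norm k) * ?V" by (simp only: s(2))
    finally have y1: "y N \<le> 2 * (t * norm k) * ?V" .
    have ne: "side I a (shifted a b k (- s)) i \<noteq> {}" if "i \<in> I" for i using elim(1) that by (simp add: s_def)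
    have "0 < ?v (?P s)" using d2 by (simp add: \<delta>_def)
    have convP: "convex (?P s)" by (intro convex_Int convex_cap convex_halfspace_le)
    have "?P s \<subseteq> P" using eros[of s] s by auto
    then have bdP: "bounded (?P s)" by (rule bounded_subset[OF DP(5)])
    have "interior (?P s) \<noteq> {}"
    proof
      assume "interior (?P s) = {}"
      moreover have "closed (?P s)" by (intro closed_Int closed_cap closed_halfspace_le)
      ultimately have "?P s = frontier (?P s)" by (simp add: frontier_def)
      then have "negligible (?P s)" using negligible_convex_frontier[OF convP] by simp
      then show False using \<open>0 < ?v (?P s)\<close> by (simp add: negligible_imp_measure0)
    qed
    moreover have "polyhedron (?P s)"
    proof -
      have "?C (- s) = \<Inter>((\<lambda>i. {x. a i \<bullet> x \<le> shifted a b k (- s) i}) ` I)" by (auto simp: cap_def)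
      moreover have "polyhedron (\<Inter>((\<lambda>i. {x. a i \<bullet> x \<le> shifted a b k (- s) i}) ` I))"
        by (rule polyhedron_Inter) (use fin polyhedron_halfspace_le in auto)
      ultimately show ?thesis by (metis polyhedron_Int polyhedron_halfspace_le)
    qed
    ultimately have Ps: "convex_polyhedron (?P s)" using bdP by (simp add: convex_polyhedron_def polytope_eq_bounded_polyhedron)
    have nfs: "num_faces (?P s) \<le> Suc (card I)" by (rule cap_cut_by_plane(1)[OF fin a n(1) Ps])
    have E1: "2 * (total_edge_length (?P s) + g + s * \<eta>) \<le> side_girth I a (shifted a b k (- s))"
      using elim(1) Ps by (simp add: s_def)
    have em: "e * (1 - \<delta> s / 3 - (\<delta> s)\<^sup>2) \<le> total_edge_length (?P s)"
      using mel[OF Ps nfs] by (intro cube_root_lower'[OF e0 _ d(2) d2]) (auto simp: \<delta>_def)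
    have ep: "e * (1 + y N / 3 - (y N)\<^sup>2 / 9) \<le> total_edge_length (?C t)"
    proof (rule cube_root_lower[OF e0 _ y0])
      have "e ^ 3 * (1 + y N) \<le> e ^ 3 * ?v (?C t)" using vt[of N] N e0 by (intro mult_left_mono) auto
      then show "e ^ 3 * (1 + y N) \<le> total_edge_length (?C t) ^ 3" using mel[OF Ct nf_t] by fastforce
      show "0 \<le> total_edge_length (?C t)" using mel[OF Ct nf_t] by simp
    qed
    have conc: "(real N / (real N + 1)) * side_girth I a (shifted a b k (- s)) + (1 / (real N + 1)) * side_girth I a (shifted a b k t)
        \<le> side_girth I a b"
    proof (rule side_girth_concave)
      show "compact (cap I a b)" by (rule compact_cap[OF bd])
      show "compact (?C t)" by (rule compact_cap[OF bdt])
      show "compact (?C (- s))"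
      proof (rule compact_cap)
        have "?C (- s) \<subseteq> cap I a b" using cap_shifted_erosion[of s I a b k] s by auto
        then show "bounded (?C (- s))" by (rule bounded_subset[OF bd])
      qed
      fix i assume "i \<in> I"
      have "(real N / (real N + 1)) * (b i + - s * m) + (1 / (real N + 1)) * (b i + t * m) = b i" for m
      proof -
        have "real N * (b i + - s * m) + (b i + t * m) = b i * (real N + 1)"
          unfolding s(2)[symmetric] by (simp add: algebra_simps)
        moreover have "(real N / (real N + 1)) * (b i + - s * m) + (1 / (real N + 1)) * (b i + t * m)
            = (real N * (b i + - s * m) + (b i + t * m)) / (real N + 1)" by (simp add: add_divide_distrib)
        ultimately show ?thesis using N by simp
      qed
      then show "b i = (real N / (real N + 1)) * shifted a b k (- s) i + (1 / (real N + 1)) * shifted a b k t i"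
        by (simp add: shifted_def)
    qed (use ne side_t N in auto)
    have "real N * side_girth I a (shifted a b k (- s)) + side_girth I a (shifted a b k t) \<le> (real N + 1) * (2 * (e + g))"
    proof -
      have "(real N * side_girth I a (shifted a b k (- s)) + side_girth I a (shifted a b k t)) / (real N + 1) \<le> 2 * (e + g)"
        using conc unfolding G by (simp add: add_divide_distrib)
      then show ?thesis using N by (simp add: pos_divide_le_eq mult.commute)
    qed
    moreover have "real N * (2 * (total_edge_length (?P s) + g + s * \<eta>)) \<le> real N * side_girth I a (shifted a b k (- s))"
      using E1 N by (intro mult_left_mono) auto
    moreover have "real N * (2 * (total_edge_length (?P s) + g + s * \<eta>)) = 2 * (real N * total_edge_length (?P s)) + 2 * real N * g + 2 * t * \<eta>"
      using s(2) by (simp add: algebra_simps)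
    moreover have "real N * (e * (1 - \<delta> s / 3 - (\<delta> s)\<^sup>2)) \<le> real N * total_edge_length (?P s)"
      using em N by (intro mult_left_mono) auto
    moreover have "real N * (e * (1 - \<delta> s / 3 - (\<delta> s)\<^sup>2)) = real N * e - e * y N / 3 - e * (y N * \<delta> s)"
      by (simp add: yN algebra_simps power2_eq_square)
    moreover have "e * (1 + y N / 3 - (y N)\<^sup>2 / 9) = e + e * y N / 3 - e * (y N)\<^sup>2 / 9" by (simp add: algebra_simps)
    moreover have "e * (y N * \<delta> s) \<le> e * (y N)\<^sup>2"
    proof -
      have "\<delta> s \<le> y N" unfolding yN using d(2) elim(4) mult_right_mono[of 1 "real N" "\<delta> s"] by simp
      then have "y N * \<delta> s \<le> y N * y N" using y0 by (intro mult_left_mono)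
      then show ?thesis using e0 by (intro mult_left_mono) (simp_all add: power2_eq_square)
    qed
    moreover have "0 \<le> e * (y N)\<^sup>2" using e0 by simp
    moreover have "(real N + 1) * (2 * (e + g)) = 2 * (real N * e) + 2 * real N * g + 2 * e + 2 * g" by (simp add: algebra_simps)
    ultimately have "t * \<eta> - 2 * e * (y N)\<^sup>2 \<le> g" using len_t ep by linarith
    then show ?case using y0 y1 by simp
  qed
  then obtain N where N: "t * \<eta> - 2 * e * (y N)\<^sup>2 \<le> g" "0 \<le> y N" "y N \<le> 2 * (t * norm k) * ?V"
    using eventually_happens'[OF sequentially_bot] by blast
  have "(y N)\<^sup>2 \<le> (2 * (t * norm k) * ?V)\<^sup>2" using N by (intro power_mono)
  then have "2 * e * (y N)\<^sup>2 \<le> 2 * e * (2 * (t * norm k) * ?V)\<^sup>2" using e0 by (intro mult_left_mono) auto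
  also have "\<dots> = 8 * e * ?V\<^sup>2 * (t * norm k)\<^sup>2" by (simp add: power_mult_distrib)
  finally show ?thesis using N(1) by linarith
qed

section \<open>Coordinates of a wedge\<close>

text \<open>A point of a quadrilateral given by four inequalities lies in one of the two triangles into
  which the diagonal from the origin divides it.\<close>

lemma quadrilateral_weights:
  fixes x y :: real
  assumes xy: "0 \<le> x" "0 \<le> y" "x + c * y \<le> X" "\<alpha> * x + y \<le> Y"
    and v: "0 < x1" "0 < y1" "x1 + c * y1 = X" "\<alpha> * x1 + y1 = Y" and XY: "0 < X" "0 < Y"
  obtains w1 w2 w3 where "0 \<le> w1" "0 \<le> w2" "0 \<le> w3" "w1 + w2 + w3 \<le> 1"
    "x = w1 * X + w2 * x1" "y = w2 * y1 + w3 * Y"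
proof (cases "y * x1 \<le> x * y1")
  case True
  define w2 where "w2 = y / y1"
  define w1 where "w1 = (x - w2 * x1) / X"
  have "w2 * x1 \<le> x" using True v by (simp add: w2_def field_simps)
  then have "0 \<le> w1" using XY by (simp add: w1_def)
  moreover have "0 \<le> w2" using xy v by (simp add: w2_def)
  moreover have "w1 + w2 \<le> 1"
  proof -
    have "w1 * X = x - w2 * x1" using XY by (simp add: w1_def)
    then have "(w1 + w2) * X = x + w2 * (X - x1)" by (simp add: algebra_simps)
    also have "X - x1 = c * y1" using v by simp
    also have "x + w2 * (c * y1) = x + c * y" using v by (simp add: w2_def)
    finally have "(w1 + w2) * X \<le> 1 * X" using xy by simp
    then show ?thesis using XY by (simp only: mult_le_cancel_right_pos)
  qed
  ultimately show thesis
  proof (intro that[of w1 w2 0])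
    show "x = w1 * X + w2 * x1" using XY by (simp add: w1_def)
    show "y = w2 * y1 + 0 * Y" using v by (simp add: w2_def)
  qed auto
next
  case False
  define w2 where "w2 = x / x1"
  define w3 where "w3 = (y - w2 * y1) / Y"
  have "w2 * y1 \<le> y" using False v by (simp add: w2_def field_simps)
  then have "0 \<le> w3" using XY by (simp add: w3_def)
  moreover have "0 \<le> w2" using xy v by (simp add: w2_def)
  moreover have "w2 + w3 \<le> 1"
  proof -
    have "w3 * Y = y - w2 * y1" using XY by (simp add: w3_def)
    then have "(w2 + w3) * Y = y + w2 * (Y - y1)" by (simp add: algebra_simps)
    also have "Y - y1 = \<alpha> * x1" using v by simp
    also have "y + w2 * (\<alpha> * x1) = \<alpha> * x + y" using v by (simp add: w2_def)
    finally have "(w2 + w3) * Y \<le> 1 * Y" using xy by simp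
    then show ?thesis using XY by (simp only: mult_le_cancel_right_pos)
  qed
  ultimately show thesis
  proof (intro that[of 0 w2 w3])
    show "x = 0 * X + w2 * x1" using v by (simp add: w2_def)
    show "y = w2 * y1 + w3 * Y" using XY by (simp add: w3_def)
  qed auto
qed

lemma convex_mem_weights:
  assumes "convex S" "o' \<in> S" "o' + u \<in> S" "o' + v \<in> S" "o' + w \<in> S"
    and "0 \<le> w1" "0 \<le> w2" "0 \<le> w3" "w1 + w2 + w3 \<le> (1::real)"
  shows "o' + (w1 *\<^sub>R u + w2 *\<^sub>R v + w3 *\<^sub>R w) \<in> S"
proof -
  have "convex hull {o', o' + u, o' + v, o' + w} \<subseteq> S" using assms by (intro hull_minimal) auto
  moreover have "(1 - w1 - w2 - w3) *\<^sub>R o' + w1 *\<^sub>R (o' + u) + w2 *\<^sub>R (o' + v) + w3 *\<^sub>R (o' + w) \<in> S"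
  proof -
    have 1: "(1 - w1 - w2 - w3) + w1 + w2 + w3 = 1" by simp
    let ?f = "\<lambda>i :: nat. if i = 0 then o' else if i = 1 then o' + u else if i = 2 then o' + v else o' + w"
    let ?c = "\<lambda>i :: nat. if i = 0 then 1 - w1 - w2 - w3 else if i = 1 then w1 else if i = 2 then w2 else w3"
    have "(\<Sum>i\<in>{0,1,2,3}. ?c i *\<^sub>R ?f i) \<in> S"
      by (rule convex_sum[OF _ assms(1)]) (use assms in auto)
    then show ?thesis by (simp add: add.assoc)
  qed
  moreover have "(1 - w1 - w2 - w3) *\<^sub>R o' + w1 *\<^sub>R (o' + u) + w2 *\<^sub>R (o' + v) + w3 *\<^sub>R (o' + w)
      = o' + (w1 *\<^sub>R u + w2 *\<^sub>R v + w3 *\<^sub>R w)" by (simp add: algebra_simps)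
  ultimately show ?thesis by simp
qed

text \<open>The wedge is the part of \<open>cap I a b\<close> above the plane \<open>n \<bullet> x = d\<close>.  Its side faces lie on the planes \<open>iA\<close> (triangle \<open>H1 H2 T1\<close>),
  \<open>iB\<close> (quadrilateral \<open>H4 H1 T1 T2\<close>), \<open>iC\<close> (triangle \<open>H3 H4 T2\<close>) and \<open>iD\<close> (quadrilateral \<open>H2 H3 T2 T1\<close>).  The labels are
  chosen such that \<open>T1\<close> is not higher than \<open>T2\<close>.\<close>

locale wedge_cap =
  fixes I :: "'i set" and a :: "'i \<Rightarrow> pt" and b :: "'i \<Rightarrow> real" and n :: pt and d :: real
    and iA iB iC iD :: 'i and H1 H2 H3 H4 T1 T2 :: pt
  assumes fin: "finite I" and bd: "bounded (cap I a b)"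
    and idx: "iA \<in> I" "iB \<in> I" "iC \<in> I" "iD \<in> I"
      "iA \<noteq> iB" "iA \<noteq> iC" "iA \<noteq> iD" "iB \<noteq> iC" "iB \<noteq> iD" "iC \<noteq> iD"
    and A: "a iA \<bullet> H1 = b iA" "a iA \<bullet> H2 = b iA" "a iA \<bullet> T1 = b iA"
      "a iA \<bullet> H3 < b iA" "a iA \<bullet> H4 < b iA" "a iA \<bullet> T2 < b iA"
    and B: "a iB \<bullet> H4 = b iB" "a iB \<bullet> H1 = b iB" "a iB \<bullet> T1 = b iB" "a iB \<bullet> T2 = b iB"
      "a iB \<bullet> H2 < b iB" "a iB \<bullet> H3 < b iB"
    and C: "a iC \<bullet> H3 = b iC" "a iC \<bullet> H4 = b iC" "a iC \<bullet> T2 = b iC"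
      "a iC \<bullet> H1 < b iC" "a iC \<bullet> H2 < b iC" "a iC \<bullet> T1 < b iC"
    and D: "a iD \<bullet> H2 = b iD" "a iD \<bullet> H3 = b iD" "a iD \<bullet> T1 = b iD" "a iD \<bullet> T2 = b iD"
      "a iD \<bullet> H1 < b iD" "a iD \<bullet> H4 < b iD"
    and base: "n \<bullet> H1 = d" "n \<bullet> H2 = d" "n \<bullet> H3 = d" "n \<bullet> H4 = d"
    and top: "d < n \<bullet> T1" "n \<bullet> T1 \<le> n \<bullet> T2"
    and in_cap: "H1 \<in> cap I a b" "H2 \<in> cap I a b" "H3 \<in> cap I a b" "H4 \<in> cap I a b"
      "T1 \<in> cap I a b" "T2 \<in> cap I a b"
    and others: "\<And>i x. i \<in> I - {iA, iB, iC, iD} \<Longrightarrow> x \<in> cap I a b \<Longrightarrow> d < n \<bullet> x \<Longrightarrow> a i \<bullet> x < b i"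
begin

text \<open>Affine coordinates \<open>cp\<close>, \<open>cq\<close>, \<open>cr\<close> with origin \<open>T2\<close>, which vanish on the planes \<open>iD\<close>, \<open>iB\<close>, \<open>iC\<close>.  The height \<open>ht\<close> is \<open>0\<close> on the
  base and \<open>1\<close> at \<open>T2\<close>; the function \<open>sl\<close> is proportional to the distance from the plane \<open>iA\<close>, with value \<open>1\<close> at \<open>T2\<close>.  In these
  coordinates the shape of the wedge is described by \<open>c\<close>, \<open>\<alpha>\<close> and \<open>\<beta>\<close>.\<close>

definition e1 where "e1 = H4 - T2"
definition e2 where "e2 = H3 - T2"
definition e3 where "e3 = T1 - T2"
definition cp where "cp x = a iD \<bullet> (x - T2) / (a iD \<bullet> e1)"
definition cq where "cq x = a iB \<bullet> (x - T2) / (a iB \<bullet> e2)"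
definition cr where "cr x = a iC \<bullet> (x - T2) / (a iC \<bullet> e3)"
definition ht where "ht x = (n \<bullet> x - d) / (n \<bullet> T2 - d)"
definition sl where "sl x = (b iA - a iA \<bullet> x) / (b iA - a iA \<bullet> T2)"
definition c where "c = 1 - ht T1"
definition \<alpha> where "\<alpha> = 1 - sl H4"
definition \<beta> where "\<beta> = 1 - sl H3"

lemma dual:
  "a iB \<bullet> e1 = 0" "a iB \<bullet> e3 = 0" "a iB \<bullet> e2 < 0"
  "a iC \<bullet> e1 = 0" "a iC \<bullet> e2 = 0" "a iC \<bullet> e3 < 0"
  "a iD \<bullet> e2 = 0" "a iD \<bullet> e3 = 0" "a iD \<bullet> e1 < 0"
  using B C D by (auto simp: e1_def e2_def e3_def inner_diff_right)

text \<open>The differences \<open>e1\<close>, \<open>e2\<close>, \<open>e3\<close> form a basis that is dual to the normals of the three planes through \<open>T2\<close>, up to factors.\<close>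

lemma coords: "x = T2 + cp x *\<^sub>R e1 + cq x *\<^sub>R e2 + cr x *\<^sub>R e3"
proof -
  have zero: "z = 0" if z: "a iB \<bullet> z = 0" "a iC \<bullet> z = 0" "a iD \<bullet> z = 0" for z
  proof -
    let ?E = "{e1, e2, e3}"
    have distinct: "e1 \<noteq> e2" "e1 \<noteq> e3" "e2 \<noteq> e3" using dual by force+
    have "independent ?E"
    proof
      assume "dependent ?E"
      then obtain f where f: "\<exists>x\<in>?E. f x \<noteq> 0" "(\<Sum>x\<in>?E. f x *\<^sub>R x) = 0"
        using dependent_finite[of ?E] by auto
      have s: "f e1 *\<^sub>R e1 + f e2 *\<^sub>R e2 + f e3 *\<^sub>R e3 = 0" using f(2) distinct by (simp add: add.assoc)
      have "f e1 = 0" using arg_cong[OF s, of "\<lambda>x. a iD \<bullet> x"] dual by (simp add: inner_add_right)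
      moreover have "f e2 = 0" using arg_cong[OF s, of "\<lambda>x. a iB \<bullet> x"] dual by (simp add: inner_add_right)
      moreover have "f e3 = 0" using arg_cong[OF s, of "\<lambda>x. a iC \<bullet> x"] dual by (simp add: inner_add_right)
      ultimately show False using f(1) by auto
    qed
    moreover have "card ?E = 3" using distinct by simp
    ultimately have "UNIV \<subseteq> span ?E"
      by (intro card_ge_dim_independent) auto
    then have "z \<in> span ?E" by blast
    then obtain c1 c2 c3 where "z - c1 *\<^sub>R e1 - c2 *\<^sub>R e2 - c3 *\<^sub>R e3 = 0"
      by (auto simp: span_insert)
    then have comb: "z = c1 *\<^sub>R e1 + c2 *\<^sub>R e2 + c3 *\<^sub>R e3" by (simp add: algebra_simps)
    have "c1 = 0" using arg_cong[OF comb, of "\<lambda>x. a iD \<bullet> x"] z dual by (simp add: inner_add_right)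
    moreover have "c2 = 0" using arg_cong[OF comb, of "\<lambda>x. a iB \<bullet> x"] z dual by (simp add: inner_add_right)
    moreover have "c3 = 0" using arg_cong[OF comb, of "\<lambda>x. a iC \<bullet> x"] z dual by (simp add: inner_add_right)
    ultimately show "z = 0" using comb by simp
  qed
  have "x - T2 - (cp x *\<^sub>R e1 + cq x *\<^sub>R e2 + cr x *\<^sub>R e3) = 0"
    by (rule zero) (use dual in \<open>simp_all add: cp_def cq_def cr_def inner_diff_right inner_add_right\<close>)
  then show ?thesis by (simp add: algebra_simps)
qed

lemma coords_pt:
  "cp (T2 + p *\<^sub>R e1 + q *\<^sub>R e2 + r *\<^sub>R e3) = p"
  "cq (T2 + p *\<^sub>R e1 + q *\<^sub>R e2 + r *\<^sub>R e3) = q"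
  "cr (T2 + p *\<^sub>R e1 + q *\<^sub>R e2 + r *\<^sub>R e3) = r"
  using dual by (simp_all add: cp_def cq_def cr_def inner_add_right)

lemma top_pos: "0 < n \<bullet> T2 - d" "0 < b iA - a iA \<bullet> T2" using top A by auto

lemma ht_coords: "ht x = 1 - cp x - cq x - c * cr x"
proof -
  have e: "n \<bullet> e1 = - (n \<bullet> T2 - d)" "n \<bullet> e2 = - (n \<bullet> T2 - d)" "n \<bullet> e3 = - c * (n \<bullet> T2 - d)"
    using base top_pos by (simp_all add: e1_def e2_def e3_def inner_diff_right c_def ht_def field_simps)
  have "n \<bullet> x - d = (n \<bullet> T2 - d) * (1 - cp x - cq x - c * cr x)"
    by (subst coords[of x]) (simp add: inner_add_right e algebra_simps)
  then show ?thesis using top_pos by (simp add: ht_def)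
qed

lemma sl_coords: "sl x = 1 - \<alpha> * cp x - \<beta> * cq x - cr x"
proof -
  let ?w = "b iA - a iA \<bullet> T2"
  have e: "a iA \<bullet> e1 = \<alpha> * ?w" "a iA \<bullet> e2 = \<beta> * ?w" "a iA \<bullet> e3 = ?w"
    using A top_pos by (simp_all add: e1_def e2_def e3_def inner_diff_right \<alpha>_def \<beta>_def sl_def field_simps)
  have "b iA - a iA \<bullet> x = ?w * (1 - \<alpha> * cp x - \<beta> * cq x - cr x)"
    by (subst coords[of x]) (simp add: inner_add_right e algebra_simps)
  then show ?thesis using top_pos by (simp add: sl_def)
qed

lemma c_range: "0 \<le> c" "c < 1"
  using top top_pos by (auto simp: c_def ht_def divide_simps)

lemma vertex_coords:
  "cp H4 = 1" "cq H4 = 0" "cr H4 = 0" "cp H3 = 0" "cq H3 = 1" "cr H3 = 0"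
  "cp T1 = 0" "cq T1 = 0" "cr T1 = 1" "cp T2 = 0" "cq T2 = 0" "cr T2 = 0"
  "cq H1 = 0" "0 < cp H1" "0 < cr H1" "cp H2 = 0" "0 < cq H2" "0 < cr H2"
  "ht H1 = 0" "ht H2 = 0" "sl H1 = 0" "sl H2 = 0" "0 < sl H4" "0 < sl H3"
  using dual A B C D base top_pos
  by (simp_all add: cp_def cq_def cr_def e1_def[symmetric] e2_def[symmetric] e3_def[symmetric] ht_def sl_def
      divide_neg_neg inner_diff_right)

lemma H1_eqs: "cp H1 + c * cr H1 = 1" "\<alpha> * cp H1 + cr H1 = 1"
  using ht_coords[of H1] sl_coords[of H1] vertex_coords by auto

lemma H2_eqs: "cq H2 + c * cr H2 = 1" "\<beta> * cq H2 + cr H2 = 1"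
  using ht_coords[of H2] sl_coords[of H2] vertex_coords by auto

lemma slopes: "\<alpha> < 1" "\<beta> < 1" "c * \<alpha> < 1" "c * \<beta> < 1"
proof -
  show "\<alpha> < 1" "\<beta> < 1" using vertex_coords by (auto simp: \<alpha>_def \<beta>_def)
  have "(1 - c * \<alpha>) * cp H1 = cp H1 + c * cr H1 - c * (\<alpha> * cp H1 + cr H1)" by (simp add: algebra_simps)
  then have "(1 - c * \<alpha>) * cp H1 = 1 - c" using H1_eqs by simp
  then show "c * \<alpha> < 1" using vertex_coords c_range by (metis diff_gt_0_iff_gt zero_less_mult_pos2)
  have "(1 - c * \<beta>) * cq H2 = cq H2 + c * cr H2 - c * (\<beta> * cq H2 + cr H2)" by (simp add: algebra_simps)
  then have "(1 - c * \<beta>) * cq H2 = 1 - c" using H2_eqs by simp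
  then show "c * \<beta> < 1" using vertex_coords c_range by (metis diff_gt_0_iff_gt zero_less_mult_pos2)
qed

lemma cap_ineqs:
  assumes "x \<in> cap I a b"
  shows "0 \<le> cp x" "0 \<le> cq x" "0 \<le> cr x" "0 \<le> sl x"
proof -
  have "a iB \<bullet> x \<le> b iB" "a iC \<bullet> x \<le> b iC" "a iD \<bullet> x \<le> b iD" "a iA \<bullet> x \<le> b iA"
    using assms idx by (auto simp: cap_def)
  then show "0 \<le> cp x" "0 \<le> cq x" "0 \<le> cr x" "0 \<le> sl x"
    using dual B C D top_pos by (auto simp: cp_def cq_def cr_def sl_def inner_diff_right intro!: divide_nonpos_neg)
qed

definition pt3 where "pt3 p q r = T2 + p *\<^sub>R e1 + q *\<^sub>R e2 + r *\<^sub>R e3"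

lemma pt3_coords [simp]: "cp (pt3 p q r) = p" "cq (pt3 p q r) = q" "cr (pt3 p q r) = r"
  by (simp_all add: pt3_def coords_pt)

lemma pt3_eq: "x = pt3 (cp x) (cq x) (cr x)"
  using coords[of x] by (simp add: pt3_def)

text \<open>The inequalities describe the quadrilateral with vertices \<open>T2\<close>, \<open>H4\<close>, \<open>H1\<close>, \<open>T1\<close> in the plane \<open>iB\<close>.\<close>

lemma mem_cap_B:
  assumes "0 \<le> p" "0 \<le> r" "p + c * r \<le> 1" "\<alpha> * p + r \<le> 1"
  shows "pt3 p 0 r \<in> cap I a b"
proof -
  obtain w1 w2 w3 where w: "0 \<le> w1" "0 \<le> w2" "0 \<le> w3" "w1 + w2 + w3 \<le> 1"
    "p = w1 * 1 + w2 * cp H1" "r = w2 * cr H1 + w3 * 1"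
    by (rule quadrilateral_weights[OF assms vertex_coords(14,15) H1_eqs]) auto
  have "T2 + (w1 *\<^sub>R e1 + w2 *\<^sub>R (cp H1 *\<^sub>R e1 + cr H1 *\<^sub>R e3) + w3 *\<^sub>R e3) \<in> cap I a b"
  proof (rule convex_mem_weights[OF convex_cap in_cap(6) _ _ _ w(1-4)])
    show "T2 + e1 \<in> cap I a b" "T2 + e3 \<in> cap I a b" using in_cap by (simp_all add: e1_def e3_def)
    show "T2 + (cp H1 *\<^sub>R e1 + cr H1 *\<^sub>R e3) \<in> cap I a b"
      using in_cap(1) coords[of H1] vertex_coords(13) by (simp add: add.assoc)
  qed
  moreover have "T2 + (w1 *\<^sub>R e1 + w2 *\<^sub>R (cp H1 *\<^sub>R e1 + cr H1 *\<^sub>R e3) + w3 *\<^sub>R e3) = pt3 p 0 r"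
    by (simp add: pt3_def w(5,6) algebra_simps)
  ultimately show ?thesis by simp
qed

text \<open>The inequalities describe the quadrilateral with vertices \<open>T2\<close>, \<open>H3\<close>, \<open>H2\<close>, \<open>T1\<close> in the plane \<open>iD\<close>.\<close>

lemma mem_cap_D:
  assumes "0 \<le> q" "0 \<le> r" "q + c * r \<le> 1" "\<beta> * q + r \<le> 1"
  shows "pt3 0 q r \<in> cap I a b"
proof -
  obtain w1 w2 w3 where w: "0 \<le> w1" "0 \<le> w2" "0 \<le> w3" "w1 + w2 + w3 \<le> 1"
    "q = w1 * 1 + w2 * cq H2" "r = w2 * cr H2 + w3 * 1"
    by (rule quadrilateral_weights[OF assms vertex_coords(17,18) H2_eqs]) auto
  have "T2 + (w1 *\<^sub>R e2 + w2 *\<^sub>R (cq H2 *\<^sub>R e2 + cr H2 *\<^sub>R e3) + w3 *\<^sub>R e3) \<in> cap I a b"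
  proof (rule convex_mem_weights[OF convex_cap in_cap(6) _ _ _ w(1-4)])
    show "T2 + e2 \<in> cap I a b" "T2 + e3 \<in> cap I a b" using in_cap by (simp_all add: e2_def e3_def)
    show "T2 + (cq H2 *\<^sub>R e2 + cr H2 *\<^sub>R e3) \<in> cap I a b"
      using in_cap(2) coords[of H2] vertex_coords(16) by (simp add: add.assoc)
  qed
  moreover have "T2 + (w1 *\<^sub>R e2 + w2 *\<^sub>R (cq H2 *\<^sub>R e2 + cr H2 *\<^sub>R e3) + w3 *\<^sub>R e3) = pt3 0 q r"
    by (simp add: pt3_def w(5,6) algebra_simps)
  ultimately show ?thesis by simp
qed

end

section \<open>Sections of the shifted wedge\<close>

lemma segment_weights:
  assumes "0 \<le> w1" "0 \<le> w2" "w1 + w2 = 1"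
  shows "w1 *\<^sub>R a + w2 *\<^sub>R b \<in> closed_segment a b"
  using assms unfolding closed_segment_def by (auto intro!: exI[of _ w2] simp: algebra_simps) (metis scaleR_left.add scaleR_one)

lemma hull_weights:
  assumes "0 \<le> w1" "0 \<le> w2" "0 \<le> w3" "0 \<le> w4" "w1 + w2 + w3 + w4 = (1 :: real)"
    and x: "x = w1 *\<^sub>R v1 + w2 *\<^sub>R v2 + w3 *\<^sub>R v3 + w4 *\<^sub>R v4"
    and S: "convex S" "v1 \<in> S" "v2 \<in> S" "v3 \<in> S" "v4 \<in> S"
  shows "(x :: pt) \<in> S"
proof -
  have "v1 + (w2 *\<^sub>R (v2 - v1) + w3 *\<^sub>R (v3 - v1) + w4 *\<^sub>R (v4 - v1)) \<in> S"
    by (rule convex_mem_weights[OF S(1,2)]) (use S assms in auto)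
  moreover have w1: "w1 = 1 - w2 - w3 - w4" using assms by simp
  have "x = v1 + (w2 *\<^sub>R (v2 - v1) + w3 *\<^sub>R (v3 - v1) + w4 *\<^sub>R (v4 - v1))"
    unfolding x w1 by (simp add: algebra_simps)
  ultimately show ?thesis by simp
qed

context wedge_cap
begin

text \<open>The range of parameters in which the cap, shifted by \<open>-s\<close> along \<open>e3\<close>, still looks like the wedge above height \<open>\<delta>\<close>: the section
  at this height is a quadrilateral below the top edge, and by \<open>c * s \<le> \<delta>\<close> no other face reaches above it.\<close>

definition valid where
  "valid s \<delta> \<longleftrightarrow> 0 \<le> s \<and> s < 1 \<and> c * s \<le> \<delta> \<and> \<delta> < 1 \<and> c * (1 - s) < 1 - \<delta> \<and>
     \<alpha> * (1 - \<delta>) < 1 - s \<and> \<beta> * (1 - \<delta>) < 1 - s"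

definition cap_s where "cap_s s = cap I a (shifted a b e3 (- s))"
definition side_s where "side_s s i = side I a (shifted a b e3 (- s)) i"
definition lev where "lev \<delta> = d + \<delta> * (n \<bullet> T2 - d)"
definition lam where "lam s \<delta> = (1 - \<delta>) - c * (1 - s)"
definition \<rho>1 where "\<rho>1 s \<delta> = (1 - s) - \<alpha> * (1 - \<delta>)"
definition \<rho>2 where "\<rho>2 s \<delta> = (1 - s) - \<beta> * (1 - \<delta>)"

text \<open>The corners of the section at height \<open>\<delta>\<close> are \<open>V1\<close>, \<open>V2\<close> on the plane \<open>iA\<close>, and \<open>V3\<close>, \<open>V4\<close> on the plane \<open>iC\<close>; the lower top vertex has moved to
  \<open>VT\<close>, while \<open>T2\<close> stays.  The edges of this part of the wedge keep their directions.  Those at \<open>V1\<close> and \<open>V2\<close>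
  are multiples of \<open>f1\<close>, \<open>f2\<close>, \<open>f1 - f2\<close>, \<open>g1\<close>, \<open>g2\<close>, whose factors \<open>lam\<close>, \<open>\<rho>1\<close> and \<open>\<rho>2\<close> are affine functions of \<open>s\<close> and \<open>\<delta>\<close>.\<close>

definition f1 where "f1 = (1 / (1 - c * \<alpha>)) *\<^sub>R (e1 - \<alpha> *\<^sub>R e3)"
definition f2 where "f2 = (1 / (1 - c * \<beta>)) *\<^sub>R (e2 - \<beta> *\<^sub>R e3)"
definition g1 where "g1 = (1 / (1 - c * \<alpha>)) *\<^sub>R (e3 - c *\<^sub>R e1)"
definition g2 where "g2 = (1 / (1 - c * \<beta>)) *\<^sub>R (e3 - c *\<^sub>R e2)"
definition p1 where "p1 s \<delta> = lam s \<delta> / (1 - c * \<alpha>)"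
definition r1 where "r1 s \<delta> = \<rho>1 s \<delta> / (1 - c * \<alpha>)"
definition q2 where "q2 s \<delta> = lam s \<delta> / (1 - c * \<beta>)"
definition r2 where "r2 s \<delta> = \<rho>2 s \<delta> / (1 - c * \<beta>)"
definition V1 where "V1 s \<delta> = pt3 (p1 s \<delta>) 0 (r1 s \<delta>)"
definition V2 where "V2 s \<delta> = pt3 0 (q2 s \<delta>) (r2 s \<delta>)"
definition V3 where "V3 \<delta> = pt3 0 (1 - \<delta>) 0"
definition V4 where "V4 \<delta> = pt3 (1 - \<delta>) 0 0"
definition VT where "VT s = pt3 0 0 (1 - s)"

lemma cap_s_iff: "0 \<le> s \<Longrightarrow> x \<in> cap_s s \<longleftrightarrow> x \<in> cap I a b \<and> x + s *\<^sub>R e3 \<in> cap I a b"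
  unfolding cap_s_def by (simp add: cap_shifted_erosion)

lemma convex_cap_s: "convex (cap_s s)"
  unfolding cap_s_def by (rule convex_cap)

lemma compact_cap_s: "0 \<le> s \<Longrightarrow> compact (cap_s s)"
proof -
  assume "0 \<le> s"
  then have "cap_s s \<subseteq> cap I a b" using cap_s_iff by blast
  then show ?thesis unfolding cap_s_def by (intro compact_cap bounded_subset[OF bd])
qed

lemma pt3_shift: "pt3 p q r + s *\<^sub>R e3 = pt3 p q (r + s)"
  by (simp add: pt3_def algebra_simps)

lemma mem_cap_s_B:
  assumes "0 \<le> s" "0 \<le> p" "0 \<le> r" "p + c * (r + s) \<le> 1" "\<alpha> * p + (r + s) \<le> 1"
  shows "pt3 p 0 r \<in> cap_s s"
proof -
  have "c * r \<le> c * (r + s)" using assms c_range by (intro mult_left_mono) auto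
  then show ?thesis using assms by (simp add: cap_s_iff pt3_shift mem_cap_B)
qed

lemma mem_cap_s_D:
  assumes "0 \<le> s" "0 \<le> q" "0 \<le> r" "q + c * (r + s) \<le> 1" "\<beta> * q + (r + s) \<le> 1"
  shows "pt3 0 q r \<in> cap_s s"
proof -
  have "c * r \<le> c * (r + s)" using assms c_range by (intro mult_left_mono) auto
  then show ?thesis using assms by (simp add: cap_s_iff pt3_shift mem_cap_D)
qed

lemma cap_s_ineqs:
  assumes "0 \<le> s" "x \<in> cap_s s"
  shows "0 \<le> cp x" "0 \<le> cq x" "0 \<le> cr x" "\<alpha> * cp x + \<beta> * cq x + cr x \<le> 1 - s"
proof -
  have x: "x \<in> cap I a b" "x + s *\<^sub>R e3 \<in> cap I a b" using assms by (auto simp: cap_s_iff)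
  show "0 \<le> cp x" "0 \<le> cq x" "0 \<le> cr x" using cap_ineqs[OF x(1)] by auto
  have xs: "x + s *\<^sub>R e3 = pt3 (cp x) (cq x) (cr x + s)" using pt3_eq[of x] pt3_shift by metis
  have "0 \<le> sl (x + s *\<^sub>R e3)" using cap_ineqs[OF x(2)] by auto
  then show "\<alpha> * cp x + \<beta> * cq x + cr x \<le> 1 - s" unfolding sl_coords xs by simp
qed

lemma lev_iff: "n \<bullet> x \<le> lev \<delta> \<longleftrightarrow> ht x \<le> \<delta>" "lev \<delta> \<le> n \<bullet> x \<longleftrightarrow> \<delta> \<le> ht x" "n \<bullet> x = lev \<delta> \<longleftrightarrow> ht x = \<delta>"
  using top_pos by (auto simp: lev_def ht_def field_simps)

text \<open>Of the four planes only \<open>iA\<close> moves: the others contain the direction \<open>e3\<close> or have it on their inner side.\<close>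

lemma side_s_iff:
  assumes "0 \<le> s"
  shows "x \<in> side_s s iA \<longleftrightarrow> x \<in> cap_s s \<and> sl x = s" "x \<in> side_s s iB \<longleftrightarrow> x \<in> cap_s s \<and> cq x = 0"
    "x \<in> side_s s iC \<longleftrightarrow> x \<in> cap_s s \<and> cr x = 0" "x \<in> side_s s iD \<longleftrightarrow> x \<in> cap_s s \<and> cp x = 0"
proof -
  have ms: "x \<in> side_s s i \<longleftrightarrow> x \<in> cap_s s \<and> a i \<bullet> x = b i - s * max 0 (a i \<bullet> e3)" for i
    by (simp add: side_s_def side_def cap_s_def shifted_def)
  have "a iA \<bullet> e3 = b iA - a iA \<bullet> T2" using A by (simp add: e3_def inner_diff_right)
  then have "max 0 (a iA \<bullet> e3) = b iA - a iA \<bullet> T2" using top_pos by simp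
  moreover have "sl x = s \<longleftrightarrow> b iA - a iA \<bullet> x = s * (b iA - a iA \<bullet> T2)"
    using top_pos by (simp add: sl_def divide_eq_eq)
  ultimately have "a iA \<bullet> x = b iA - s * max 0 (a iA \<bullet> e3) \<longleftrightarrow> sl x = s" by auto
  then show "x \<in> side_s s iA \<longleftrightarrow> x \<in> cap_s s \<and> sl x = s" using ms by simp
  show "x \<in> side_s s iB \<longleftrightarrow> x \<in> cap_s s \<and> cq x = 0"
    using ms[of iB] dual B by (simp add: cq_def inner_diff_right)
  show "x \<in> side_s s iC \<longleftrightarrow> x \<in> cap_s s \<and> cr x = 0"
    using ms[of iC] dual C by (simp add: cr_def inner_diff_right)
  show "x \<in> side_s s iD \<longleftrightarrow> x \<in> cap_s s \<and> cp x = 0"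
    using ms[of iD] dual D by (simp add: cp_def inner_diff_right)
qed

lemma denom_pos: "0 < 1 - c * \<alpha>" "0 < 1 - c * \<beta>" using slopes by auto

lemma corner_eqs:
  "p1 s \<delta> + c * r1 s \<delta> = 1 - \<delta>" "\<alpha> * p1 s \<delta> + r1 s \<delta> = 1 - s"
  "q2 s \<delta> + c * r2 s \<delta> = 1 - \<delta>" "\<beta> * q2 s \<delta> + r2 s \<delta> = 1 - s"
proof -
  have "p1 s \<delta> + c * r1 s \<delta> = (lam s \<delta> + c * \<rho>1 s \<delta>) / (1 - c * \<alpha>)" by (simp add: p1_def r1_def add_divide_distrib)
  also have "lam s \<delta> + c * \<rho>1 s \<delta> = (1 - \<delta>) * (1 - c * \<alpha>)" by (simp add: lam_def \<rho>1_def algebra_simps)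
  finally show "p1 s \<delta> + c * r1 s \<delta> = 1 - \<delta>" using denom_pos by simp
  have "\<alpha> * p1 s \<delta> + r1 s \<delta> = (\<alpha> * lam s \<delta> + \<rho>1 s \<delta>) / (1 - c * \<alpha>)" by (simp add: p1_def r1_def add_divide_distrib)
  also have "\<alpha> * lam s \<delta> + \<rho>1 s \<delta> = (1 - s) * (1 - c * \<alpha>)" by (simp add: lam_def \<rho>1_def algebra_simps)
  finally show "\<alpha> * p1 s \<delta> + r1 s \<delta> = 1 - s" using denom_pos by simp
  have "q2 s \<delta> + c * r2 s \<delta> = (lam s \<delta> + c * \<rho>2 s \<delta>) / (1 - c * \<beta>)" by (simp add: q2_def r2_def add_divide_distrib)
  also have "lam s \<delta> + c * \<rho>2 s \<delta> = (1 - \<delta>) * (1 - c * \<beta>)" by (simp add: lam_def \<rho>2_def algebra_simps)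
  finally show "q2 s \<delta> + c * r2 s \<delta> = 1 - \<delta>" using denom_pos by simp
  have "\<beta> * q2 s \<delta> + r2 s \<delta> = (\<beta> * lam s \<delta> + \<rho>2 s \<delta>) / (1 - c * \<beta>)" by (simp add: q2_def r2_def add_divide_distrib)
  also have "\<beta> * lam s \<delta> + \<rho>2 s \<delta> = (1 - s) * (1 - c * \<beta>)" by (simp add: lam_def \<rho>2_def algebra_simps)
  finally show "\<beta> * q2 s \<delta> + r2 s \<delta> = 1 - s" using denom_pos by simp
qed

lemma corner_pos:
  assumes "valid s \<delta>"
  shows "0 < lam s \<delta>" "0 < \<rho>1 s \<delta>" "0 < \<rho>2 s \<delta>" "0 < p1 s \<delta>" "0 < r1 s \<delta>" "0 < q2 s \<delta>" "0 < r2 s \<delta>"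
    "0 < 1 - \<delta>" "0 < 1 - s" "0 \<le> s" "0 \<le> \<delta>" "c * s \<le> \<delta>"
proof -
  show l: "0 < lam s \<delta>" "0 < \<rho>1 s \<delta>" "0 < \<rho>2 s \<delta>" "0 < 1 - \<delta>" "0 < 1 - s" "0 \<le> s" "c * s \<le> \<delta>"
    using assms by (auto simp: valid_def lam_def \<rho>1_def \<rho>2_def)
  show "0 < p1 s \<delta>" "0 < r1 s \<delta>" "0 < q2 s \<delta>" "0 < r2 s \<delta>"
    using l denom_pos by (auto simp: p1_def r1_def q2_def r2_def)
  have "0 \<le> c * s" using l c_range by simp
  then show "0 \<le> \<delta>" using l by linarith
qed

lemma corner_mem:
  assumes "valid s \<delta>"
  shows "V1 s \<delta> \<in> cap_s s" "V2 s \<delta> \<in> cap_s s" "V3 \<delta> \<in> cap_s s" "V4 \<delta> \<in> cap_s s" "VT s \<in> cap_s s" "T2 \<in> cap_s s"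
proof -
  note P = corner_pos[OF assms]
  have k: "\<alpha> * (1 - \<delta>) + s \<le> 1" "\<beta> * (1 - \<delta>) + s \<le> 1" using P(2,3) by (auto simp: \<rho>1_def \<rho>2_def)
  show "V1 s \<delta> \<in> cap_s s" unfolding V1_def
    by (rule mem_cap_s_B) (use P corner_eqs(1,2)[of s \<delta>] in \<open>auto simp: algebra_simps\<close>)
  show "V2 s \<delta> \<in> cap_s s" unfolding V2_def
    by (rule mem_cap_s_D) (use P corner_eqs(3,4)[of s \<delta>] in \<open>auto simp: algebra_simps\<close>)
  show "V3 \<delta> \<in> cap_s s" unfolding V3_def
    by (rule mem_cap_s_D) (use P k in \<open>auto simp: algebra_simps\<close>)
  show "V4 \<delta> \<in> cap_s s" unfolding V4_def
    by (rule mem_cap_s_B) (use P k in \<open>auto simp: algebra_simps\<close>)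
  show "VT s \<in> cap_s s" unfolding VT_def
    by (rule mem_cap_s_B) (use P c_range in \<open>auto simp: algebra_simps\<close>)
  have "c * s \<le> 1" using P by linarith
  then have "pt3 0 0 0 \<in> cap_s s" by (intro mem_cap_s_B) (use P in auto)
  then show "T2 \<in> cap_s s" by (simp add: pt3_def)
qed

lemma pt3_0: "pt3 0 0 0 = T2" by (simp add: pt3_def)

lemma ht_pt3: "ht (pt3 p q r) = 1 - p - q - c * r" and sl_pt3: "sl (pt3 p q r) = 1 - \<alpha> * p - \<beta> * q - r"
  by (simp_all add: ht_coords sl_coords)

lemma corner_ht:
  "ht (V1 s \<delta>) = \<delta>" "ht (V2 s \<delta>) = \<delta>" "ht (V3 \<delta>) = \<delta>" "ht (V4 \<delta>) = \<delta>" "ht (VT s) = 1 - c * (1 - s)" "ht T2 = 1"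
  "sl (V1 s \<delta>) = s" "sl (V2 s \<delta>) = s" "sl (VT s) = s"
proof -
  show "ht (V1 s \<delta>) = \<delta>" "sl (V1 s \<delta>) = s"
    unfolding V1_def ht_pt3 sl_pt3 using corner_eqs(1,2)[of s \<delta>] by simp_all
  show "ht (V2 s \<delta>) = \<delta>" "sl (V2 s \<delta>) = s"
    unfolding V2_def ht_pt3 sl_pt3 using corner_eqs(3,4)[of s \<delta>] by simp_all
  show "ht (V3 \<delta>) = \<delta>" "ht (V4 \<delta>) = \<delta>" "ht (VT s) = 1 - c * (1 - s)" "sl (VT s) = s"
    unfolding V3_def V4_def VT_def ht_pt3 sl_pt3 by simp_all
  show "ht T2 = 1" using ht_pt3[of 0 0 0] unfolding pt3_0 by simp
qed

lemma pt3_scale: "w1 *\<^sub>R pt3 p q r + w2 *\<^sub>R pt3 p' q' r' + w3 *\<^sub>R pt3 p'' q'' r'' + w4 *\<^sub>R pt3 p3 q3 r3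
   = (w1 + w2 + w3 + w4) *\<^sub>R T2 + ((w1 * p + w2 * p' + w3 * p'' + w4 * p3) *\<^sub>R e1
      + (w1 * q + w2 * q' + w3 * q'' + w4 * q3) *\<^sub>R e2 + (w1 * r + w2 * r' + w3 * r'' + w4 * r3) *\<^sub>R e3)"
  by (simp add: pt3_def algebra_simps)

lemma pt3_weights:
  assumes "w1 + w2 + w3 + w4 = 1"
    "cp x = w1 * p + w2 * p' + w3 * p'' + w4 * p3" "cq x = w1 * q + w2 * q' + w3 * q'' + w4 * q3"
    "cr x = w1 * r + w2 * r' + w3 * r'' + w4 * r3"
  shows "x = w1 *\<^sub>R pt3 p q r + w2 *\<^sub>R pt3 p' q' r' + w3 *\<^sub>R pt3 p'' q'' r'' + w4 *\<^sub>R pt3 p3 q3 r3"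
  unfolding pt3_scale assms(1) assms(2-4)[symmetric] using coords[of x] by (simp add: add.assoc)

lemma pt3_weights0:
  assumes "w1 + w2 + w3 + w4 = 1"
    "cp x = w2 * p' + w3 * p'' + w4 * p3" "cq x = w2 * q' + w3 * q'' + w4 * q3"
    "cr x = w2 * r' + w3 * r'' + w4 * r3"
  shows "x = w1 *\<^sub>R T2 + w2 *\<^sub>R pt3 p' q' r' + w3 *\<^sub>R pt3 p'' q'' r'' + w4 *\<^sub>R pt3 p3 q3 r3"
proof -
  have "x = w1 *\<^sub>R pt3 0 0 0 + w2 *\<^sub>R pt3 p' q' r' + w3 *\<^sub>R pt3 p'' q'' r'' + w4 *\<^sub>R pt3 p3 q3 r3"
    by (rule pt3_weights) (use assms in simp_all)
  then show ?thesis unfolding pt3_0 .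
qed

lemma convex_ht: "convex {x. \<delta> \<le> ht x}" "convex {x. ht x = \<delta>}"
proof -
  have "{x. \<delta> \<le> ht x} = {x. lev \<delta> \<le> n \<bullet> x}" "{x. ht x = \<delta>} = {x. n \<bullet> x = lev \<delta>}" by (auto simp: lev_iff)
  then show "convex {x. \<delta> \<le> ht x}" "convex {x. ht x = \<delta>}" by (simp_all add: convex_halfspace_ge convex_hyperplane)
qed

lemma convex_side_s: "convex (side_s s i)"
  unfolding side_s_def side_def by (intro convex_Int convex_cap convex_hyperplane)

lemma compact_side_s: "0 \<le> s \<Longrightarrow> compact (side_s s i)"
  using compact_cut(3)[OF compact_cap_s] by (simp add: side_s_def side_def cap_s_def)

text \<open>Above height \<open>\<delta>\<close> the face is again a quadrilateral, and \<open>quadrilateral_weights\<close> writes its points as combinations of the vertices.\<close>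

lemma face_B:
  assumes v: "valid s \<delta>"
  shows "side_s s iB \<inter> {x. \<delta> \<le> ht x} = convex hull {T2, V4 \<delta>, V1 s \<delta>, VT s}"
    and "side_s s iB \<inter> {x. ht x = \<delta>} = closed_segment (V4 \<delta>) (V1 s \<delta>)"
proof -
  note P = corner_pos[OF v]
  show "side_s s iB \<inter> {x. \<delta> \<le> ht x} = convex hull {T2, V4 \<delta>, V1 s \<delta>, VT s}"
  proof (intro equalityI subsetI)
    fix x assume x: "x \<in> side_s s iB \<inter> {x. \<delta> \<le> ht x}"
    then have q: "cq x = 0" and xc: "x \<in> cap_s s" using side_s_iff(2)[OF P(10)] by auto
    note ine = cap_s_ineqs[OF P(10) xc]
    obtain w1 w2 w3 where w: "0 \<le> w1" "0 \<le> w2" "0 \<le> w3" "w1 + w2 + w3 \<le> 1"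
      "cp x = w1 * (1 - \<delta>) + w2 * p1 s \<delta>" "cr x = w2 * r1 s \<delta> + w3 * (1 - s)"
    proof (rule quadrilateral_weights[OF ine(1,3) _ _ P(4,5) corner_eqs(1,2) P(8,9)])
      show "cp x + c * cr x \<le> 1 - \<delta>" using x q ht_coords[of x] by simp
      show "\<alpha> * cp x + cr x \<le> 1 - s" using ine(4) q by simp
    qed
    show "x \<in> convex hull {T2, V4 \<delta>, V1 s \<delta>, VT s}"
    proof (rule hull_weights[where ?w1.0 = "1 - w1 - w2 - w3" and ?w2.0 = w1 and ?w3.0 = w2 and ?w4.0 = w3])
      show "x = (1 - w1 - w2 - w3) *\<^sub>R T2 + w1 *\<^sub>R V4 \<delta> + w2 *\<^sub>R V1 s \<delta> + w3 *\<^sub>R VT s"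
        unfolding V4_def V1_def VT_def by (rule pt3_weights0) (use w q in auto)
    qed (use w in \<open>auto intro: hull_inc\<close>)
  next
    fix x assume "x \<in> convex hull {T2, V4 \<delta>, V1 s \<delta>, VT s}"
    moreover have "convex hull {T2, V4 \<delta>, V1 s \<delta>, VT s} \<subseteq> side_s s iB \<inter> {x. \<delta> \<le> ht x}"
    proof (rule hull_minimal)
      have "c * (1 - s) \<le> 1 - \<delta>" using P(1) by (simp add: lam_def)
      then show "{T2, V4 \<delta>, V1 s \<delta>, VT s} \<subseteq> side_s s iB \<inter> {x. \<delta> \<le> ht x}"
        using corner_mem[OF v] corner_ht P by (auto simp: side_s_iff) (simp_all add: vertex_coords V4_def V1_def VT_def)
      show "convex (side_s s iB \<inter> {x. \<delta> \<le> ht x})" by (intro convex_Int convex_side_s convex_ht)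
    qed
    ultimately show "x \<in> side_s s iB \<inter> {x. \<delta> \<le> ht x}" by blast
  qed
  show "side_s s iB \<inter> {x. ht x = \<delta>} = closed_segment (V4 \<delta>) (V1 s \<delta>)"
  proof (intro equalityI subsetI)
    fix x assume x: "x \<in> side_s s iB \<inter> {x. ht x = \<delta>}"
    then have q: "cq x = 0" and xc: "x \<in> cap_s s" using side_s_iff(2)[OF P(10)] by auto
    note ine = cap_s_ineqs[OF P(10) xc]
    have p: "cp x = 1 - \<delta> - c * cr x" using x q ht_coords[of x] by simp
    define w where "w = cr x / r1 s \<delta>"
    have wr: "cr x = w * r1 s \<delta>" using P by (simp add: w_def)
    have "(1 - c * \<alpha>) * cr x \<le> \<rho>1 s \<delta>" using ine(4) q p by (simp add: \<rho>1_def algebra_simps)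
    then have "cr x \<le> r1 s \<delta>" using denom_pos by (simp add: r1_def field_simps)
    then have w01: "0 \<le> w" "w \<le> 1" using ine(3) P by (auto simp: w_def)
    show "x \<in> closed_segment (V4 \<delta>) (V1 s \<delta>)"
    proof (rule hull_weights[where ?w1.0 = "1 - w" and ?w2.0 = w and ?w3.0 = 0 and ?w4.0 = 0])
      have "cp x = (1 - w) * (1 - \<delta>) + w * p1 s \<delta>"
      proof -
        have "p1 s \<delta> = (1 - \<delta>) - c * r1 s \<delta>" using corner_eqs(1)[of s \<delta>] by linarith
        show ?thesis unfolding p wr \<open>p1 s \<delta> = _\<close> by (simp add: algebra_simps)
      qed
      then show "x = (1 - w) *\<^sub>R V4 \<delta> + w *\<^sub>R V1 s \<delta> + 0 *\<^sub>R V1 s \<delta> + 0 *\<^sub>R V1 s \<delta>"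
        unfolding V4_def V1_def by (intro pt3_weights) (use wr q in auto)
    qed (use w01 in auto)
  next
    fix x assume "x \<in> closed_segment (V4 \<delta>) (V1 s \<delta>)"
    moreover have "closed_segment (V4 \<delta>) (V1 s \<delta>) \<subseteq> side_s s iB \<inter> {x. ht x = \<delta>}"
      using corner_mem[OF v] corner_ht P
      by (intro closed_segment_subset convex_Int convex_side_s convex_ht) (auto simp: side_s_iff, simp_all add: V4_def V1_def)
    ultimately show "x \<in> side_s s iB \<inter> {x. ht x = \<delta>}" by blast
  qed
qed

lemma face_D:
  assumes v: "valid s \<delta>"
  shows "side_s s iD \<inter> {x. \<delta> \<le> ht x} = convex hull {T2, V3 \<delta>, V2 s \<delta>, VT s}"
    and "side_s s iD \<inter> {x. ht x = \<delta>} = closed_segment (V3 \<delta>) (V2 s \<delta>)"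
proof -
  note P = corner_pos[OF v]
  show "side_s s iD \<inter> {x. \<delta> \<le> ht x} = convex hull {T2, V3 \<delta>, V2 s \<delta>, VT s}"
  proof (intro equalityI subsetI)
    fix x assume x: "x \<in> side_s s iD \<inter> {x. \<delta> \<le> ht x}"
    then have q: "cp x = 0" and xc: "x \<in> cap_s s" using side_s_iff(4)[OF P(10)] by auto
    note ine = cap_s_ineqs[OF P(10) xc]
    obtain w1 w2 w3 where w: "0 \<le> w1" "0 \<le> w2" "0 \<le> w3" "w1 + w2 + w3 \<le> 1"
      "cq x = w1 * (1 - \<delta>) + w2 * q2 s \<delta>" "cr x = w2 * r2 s \<delta> + w3 * (1 - s)"
    proof (rule quadrilateral_weights[OF ine(2,3) _ _ P(6,7) corner_eqs(3,4) P(8,9)])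
      show "cq x + c * cr x \<le> 1 - \<delta>" using x q ht_coords[of x] by simp
      show "\<beta> * cq x + cr x \<le> 1 - s" using ine(4) q by simp
    qed
    show "x \<in> convex hull {T2, V3 \<delta>, V2 s \<delta>, VT s}"
    proof (rule hull_weights[where ?w1.0 = "1 - w1 - w2 - w3" and ?w2.0 = w1 and ?w3.0 = w2 and ?w4.0 = w3])
      show "x = (1 - w1 - w2 - w3) *\<^sub>R T2 + w1 *\<^sub>R V3 \<delta> + w2 *\<^sub>R V2 s \<delta> + w3 *\<^sub>R VT s"
        unfolding V3_def V2_def VT_def by (rule pt3_weights0) (use w q in auto)
    qed (use w in \<open>auto intro: hull_inc\<close>)
  next
    fix x assume "x \<in> convex hull {T2, V3 \<delta>, V2 s \<delta>, VT s}"
    moreover have "convex hull {T2, V3 \<delta>, V2 s \<delta>, VT s} \<subseteq> side_s s iD \<inter> {x. \<delta> \<le> ht x}"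
    proof (rule hull_minimal)
      have "c * (1 - s) \<le> 1 - \<delta>" using P(1) by (simp add: lam_def)
      then show "{T2, V3 \<delta>, V2 s \<delta>, VT s} \<subseteq> side_s s iD \<inter> {x. \<delta> \<le> ht x}"
        using corner_mem[OF v] corner_ht P by (auto simp: side_s_iff) (simp_all add: vertex_coords V3_def V2_def VT_def)
      show "convex (side_s s iD \<inter> {x. \<delta> \<le> ht x})" by (intro convex_Int convex_side_s convex_ht)
    qed
    ultimately show "x \<in> side_s s iD \<inter> {x. \<delta> \<le> ht x}" by blast
  qed
  show "side_s s iD \<inter> {x. ht x = \<delta>} = closed_segment (V3 \<delta>) (V2 s \<delta>)"
  proof (intro equalityI subsetI)
    fix x assume x: "x \<in> side_s s iD \<inter> {x. ht x = \<delta>}"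
    then have q: "cp x = 0" and xc: "x \<in> cap_s s" using side_s_iff(4)[OF P(10)] by auto
    note ine = cap_s_ineqs[OF P(10) xc]
    have p: "cq x = 1 - \<delta> - c * cr x" using x q ht_coords[of x] by simp
    define w where "w = cr x / r2 s \<delta>"
    have wr: "cr x = w * r2 s \<delta>" using P by (simp add: w_def)
    have "(1 - c * \<beta>) * cr x \<le> \<rho>2 s \<delta>" using ine(4) q p by (simp add: \<rho>2_def algebra_simps)
    then have "cr x \<le> r2 s \<delta>" using denom_pos by (simp add: r2_def field_simps)
    then have w01: "0 \<le> w" "w \<le> 1" using ine(3) P by (auto simp: w_def)
    show "x \<in> closed_segment (V3 \<delta>) (V2 s \<delta>)"
    proof (rule hull_weights[where ?w1.0 = "1 - w" and ?w2.0 = w and ?w3.0 = 0 and ?w4.0 = 0])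
      have "cq x = (1 - w) * (1 - \<delta>) + w * q2 s \<delta>"
      proof -
        have "q2 s \<delta> = (1 - \<delta>) - c * r2 s \<delta>" using corner_eqs(3)[of s \<delta>] by linarith
        show ?thesis unfolding p wr \<open>q2 s \<delta> = _\<close> by (simp add: algebra_simps)
      qed
      then show "x = (1 - w) *\<^sub>R V3 \<delta> + w *\<^sub>R V2 s \<delta> + 0 *\<^sub>R V2 s \<delta> + 0 *\<^sub>R V2 s \<delta>"
        unfolding V3_def V2_def by (intro pt3_weights) (use wr q in auto)
    qed (use w01 in auto)
  next
    fix x assume "x \<in> closed_segment (V3 \<delta>) (V2 s \<delta>)"
    moreover have "closed_segment (V3 \<delta>) (V2 s \<delta>) \<subseteq> side_s s iD \<inter> {x. ht x = \<delta>}"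
      using corner_mem[OF v] corner_ht P
      by (intro closed_segment_subset convex_Int convex_side_s convex_ht) (auto simp: side_s_iff, simp_all add: V3_def V2_def)
    ultimately show "x \<in> side_s s iD \<inter> {x. ht x = \<delta>}" by blast
  qed
qed

lemma face_C:
  assumes v: "valid s \<delta>"
  shows "side_s s iC \<inter> {x. \<delta> \<le> ht x} = convex hull {T2, V3 \<delta>, V4 \<delta>}"
    and "side_s s iC \<inter> {x. ht x = \<delta>} = closed_segment (V3 \<delta>) (V4 \<delta>)"
proof -
  note P = corner_pos[OF v]
  have wts: "x = (1 - cp x / (1 - \<delta>) - cq x / (1 - \<delta>)) *\<^sub>R T2 + (cq x / (1 - \<delta>)) *\<^sub>R V3 \<delta> + (cp x / (1 - \<delta>)) *\<^sub>R V4 \<delta> + 0 *\<^sub>R V4 \<delta>"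
    if "cr x = 0" for x
    unfolding V3_def V4_def by (rule pt3_weights0) (use that P(8) in auto)
  show "side_s s iC \<inter> {x. \<delta> \<le> ht x} = convex hull {T2, V3 \<delta>, V4 \<delta>}"
  proof (intro equalityI subsetI)
    fix x assume x: "x \<in> side_s s iC \<inter> {x. \<delta> \<le> ht x}"
    then have q: "cr x = 0" and xc: "x \<in> cap_s s" using side_s_iff(3)[OF P(10)] by auto
    note ine = cap_s_ineqs[OF P(10) xc]
    have "cp x + cq x \<le> 1 - \<delta>" using x q ht_coords[of x] by simp
    then have "cp x / (1 - \<delta>) + cq x / (1 - \<delta>) \<le> 1" using P(8) by (simp add: add_divide_distrib[symmetric])
    then show "x \<in> convex hull {T2, V3 \<delta>, V4 \<delta>}"
      by (intro hull_weights[OF _ _ _ _ _ wts[OF q]]) (use ine P in \<open>auto intro: hull_inc\<close>)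
  next
    fix x assume "x \<in> convex hull {T2, V3 \<delta>, V4 \<delta>}"
    moreover have "convex hull {T2, V3 \<delta>, V4 \<delta>} \<subseteq> side_s s iC \<inter> {x. \<delta> \<le> ht x}"
    proof (rule hull_minimal)
      show "{T2, V3 \<delta>, V4 \<delta>} \<subseteq> side_s s iC \<inter> {x. \<delta> \<le> ht x}"
        using corner_mem[OF v] corner_ht P by (auto simp: side_s_iff) (simp_all add: vertex_coords V3_def V4_def)
      show "convex (side_s s iC \<inter> {x. \<delta> \<le> ht x})" by (intro convex_Int convex_side_s convex_ht)
    qed
    ultimately show "x \<in> side_s s iC \<inter> {x. \<delta> \<le> ht x}" by blast
  qed
  show "side_s s iC \<inter> {x. ht x = \<delta>} = closed_segment (V3 \<delta>) (V4 \<delta>)"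
  proof (intro equalityI subsetI)
    fix x assume x: "x \<in> side_s s iC \<inter> {x. ht x = \<delta>}"
    then have q: "cr x = 0" and xc: "x \<in> cap_s s" using side_s_iff(3)[OF P(10)] by auto
    note ine = cap_s_ineqs[OF P(10) xc]
    have "cp x + cq x = 1 - \<delta>" using x q ht_coords[of x] by simp
    then have sum1: "cq x / (1 - \<delta>) + cp x / (1 - \<delta>) = 1" using P(8) by (simp add: add_divide_distrib[symmetric])
    have "x = (cq x / (1 - \<delta>)) *\<^sub>R V3 \<delta> + (cp x / (1 - \<delta>)) *\<^sub>R V4 \<delta>"
    proof -
      have "1 - cp x / (1 - \<delta>) - cq x / (1 - \<delta>) = 0" using sum1 by simp
      then show ?thesis using wts[OF q] by simp
    qed
    then show "x \<in> closed_segment (V3 \<delta>) (V4 \<delta>)"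
      using segment_weights[of "cq x / (1 - \<delta>)" "cp x / (1 - \<delta>)" "V3 \<delta>" "V4 \<delta>"] sum1 ine P by simp
  next
    fix x assume "x \<in> closed_segment (V3 \<delta>) (V4 \<delta>)"
    moreover have "closed_segment (V3 \<delta>) (V4 \<delta>) \<subseteq> side_s s iC \<inter> {x. ht x = \<delta>}"
      using corner_mem[OF v] corner_ht P
      by (intro closed_segment_subset convex_Int convex_side_s convex_ht) (auto simp: side_s_iff, simp_all add: V3_def V4_def)
    ultimately show "x \<in> side_s s iC \<inter> {x. ht x = \<delta>}" by blast
  qed
qed

end

context wedge_cap
begin

lemma face_A:
  assumes v: "valid s \<delta>"
  shows "side_s s iA \<inter> {x. \<delta> \<le> ht x} = convex hull {VT s, V1 s \<delta>, V2 s \<delta>}"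
    and "side_s s iA \<inter> {x. ht x = \<delta>} = closed_segment (V1 s \<delta>) (V2 s \<delta>)"
proof -
  note P = corner_pos[OF v]
  have sub: "side_s s iA \<inter> {x. ht x = \<delta>} \<subseteq> side_s s iA \<inter> {x. \<delta> \<le> ht x}" by auto
  have key: "0 \<le> cp x / p1 s \<delta>" "0 \<le> cq x / q2 s \<delta>" "cp x / p1 s \<delta> + cq x / q2 s \<delta> \<le> 1"
    "ht x = \<delta> \<Longrightarrow> cp x / p1 s \<delta> + cq x / q2 s \<delta> = 1"
    "x = (1 - cp x / p1 s \<delta> - cq x / q2 s \<delta>) *\<^sub>R VT s + (cp x / p1 s \<delta>) *\<^sub>R V1 s \<delta> + (cq x / q2 s \<delta>) *\<^sub>R V2 s \<delta> + 0 *\<^sub>R V2 s \<delta>"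
    if x: "x \<in> side_s s iA \<inter> {x. \<delta> \<le> ht x}" for x
  proof -
    have q: "sl x = s" and xc: "x \<in> cap_s s" using x side_s_iff(1)[OF P(10)] by auto
    note ine = cap_s_ineqs[OF P(10) xc]
    show "0 \<le> cp x / p1 s \<delta>" "0 \<le> cq x / q2 s \<delta>" using ine P by simp_all
    have r: "cr x = 1 - s - \<alpha> * cp x - \<beta> * cq x" using q sl_coords[of x] by simp
    have quot: "cp x / p1 s \<delta> + cq x / q2 s \<delta> = (cp x * (1 - c * \<alpha>) + cq x * (1 - c * \<beta>)) / lam s \<delta>"
      by (simp add: p1_def q2_def add_divide_distrib)
    have num: "cp x * (1 - c * \<alpha>) + cq x * (1 - c * \<beta>) = lam s \<delta> - (ht x - \<delta>)"
      unfolding ht_coords r lam_def by (simp add: algebra_simps)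
    show "cp x / p1 s \<delta> + cq x / q2 s \<delta> \<le> 1" unfolding quot num using x P(1) by simp
    show "cp x / p1 s \<delta> + cq x / q2 s \<delta> = 1" if "ht x = \<delta>" unfolding quot num using that P(1) by simp
    have r1: "r1 s \<delta> = 1 - s - \<alpha> * p1 s \<delta>" and r2: "r2 s \<delta> = 1 - s - \<beta> * q2 s \<delta>"
      using corner_eqs[of s \<delta>] by linarith+
    define u w where "u = cp x / p1 s \<delta>" and "w = cq x / q2 s \<delta>"
    have uw: "cp x = u * p1 s \<delta>" "cq x = w * q2 s \<delta>" using P by (simp_all add: u_def w_def)
    have "x = (1 - u - w) *\<^sub>R VT s + u *\<^sub>R V1 s \<delta> + w *\<^sub>R V2 s \<delta> + 0 *\<^sub>R V2 s \<delta>"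
      unfolding VT_def V1_def V2_def
    proof (rule pt3_weights)
      show "cr x = (1 - u - w) * (1 - s) + u * r1 s \<delta> + w * r2 s \<delta> + 0 * r2 s \<delta>"
        unfolding r r1 r2 uw by (simp add: algebra_simps)
    qed (simp_all add: uw)
    then show "x = (1 - cp x / p1 s \<delta> - cq x / q2 s \<delta>) *\<^sub>R VT s + (cp x / p1 s \<delta>) *\<^sub>R V1 s \<delta>
        + (cq x / q2 s \<delta>) *\<^sub>R V2 s \<delta> + 0 *\<^sub>R V2 s \<delta>" unfolding u_def w_def .
  qed
  show "side_s s iA \<inter> {x. \<delta> \<le> ht x} = convex hull {VT s, V1 s \<delta>, V2 s \<delta>}"
  proof (intro equalityI subsetI)
    fix x assume x: "x \<in> side_s s iA \<inter> {x. \<delta> \<le> ht x}"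
    show "x \<in> convex hull {VT s, V1 s \<delta>, V2 s \<delta>}"
      by (rule hull_weights[OF _ _ _ _ _ key(5)[OF x]]) (use key(1-3)[OF x] in \<open>auto intro: hull_inc\<close>)
  next
    fix x assume "x \<in> convex hull {VT s, V1 s \<delta>, V2 s \<delta>}"
    moreover have "convex hull {VT s, V1 s \<delta>, V2 s \<delta>} \<subseteq> side_s s iA \<inter> {x. \<delta> \<le> ht x}"
    proof (rule hull_minimal)
      have "c * (1 - s) \<le> 1 - \<delta>" using P(1) by (simp add: lam_def)
      then show "{VT s, V1 s \<delta>, V2 s \<delta>} \<subseteq> side_s s iA \<inter> {x. \<delta> \<le> ht x}"
        using corner_mem[OF v] corner_ht P by (auto simp: side_s_iff)
      show "convex (side_s s iA \<inter> {x. \<delta> \<le> ht x})" by (intro convex_Int convex_side_s convex_ht)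
    qed
    ultimately show "x \<in> side_s s iA \<inter> {x. \<delta> \<le> ht x}" by blast
  qed
  show "side_s s iA \<inter> {x. ht x = \<delta>} = closed_segment (V1 s \<delta>) (V2 s \<delta>)"
  proof (intro equalityI subsetI)
    fix x assume x: "x \<in> side_s s iA \<inter> {x. ht x = \<delta>}"
    then have x': "x \<in> side_s s iA \<inter> {x. \<delta> \<le> ht x}" using sub by blast
    have sum1: "cp x / p1 s \<delta> + cq x / q2 s \<delta> = 1" using key(4)[OF x'] x by blast
    have "x = (cp x / p1 s \<delta>) *\<^sub>R V1 s \<delta> + (cq x / q2 s \<delta>) *\<^sub>R V2 s \<delta>"
    proof -
      have "1 - cp x / p1 s \<delta> - cq x / q2 s \<delta> = 0" using sum1 by linarith
      then show ?thesis using key(5)[OF x'] by simp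
    qed
    then show "x \<in> closed_segment (V1 s \<delta>) (V2 s \<delta>)"
      using segment_weights[OF key(1,2)[OF x'] sum1, of "V1 s \<delta>" "V2 s \<delta>"] by simp
  next
    fix x assume "x \<in> closed_segment (V1 s \<delta>) (V2 s \<delta>)"
    moreover have "closed_segment (V1 s \<delta>) (V2 s \<delta>) \<subseteq> side_s s iA \<inter> {x. ht x = \<delta>}"
      using corner_mem[OF v] corner_ht P
      by (intro closed_segment_subset convex_Int convex_side_s convex_ht) (auto simp: side_s_iff)
    ultimately show "x \<in> side_s s iA \<inter> {x. ht x = \<delta>}" by blast
  qed
qed

text \<open>A point of the section lies on the segment between a point of \<open>V1 V2\<close> and the point of \<open>V3 V4\<close> with the same ratio of
  \<open>cp\<close> and \<open>cq\<close>.\<close>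

lemma section_quadrilateral:
  assumes v: "valid s \<delta>"
  shows "cap_s s \<inter> {x. ht x = \<delta>} = convex hull {V1 s \<delta>, V2 s \<delta>, V3 \<delta>, V4 \<delta>}"
proof (intro equalityI subsetI)
  note P = corner_pos[OF v]
  fix x assume x: "x \<in> cap_s s \<inter> {x. ht x = \<delta>}"
  then have xc: "x \<in> cap_s s" and hx: "ht x = \<delta>" by auto
  note ine = cap_s_ineqs[OF P(10) xc]
  have h: "cp x + cq x + c * cr x = 1 - \<delta>" using hx ht_coords[of x] by simp
  define z where "z = cp x + cq x"
  have "0 < z"
  proof (rule ccontr)
    assume "\<not> 0 < z"
    then have "cp x = 0" "cq x = 0" using ine by (auto simp: z_def)
    then have "1 - \<delta> \<le> c * (1 - s)" using h ine(4) c_range mult_left_mono[of "cr x" "1 - s" c] by simp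
    then show False using P(1) by (simp add: lam_def)
  qed
  \<comment> \<open>The value of \<open>cr\<close> at the point of the line through \<open>V1\<close> and \<open>V2\<close> with the same ratio of \<open>cp\<close> and \<open>cq\<close>.\<close>
  define S where "S = cp x * (r1 s \<delta> / p1 s \<delta>) + cq x * (r2 s \<delta> / q2 s \<delta>)"
  have S: "0 < S"
  proof -
    have "0 \<le> cp x * (r1 s \<delta> / p1 s \<delta>)" "0 \<le> cq x * (r2 s \<delta> / q2 s \<delta>)" using ine P by simp_all
    moreover have "cp x \<noteq> 0 \<or> cq x \<noteq> 0" using \<open>0 < z\<close> by (auto simp: z_def)
    then have "0 < cp x * (r1 s \<delta> / p1 s \<delta>) \<or> 0 < cq x * (r2 s \<delta> / q2 s \<delta>)"
      using ine P by (auto simp: less_le)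
    ultimately show ?thesis unfolding S_def by linarith
  qed
  define u w where "u = cp x / p1 s \<delta>" and "w = cq x / q2 s \<delta>"
  have uw: "cp x = u * p1 s \<delta>" "cq x = w * q2 s \<delta>" "0 \<le> u" "0 \<le> w" "S = u * r1 s \<delta> + w * r2 s \<delta>"
    using P ine by (simp_all add: u_def w_def S_def)
  have sum: "(u + w) * (1 - \<delta>) = z + c * S"
  proof -
    have "(u + w) * (1 - \<delta>) = u * (1 - \<delta>) + w * (1 - \<delta>)" by (rule distrib_right)
    also have "\<dots> = u * (p1 s \<delta> + c * r1 s \<delta>) + w * (q2 s \<delta> + c * r2 s \<delta>)" by (simp only: corner_eqs)
    also have "\<dots> = z + c * S" unfolding z_def uw(1,2,5) by (simp add: distrib_left mult.left_commute)
    finally show ?thesis .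
  qed
  have sum2: "(u + w) * (1 - s) = \<alpha> * cp x + \<beta> * cq x + S"
  proof -
    have "(u + w) * (1 - s) = u * (1 - s) + w * (1 - s)" by (rule distrib_right)
    also have "\<dots> = u * (\<alpha> * p1 s \<delta> + r1 s \<delta>) + w * (\<beta> * q2 s \<delta> + r2 s \<delta>)" by (simp only: corner_eqs)
    also have "\<dots> = \<alpha> * cp x + \<beta> * cq x + S" unfolding uw(1,2,5) by (simp add: distrib_left mult.left_commute)
    finally show ?thesis .
  qed
  have rS: "cr x \<le> S"
  proof (rule ccontr)
    assume "\<not> cr x \<le> S"
    then have gt: "0 < cr x - S" by simp
    have "(u + w) * (1 - \<delta>) = (1 - \<delta>) - c * (cr x - S)"
      using h by (subst sum) (simp add: z_def right_diff_distrib)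
    then have e1: "(1 - (u + w)) * (1 - \<delta>) = c * (cr x - S)" by (simp only: left_diff_distrib[of 1 "u + w"]) simp
    have "(1 - (u + w)) * (1 - s) = (1 - s) - (u + w) * (1 - s)" by (simp only: left_diff_distrib[of 1 "u + w"]) simp
    then have "cr x - S \<le> (1 - (u + w)) * (1 - s)" using sum2 ine(4) by simp
    then have "(cr x - S) * (1 - \<delta>) \<le> (1 - (u + w)) * (1 - s) * (1 - \<delta>)" using P(8) by (intro mult_right_mono) auto
    also have "\<dots> = (1 - s) * ((1 - (u + w)) * (1 - \<delta>))" by (simp only: mult.commute mult.left_commute)
    also have "\<dots> = (cr x - S) * (c * (1 - s))" unfolding e1 by (simp only: mult.commute mult.left_commute)
    finally have "(cr x - S) * lam s \<delta> \<le> 0" by (simp add: lam_def algebra_simps)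
    then show False using gt P(1) by (simp add: mult_le_0_iff)
  qed
  define \<kappa> where "\<kappa> = cr x / S"
  have k: "0 \<le> \<kappa>" "\<kappa> \<le> 1" "cr x = \<kappa> * S" using rS S ine by (auto simp: \<kappa>_def)
  define w3 w4 where "w3 = (1 - \<kappa>) * (cq x / (1 - \<delta>))" and "w4 = (1 - \<kappa>) * (cp x / (1 - \<delta>))"
  have w34: "0 \<le> w3" "0 \<le> w4" "w3 * (1 - \<delta>) = (1 - \<kappa>) * cq x" "w4 * (1 - \<delta>) = (1 - \<kappa>) * cp x"
    using k ine P by (simp_all add: w3_def w4_def)
  have tot: "\<kappa> * u + \<kappa> * w + w3 + w4 = 1"
  proof -
    have "(\<kappa> * u + \<kappa> * w + w3 + w4) * (1 - \<delta>) = \<kappa> * ((u + w) * (1 - \<delta>)) + w3 * (1 - \<delta>) + w4 * (1 - \<delta>)"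
      by (simp add: algebra_simps)
    also have "\<dots> = z + c * (\<kappa> * S)" unfolding sum w34 z_def by (simp add: algebra_simps)
    also have "\<dots> = 1 * (1 - \<delta>)" using h k(3) by (simp add: z_def)
    finally show ?thesis using P(8) by simp
  qed
  show "x \<in> convex hull {V1 s \<delta>, V2 s \<delta>, V3 \<delta>, V4 \<delta>}"
  proof (rule hull_weights[where ?w1.0 = "\<kappa> * u" and ?w2.0 = "\<kappa> * w" and ?w3.0 = w3 and ?w4.0 = w4])
    show "x = (\<kappa> * u) *\<^sub>R V1 s \<delta> + (\<kappa> * w) *\<^sub>R V2 s \<delta> + w3 *\<^sub>R V3 \<delta> + w4 *\<^sub>R V4 \<delta>"
      unfolding V1_def V2_def V3_def V4_def
    proof (rule pt3_weights[OF tot])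
      show "cp x = \<kappa> * u * p1 s \<delta> + \<kappa> * w * 0 + w3 * 0 + w4 * (1 - \<delta>)"
        unfolding w34 uw(1) by (simp add: algebra_simps)
      show "cq x = \<kappa> * u * 0 + \<kappa> * w * q2 s \<delta> + w3 * (1 - \<delta>) + w4 * 0"
        unfolding w34 uw(2) by (simp add: algebra_simps)
      show "cr x = \<kappa> * u * r1 s \<delta> + \<kappa> * w * r2 s \<delta> + w3 * 0 + w4 * 0"
        unfolding k(3) uw(5) by (simp add: algebra_simps)
    qed
  qed (use k uw w34 tot in \<open>auto intro: hull_inc\<close>)
next
  fix x assume "x \<in> convex hull {V1 s \<delta>, V2 s \<delta>, V3 \<delta>, V4 \<delta>}"
  moreover have "convex hull {V1 s \<delta>, V2 s \<delta>, V3 \<delta>, V4 \<delta>} \<subseteq> cap_s s \<inter> {x. ht x = \<delta>}"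
    using corner_mem[OF v] corner_ht by (intro hull_minimal convex_Int convex_cap_s convex_ht) auto
  ultimately show "x \<in> cap_s s \<inter> {x. ht x = \<delta>}" by blast
qed

lemma segments_cross:
  assumes "0 \<le> u" "u \<le> 1" "0 \<le> w" "w \<le> 1" "(1 - u) *\<^sub>R x + u *\<^sub>R y = (1 - w) *\<^sub>R x' + w *\<^sub>R y'"
  shows "closed_segment x y \<inter> closed_segment x' y' \<noteq> {}"
proof -
  have "(1 - u) *\<^sub>R x + u *\<^sub>R y \<in> closed_segment x y" "(1 - w) *\<^sub>R x' + w *\<^sub>R y' \<in> closed_segment x' y'"
    using assms(1-4) by (intro segment_weights; simp)+
  then show ?thesis using assms(5) by auto
qed

text \<open>The perimeter formula for quadrilaterals asks for the order of the vertices.  In the planes \<open>iB\<close> and \<open>iD\<close> the multiple of \<open>V1\<close> or \<open>V2\<close> on the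
  opposite diagonal is computed from the coordinates; in the section the common point of the diagonals is found in the same way.\<close>

lemma diagonals_cross:
  assumes v: "valid s \<delta>"
  shows "closed_segment T2 (V1 s \<delta>) \<inter> closed_segment (V4 \<delta>) (VT s) \<noteq> {}"
    "closed_segment T2 (V2 s \<delta>) \<inter> closed_segment (V3 \<delta>) (VT s) \<noteq> {}"
    "closed_segment (V1 s \<delta>) (V3 \<delta>) \<inter> closed_segment (V2 s \<delta>) (V4 \<delta>) \<noteq> {}"
proof -
  note P = corner_pos[OF v]
  have cs: "c * (1 - s) \<le> 1 - \<delta>" using P(1) by (simp add: lam_def)
  have aux: "\<exists>u w. 0 \<le> u \<and> u \<le> 1 \<and> 0 \<le> w \<and> w \<le> 1 \<and> u * p = (1 - w) * (1 - \<delta>) \<and> u * r = w * (1 - s)"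
    if pr: "0 < p" "0 < r" "p + c * r = 1 - \<delta>" for p r
  proof -
    define N where "N = p / (1 - \<delta>) + r / (1 - s)"
    have "p / (1 - \<delta>) = 1 - c * r / (1 - \<delta>)" using pr P(8) by (simp add: field_simps)
    moreover have "c * r / (1 - \<delta>) \<le> r / (1 - s)"
      using mult_left_mono[OF cs, of r] P(8,9) pr by (simp add: divide_le_eq pos_le_divide_eq mult.commute mult.left_commute)
    ultimately have N: "1 \<le> N" by (simp add: N_def)
    define u w where "u = 1 / N" and "w = u * r / (1 - s)"
    have "u * N = 1" using N by (simp add: u_def)
    then have "u * p / (1 - \<delta>) + w = 1" by (simp add: N_def w_def algebra_simps)
    moreover have "0 \<le> u * p / (1 - \<delta>)" "0 \<le> u" "u \<le> 1" using N pr P by (simp_all add: u_def)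
    moreover have w: "0 \<le> w" "u * r = w * (1 - s)" using N pr P by (simp_all add: u_def w_def)
    moreover have "u * p = (u * p / (1 - \<delta>)) * (1 - \<delta>)" using P(8) by simp
    ultimately have "0 \<le> u" "u \<le> 1" "w \<le> 1" "u * p = (1 - w) * (1 - \<delta>)" by (linarith+, metis add_diff_cancel_right')
    then show ?thesis using w by blast
  qed
  obtain u w where uw: "0 \<le> u" "u \<le> 1" "0 \<le> w" "w \<le> 1" "u * p1 s \<delta> = (1 - w) * (1 - \<delta>)" "u * r1 s \<delta> = w * (1 - s)"
    using aux[OF P(4,5) corner_eqs(1)] by blast
  show "closed_segment T2 (V1 s \<delta>) \<inter> closed_segment (V4 \<delta>) (VT s) \<noteq> {}"
  proof (rule segments_cross[OF uw(1-4)])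
    have "(1 - u) *\<^sub>R T2 + u *\<^sub>R V1 s \<delta> = T2 + (u * p1 s \<delta>) *\<^sub>R e1 + (u * r1 s \<delta>) *\<^sub>R e3"
      by (simp add: V1_def pt3_def algebra_simps)
    also have "\<dots> = (1 - w) *\<^sub>R V4 \<delta> + w *\<^sub>R VT s"
      unfolding uw by (simp add: V4_def VT_def pt3_def algebra_simps)
    finally show "(1 - u) *\<^sub>R T2 + u *\<^sub>R V1 s \<delta> = (1 - w) *\<^sub>R V4 \<delta> + w *\<^sub>R VT s" .
  qed
  obtain u w where uw: "0 \<le> u" "u \<le> 1" "0 \<le> w" "w \<le> 1" "u * q2 s \<delta> = (1 - w) * (1 - \<delta>)" "u * r2 s \<delta> = w * (1 - s)"
    using aux[OF P(6,7) corner_eqs(3)] by blast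
  show "closed_segment T2 (V2 s \<delta>) \<inter> closed_segment (V3 \<delta>) (VT s) \<noteq> {}"
  proof (rule segments_cross[OF uw(1-4)])
    have "(1 - u) *\<^sub>R T2 + u *\<^sub>R V2 s \<delta> = T2 + (u * q2 s \<delta>) *\<^sub>R e2 + (u * r2 s \<delta>) *\<^sub>R e3"
      by (simp add: V2_def pt3_def algebra_simps)
    also have "\<dots> = (1 - w) *\<^sub>R V3 \<delta> + w *\<^sub>R VT s"
      unfolding uw by (simp add: V3_def VT_def pt3_def algebra_simps)
    finally show "(1 - u) *\<^sub>R T2 + u *\<^sub>R V2 s \<delta> = (1 - w) *\<^sub>R V3 \<delta> + w *\<^sub>R VT s" .
  qed
  define Z where "Z = 1 - \<delta>"
  let ?r = "r1 s \<delta>" and ?r' = "r2 s \<delta>"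
  define N where "N = Z * (?r + ?r') - c * ?r * ?r'"
  have pq: "p1 s \<delta> = Z - c * ?r" "q2 s \<delta> = Z - c * ?r'" using corner_eqs[of s \<delta>] by (simp_all add: Z_def)
  have ZN: "Z * ?r' \<le> N" "Z * ?r \<le> N"
  proof -
    have "N - Z * ?r' = ?r * q2 s \<delta>" "N - Z * ?r = ?r' * p1 s \<delta>" by (simp_all add: N_def pq algebra_simps)
    moreover have "0 \<le> ?r * q2 s \<delta>" "0 \<le> ?r' * p1 s \<delta>" using P by simp_all
    ultimately show "Z * ?r' \<le> N" "Z * ?r \<le> N" by linarith+
  qed
  have "0 < Z * ?r'" using P by (simp add: Z_def)
  then have Npos: "0 < N" using ZN(1) by linarith
  define u w where "u = 1 - Z * ?r' / N" and "w = 1 - Z * ?r / N"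
  have uw: "(1 - u) * N = Z * ?r'" "(1 - w) * N = Z * ?r" using Npos by (simp_all add: u_def w_def)
  have bounds: "0 \<le> u" "u \<le> 1" "0 \<le> w" "w \<le> 1" using ZN Npos P by (simp_all add: u_def w_def Z_def)
  have wN: "w * N = ?r' * p1 s \<delta>" "u * N = ?r * q2 s \<delta>"
  proof -
    have "N - Z * ?r = ?r' * p1 s \<delta>" "N - Z * ?r' = ?r * q2 s \<delta>" by (simp_all add: N_def pq algebra_simps)
    moreover have "w * N = N - (1 - w) * N" "u * N = N - (1 - u) * N" by (simp_all add: left_diff_distrib)
    ultimately show "w * N = ?r' * p1 s \<delta>" "u * N = ?r * q2 s \<delta>" unfolding uw by simp_all
  qed
  show "closed_segment (V1 s \<delta>) (V3 \<delta>) \<inter> closed_segment (V2 s \<delta>) (V4 \<delta>) \<noteq> {}"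
  proof (rule segments_cross[OF bounds])
    have a1: "(1 - u) * p1 s \<delta> = w * Z"
    proof -
      have "((1 - u) * p1 s \<delta>) * N = p1 s \<delta> * ((1 - u) * N)" by (simp only: mult.commute mult.left_commute)
      also have "\<dots> = Z * (w * N)" unfolding uw wN by (simp only: mult.commute mult.left_commute)
      finally have "((1 - u) * p1 s \<delta>) * N = (w * Z) * N" by (simp only: mult.commute mult.left_commute)
      then show ?thesis using Npos by simp
    qed
    have a2: "u * Z = (1 - w) * q2 s \<delta>"
    proof -
      have "((1 - w) * q2 s \<delta>) * N = q2 s \<delta> * ((1 - w) * N)" by (simp only: mult.commute mult.left_commute)
      also have "\<dots> = Z * (u * N)" unfolding uw wN by (simp only: mult.commute mult.left_commute)
      finally have "(u * Z) * N = ((1 - w) * q2 s \<delta>) * N" by (simp only: mult.commute mult.left_commute)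
      then show ?thesis using Npos by simp
    qed
    have a3: "(1 - u) * ?r = (1 - w) * ?r'"
    proof -
      have "((1 - u) * ?r) * N = ?r * ((1 - u) * N)" by (simp only: mult.commute mult.left_commute)
      also have "\<dots> = ?r' * ((1 - w) * N)" unfolding uw by (simp only: mult.commute mult.left_commute)
      finally have "((1 - u) * ?r) * N = ((1 - w) * ?r') * N" by (simp only: mult.commute mult.left_commute)
      then show ?thesis using Npos by simp
    qed
    have "(1 - u) *\<^sub>R V1 s \<delta> + u *\<^sub>R V3 \<delta> = T2 + ((1 - u) * p1 s \<delta>) *\<^sub>R e1 + (u * Z) *\<^sub>R e2 + ((1 - u) * ?r) *\<^sub>R e3"
      by (simp add: V1_def V3_def pt3_def Z_def algebra_simps)
    also have "\<dots> = (1 - w) *\<^sub>R V2 s \<delta> + w *\<^sub>R V4 \<delta>"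
      unfolding a1 a2 a3 by (simp add: V2_def V4_def pt3_def Z_def algebra_simps)
    finally show "(1 - u) *\<^sub>R V1 s \<delta> + u *\<^sub>R V3 \<delta> = (1 - w) *\<^sub>R V2 s \<delta> + w *\<^sub>R V4 \<delta>" .
  qed
qed

section \<open>The gain of girth above a level\<close>

lemma corner_diff:
  "V1 s \<delta> = VT s + lam s \<delta> *\<^sub>R f1" "V2 s \<delta> = VT s + lam s \<delta> *\<^sub>R f2"
  "V1 s \<delta> = V4 \<delta> + \<rho>1 s \<delta> *\<^sub>R g1" "V2 s \<delta> = V3 \<delta> + \<rho>2 s \<delta> *\<^sub>R g2"
  "V4 \<delta> = T2 + (1 - \<delta>) *\<^sub>R e1" "V3 \<delta> = T2 + (1 - \<delta>) *\<^sub>R e2" "VT s = T2 + (1 - s) *\<^sub>R e3"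
proof -
  have r: "r1 s \<delta> = 1 - s - \<alpha> * p1 s \<delta>" "r2 s \<delta> = 1 - s - \<beta> * q2 s \<delta>"
    using corner_eqs[of s \<delta>] by linarith+
  have lf: "lam s \<delta> *\<^sub>R f1 = p1 s \<delta> *\<^sub>R (e1 - \<alpha> *\<^sub>R e3)" "lam s \<delta> *\<^sub>R f2 = q2 s \<delta> *\<^sub>R (e2 - \<beta> *\<^sub>R e3)"
    by (simp_all add: f1_def f2_def p1_def q2_def)
  show "V1 s \<delta> = VT s + lam s \<delta> *\<^sub>R f1" "V2 s \<delta> = VT s + lam s \<delta> *\<^sub>R f2"
    unfolding lf V1_def V2_def VT_def pt3_def r by (simp_all add: algebra_simps)
  have p: "p1 s \<delta> = 1 - \<delta> - c * r1 s \<delta>" "q2 s \<delta> = 1 - \<delta> - c * r2 s \<delta>"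
    using corner_eqs[of s \<delta>] by linarith+
  have rg: "\<rho>1 s \<delta> *\<^sub>R g1 = r1 s \<delta> *\<^sub>R (e3 - c *\<^sub>R e1)" "\<rho>2 s \<delta> *\<^sub>R g2 = r2 s \<delta> *\<^sub>R (e3 - c *\<^sub>R e2)"
    by (simp_all add: g1_def g2_def r1_def r2_def)
  show "V1 s \<delta> = V4 \<delta> + \<rho>1 s \<delta> *\<^sub>R g1" "V2 s \<delta> = V3 \<delta> + \<rho>2 s \<delta> *\<^sub>R g2"
    unfolding rg V1_def V2_def V3_def V4_def pt3_def p by (simp_all add: algebra_simps)
  show "V4 \<delta> = T2 + (1 - \<delta>) *\<^sub>R e1" "V3 \<delta> = T2 + (1 - \<delta>) *\<^sub>R e2" "VT s = T2 + (1 - s) *\<^sub>R e3"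
    by (simp_all add: V3_def V4_def VT_def pt3_def)
qed

text \<open>Half the total girth of the side faces above the section, minus half the girth of the section and of the cut edges: what dropping the
  face at height \<open>\<delta>\<close> adds to the total edge length after a shift by \<open>-s\<close>.\<close>

definition gain where
  "gain s \<delta> = lam s \<delta> * (norm f1 + norm f2 - norm (f1 - f2)) + (1 - \<delta>) * (norm e1 + norm e2 - norm (e1 - e2))
     + (1 - s) * norm e3 - \<rho>1 s \<delta> * norm g1 - \<rho>2 s \<delta> * norm g2"

lemma corner_dist:
  assumes v: "valid s \<delta>"
  shows "dist (VT s) (V1 s \<delta>) = lam s \<delta> * norm f1" "dist (V2 s \<delta>) (VT s) = lam s \<delta> * norm f2"
    "dist (V1 s \<delta>) (VT s) = lam s \<delta> * norm f1"
    "dist (V1 s \<delta>) (V2 s \<delta>) = lam s \<delta> * norm (f1 - f2)" "dist (V4 \<delta>) (V1 s \<delta>) = \<rho>1 s \<delta> * norm g1"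
    "dist (V3 \<delta>) (V2 s \<delta>) = \<rho>2 s \<delta> * norm g2" "dist (V2 s \<delta>) (V3 \<delta>) = \<rho>2 s \<delta> * norm g2"
    "dist T2 (V4 \<delta>) = (1 - \<delta>) * norm e1" "dist (V4 \<delta>) T2 = (1 - \<delta>) * norm e1"
    "dist T2 (V3 \<delta>) = (1 - \<delta>) * norm e2" "dist (V3 \<delta>) (V4 \<delta>) = (1 - \<delta>) * norm (e1 - e2)"
    "dist (VT s) T2 = (1 - s) * norm e3"
proof -
  note P = corner_pos[OF v]
  have d: "dist x (x + t *\<^sub>R z) = t * norm z" "dist (x + t *\<^sub>R z) x = t * norm z" if "0 \<le> t" for x z :: pt and t
    using that by (simp_all add: dist_norm)
  show "dist (VT s) (V1 s \<delta>) = lam s \<delta> * norm f1" "dist (V1 s \<delta>) (VT s) = lam s \<delta> * norm f1"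
    unfolding corner_diff(1)[of s \<delta>] using P by (simp_all add: d)
  show "dist (V2 s \<delta>) (VT s) = lam s \<delta> * norm f2" unfolding corner_diff(2)[of s \<delta>] using P by (simp add: d)
  have "V1 s \<delta> - V2 s \<delta> = lam s \<delta> *\<^sub>R (f1 - f2)"
    unfolding corner_diff(1,2)[of s \<delta>] by (simp add: algebra_simps)
  then show "dist (V1 s \<delta>) (V2 s \<delta>) = lam s \<delta> * norm (f1 - f2)" using P by (simp add: dist_norm)
  show "dist (V4 \<delta>) (V1 s \<delta>) = \<rho>1 s \<delta> * norm g1" unfolding corner_diff(3)[of s \<delta>] using P by (simp add: d)
  show "dist (V3 \<delta>) (V2 s \<delta>) = \<rho>2 s \<delta> * norm g2" "dist (V2 s \<delta>) (V3 \<delta>) = \<rho>2 s \<delta> * norm g2"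
    unfolding corner_diff(4)[of s \<delta>] using P by (simp_all add: d)
  show "dist T2 (V4 \<delta>) = (1 - \<delta>) * norm e1" "dist (V4 \<delta>) T2 = (1 - \<delta>) * norm e1"
    unfolding corner_diff(5) using P by (simp_all add: d)
  show "dist T2 (V3 \<delta>) = (1 - \<delta>) * norm e2" unfolding corner_diff(6) using P by (simp add: d)
  have "V4 \<delta> - V3 \<delta> = (1 - \<delta>) *\<^sub>R (e1 - e2)" unfolding corner_diff(5,6) by (simp add: algebra_simps)
  then have "dist (V4 \<delta>) (V3 \<delta>) = (1 - \<delta>) * norm (e1 - e2)" using P by (simp add: dist_norm)
  then show "dist (V3 \<delta>) (V4 \<delta>) = (1 - \<delta>) * norm (e1 - e2)" by (simp only: dist_commute)
  show "dist (VT s) T2 = (1 - s) * norm e3" unfolding corner_diff(7) using P by (simp add: d)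
qed

text \<open>The girth is a valuation.\<close>

lemma side_s_cut:
  assumes "0 \<le> s" "side_s s i \<inter> {x. ht x = \<delta>} \<noteq> {}"
  shows "girth (side_s s i) = girth (side_s s i \<inter> {x. ht x \<le> \<delta>}) + girth (side_s s i \<inter> {x. \<delta> \<le> ht x})
     - girth (side_s s i \<inter> {x. ht x = \<delta>})"
  using girth_valuation[OF compact_side_s[OF assms(1)] convex_side_s, of i n "lev \<delta>"] assms(2)
  by (simp add: lev_iff)

text \<open>All faces other than the four side faces of the wedge stay below height \<open>\<delta>\<close>, and the girths of the four side faces are perimeters
  of explicit triangles and quadrilaterals.  The cut edges are counted twice, as degenerate polygons.\<close>

lemma level_girth:
  assumes v: "valid s \<delta>"
  shows "(\<Sum>i\<in>I. girth (side_s s i)) = (\<Sum>i\<in>I. girth (side_s s i \<inter> {x. ht x \<le> \<delta>}))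
     + girth (cap_s s \<inter> {x. ht x = \<delta>}) + 2 * gain s \<delta>"
proof -
  note P = corner_pos[OF v]
  note D = corner_dist[OF v]
  let ?J = "{iA, iB, iC, iD}"
  let ?lo = "\<lambda>i. girth (side_s s i \<inter> {x. ht x \<le> \<delta>})"
  have other: "girth (side_s s i) = ?lo i" if i: "i \<in> I - ?J" for i
  proof -
    have "ht x \<le> \<delta>" if x: "x \<in> side_s s i" for x
    proof (rule ccontr)
      assume "\<not> ht x \<le> \<delta>"
      then have h: "c * s < ht x" using P(12) by linarith
      have "x \<in> cap_s s" and ax: "a i \<bullet> x = b i - s * max 0 (a i \<bullet> e3)"
        using x by (auto simp: side_s_def side_def cap_s_def shifted_def)
      then have xc: "x \<in> cap I a b" "x + s *\<^sub>R e3 \<in> cap I a b" using cap_s_iff[OF P(10)] by auto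
      have "0 \<le> c * s" using c_range P(10) by simp
      have pos: "d < n \<bullet> y" if "0 < ht y" for y using that top_pos by (simp add: ht_def zero_less_divide_iff)
      show False
      proof (cases "0 \<le> a i \<bullet> e3")
        case True
        have "x + s *\<^sub>R e3 = pt3 (cp x) (cq x) (cr x + s)" using pt3_eq[of x] pt3_shift by metis
        then have "ht (x + s *\<^sub>R e3) = ht x - c * s" unfolding ht_coords by (simp add: algebra_simps)
        then have "a i \<bullet> (x + s *\<^sub>R e3) < b i" using others[OF i xc(2)] pos h by simp
        then show False using ax True by (simp add: inner_add_right)
      next
        case False
        have "a i \<bullet> x < b i" using others[OF i xc(1)] pos h \<open>0 \<le> c * s\<close> by simp
        then show False using ax False by simp
      qed
    qed
    then have "side_s s i \<inter> {x. ht x \<le> \<delta>} = side_s s i" by blast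
    then show ?thesis by simp
  qed
  have split: "(\<Sum>i\<in>I. F i) = (\<Sum>i\<in>I - ?J. F i) + F iA + F iB + F iC + F iD" for F :: "'i \<Rightarrow> real"
  proof -
    have "(\<Sum>i\<in>I. F i) = (\<Sum>i\<in>I - ?J. F i) + (\<Sum>i\<in>?J. F i)"
      using idx fin by (intro sum.subset_diff) auto
    then show ?thesis using idx by (simp add: add.assoc)
  qed
  have gA: "girth (side_s s iA) = ?lo iA + (dist (VT s) (V1 s \<delta>) + dist (V1 s \<delta>) (V2 s \<delta>) + dist (V2 s \<delta>) (VT s)) - 2 * dist (V1 s \<delta>) (V2 s \<delta>)"
    using side_s_cut[OF P(10), of iA \<delta>] unfolding face_A[OF v] by (simp add: girth_triangle girth_segment)
  have gB: "girth (side_s s iB) = ?lo iB + (dist T2 (V4 \<delta>) + dist (V4 \<delta>) (V1 s \<delta>) + dist (V1 s \<delta>) (VT s) + dist (VT s) T2) - 2 * dist (V4 \<delta>) (V1 s \<delta>)"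
    using side_s_cut[OF P(10), of iB \<delta>] unfolding face_B[OF v]
    by (simp add: girth_quadrilateral[OF diagonals_cross(1)[OF v]] girth_segment)
  have gC: "girth (side_s s iC) = ?lo iC + (dist T2 (V3 \<delta>) + dist (V3 \<delta>) (V4 \<delta>) + dist (V4 \<delta>) T2) - 2 * dist (V3 \<delta>) (V4 \<delta>)"
    using side_s_cut[OF P(10), of iC \<delta>] unfolding face_C[OF v] by (simp add: girth_triangle girth_segment)
  have gD: "girth (side_s s iD) = ?lo iD + (dist T2 (V3 \<delta>) + dist (V3 \<delta>) (V2 s \<delta>) + dist (V2 s \<delta>) (VT s) + dist (VT s) T2) - 2 * dist (V3 \<delta>) (V2 s \<delta>)"
    using side_s_cut[OF P(10), of iD \<delta>] unfolding face_D[OF v]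
    by (simp add: girth_quadrilateral[OF diagonals_cross(2)[OF v]] girth_segment)
  have gS: "girth (cap_s s \<inter> {x. ht x = \<delta>}) = dist (V1 s \<delta>) (V2 s \<delta>) + dist (V2 s \<delta>) (V3 \<delta>) + dist (V3 \<delta>) (V4 \<delta>) + dist (V4 \<delta>) (V1 s \<delta>)"
    unfolding section_quadrilateral[OF v] by (rule girth_quadrilateral[OF diagonals_cross(3)[OF v]])
  have "(\<Sum>i\<in>I - ?J. girth (side_s s i)) = (\<Sum>i\<in>I - ?J. ?lo i)" by (rule sum.cong) (use other in auto)
  then show ?thesis
    unfolding split[of "\<lambda>i. girth (side_s s i)"] split[of ?lo] gA gB gC gD gS D gain_def by (simp add: algebra_simps)
qed

text \<open>The gain is an affine function of both arguments.\<close>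

lemma gain_affine: "2 * gain s \<delta> - gain s (2 * \<delta>) = gain s 0"
  by (simp add: gain_def lam_def \<rho>1_def \<rho>2_def algebra_simps)

end

context wedge_cap
begin

text \<open>The cap lies in the cone over \<open>T2\<close> that is bounded by the planes \<open>iB\<close>, \<open>iC\<close>, \<open>iD\<close>.  The parts of this cone above the
  heights \<open>0\<close> and \<open>-\<epsilon>\<close> are homothetic with ratio \<open>1 + \<epsilon>\<close>, and \<open>(1 + \<epsilon>)\<^sup>3 - 1 \<le> 7 * \<epsilon>\<close>.\<close>

lemma slab_measure:
  assumes c: "0 < c" and P: "compact P" "P \<subseteq> cap I a b" "\<And>x. x \<in> P \<Longrightarrow> ht x \<le> 0" and \<epsilon>: "0 < \<epsilon>" "\<epsilon> \<le> 1"
  shows "measure lebesgue P - measure lebesgue (P \<inter> {x. ht x \<le> - \<epsilon>})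
    \<le> 7 * \<epsilon> * \<bar>((1 / c) *\<^sub>R e3) \<bullet> cross3 e1 e2\<bar>"
proof -
  define \<Delta> :: "pt set" where "\<Delta> = {v. 0 \<le> v$1 \<and> 0 \<le> v$2 \<and> 0 \<le> v$3 \<and> v$1 + v$2 + v$3 < 1}"
  define w where "w = (1 / c) *\<^sub>R e3"
  define L where "L = (\<lambda>v :: pt. v$1 *\<^sub>R e1 + v$2 *\<^sub>R e2 + v$3 *\<^sub>R w)"
  define \<Theta> where "\<Theta> \<rho> = (\<lambda>x. \<rho> *\<^sub>R x + T2) ` L ` \<Delta>" for \<rho> :: real
  have L: "linear L"
    by (rule linearI) (simp_all add: L_def algebra_simps)
  have \<Delta>1: "\<Delta> \<subseteq> cbox 0 One"
  proof
    fix v assume v: "v \<in> \<Delta>"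
    have "0 \<le> v $ i \<and> v $ i \<le> 1" for i :: 3
      using v exhaust_3[of i] by (auto simp: \<Delta>_def)
    moreover have "\<exists>i. u = axis i 1" if "u \<in> Basis" for u :: pt using that by (auto simp: Basis_vec_def)
    ultimately show "v \<in> cbox 0 One" by (fastforce simp: mem_box inner_axis)
  qed
  have "convex \<Delta>"
  proof -
    have "\<Delta> = {v. 0 \<le> axis 1 1 \<bullet> v} \<inter> {v. 0 \<le> axis 2 1 \<bullet> v} \<inter> {v. 0 \<le> axis 3 1 \<bullet> v} \<inter> {v. (axis 1 1 + axis 2 1 + axis 3 1) \<bullet> v < 1}"
      by (auto simp: \<Delta>_def inner_axis' inner_add_left)
    moreover have "convex {v :: pt. 0 \<le> u \<bullet> v}" for u using convex_halfspace_ge[of 0 u] by simp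
    ultimately show ?thesis by (simp only:) (intro convex_Int convex_halfspace_lt)
  qed
  then have \<Delta>: "\<Delta> \<in> lmeasurable" using bounded_subset[OF bounded_cbox \<Delta>1] by (intro measurable_convex)
  have "measure lebesgue \<Delta> \<le> measure lebesgue (cbox 0 (One :: pt))"
    by (rule measure_mono_fmeasurable[OF \<Delta>1]) (use \<Delta> in auto)
  then have m\<Delta>: "measure lebesgue \<Delta> \<le> 1" by simp
  have det: "\<bar>det (matrix L)\<bar> = \<bar>w \<bullet> cross3 e1 e2\<bar>"
    by (simp add: L_def matrix_def det_3 cross3_def inner_vec_def sum_3 axis_def vector_def algebra_simps)
  have mL: "measure lebesgue (L ` \<Delta>) \<le> \<bar>w \<bullet> cross3 e1 e2\<bar>"
    unfolding measure_linear_image[OF L \<Delta>] det using m\<Delta> by (simp add: mult_left_le)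
  have m\<Theta>: "measure lebesgue (\<Theta> \<rho>) = \<rho> ^ 3 * measure lebesgue (L ` \<Delta>)" if "0 \<le> \<rho>" for \<rho>
    unfolding \<Theta>_def using measure_lebesgue_affine[of \<rho> T2 "L ` \<Delta>"] that by simp
  have lm\<Theta>: "\<Theta> \<rho> \<in> lmeasurable" for \<rho>
  proof -
    have eq: "\<Theta> \<rho> = (+) T2 ` ((*\<^sub>R) \<rho> ` (L ` \<Delta>))" by (auto simp: \<Theta>_def image_image add.commute)
    have "bounded (L ` \<Delta>)"
      by (rule bounded_linear_image) (use L bounded_subset[OF bounded_cbox \<Delta>1] in \<open>auto simp: linear_conv_bounded_linear\<close>)
    then have "bounded (\<Theta> \<rho>)" unfolding eq by (intro bounded_translation bounded_scaling)
    moreover have "convex (\<Theta> \<rho>)"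
      unfolding eq using L \<open>convex \<Delta>\<close> by (intro convex_translation convex_scaling convex_linear_image)
    ultimately show ?thesis by (intro measurable_convex)
  qed
  have mem: "x \<in> \<Theta> \<rho> \<longleftrightarrow> 0 \<le> cp x \<and> 0 \<le> cq x \<and> 0 \<le> cr x \<and> 1 - \<rho> < ht x" if \<rho>: "0 < \<rho>" for x \<rho>
  proof
    assume "x \<in> \<Theta> \<rho>"
    then obtain v where v: "v \<in> \<Delta>" "x = \<rho> *\<^sub>R L v + T2" by (auto simp: \<Theta>_def)
    have "x = pt3 (\<rho> * v$1) (\<rho> * v$2) (\<rho> * v$3 / c)"
      unfolding v(2) L_def w_def pt3_def by (simp add: algebra_simps)
    then have k: "cp x = \<rho> * v$1" "cq x = \<rho> * v$2" "cr x = \<rho> * v$3 / c" by simp_all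
    have "\<rho> * (v$1 + v$2 + v$3) < \<rho> * 1" using v(1) \<rho> by (intro mult_strict_left_mono) (auto simp: \<Delta>_def)
    then show "0 \<le> cp x \<and> 0 \<le> cq x \<and> 0 \<le> cr x \<and> 1 - \<rho> < ht x"
      unfolding ht_coords k using v(1) \<rho> c by (simp add: \<Delta>_def algebra_simps)
  next
    assume x: "0 \<le> cp x \<and> 0 \<le> cq x \<and> 0 \<le> cr x \<and> 1 - \<rho> < ht x"
    define v :: pt where "v = vector [cp x / \<rho>, cq x / \<rho>, c * cr x / \<rho>]"
    have v: "v$1 = cp x / \<rho>" "v$2 = cq x / \<rho>" "v$3 = c * cr x / \<rho>" by (simp_all add: v_def)
    have "cp x / \<rho> + cq x / \<rho> + c * cr x / \<rho> < 1"
    proof -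
      have "(cp x + cq x + c * cr x) / \<rho> < 1" using x \<rho> ht_coords[of x] by simp
      then show ?thesis by (simp add: add_divide_distrib)
    qed
    then have "v \<in> \<Delta>" using x \<rho> c by (simp add: \<Delta>_def v)
    moreover have "x = \<rho> *\<^sub>R L v + T2"
      using coords[of x] \<rho> c by (simp add: L_def w_def v algebra_simps)
    ultimately show "x \<in> \<Theta> \<rho>" by (auto simp: \<Theta>_def)
  qed
  let ?A = "P \<inter> {x. ht x \<le> - \<epsilon>}" and ?B = "P \<inter> {x. - \<epsilon> < ht x}"
  have lmP: "P \<in> lmeasurable" by (rule lmeasurable_compact[OF P(1)])
  have A_eq: "?A = P \<inter> {x. n \<bullet> x \<le> lev (- \<epsilon>)}" by (auto simp: lev_iff)
  have lmA: "?A \<in> lmeasurable" unfolding A_eq by (intro lmeasurable_compact compact_cut(1) P(1))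
  have B_eq: "?B = P - ?A" by auto
  have lmB: "?B \<in> lmeasurable" unfolding B_eq by (rule fmeasurable.Diff[OF lmP lmA])
  have mB: "measure lebesgue ?B = measure lebesgue P - measure lebesgue ?A"
    unfolding B_eq by (rule measurable_measure_Diff[OF lmP]) (use lmA in auto)
  have "measure lebesgue ?B + measure lebesgue (\<Theta> 1) = measure lebesgue (?B \<union> \<Theta> 1)"
  proof (rule measure_Union[symmetric])
    show "?B \<inter> \<Theta> 1 = {}" using mem[of 1] P(3) by force
  qed (use lmB lm\<Theta>[of 1] in \<open>auto simp: fmeasurable_def\<close>)
  also have "\<dots> \<le> measure lebesgue (\<Theta> (1 + \<epsilon>))"
  proof (rule measure_mono_fmeasurable)
    show "?B \<union> \<Theta> 1 \<subseteq> \<Theta> (1 + \<epsilon>)"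
    proof
      fix x assume "x \<in> ?B \<union> \<Theta> 1"
      then show "x \<in> \<Theta> (1 + \<epsilon>)"
      proof
        assume "x \<in> ?B"
        then show ?thesis using mem[of "1 + \<epsilon>" x] cap_ineqs[of x] P(2) \<epsilon> by auto
      next
        assume "x \<in> \<Theta> 1"
        then show ?thesis using mem[of "1 + \<epsilon>" x] mem[of 1 x] \<epsilon> by auto
      qed
    qed
    show "?B \<union> \<Theta> 1 \<in> sets lebesgue" using lmB lm\<Theta>[of 1] by auto
    show "\<Theta> (1 + \<epsilon>) \<in> lmeasurable" by (rule lm\<Theta>)
  qed
  also have "\<dots> = (1 + \<epsilon>) ^ 3 * measure lebesgue (L ` \<Delta>)" using m\<Theta> \<epsilon> by simp
  finally have "measure lebesgue ?B \<le> ((1 + \<epsilon>) ^ 3 - 1) * measure lebesgue (L ` \<Delta>)"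
    using m\<Theta>[of 1] by (simp add: algebra_simps)
  also have "\<dots> \<le> (7 * \<epsilon>) * \<bar>w \<bullet> cross3 e1 e2\<bar>"
  proof (intro mult_mono mL)
    have "\<epsilon> * \<epsilon> \<le> \<epsilon>" "\<epsilon> * (\<epsilon> * \<epsilon>) \<le> \<epsilon> * 1" using \<epsilon> by (auto intro!: mult_left_mono simp: mult_le_one mult_left_le)
    then show "(1 + \<epsilon>) ^ 3 - 1 \<le> 7 * \<epsilon>" by (simp add: power3_eq_cube algebra_simps)
  qed (use \<epsilon> in auto)
  finally show ?thesis unfolding mB w_def by simp
qed

lemma wedge_corners: "V1 0 0 = H1" "V2 0 0 = H2" "V3 0 = H3" "V4 0 = H4" "VT 0 = T1"
proof -
  have "(1 - c * \<alpha>) * cp H1 = cp H1 + c * cr H1 - c * (\<alpha> * cp H1 + cr H1)" by (simp add: algebra_simps)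
  then have "(1 - c * \<alpha>) * cp H1 = 1 - c" using H1_eqs by simp
  then have "p1 0 0 = cp H1" using denom_pos(1) by (simp add: p1_def lam_def field_simps)
  moreover from this have "r1 0 0 = cr H1" using corner_eqs(2)[of 0 0] H1_eqs(2) by simp
  ultimately show "V1 0 0 = H1" using pt3_eq[of H1] vertex_coords by (simp add: V1_def)
  have "(1 - c * \<beta>) * cq H2 = cq H2 + c * cr H2 - c * (\<beta> * cq H2 + cr H2)" by (simp add: algebra_simps)
  then have "(1 - c * \<beta>) * cq H2 = 1 - c" using H2_eqs by simp
  then have "q2 0 0 = cq H2" using denom_pos(2) by (simp add: q2_def lam_def field_simps)
  moreover from this have "r2 0 0 = cr H2" using corner_eqs(4)[of 0 0] H2_eqs(2) by simp
  ultimately show "V2 0 0 = H2" using pt3_eq[of H2] vertex_coords by (simp add: V2_def)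
  show "V3 0 = H3" "V4 0 = H4" "VT 0 = T1" by (simp_all add: V3_def V4_def VT_def pt3_def e1_def e2_def e3_def)
qed

text \<open>The derivative of the gain at the base with respect to \<open>s\<close>.\<close>

definition eta where "eta = c * (norm f1 + norm f2 - norm (f1 - f2)) + norm g1 + norm g2 - norm e3"

lemma gain_shift: "gain s 0 = gain 0 0 + s * eta"
  by (simp add: gain_def eta_def lam_def \<rho>1_def \<rho>2_def algebra_simps)

text \<open>An upper bound for twice the total edge length of the shifted cap below height \<open>\<delta>\<close>; it stays meaningful when faces
  degenerate.\<close>

definition levels where
  "levels s \<delta> = (\<Sum>i\<in>I. girth (side_s s i \<inter> {x. ht x \<le> \<delta>})) + girth (cap_s s \<inter> {x. ht x = \<delta>})"

lemma ht_convex: "ht (\<mu> *\<^sub>R x + \<nu> *\<^sub>R y) = \<mu> * ht x + \<nu> * ht y" if "\<mu> + \<nu> = 1"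
proof -
  have d: "d = \<mu> * d + \<nu> * d" using that by (metis distrib_right mult_1)
  have "n \<bullet> (\<mu> *\<^sub>R x + \<nu> *\<^sub>R y) - d = \<mu> * (n \<bullet> x - d) + \<nu> * (n \<bullet> y - d)"
    by (subst d) (simp add: inner_add_right algebra_simps)
  then show ?thesis by (simp add: ht_def add_divide_distrib)
qed

text \<open>The sets below the levels \<open>\<delta>\<close> and \<open>\<delta>'\<close> combine to a subset of the set below the combined level.\<close>

lemma levels_concave:
  assumes s: "0 \<le> s" and w: "0 \<le> \<mu>" "0 \<le> \<nu>" "\<mu> + \<nu> = 1"
    and ne: "\<And>i. i \<in> I \<Longrightarrow> side_s s i \<inter> {x. ht x \<le> \<delta>} \<noteq> {}" "\<And>i. i \<in> I \<Longrightarrow> side_s s i \<inter> {x. ht x \<le> \<delta>'} \<noteq> {}"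
      "cap_s s \<inter> {x. ht x = \<delta>} \<noteq> {}" "cap_s s \<inter> {x. ht x = \<delta>'} \<noteq> {}"
  shows "\<mu> * levels s \<delta> + \<nu> * levels s \<delta>' \<le> levels s (\<mu> * \<delta> + \<nu> * \<delta>')"
proof -
  have c1: "compact (side_s s i \<inter> {x. ht x \<le> \<delta>})" for i \<delta>
    using compact_cut(1)[OF compact_side_s[OF s], of i n "lev \<delta>"] by (simp add: lev_iff)
  have c2: "compact (cap_s s \<inter> {x. ht x = \<delta>})" for \<delta>
    using compact_cut(3)[OF compact_cap_s[OF s], of n "lev \<delta>"] by (simp add: lev_iff)
  have "\<mu> * girth (side_s s i \<inter> {x. ht x \<le> \<delta>}) + \<nu> * girth (side_s s i \<inter> {x. ht x \<le> \<delta>'})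
      \<le> girth (side_s s i \<inter> {x. ht x \<le> \<mu> * \<delta> + \<nu> * \<delta>'})" if i: "i \<in> I" for i
  proof (rule girth_concave[OF c1 c1 c1 ne(1,2)[OF i] w(1,2)])
    fix x y assume "x \<in> side_s s i \<inter> {x. ht x \<le> \<delta>}" "y \<in> side_s s i \<inter> {x. ht x \<le> \<delta>'}"
    then show "\<mu> *\<^sub>R x + \<nu> *\<^sub>R y \<in> side_s s i \<inter> {x. ht x \<le> \<mu> * \<delta> + \<nu> * \<delta>'}"
      using convexD[OF convex_side_s _ _ w, of x s i y] w by (auto simp: ht_convex[OF w(3)] intro!: add_mono mult_left_mono)
  qed
  then have "(\<Sum>i\<in>I. \<mu> * girth (side_s s i \<inter> {x. ht x \<le> \<delta>}) + \<nu> * girth (side_s s i \<inter> {x. ht x \<le> \<delta>'}))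
      \<le> (\<Sum>i\<in>I. girth (side_s s i \<inter> {x. ht x \<le> \<mu> * \<delta> + \<nu> * \<delta>'}))" by (rule sum_mono)
  moreover have "\<mu> * girth (cap_s s \<inter> {x. ht x = \<delta>}) + \<nu> * girth (cap_s s \<inter> {x. ht x = \<delta>'})
      \<le> girth (cap_s s \<inter> {x. ht x = \<mu> * \<delta> + \<nu> * \<delta>'})"
  proof (rule girth_concave[OF c2 c2 c2 ne(3,4) w(1,2)])
    fix x y assume "x \<in> cap_s s \<inter> {x. ht x = \<delta>}" "y \<in> cap_s s \<inter> {x. ht x = \<delta>'}"
    then show "\<mu> *\<^sub>R x + \<nu> *\<^sub>R y \<in> cap_s s \<inter> {x. ht x = \<mu> * \<delta> + \<nu> * \<delta>'}"
      using convexD[OF convex_cap_s _ _ w, of x s y] by (auto simp: ht_convex[OF w(3)])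
  qed
  ultimately show ?thesis by (simp add: levels_def sum.distrib sum_distrib_left distrib_left)
qed

lemma valid_0: "valid 0 0" using c_range slopes by (simp add: valid_def)

lemma eventually_valid:
  assumes "c \<le> k"
  shows "\<forall>\<^sub>F s in at_right 0. valid s (k * s)"
proof -
  have pos: "\<forall>\<^sub>F s in at_right (0 :: real). 0 < f s" if "(f \<longlongrightarrow> f 0) (at_right 0)" "0 < f 0" for f :: "real \<Rightarrow> real"
    using order_tendstoD(1)[OF that] .
  have 1: "\<forall>\<^sub>F s :: real in at_right 0. 0 < 1 - s" by (rule pos[of "\<lambda>s. 1 - s"]) (auto intro!: tendsto_eq_intros)
  have 2: "\<forall>\<^sub>F s in at_right 0. 0 < 1 - k * s" by (rule pos[of "\<lambda>s. 1 - k * s"]) (auto intro!: tendsto_eq_intros)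
  have 3: "\<forall>\<^sub>F s in at_right 0. 0 < 1 - k * s - c * (1 - s)" by (rule pos[of "\<lambda>s. 1 - k * s - c * (1 - s)"]) (use c_range in \<open>auto intro!: tendsto_eq_intros\<close>)
  have 4: "\<forall>\<^sub>F s in at_right 0. 0 < 1 - s - \<alpha> * (1 - k * s)" by (rule pos[of "\<lambda>s. 1 - s - \<alpha> * (1 - k * s)"]) (use slopes in \<open>auto intro!: tendsto_eq_intros\<close>)
  have 5: "\<forall>\<^sub>F s in at_right 0. 0 < 1 - s - \<beta> * (1 - k * s)" by (rule pos[of "\<lambda>s. 1 - s - \<beta> * (1 - k * s)"]) (use slopes in \<open>auto intro!: tendsto_eq_intros\<close>)
  have 6: "\<forall>\<^sub>F s :: real in at_right 0. 0 < s" by (rule eventually_at_right_less)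
  from 1 2 3 4 5 6 show ?thesis
  proof eventually_elim
    case (elim s)
    have "c * s \<le> k * s" using assms elim by (intro mult_right_mono) auto
    then show ?case using elim by (simp add: valid_def)
  qed
qed

lemma mem_side_s: "x \<in> side_s s i \<longleftrightarrow> x \<in> cap_s s \<and> a i \<bullet> x = b i - s * max 0 (a i \<bullet> e3)"
  by (simp add: side_s_def side_def cap_s_def shifted_def)

lemma cap_s_0: "cap_s 0 = cap I a b" "side_s 0 i = side I a b i"
proof -
  have "shifted a b e3 (- 0) = b" by (rule ext) (simp add: shifted_def)
  then show "cap_s 0 = cap I a b" "side_s 0 i = side I a b i" by (simp_all add: cap_s_def side_s_def)
qed

end

section \<open>Two variations of a minimizer\<close>

text \<open>The remaining facts about a minimizer \<open>P\<close> under a wedge: \<open>I\<close> describes all faces other than the base of the wedge, each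
  of them irredundant.\<close>

locale minimal_wedge = wedge_cap +
  fixes P :: "pt set" and e :: real
  assumes normal: "\<And>i. i \<in> I \<Longrightarrow> a i \<noteq> 0"
    and inner: "\<And>i. i \<in> I \<Longrightarrow> \<exists>x. a i \<bullet> x = b i \<and> (\<forall>j\<in>I - {i}. a j \<bullet> x < b j) \<and> n \<bullet> x < d"
    and base_inner: "\<exists>x. n \<bullet> x = d \<and> (\<forall>i\<in>I. a i \<bullet> x < b i)"
    and P: "P = cap I a b \<inter> {x. n \<bullet> x \<le> d}" and polyhedron: "convex_polyhedron P"
    and volume: "measure lebesgue P = 1"
    and minimal: "\<And>R. convex_polyhedron R \<Longrightarrow> num_faces R \<le> Suc (card I) \<Longrightarrow> melzak P \<le> melzak R"
    and edges: "e = total_edge_length P"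
      "(\<Sum>i\<in>I. girth (side I a b i \<inter> {x. n \<bullet> x \<le> d})) + girth (cap I a b \<inter> {x. n \<bullet> x = d}) = 2 * e"
begin

lemma n_nz: "n \<noteq> 0" using top base by auto

lemma e3_nz: "e3 \<noteq> 0" using dual(6) by auto

lemma n_e3: "n \<bullet> e3 \<le> 0" using top by (simp add: e3_def inner_diff_right)

lemma ht_neg: "ht x < 0 \<longleftrightarrow> n \<bullet> x < d"
  using top_pos by (auto simp: ht_def divide_less_0_iff)

lemma lev_0: "lev 0 = d" by (simp add: lev_def)

lemma eventually_near:
  assumes "u \<bullet> x < (r :: real)"
  shows "\<forall>\<^sub>F s in at_right 0. u \<bullet> (x - s *\<^sub>R z) < r \<and> u \<bullet> (x + s *\<^sub>R z) < r"
proof -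
  have "((\<lambda>s. u \<bullet> (x - s *\<^sub>R z)) \<longlongrightarrow> u \<bullet> (x - 0 *\<^sub>R z)) (at_right 0)" "((\<lambda>s. u \<bullet> (x + s *\<^sub>R z)) \<longlongrightarrow> u \<bullet> (x + 0 *\<^sub>R z)) (at_right 0)"
    by (intro tendsto_intros)+
  then show ?thesis using assms by (intro eventually_conj order_tendstoD(2)[where a = r]) auto
qed

text \<open>The face has points below the base, so that it does not disappear when the base is moved inwards a little.\<close>

lemma side_point:
  assumes i: "i \<in> I"
  shows "\<exists>x\<in>side I a b i. ht x < 0"
proof -
  obtain x where x: "a i \<bullet> x = b i" "\<And>j. j \<in> I - {i} \<Longrightarrow> a j \<bullet> x < b j" "n \<bullet> x < d" using inner[OF i] by blast
  have "a j \<bullet> x \<le> b j" if "j \<in> I" for j using x that by (cases "j = i") (auto intro: less_imp_le)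
  then have "x \<in> side I a b i" using x by (auto simp: side_def cap_def)
  then show ?thesis using ht_neg x(3) by blast
qed

text \<open>An inner point of the face is translated together with the plane; it stays below all other planes as long as \<open>s\<close> is small.\<close>

lemma eventually_side:
  assumes i: "i \<in> I"
  shows "\<forall>\<^sub>F s in at_right 0. \<exists>y\<in>side_s s i. ht y \<le> 0"
proof -
  obtain x where x: "a i \<bullet> x = b i" "\<And>j. j \<in> I - {i} \<Longrightarrow> a j \<bullet> x < b j" "n \<bullet> x < d" using inner[OF i] by blast
  have "\<forall>\<^sub>F s in at_right 0. \<forall>j\<in>I - {i}. a j \<bullet> (x - s *\<^sub>R e3) < b j \<and> a j \<bullet> (x + s *\<^sub>R e3) < b j"
    using fin x(2) by (intro eventually_ball_finite ballI eventually_near) auto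
  with eventually_near[OF x(3), of e3] eventually_at_right_less[of 0] show ?thesis
  proof eventually_elim
    case (elim s)
    \<comment> \<open>Planes whose normal makes an obtuse angle with \<open>e3\<close> do not move.\<close>
    let ?y = "if 0 \<le> a i \<bullet> e3 then x - s *\<^sub>R e3 else x"
    have xc: "a j \<bullet> x \<le> b j" if "j \<in> I" for j using x that by (cases "j = i") (auto intro: less_imp_le)
    have y: "a j \<bullet> ?y \<le> b j \<and> a j \<bullet> (?y + s *\<^sub>R e3) \<le> b j" if j: "j \<in> I" for j
    proof (cases "j = i")
      case True
      have "0 \<le> s * (a i \<bullet> e3)" if "0 \<le> a i \<bullet> e3" using that elim by simp
      moreover have "s * (a i \<bullet> e3) \<le> 0" if "\<not> 0 \<le> a i \<bullet> e3" using that elim by (simp add: mult_nonneg_nonpos)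
      ultimately show ?thesis using x(1) True by (auto simp: inner_diff_right inner_add_right)
    next
      case False
      then have "j \<in> I - {i}" using j by simp
      then show ?thesis using elim(3) xc[OF j] by (auto simp: less_imp_le)
    qed
    have "?y \<in> cap_s s" using y elim by (auto simp: cap_s_iff cap_def)
    moreover have "a i \<bullet> ?y = b i - s * max 0 (a i \<bullet> e3)" using x(1) by (auto simp: inner_diff_right max_def)
    ultimately have "?y \<in> side_s s i" by (simp add: mem_side_s)
    moreover have "ht ?y \<le> 0" using ht_neg[of ?y] elim(1) x(3) by auto
    ultimately show ?case by blast
  qed
qed

lemma eventually_base: "\<forall>\<^sub>F s in at_right 0. cap_s s \<inter> {x. ht x = 0} \<noteq> {}"
proof -
  obtain x where x: "n \<bullet> x = d" "\<And>i. i \<in> I \<Longrightarrow> a i \<bullet> x < b i" using base_inner by blast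
  have "\<forall>\<^sub>F s in at_right 0. \<forall>j\<in>I. a j \<bullet> (x - s *\<^sub>R e3) < b j \<and> a j \<bullet> (x + s *\<^sub>R e3) < b j"
    using fin x(2) by (intro eventually_ball_finite ballI eventually_near) auto
  with eventually_at_right_less[of 0] show ?thesis
  proof eventually_elim
    case (elim s)
    have "x \<in> cap_s s" using elim x(2) by (auto simp: cap_s_iff cap_def less_imp_le)
    moreover have "ht x = 0" using x(1) by (simp add: ht_def)
    ultimately show ?case by blast
  qed
qed

lemma levels_0: "levels s 0 = (\<Sum>i\<in>I. girth (side_s s i \<inter> {x. n \<bullet> x \<le> d})) + girth (cap_s s \<inter> {x. n \<bullet> x = d})"
  unfolding levels_def using lev_iff[of _ 0] by (simp add: lev_0)

lemma side_girth_gain: "side_girth I a b = 2 * (e + gain 0 0)"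
  using level_girth[OF valid_0] levels_0[of 0] edges by (simp add: levels_def cap_s_0 side_girth_def)

text \<open>The base itself may be too low to be a valid level after the shift.  Concavity in the level at \<open>0\<close>, \<open>c * s\<close> and
  \<open>2 * c * s\<close> transfers the gain, which is affine, from the two valid levels to the base.\<close>

lemma eventually_gain:
  "\<forall>\<^sub>F s in at_right 0. (\<forall>i\<in>I. side_s s i \<noteq> {}) \<and>
    (convex_polyhedron (cap_s s \<inter> {x. n \<bullet> x \<le> d}) \<longrightarrow>
       2 * (total_edge_length (cap_s s \<inter> {x. n \<bullet> x \<le> d}) + gain 0 0 + s * eta) \<le> (\<Sum>i\<in>I. girth (side_s s i)))"
proof -
  have c2: "c \<le> 2 * c" using c_range by simp
  have "\<forall>\<^sub>F s in at_right 0. \<forall>i\<in>I. \<exists>y\<in>side_s s i. ht y \<le> 0"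
    using fin eventually_side by (intro eventually_ball_finite) auto
  with eventually_base eventually_valid[OF order_refl] eventually_valid[OF c2] eventually_at_right_less[of 0]
  show ?thesis
  proof eventually_elim
    case (elim s)
    have cs: "0 \<le> c * s" "0 \<le> 2 * c * s" using c_range elim by simp_all
    have ne: "side_s s i \<inter> {x. ht x \<le> \<delta>} \<noteq> {}" if "i \<in> I" "0 \<le> \<delta>" for i \<delta>
      using elim(5) that by fastforce
    have ne2: "cap_s s \<inter> {x. ht x = 2 * c * s} \<noteq> {}" using corner_mem(3)[OF elim(3)] corner_ht(3) by blast
    have "(1/2) * levels s 0 + (1/2) * levels s (2 * c * s) \<le> levels s ((1/2) * 0 + (1/2) * (2 * c * s))"
      by (rule levels_concave) (use ne[OF _ cs(2)] ne[OF _ order_refl] elim(1,4) ne2 in auto)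
    then have conc: "levels s 0 + levels s (2 * c * s) \<le> 2 * levels s (c * s)" by simp
    have "(\<Sum>i\<in>I. girth (side_s s i)) = levels s (c * s) + 2 * gain s (c * s)"
      "(\<Sum>i\<in>I. girth (side_s s i)) = levels s (2 * c * s) + 2 * gain s (2 * c * s)"
      using level_girth[OF elim(2)] level_girth[OF elim(3)] by (simp_all add: levels_def)
    moreover have "2 * gain s (c * s) - gain s (2 * c * s) = gain s 0" using gain_affine[of s "c * s"] by (simp add: mult.assoc)
    ultimately have lo: "levels s 0 + 2 * gain s 0 \<le> (\<Sum>i\<in>I. girth (side_s s i))" using conc by linarith
    have "2 * total_edge_length (cap_s s \<inter> {x. n \<bullet> x \<le> d}) \<le> levels s 0"
      if R: "convex_polyhedron (cap_s s \<inter> {x. n \<bullet> x \<le> d})"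
      unfolding levels_0 unfolding cap_s_def side_s_def
    proof (rule cap_cut_by_plane(2)[OF fin normal n_nz R[unfolded cap_s_def]])
      show "side I a (shifted a b e3 (- s)) i \<inter> {x. n \<bullet> x \<le> d} \<noteq> {}" if "i \<in> I" for i
        using ne[OF that, of 0] lev_iff(1)[of _ 0] by (simp add: side_s_def lev_0)
      show "cap I a (shifted a b e3 (- s)) \<inter> {x. n \<bullet> x = d} \<noteq> {}"
        using elim(1) lev_iff(3)[of _ 0] by (simp add: cap_s_def lev_0)
    qed
    then show ?case using lo gain_shift[of s] ne[of _ 0] by auto
  qed
qed

lemma wedge_variation:
  assumes "P \<subseteq> cball p D" "0 < t"
  shows "t * eta - 8 * e * (measure lebesgue (cball p (D + 1)))\<^sup>2 * (t * norm e3)\<^sup>2 \<le> gain 0 0"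
proof (rule variation_inequality[OF fin normal bd P polyhedron n_nz n_e3 e3_nz volume minimal edges(1) _ side_girth_gain _ assms])
  show "side I a b i \<noteq> {}" if "i \<in> I" for i using side_point[OF that] by blast
  show "\<forall>\<^sub>F s in at_right 0. (\<forall>i\<in>I. side I a (shifted a b e3 (- s)) i \<noteq> {}) \<and>
        (convex_polyhedron (cap I a (shifted a b e3 (- s)) \<inter> {x. n \<bullet> x \<le> d}) \<longrightarrow>
        2 * (total_edge_length (cap I a (shifted a b e3 (- s)) \<inter> {x. n \<bullet> x \<le> d}) + gain 0 0 + s * eta)
          \<le> side_girth I a (shifted a b e3 (- s)))"
    using eventually_gain unfolding cap_s_def side_s_def side_girth_def by eventually_elim auto
qed

lemma edge_cube_le:
  assumes R: "convex_polyhedron R" "num_faces R \<le> Suc (card I)"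
  shows "e ^ 3 * measure lebesgue R \<le> total_edge_length R ^ 3" "0 \<le> total_edge_length R"
proof -
  have "e ^ 3 \<le> total_edge_length R ^ 3 / measure lebesgue R"
    using minimal[OF R] volume by (simp add: melzak_def edges(1))
  then show "e ^ 3 * measure lebesgue R \<le> total_edge_length R ^ 3"
    using measure_polyhedron_pos[OF R(1)] by (simp add: pos_le_divide_eq)
  obtain x where "x \<in> R" using convex_polyhedronD(9)[OF R(1)] by blast
  then show "0 \<le> total_edge_length R" using diameter_le_total_edge_length[OF R(1), of x x] by simp
qed

lemma e_nonneg: "0 \<le> e"
proof -
  obtain x where "x \<in> P" using convex_polyhedronD(9)[OF polyhedron] by blast
  then show ?thesis using diameter_le_total_edge_length[OF polyhedron, of x x] edges(1) by simp
qed

text \<open>Dropping the base yields a polyhedron with fewer faces and larger volume, which cannot have smaller total edge length.\<close>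

lemma gain_nonneg: "0 \<le> gain 0 0"
proof -
  let ?C = "cap I a b"
  have "interior ?C \<noteq> {}"
    using convex_polyhedronD(8)[OF polyhedron] interior_mono[of P ?C] P by blast
  then have C: "convex_polyhedron ?C"
    by (intro convex_polyhedron_halfspaces[OF fin _ bd]) (simp_all add: cap_def)
  have nf: "num_faces ?C \<le> Suc (card I)" using num_faces_halfspaces[OF fin cap_def normal C] by simp
  have "side I a b i \<noteq> {}" if "i \<in> I" for i using side_point[OF that] by blast
  then have "2 * total_edge_length ?C \<le> side_girth I a b"
    using girth_sum_le[OF fin cap_def normal C] by (simp add: side_girth_def side_def)
  moreover have "e \<le> total_edge_length ?C"
  proof -
    have "1 \<le> measure lebesgue ?C"
      unfolding volume[symmetric] by (rule measure_mono_fmeasurable)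
        (use P lmeasurable_compact[OF convex_polyhedronD(4)[OF polyhedron]] lmeasurable_compact[OF compact_cap[OF bd]] in auto)
    then have "e ^ 3 * 1 \<le> e ^ 3 * measure lebesgue ?C" using e_nonneg by (intro mult_left_mono) auto
    then have "e ^ 3 \<le> total_edge_length ?C ^ 3" using edge_cube_le(1)[OF C nf] by simp
    then show ?thesis using edge_cube_le(2)[OF C nf] e_nonneg by (simp add: power_mono_iff)
  qed
  ultimately show ?thesis using side_girth_gain by simp
qed

text \<open>Moving the base face inwards: by concavity in the level, what is gained when the face is moved out to the
  top of the wedge is paid for, in proportion, when it is moved in; there only the small volume of a slab is lost.\<close>

lemma gain_le_volume:
  assumes c: "0 < c"
  shows "gain 0 0 \<le> 7 * e * \<bar>((1 / c) *\<^sub>R e3) \<bullet> cross3 e1 e2\<bar>"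
proof -
  let ?W = "\<bar>((1 / c) *\<^sub>R e3) \<bullet> cross3 e1 e2\<bar>"
  obtain z where z: "z \<in> interior P" using convex_polyhedronD(8)[OF polyhedron] by blast
  have zP: "z \<in> P" using z interior_subset[of P] by blast
  have zc: "z \<in> cap I a b" using zP P by blast
  have zd: "n \<bullet> z < d" by (rule interior_strict[OF z _ n_nz]) (use P in auto)
  have small: "\<forall>\<^sub>F \<epsilon> in at_right 0. \<epsilon> < r" if "0 < r" for r :: real
    using that by (auto simp: eventually_at_right)
  have "\<forall>\<^sub>F \<epsilon> in at_right 0. \<forall>i\<in>I. \<exists>x\<in>side I a b i. ht x \<le> - \<epsilon>"
  proof (intro eventually_ball_finite fin ballI)
    fix i assume "i \<in> I"
    then obtain x where x: "x \<in> side I a b i" "0 < - ht x" using side_point by fastforce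
    from small[OF x(2)] show "\<forall>\<^sub>F \<epsilon> in at_right 0. \<exists>x\<in>side I a b i. ht x \<le> - \<epsilon>"
      by eventually_elim (use x(1) in force)
  qed
  moreover have "\<forall>\<^sub>F \<epsilon> in at_right 0. \<epsilon> < - ht z" by (rule small) (use zd ht_neg in force)
  moreover have "\<forall>\<^sub>F \<epsilon> :: real in at_right 0. \<epsilon> < 1" by (rule small) simp
  moreover have "\<forall>\<^sub>F \<epsilon> :: real in at_right 0. \<epsilon> < 1 / (14 * (?W + 1))"
    by (rule small, rule divide_pos_pos, simp, rule mult_pos_pos, simp, rule add_nonneg_pos) simp_all
  moreover have "\<forall>\<^sub>F \<epsilon> :: real in at_right 0. 0 < \<epsilon>" by (rule eventually_at_right_less)
  ultimately have "\<forall>\<^sub>F \<epsilon> in at_right 0. (\<forall>i\<in>I. \<exists>x\<in>side I a b i. ht x \<le> - \<epsilon>) \<and> \<epsilon> < - ht z \<and> \<epsilon> < 1 \<and>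
     \<epsilon> < 1 / (14 * (?W + 1)) \<and> 0 < \<epsilon>" by eventually_elim blast
  then obtain \<epsilon> where eps: "\<And>i. i \<in> I \<Longrightarrow> \<exists>x\<in>side I a b i. ht x \<le> - \<epsilon>" "\<epsilon> < - ht z" "\<epsilon> < 1"
     "\<epsilon> < 1 / (14 * (?W + 1))" "0 < \<epsilon>"
    using eventually_happens'[OF trivial_limit_at_right_real] by blast
  let ?R = "cap I a b \<inter> {x. n \<bullet> x \<le> lev (- \<epsilon>)}"
  have lev: "lev (- \<epsilon>) < d" using top_pos eps(5) by (simp add: lev_def)
  have R_eq: "?R = P \<inter> {x. ht x \<le> - \<epsilon>}" using lev by (auto simp: P lev_iff[symmetric])
  have "z \<in> interior P \<inter> {x. n \<bullet> x < lev (- \<epsilon>)}"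
    using z eps(2) lev_iff(2)[of "- \<epsilon>" z] by (auto simp: not_le[symmetric])
  moreover have "interior P \<inter> {x. n \<bullet> x < lev (- \<epsilon>)} \<subseteq> interior ?R"
  proof (rule interior_maximal)
    show "interior P \<inter> {x. n \<bullet> x < lev (- \<epsilon>)} \<subseteq> ?R" using interior_subset[of P] P by auto
  qed (intro open_Int open_interior open_halfspace_lt)
  ultimately have "interior ?R \<noteq> {}" by blast
  moreover have "bounded ?R" using bounded_subset[OF bd, of ?R] by blast
  moreover have "finite (insert None (Some ` I))" using fin by simp
  moreover have "?R = {x. \<forall>j\<in>insert None (Some ` I). (case j of None \<Rightarrow> n | Some i \<Rightarrow> a i) \<bullet> x \<le> (case j of None \<Rightarrow> lev (- \<epsilon>) | Some i \<Rightarrow> b i)}"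
    by (auto simp: cap_def)
  ultimately have R: "convex_polyhedron ?R"
    using convex_polyhedron_halfspaces[of "insert None (Some ` I)" ?R "\<lambda>j. case j of None \<Rightarrow> n | Some i \<Rightarrow> a i" "\<lambda>j. case j of None \<Rightarrow> lev (- \<epsilon>) | Some i \<Rightarrow> b i"]
    by blast
  have nf: "num_faces ?R \<le> Suc (card I)" by (rule cap_cut_by_plane(1)[OF fin normal n_nz R])
  have sec: "cap_s 0 \<inter> {x. ht x = - \<epsilon>} \<noteq> {}"
  proof -
    define w where "w = - \<epsilon> / ht z"
    have hz: "ht z < 0" using zd ht_neg by blast
    have w: "0 \<le> w" "w \<le> 1" "w * ht z = - \<epsilon>" using hz eps by (simp_all add: w_def divide_simps)
    have "(1 - w) *\<^sub>R H1 + w *\<^sub>R z \<in> cap I a b"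
      using convexD[OF convex_cap in_cap(1) zc, of "1 - w" w] w by simp
    moreover have "ht ((1 - w) *\<^sub>R H1 + w *\<^sub>R z) = - \<epsilon>"
      using ht_convex[of "1 - w" w H1 z] w vertex_coords by simp
    ultimately show ?thesis by (auto simp: cap_s_0)
  qed
  have low: "2 * total_edge_length ?R \<le> levels 0 (- \<epsilon>)"
    unfolding levels_def cap_s_0 lev_iff[symmetric]
    by (rule cap_cut_by_plane(2)[OF fin normal n_nz R]) (use eps(1) sec in \<open>auto simp: lev_iff cap_s_0\<close>)
  have ht1: "ht x \<le> 1" if "x \<in> cap I a b" for x
    using cap_ineqs[OF that] mult_nonneg_nonneg[OF c_range(1), of "cr x"] by (simp add: ht_coords)
  have T2: "T2 \<in> cap_s 0 \<inter> {x. ht x = 1}" using in_cap corner_ht by (simp add: cap_s_0)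
  have high: "side_girth I a b \<le> levels 0 1"
  proof -
    have "side I a b i \<inter> {x. ht x \<le> 1} = side I a b i" for i using ht1 by (auto simp: side_def)
    moreover have "0 \<le> girth (cap_s 0 \<inter> {x. ht x = 1})"
      using girth_nonneg[of "cap_s 0 \<inter> {x. ht x = 1}"] T2 compact_cut(3)[OF compact_cap_s[of 0], of n "lev 1"] by (auto simp: lev_iff)
    ultimately show ?thesis by (simp add: levels_def cap_s_0 side_girth_def)
  qed
  \<comment> \<open>Height \<open>0\<close> is the mean of \<open>-\<epsilon>\<close> and \<open>1\<close>, the height of \<open>T2\<close>, with these weights.\<close>
  have "(1 / (1 + \<epsilon>)) * levels 0 (- \<epsilon>) + (\<epsilon> / (1 + \<epsilon>)) * levels 0 1
      \<le> levels 0 ((1 / (1 + \<epsilon>)) * (- \<epsilon>) + (\<epsilon> / (1 + \<epsilon>)) * 1)"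
  proof (rule levels_concave)
    show "1 / (1 + \<epsilon>) + \<epsilon> / (1 + \<epsilon>) = 1" using eps(5) by (simp add: add_divide_distrib[symmetric])
    show "side_s 0 i \<inter> {x. ht x \<le> - \<epsilon>} \<noteq> {}" if "i \<in> I" for i using eps(1)[OF that] by (auto simp: cap_s_0)
    show "side_s 0 i \<inter> {x. ht x \<le> 1} \<noteq> {}" if "i \<in> I" for i using eps(1)[OF that] eps(5) by (force simp: cap_s_0)
  qed (use eps sec T2 in auto)
  also have "(1 / (1 + \<epsilon>)) * (- \<epsilon>) + (\<epsilon> / (1 + \<epsilon>)) * 1 = 0" by simp
  also have "levels 0 0 = 2 * e" using levels_0[of 0] edges(2) by (simp add: cap_s_0)
  finally have "(levels 0 (- \<epsilon>) + \<epsilon> * levels 0 1) / (1 + \<epsilon>) \<le> 2 * e" by (simp add: add_divide_distrib)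
  then have "levels 0 (- \<epsilon>) + \<epsilon> * levels 0 1 \<le> 2 * e * (1 + \<epsilon>)" using eps(5) by (simp add: pos_divide_le_eq)
  moreover have "\<epsilon> * (2 * (e + gain 0 0)) \<le> \<epsilon> * levels 0 1"
    using high side_girth_gain eps(5) by (intro mult_left_mono) auto
  ultimately have main: "\<epsilon> * gain 0 0 \<le> e - total_edge_length ?R" using low by (simp add: algebra_simps)
  define y where "y = 1 - measure lebesgue ?R"
  have "measure lebesgue P - measure lebesgue (P \<inter> {x. ht x \<le> - \<epsilon>}) \<le> 7 * \<epsilon> * ?W"
    by (rule slab_measure[OF c convex_polyhedronD(4)[OF polyhedron]]) (use P eps lev_iff(1)[of _ 0] in \<open>auto simp: lev_0\<close>)
  then have "y \<le> 7 * \<epsilon> * ?W" unfolding R_eq[symmetric] volume y_def .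
  moreover have "7 * \<epsilon> * ?W \<le> 1/2"
  proof -
    have "0 < 14 * (?W + 1)" by (rule mult_pos_pos, simp, rule add_nonneg_pos) simp_all
    then have "\<epsilon> * (14 * (?W + 1)) < 1" using eps(4) by (simp only: pos_less_divide_eq)
    moreover have "\<epsilon> * (14 * (?W + 1)) = 2 * (7 * \<epsilon> * ?W) + 14 * \<epsilon>" by (simp add: algebra_simps)
    ultimately show ?thesis using eps(5) by linarith
  qed
  moreover have "0 \<le> y"
  proof -
    have "measure lebesgue ?R \<le> measure lebesgue P"
      by (rule measure_mono_fmeasurable) (use R_eq lmeasurable_compact[OF convex_polyhedronD(4)[OF polyhedron]]
          lmeasurable_compact[OF convex_polyhedronD(4)[OF R]] in auto)
    then show ?thesis using volume by (simp add: y_def)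
  qed
  ultimately have y: "0 \<le> y" "y \<le> 1/2" "y \<le> 7 * \<epsilon> * ?W" by auto
  have "e * (1 - y / 3 - y\<^sup>2) \<le> total_edge_length ?R"
    by (rule cube_root_lower'[OF e_nonneg edge_cube_le(2)[OF R nf] y(1,2)]) (use edge_cube_le(1)[OF R nf] in \<open>simp add: y_def\<close>)
  moreover have "e * (1 - y) \<le> e * (1 - y / 3 - y\<^sup>2)"
  proof (rule mult_left_mono[OF _ e_nonneg])
    have "y * y \<le> (1/2) * y" using y by (intro mult_right_mono)
    then show "1 - y \<le> 1 - y / 3 - y\<^sup>2" using y by (simp add: power2_eq_square)
  qed
  ultimately have "\<epsilon> * gain 0 0 \<le> e * y" using main by (simp add: algebra_simps)
  also have "\<dots> \<le> e * (7 * \<epsilon> * ?W)" using y e_nonneg by (intro mult_left_mono) auto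
  also have "\<dots> = \<epsilon> * (7 * e * ?W)" by simp
  finally show ?thesis using eps(5) by (simp only: mult_le_cancel_left_pos)
qed

end

section \<open>Metric inequalities\<close>

text \<open>The triangle inequality after inversion of the three points in the unit sphere.\<close>

lemma ptolemy_origin:
  fixes x y z :: "'a :: real_inner"
  shows "norm (x - z) * norm y \<le> norm (x - y) * norm z + norm (y - z) * norm x"
proof (cases "x = 0 \<or> y = 0 \<or> z = 0")
  case True
  then show ?thesis by (auto simp: mult.commute norm_minus_commute)
next
  case False
  define inv where "inv u = (1 / (norm u)\<^sup>2) *\<^sub>R u" for u :: 'a
  have d: "norm (inv u - inv v) = norm (u - v) / (norm u * norm v)" if "u \<noteq> 0" "v \<noteq> 0" for u v
  proof (rule power2_eq_imp_eq)
    have "u \<bullet> u > 0" "v \<bullet> v > 0" using that by auto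
    then show "(norm (inv u - inv v))\<^sup>2 = (norm (u - v) / (norm u * norm v))\<^sup>2"
      unfolding inv_def power_divide power_mult_distrib power2_norm_eq_inner
      by (simp add: inner_diff_left inner_diff_right inner_commute divide_simps power2_eq_square)
  qed auto
  have "norm (inv x - inv z) \<le> norm (inv x - inv y) + norm (inv y - inv z)"
    using norm_triangle_ineq[of "inv x - inv y" "inv y - inv z"] by simp
  then have "norm (x - z) / (norm x * norm z) \<le> norm (x - y) / (norm x * norm y) + norm (y - z) / (norm y * norm z)"
    using d False by auto
  then have "(norm x * norm y * norm z) * (norm (x - z) / (norm x * norm z))
      \<le> (norm x * norm y * norm z) * (norm (x - y) / (norm x * norm y) + norm (y - z) / (norm y * norm z))"
    by (intro mult_left_mono) auto
  then show ?thesis using False by (simp add: distrib_left mult.commute mult.left_commute)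
qed

text \<open>Euler's inequality bounds the sum of the squares of the diagonals, Ptolemy's inequality their product.  Together they bound the
  square of the sum by \<open>X\<^sup>2 + Y\<^sup>2\<close>, where \<open>X\<close> and \<open>Y\<close> are the sums of opposite sides.\<close>

lemma diagonals_le:
  fixes a b c d :: "'a :: real_inner"
  shows "dist a c + dist b d + min (dist a b + dist c d) (dist b c + dist d a) / 2
     \<le> dist a b + dist b c + dist c d + dist d a"
proof -
  define X Y where "X = dist a b + dist c d" and "Y = dist b c + dist d a"
  have XY: "0 \<le> X" "0 \<le> Y" by (simp_all add: X_def Y_def)
  have pt: "dist a c * dist b d \<le> dist a b * dist c d + dist b c * dist d a"
    using ptolemy_origin[of "a - d" "c - d" "b - d"] by (simp add: dist_norm norm_minus_commute)
  have "(dist a b)\<^sup>2 + (dist b c)\<^sup>2 + (dist c d)\<^sup>2 + (dist d a)\<^sup>2 - (dist a c)\<^sup>2 - (dist b d)\<^sup>2 = (norm (a - b + c - d))\<^sup>2"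
    unfolding dist_norm power2_norm_eq_inner
    by (simp add: inner_diff_left inner_diff_right inner_add_left inner_add_right inner_commute)
  then have eu: "(dist a c)\<^sup>2 + (dist b d)\<^sup>2 \<le> (dist a b)\<^sup>2 + (dist b c)\<^sup>2 + (dist c d)\<^sup>2 + (dist d a)\<^sup>2"
    using zero_le_power2[of "norm (a - b + c - d)"] by linarith
  have "(dist a c + dist b d)\<^sup>2 \<le> X\<^sup>2 + Y\<^sup>2"
    using pt eu by (simp add: X_def Y_def power2_sum)
  also have "\<dots> = (max X Y)\<^sup>2 + (min X Y)\<^sup>2" by (auto simp: max_def min_def)
  also have "\<dots> \<le> (max X Y + min X Y / 2)\<^sup>2"
  proof -
    have "p\<^sup>2 + q\<^sup>2 \<le> (p + q / 2)\<^sup>2" if "0 \<le> q" "q \<le> p" for p q :: real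
    proof -
      have "q\<^sup>2 \<le> p * q" using that unfolding power2_eq_square by (intro mult_right_mono) auto
      moreover have "(p + q / 2)\<^sup>2 = p\<^sup>2 + p * q + q\<^sup>2 / 4" by (simp add: power2_eq_square algebra_simps)
      ultimately show ?thesis using zero_le_power2[of q] by linarith
    qed
    from this[of "min X Y" "max X Y"] show ?thesis using XY by (auto simp: min_def max_def)
  qed
  finally have "dist a c + dist b d \<le> max X Y + min X Y / 2" by (rule power2_le_imp_le) (use XY in auto)
  moreover have "max X Y + min X Y = X + Y" by (auto simp: max_def min_def)
  ultimately show ?thesis unfolding X_def[symmetric] Y_def[symmetric] using X_def Y_def by linarith
qed

text \<open>Each distance from \<open>f\<close> to a vertex is at most the combination of the two sides at this vertex with the weights of their other
  ends.  In the sum every side misses the weight of the opposite vertex.\<close>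

lemma triangle_foot:
  fixes A B C f :: "'a :: real_normed_vector"
  assumes w: "0 \<le> u" "0 \<le> v" "0 \<le> w" "u + v + w = 1" and f: "f = u *\<^sub>R A + v *\<^sub>R B + w *\<^sub>R C"
    and s: "\<sigma> \<le> dist A B" "\<sigma> \<le> dist B C" "\<sigma> \<le> dist C A"
  shows "dist f A + dist f B + dist f C + \<sigma> \<le> dist A B + dist B C + dist C A"
proof -
  have u: "u = 1 - v - w" using w by simp
  have v: "v = 1 - u - w" using w by simp
  have w': "w = 1 - u - v" using w by simp
  have n: "norm (s *\<^sub>R x + t *\<^sub>R y) \<le> s * norm x + t * norm y" if "0 \<le> s" "0 \<le> t" for s t and x y :: 'a
    using norm_triangle_ineq[of "s *\<^sub>R x" "t *\<^sub>R y"] that by simp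
  have "f - A = v *\<^sub>R (B - A) + w *\<^sub>R (C - A)" unfolding f by (subst u) (simp add: algebra_simps)
  then have 1: "dist f A \<le> v * dist A B + w * dist C A"
    using n[OF w(2,3), of "B - A" "C - A"] by (simp add: dist_norm norm_minus_commute)
  have "f - B = u *\<^sub>R (A - B) + w *\<^sub>R (C - B)" unfolding f by (subst v) (simp add: algebra_simps)
  then have 2: "dist f B \<le> u * dist A B + w * dist B C"
    using n[OF w(1,3), of "A - B" "C - B"] by (simp add: dist_norm norm_minus_commute)
  have "f - C = u *\<^sub>R (A - C) + v *\<^sub>R (B - C)" unfolding f by (subst w') (simp add: algebra_simps)
  then have 3: "dist f C \<le> u * dist C A + v * dist B C"
    using n[OF w(1,2), of "A - C" "B - C"] by (simp add: dist_norm norm_minus_commute)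
  have "\<sigma> = w * \<sigma> + u * \<sigma> + v * \<sigma>" using w(4) by (metis add.commute add.assoc distrib_right mult_1)
  also have "\<dots> \<le> w * dist A B + u * dist B C + v * dist C A"
    using w s by (intro add_mono mult_left_mono) auto
  finally have 4: "\<sigma> \<le> w * dist A B + u * dist B C + v * dist C A" .
  have "(u + v + w) * (dist A B + dist B C + dist C A) = dist A B + dist B C + dist C A" using w by simp
  then show ?thesis using 1 2 3 4 by (simp add: algebra_simps)
qed

lemma norm_cross_le: "norm (cross3 x y) \<le> norm x * norm y"
proof (rule power2_le_imp_le)
  show "(norm (cross3 x y))\<^sup>2 \<le> (norm x * norm y)\<^sup>2"
    using norm_cross[of x y] by (simp add: power_mult_distrib)
qed simp

text \<open>Replacing the apex by a point \<open>f\<close> in the plane of the base triangle shows that the triple product is bounded by the height times the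
  norm of a cross product, which can be formed at any vertex of the triangle.\<close>

lemma tetrahedron_bound:
  fixes A B C T f :: pt
  assumes w: "u + v + w = 1" and f: "f = u *\<^sub>R A + v *\<^sub>R B + w *\<^sub>R C"
    and s: "\<sigma> \<in> {dist A B, dist B C, dist C A}" and L: "dist A B \<le> \<Lambda>" "dist B C \<le> \<Lambda>" "dist C A \<le> \<Lambda>"
  shows "\<bar>(A - T) \<bullet> cross3 (B - T) (C - T)\<bar> \<le> dist T f * \<sigma> * \<Lambda>"
proof -
  define X where "X = cross3 (B - A) (C - A)"
  have X: "X = cross3 (C - B) (A - B)" "X = cross3 (A - C) (B - C)" by (simp_all add: X_def cross3_simps)
  have L0: "0 \<le> \<Lambda>" using L(1) zero_le_dist[of A B] by linarith
  have bound: "norm X \<le> \<sigma> * \<Lambda>"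
  proof -
    consider "\<sigma> = dist A B" | "\<sigma> = dist B C" | "\<sigma> = dist C A" using s by blast
    then show ?thesis
    proof cases
      case 1
      have "norm X \<le> norm (B - A) * norm (C - A)" unfolding X_def by (rule norm_cross_le)
      also have "\<dots> \<le> norm (B - A) * \<Lambda>" using L by (intro mult_left_mono) (auto simp: dist_norm)
      finally show ?thesis using 1 by (simp add: dist_norm norm_minus_commute)
    next
      case 2
      have "norm X \<le> norm (C - B) * norm (A - B)" unfolding X(1) by (rule norm_cross_le)
      also have "\<dots> \<le> norm (C - B) * \<Lambda>" using L by (intro mult_left_mono) (auto simp: dist_norm)
      finally show ?thesis using 2 by (simp add: dist_norm norm_minus_commute)
    next
      case 3
      have "norm X \<le> norm (A - C) * norm (B - C)" unfolding X(2) by (rule norm_cross_le)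
      also have "\<dots> \<le> norm (A - C) * \<Lambda>" using L by (intro mult_left_mono) (auto simp: dist_norm)
      finally show ?thesis using 3 by (simp add: dist_norm norm_minus_commute)
    qed
  qed
  have u: "u = 1 - v - w" using w by simp
  have fA: "f - A = v *\<^sub>R (B - A) + w *\<^sub>R (C - A)" unfolding f by (subst u) (simp add: algebra_simps)
  have "(f - A) \<bullet> X = 0" unfolding fA X_def by (simp add: inner_add_left dot_cross_self)
  moreover have "(A - T) \<bullet> cross3 (B - T) (C - T) = (A - T) \<bullet> X" by (simp add: X_def cross3_simps)
  ultimately have "(A - T) \<bullet> cross3 (B - T) (C - T) = (f - T) \<bullet> X" by (simp add: inner_diff_left)
  then have "\<bar>(A - T) \<bullet> cross3 (B - T) (C - T)\<bar> \<le> norm (f - T) * norm X" using Cauchy_Schwarz_ineq2 by metis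
  also have "\<dots> \<le> norm (f - T) * (\<sigma> * \<Lambda>)" using bound by (rule mult_left_mono) simp
  finally show ?thesis by (simp add: dist_norm norm_minus_commute mult.assoc)
qed

text \<open>There are no four nonzero pairwise orthogonal vectors in three dimensions.\<close>

lemma orthogonal_to_three:
  fixes z :: pt
  assumes "x \<noteq> 0" "y \<noteq> 0" "w \<noteq> 0" "x \<bullet> y = 0" "x \<bullet> w = 0" "y \<bullet> w = 0" "z \<bullet> x = 0" "z \<bullet> y = 0" "z \<bullet> w = 0"
  shows "z = 0"
proof (rule ccontr)
  assume z: "z \<noteq> 0"
  have ne: "x \<noteq> y" "x \<noteq> w" "y \<noteq> w" "z \<noteq> x" "z \<noteq> y" "z \<noteq> w" using assms z by auto
  have "pairwise orthogonal {x, y, w, z}"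
    using assms by (auto simp: pairwise_def orthogonal_def inner_commute)
  then have "independent {x, y, w, z}" using assms z by (intro pairwise_orthogonal_independent) auto
  then have "card {x, y, w, z} \<le> DIM(pt)" by (rule independent_card_le)
  then show False using ne by simp
qed

lemma acute_vec_angle: "vec_angle u w < pi / 2 \<Longrightarrow> 0 < u \<bullet> w"
proof (rule ccontr)
  assume a: "vec_angle u w < pi / 2" and "\<not> 0 < u \<bullet> w"
  then have le: "u \<bullet> w / (norm u * norm w) \<le> 0" by (simp add: divide_nonpos_nonneg)
  have "- (norm u * norm w) \<le> u \<bullet> w" using Cauchy_Schwarz_ineq2[of u w] by linarith
  then have ge: "- 1 \<le> u \<bullet> w / (norm u * norm w)"
    by (cases "norm u * norm w = 0") (auto simp: divide_simps zero_less_mult_iff)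
  have "arccos 0 \<le> arccos (u \<bullet> w / (norm u * norm w))"
    using arccos_le_arccos[OF ge le] by simp
  then show False using a by (simp add: vec_angle_def)
qed

text \<open>Orthogonally to the edge, \<open>n\<close> and the component \<open>u\<close> of \<open>C - A\<close> are orthogonal, and so are \<open>a\<close> and the component \<open>w\<close> of \<open>D - A\<close>.  Expanding
  \<open>0 = a \<bullet> w\<close> in the orthogonal vectors \<open>u\<close> and \<open>n\<close> relates the sign of \<open>a \<bullet> n\<close> to that of \<open>u \<bullet> w\<close>, which is positive for an
  acute angle.\<close>

lemma acute_dihedral_normal:
  assumes acute: "dihedral_angle A B C D < pi / 2" and AB: "A \<noteq> B"
    and n: "n \<bullet> A = d" "n \<bullet> B = d" "n \<bullet> C = d" "d < n \<bullet> D"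
    and a: "a \<bullet> A = b" "a \<bullet> B = b" "a \<bullet> D = b" "a \<bullet> C < b"
  shows "0 < a \<bullet> n"
proof -
  define t u w where "t = B - A" and "u = orth_part t (C - A)" and "w = orth_part t (D - A)"
  have uw: "0 < u \<bullet> w" using acute_vec_angle acute by (simp add: dihedral_angle_def t_def u_def w_def)
  have t: "t \<noteq> 0" "n \<bullet> t = 0" "a \<bullet> t = 0" using AB n a by (auto simp: t_def inner_diff_right)
  have o: "orth_part t x \<bullet> t = 0" "n \<bullet> orth_part t x = n \<bullet> x" "a \<bullet> orth_part t x = a \<bullet> x" for x
    using t by (simp_all add: orth_part_def inner_diff_left inner_diff_right)
  have v: "n \<bullet> u = 0" "a \<bullet> u < 0" "0 < n \<bullet> w" "a \<bullet> w = 0" "u \<bullet> t = 0"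
    using n a o by (simp_all add: u_def w_def inner_diff_right)
  have nz: "u \<noteq> 0" "n \<noteq> 0" using v by auto
  have "a - (a \<bullet> u / (u \<bullet> u)) *\<^sub>R u - (a \<bullet> n / (n \<bullet> n)) *\<^sub>R n = 0"
  proof (rule orthogonal_to_three[of t u n])
  qed (use t v nz in \<open>simp_all add: inner_diff_left inner_diff_right inner_commute\<close>)
  then have eq: "a = (a \<bullet> u / (u \<bullet> u)) *\<^sub>R u + (a \<bullet> n / (n \<bullet> n)) *\<^sub>R n" by (simp add: algebra_simps)
  have "a \<bullet> w = (a \<bullet> u / (u \<bullet> u)) * (u \<bullet> w) + (a \<bullet> n / (n \<bullet> n)) * (n \<bullet> w)"
    by (subst eq) (simp add: inner_add_left)
  then have "(a \<bullet> n / (n \<bullet> n)) * (n \<bullet> w) = - ((a \<bullet> u / (u \<bullet> u)) * (u \<bullet> w))" using v by simp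
  moreover have "(a \<bullet> u / (u \<bullet> u)) * (u \<bullet> w) < 0"
    using uw v nz by (intro mult_neg_pos divide_neg_pos) auto
  ultimately have "0 < (a \<bullet> n / (n \<bullet> n)) * (n \<bullet> w)" by linarith
  then have "0 < a \<bullet> n / (n \<bullet> n)" using v(3) by (rule zero_less_mult_pos2)
  moreover have "0 < n \<bullet> n" using nz by simp
  ultimately show ?thesis by (simp add: zero_less_divide_iff)
qed

section \<open>Small acute wedges\<close>

context wedge_cap
begin

text \<open>The ratio \<open>T1 T2 : J T1\<close>, where \<open>J\<close> is the point in which the line of the top edge meets the base plane; it is \<open>0\<close> if they are parallel.\<close>

definition \<kappa> where "\<kappa> = c / (1 - c)"

text \<open>Up to the factor \<open>\<kappa>\<close>, \<open>g1\<close> and \<open>g2\<close> are the vectors from \<open>H1\<close> and \<open>H2\<close> to \<open>J\<close>.\<close>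

lemma scaled_sides:
  "f1 = (1 / (1 - c)) *\<^sub>R (H1 - T1)" "f2 = (1 / (1 - c)) *\<^sub>R (H2 - T1)"
  "g1 = e3 + \<kappa> *\<^sub>R (T1 - H1)" "g2 = e3 + \<kappa> *\<^sub>R (T1 - H2)"
proof -
  have H: "H1 = T1 + (1 - c) *\<^sub>R f1" "H2 = T1 + (1 - c) *\<^sub>R f2"
    using corner_diff(1,2)[of 0 0] wedge_corners by (simp_all add: lam_def)
  have c: "1 - c \<noteq> 0" using c_range by simp
  have "H1 - T1 = (1 - c) *\<^sub>R f1" "H2 - T1 = (1 - c) *\<^sub>R f2" by (subst H, simp)+
  then show f: "f1 = (1 / (1 - c)) *\<^sub>R (H1 - T1)" "f2 = (1 / (1 - c)) *\<^sub>R (H2 - T1)" using c by simp_all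
  have g: "(1 / (1 - c * u)) *\<^sub>R (z - c *\<^sub>R x) = z - c *\<^sub>R ((1 / (1 - c * u)) *\<^sub>R (x - u *\<^sub>R z))"
    if u: "0 < 1 - c * u" for u and x z :: pt
  proof -
    define q where "q = 1 / (1 - c * u)"
    have "q * (1 - c * u) = 1" using u by (simp add: q_def)
    then have q: "1 = q - c * (q * u)" by (simp add: algebra_simps)
    have "z - c *\<^sub>R (q *\<^sub>R (x - u *\<^sub>R z)) = (1 + c * (q * u)) *\<^sub>R z - (c * q) *\<^sub>R x" by (simp add: algebra_simps)
    also have "1 + c * (q * u) = q" using q by linarith
    finally show ?thesis unfolding q_def[symmetric] by (simp add: scaleR_diff_right mult.commute)
  qed
  have "g1 = e3 - c *\<^sub>R f1" "g2 = e3 - c *\<^sub>R f2"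
    unfolding g1_def g2_def f1_def f2_def using g denom_pos by auto
  moreover have "- (c *\<^sub>R f1) = \<kappa> *\<^sub>R (T1 - H1)" "- (c *\<^sub>R f2) = \<kappa> *\<^sub>R (T1 - H2)"
    unfolding f \<kappa>_def by (simp_all add: scaleR_diff_right)
  ultimately show "g1 = e3 + \<kappa> *\<^sub>R (T1 - H1)" "g2 = e3 + \<kappa> *\<^sub>R (T1 - H2)" by simp_all
qed

lemma \<kappa>_nonneg: "0 \<le> \<kappa>" using c_range by (simp add: \<kappa>_def)

lemma eta_eq:
  "eta = \<kappa> * (dist T1 H1 + dist T1 H2 - dist H1 H2) + norm g1 + norm g2 - norm e3"
proof -
  have n: "norm f1 = dist T1 H1 / (1 - c)" "norm f2 = dist T1 H2 / (1 - c)"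
    unfolding scaled_sides(1,2) using c_range by (simp_all add: dist_norm norm_minus_commute)
  have "f1 - f2 = (1 / (1 - c)) *\<^sub>R (H1 - H2)"
    unfolding scaled_sides(1,2) by (simp add: scaleR_diff_right[symmetric])
  then have "norm (f1 - f2) = dist H1 H2 / (1 - c)" using c_range by (simp add: dist_norm)
  then show ?thesis unfolding eta_def n by (simp add: \<kappa>_def diff_divide_distrib add_divide_distrib algebra_simps)
qed

lemma gain_eq:
  "gain 0 0 = dist T1 H1 + dist T1 H2 - dist H1 H2 + dist T2 H4 + dist T2 H3 - dist H3 H4 + dist T1 T2
     - dist H4 H1 - dist H3 H2"
proof -
  note D = corner_dist[OF valid_0, unfolded wedge_corners]
  have "gain 0 0 = lam 0 0 * norm f1 + lam 0 0 * norm f2 - lam 0 0 * norm (f1 - f2)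
     + (1 - 0) * norm e1 + (1 - 0) * norm e2 - (1 - 0) * norm (e1 - e2) + (1 - 0) * norm e3 - \<rho>1 0 0 * norm g1 - \<rho>2 0 0 * norm g2"
    by (simp add: gain_def algebra_simps)
  then show ?thesis unfolding D[symmetric] by (simp add: dist_commute)
qed

text \<open>If \<open>J\<close> is far away, the triangle inequality in the triangles with sides \<open>g1\<close>, \<open>e3\<close> and \<open>g2\<close>, \<open>e3\<close> gives a lower bound that does not
  depend on the height of the wedge.\<close>

lemma eta_far:
  assumes "\<kappa> * dist H1 H2 \<le> norm e3 / 2"
  shows "norm e3 / 2 \<le> eta"
proof -
  have "norm e3 \<le> norm g1 + \<kappa> * dist T1 H1" "norm e3 \<le> norm g2 + \<kappa> * dist T1 H2"
    using norm_triangle_ineq4[of g1 "\<kappa> *\<^sub>R (T1 - H1)"] norm_triangle_ineq4[of g2 "\<kappa> *\<^sub>R (T1 - H2)"] \<kappa>_nonneg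
    by (simp_all add: scaled_sides(3,4) dist_norm)
  then show ?thesis unfolding eta_eq using assms by (simp add: algebra_simps)
qed

end

locale acute_wedge = minimal_wedge +
  assumes acute: "dihedral_angle H3 H4 H1 T2 < pi / 2" "dihedral_angle H4 H1 H2 T2 < pi / 2"
    "dihedral_angle H2 H3 H4 T1 < pi / 2"
begin

text \<open>The angles at the base are acute, so that the three planes at \<open>T2\<close> lean inwards.\<close>

lemma side_normals: "0 < a iC \<bullet> n" "0 < a iB \<bullet> n" "0 < a iD \<bullet> n"
proof -
  have ne: "H3 \<noteq> H4" "H4 \<noteq> H1" "H2 \<noteq> H3" using B C D by auto
  show "0 < a iC \<bullet> n" by (rule acute_dihedral_normal[OF acute(1) ne(1)]) (use base top C in auto)
  show "0 < a iB \<bullet> n" by (rule acute_dihedral_normal[OF acute(2) ne(2)]) (use base top B in auto)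
  show "0 < a iD \<bullet> n" by (rule acute_dihedral_normal[OF acute(3) ne(3)]) (use base top D in auto)
qed

definition foot where "foot = T2 - ((n \<bullet> T2 - d) / (n \<bullet> n)) *\<^sub>R n"

lemma foot: "ht foot = 0" "0 \<le> cp foot" "0 \<le> cq foot" "0 \<le> cr foot" "dist T2 foot = (n \<bullet> T2 - d) / norm n"
proof -
  have nn: "0 < n \<bullet> n" using n_nz by simp
  define \<tau> where "\<tau> = (n \<bullet> T2 - d) / (n \<bullet> n)"
  have t: "0 < \<tau>" using top_pos nn by (simp add: \<tau>_def)
  have "n \<bullet> foot = d" using nn by (simp add: foot_def inner_diff_right)
  then show "ht foot = 0" by (simp add: ht_def)
  have ft: "foot - T2 = - (\<tau> *\<^sub>R n)" by (simp add: foot_def \<tau>_def)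
  have neg: "0 \<le> (x \<bullet> (foot - T2)) / y" if "0 < x \<bullet> n" "y < 0" for x y
    unfolding ft using that t by (simp add: divide_nonneg_neg)
  show "0 \<le> cp foot" "0 \<le> cq foot" "0 \<le> cr foot"
    unfolding cp_def cq_def cr_def by (rule neg; use side_normals dual in blast)+
  have "dist T2 foot = \<tau> * norm n" using t by (simp add: dist_norm foot_def \<tau>_def[symmetric])
  also have "\<dots> = (n \<bullet> T2 - d) / norm n" using n_nz by (simp add: \<tau>_def power2_norm_eq_inner[symmetric] power2_eq_square)
  finally show "dist T2 foot = (n \<bullet> T2 - d) / norm n" .
qed

text \<open>Here \<open>J\<close> is near.  The wedge and the piece beyond \<open>H1 H2\<close> form a tetrahedron with apex \<open>T2\<close> and base \<open>J H3 H4\<close>.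
  With \<open>M = \<eta> / \<kappa>\<close>, the quadrilateral \<open>J H1 T1 H2\<close> shows that \<open>M\<close> is at least half the height of \<open>T1\<close>, and the gain is \<open>M - L\<close>, where
  \<open>L\<close> is the perimeter of the base minus the three other edges of the tetrahedron.  The foot of \<open>T2\<close> lies in the base, hence \<open>L\<close> is at least the
  shortest side \<open>\<sigma>\<close> minus three times the height \<open>h\<close> of \<open>T2\<close>.  As the gain is nonnegative, \<open>\<sigma>\<close> and \<open>h\<close> are at most multiples of
  \<open>m = \<eta> / c\<close>, which bounds the volume of the tetrahedron and thereby the gain.\<close>

lemma extended_wedge_bounds:
  fixes E :: real
  assumes c: "0 < c" and near: "norm e3 / 2 < \<kappa> * dist H1 H2"
    and E: "dist H1 H2 \<le> E" "dist T1 T2 \<le> E" "dist T2 H4 \<le> E" "dist T2 H3 \<le> E" "dist H3 H4 \<le> E"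
  shows "0 < eta" "norm e3 / c \<le> 3 * E" "gain 0 0 \<le> 392 * e * E * (eta / c)\<^sup>2"
proof -
  define J where "J = T2 + (1 / c) *\<^sub>R e3"
  have k: "0 < \<kappa>" "1 / c = 1 / \<kappa> + 1" using c c_range by (simp_all add: \<kappa>_def field_simps)
  have e3: "T1 - T2 = e3" by (simp add: e3_def)
  have JT1: "J - T1 = (1 / \<kappa>) *\<^sub>R e3"
  proof -
    have "J - T1 = (1 / c) *\<^sub>R e3 - (T1 - T2)" by (simp add: J_def)
    also have "\<dots> = (1 / c - 1) *\<^sub>R e3" unfolding e3 by (simp add: algebra_simps)
    also have "1 / c - 1 = 1 / \<kappa>" using k(2) by simp
    finally show ?thesis .
  qed
  have dJ: "dist J T1 = norm e3 / \<kappa>" unfolding dist_norm JT1 using k by simp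
  have dJ2: "dist J T2 = norm e3 / c" using c by (simp add: dist_norm J_def)
  have dT: "dist T1 T2 = norm e3" by (simp add: e3_def dist_norm)
  have dJ2': "norm e3 / c = norm e3 / \<kappa> + norm e3" using k(2) by (metis distrib_left mult.right_neutral times_divide_eq_right)
  \<comment> \<open>The edges \<open>H4 H1\<close> and \<open>H3 H2\<close> point to \<open>J\<close>, so that distances along them add up.\<close>
  have H1J: "J - H1 = (1 / \<kappa>) *\<^sub>R g1" and H2J: "J - H2 = (1 / \<kappa>) *\<^sub>R g2"
  proof -
    have "J - H1 = (1 / \<kappa>) *\<^sub>R (e3 + \<kappa> *\<^sub>R (T1 - H1))" "J - H2 = (1 / \<kappa>) *\<^sub>R (e3 + \<kappa> *\<^sub>R (T1 - H2))"
      using JT1 k by (simp_all add: scaleR_add_right algebra_simps)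
    then show "J - H1 = (1 / \<kappa>) *\<^sub>R g1" "J - H2 = (1 / \<kappa>) *\<^sub>R g2" by (simp_all only: scaled_sides(3,4))
  qed
  have dJH: "dist J H1 = norm g1 / \<kappa>" "dist J H2 = norm g2 / \<kappa>"
    unfolding dist_norm H1J H2J using k by simp_all
  have r: "0 < \<rho>1 0 0" "0 < \<rho>2 0 0" using corner_pos(2,3)[OF valid_0] .
  have H4J: "J - H4 = (1 / \<kappa> + \<rho>1 0 0) *\<^sub>R g1" "J - H3 = (1 / \<kappa> + \<rho>2 0 0) *\<^sub>R g2"
  proof -
    have "H1 - H4 = \<rho>1 0 0 *\<^sub>R g1" "H2 - H3 = \<rho>2 0 0 *\<^sub>R g2"
      using corner_diff(3,4)[of 0 0] unfolding wedge_corners by (metis add_diff_cancel_left')+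
    moreover have "J - H4 = (J - H1) + (H1 - H4)" "J - H3 = (J - H2) + (H2 - H3)" by simp_all
    ultimately show "J - H4 = (1 / \<kappa> + \<rho>1 0 0) *\<^sub>R g1" "J - H3 = (1 / \<kappa> + \<rho>2 0 0) *\<^sub>R g2"
      unfolding H1J H2J by (simp_all only: scaleR_left.add)
  qed
  have dJ4: "dist J H4 = dist J H1 + dist H4 H1" "dist J H3 = dist J H2 + dist H3 H2"
  proof -
    note D = corner_dist[OF valid_0, unfolded wedge_corners]
    have "dist J H4 = (1 / \<kappa> + \<rho>1 0 0) * norm g1" "dist J H3 = (1 / \<kappa> + \<rho>2 0 0) * norm g2"
      unfolding dist_norm H4J using k r by simp_all
    then show "dist J H4 = dist J H1 + dist H4 H1" "dist J H3 = dist J H2 + dist H3 H2"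
      unfolding dJH D by (simp_all add: distrib_right)
  qed
  \<comment> \<open>Excess of the sides of \<open>J H1 T1 H2\<close> over its diagonals, and of the base perimeter over the edges at \<open>T2\<close>.\<close>
  define M where "M = dist T1 H1 + dist T1 H2 + dist J H1 + dist J H2 - dist H1 H2 - dist J T1"
  define L where "L = dist J H4 + dist J H3 + dist H3 H4 - dist J T2 - dist T2 H3 - dist T2 H4"
  have eta: "eta = \<kappa> * M" unfolding M_def eta_eq dJH dJ using k by (simp add: algebra_simps)
  have gain: "gain 0 0 = M - L"
    unfolding gain_eq M_def L_def dJ4 dJ2 dJ dT using dJ2' by simp
  define h where "h = dist T2 foot"
  have n0: "0 < norm n" using n_nz by simp
  have h: "0 < h" using foot(5) top_pos n0 by (simp add: h_def)
  have h1: "(1 - c) * h \<le> dist T1 H1" "(1 - c) * h \<le> dist T1 H2"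
  proof -
    have "(1 - c) * h = (n \<bullet> T1 - d) / norm n"
      unfolding h_def foot(5) c_def ht_def using top_pos by simp
    moreover have "n \<bullet> T1 - d \<le> norm n * dist T1 H1" "n \<bullet> T1 - d \<le> norm n * dist T1 H2"
      using norm_cauchy_schwarz[of n "T1 - H1"] norm_cauchy_schwarz[of n "T1 - H2"] base
      by (simp_all add: inner_diff_right dist_norm)
    ultimately show "(1 - c) * h \<le> dist T1 H1" "(1 - c) * h \<le> dist T1 H2"
      using n0 by (simp_all add: pos_divide_le_eq mult.commute)
  qed
  have Mh: "(1 - c) * h / 2 \<le> M"
  proof -
    have com: "dist H1 T1 = dist T1 H1" "dist H2 J = dist J H2" by (simp_all only: dist_commute)
    have "(1 - c) * h \<le> dist J H1 + dist T1 H2" using h1 zero_le_dist[of J H1] by linarith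
    moreover have "(1 - c) * h \<le> dist H1 T1 + dist H2 J" using h1 zero_le_dist[of H2 J] com by linarith
    ultimately have "(1 - c) * h \<le> min (dist J H1 + dist T1 H2) (dist H1 T1 + dist H2 J)" by simp
    then have "(1 - c) * h / 2 \<le> min (dist J H1 + dist T1 H2) (dist H1 T1 + dist H2 J) / 2" by (rule divide_right_mono) simp
    also have "\<dots> \<le> dist J H1 + dist H1 T1 + dist T1 H2 + dist H2 J - (dist J T1 + dist H1 H2)"
      using diagonals_le[of J T1 H1 H2] by (simp only: le_diff_eq add.commute)
    also have "\<dots> = M" unfolding M_def com by simp
    finally show ?thesis .
  qed
  define \<sigma> where "\<sigma> = Min {dist H4 H3, dist H3 J, dist J H4}"
  have \<sigma>: "\<sigma> \<in> {dist H4 H3, dist H3 J, dist J H4}" "\<sigma> \<le> dist H4 H3" "\<sigma> \<le> dist H3 J" "\<sigma> \<le> dist J H4"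
    unfolding \<sigma>_def by (rule Min_in; simp) simp_all
  have w: "0 \<le> cp foot" "0 \<le> cq foot" "0 \<le> c * cr foot" "cp foot + cq foot + c * cr foot = 1"
    using foot c ht_coords[of foot] by auto
  have fc: "foot = cp foot *\<^sub>R H4 + cq foot *\<^sub>R H3 + (c * cr foot) *\<^sub>R J"
  proof -
    have "cp foot *\<^sub>R H4 + cq foot *\<^sub>R H3 + (c * cr foot) *\<^sub>R J
        = (cp foot + cq foot + c * cr foot) *\<^sub>R T2 + cp foot *\<^sub>R e1 + cq foot *\<^sub>R e2 + cr foot *\<^sub>R e3"
      using c by (simp add: J_def e1_def e2_def algebra_simps)
    then show ?thesis unfolding w(4) using coords[of foot] by simp
  qed
  have "dist foot H4 + dist foot H3 + dist foot J + \<sigma> \<le> dist H4 H3 + dist H3 J + dist J H4"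
    by (rule triangle_foot[OF w fc \<sigma>(2-4)])
  moreover have "dist T2 x \<le> h + dist foot x" for x unfolding h_def by (rule dist_triangle)
  from this[of H4] this[of H3] this[of J]
  have "dist T2 H4 + dist T2 H3 + dist J T2 \<le> 3 * h + (dist foot H4 + dist foot H3 + dist foot J)" by (simp add: dist_commute)
  ultimately have "\<sigma> \<le> L + 3 * h" by (simp add: L_def dist_commute)
  moreover have "L \<le> M" using gain gain_nonneg by simp
  ultimately have s1: "\<sigma> \<le> M + 3 * h" by simp
  have c1: "0 < 1 - c" "1 - c \<le> 1" using c_range by auto
  have "0 < (1 - c) * h" using c1 h by simp
  then have M0: "0 < M" using Mh by linarith
  show "0 < eta" unfolding eta using k M0 by simp
  define m where "m = eta / c"
  have m: "m = M / (1 - c)" using c c1 by (simp add: m_def eta \<kappa>_def)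
  have m0: "0 < m" using M0 c1 by (simp add: m)
  have hm: "h \<le> 2 * m" using Mh c1 by (simp add: m field_simps)
  have Mm: "M \<le> m" using M0 c1 by (simp add: m pos_le_divide_eq mult_left_le)
  have sm: "\<sigma> \<le> 7 * m" using s1 hm Mm by simp
  have R: "norm e3 / \<kappa> < 2 * E"
  proof -
    have "norm e3 < 2 * dist H1 H2 * \<kappa>" using near by (simp add: mult.commute mult.left_commute)
    then have "norm e3 / \<kappa> < 2 * dist H1 H2" using k by (simp only: pos_divide_less_eq)
    then show ?thesis using E by simp
  qed
  show D: "norm e3 / c \<le> 3 * E" using dJ2' R E dT by simp
  have sides: "dist H4 H3 \<le> 4 * E" "dist H3 J \<le> 4 * E" "dist J H4 \<le> 4 * E"
  proof -
    have "0 \<le> E" using E(1) zero_le_dist[of H1 H2] by linarith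
    then show "dist H4 H3 \<le> 4 * E" using E(5) by (simp add: dist_commute)
    show "dist J H4 \<le> 4 * E" using dist_triangle[of J H4 T2] D E(3) dJ2 by linarith
    show "dist H3 J \<le> 4 * E" using dist_triangle[of J H3 T2] D E(4) dJ2 by (simp add: dist_commute)
  qed
  have cyclic: "z \<bullet> cross3 x y = x \<bullet> cross3 y z" for x y z :: pt by (simp add: cross3_simps)
  have "J - T2 = (1 / c) *\<^sub>R e3" by (simp add: J_def)
  then have "\<bar>((1 / c) *\<^sub>R e3) \<bullet> cross3 e1 e2\<bar> = \<bar>(H4 - T2) \<bullet> cross3 (H3 - T2) (J - T2)\<bar>"
    unfolding cyclic[of _ e1 e2] by (simp add: e1_def e2_def)
  also have "\<dots> \<le> h * \<sigma> * (4 * E)"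
    unfolding h_def by (rule tetrahedron_bound[OF w(4) fc \<sigma>(1) sides])
  also have "\<dots> \<le> (2 * m) * (7 * m) * (4 * E)"
  proof (rule mult_right_mono)
    have "0 \<le> \<sigma>" using \<sigma>(1) by auto
    then show "h * \<sigma> \<le> (2 * m) * (7 * m)" using hm sm m0 by (intro mult_mono) auto
    show "0 \<le> 4 * E" using sides(1) zero_le_dist[of H4 H3] by linarith
  qed
  finally have W: "\<bar>((1 / c) *\<^sub>R e3) \<bullet> cross3 e1 e2\<bar> \<le> 56 * E * m\<^sup>2" by (simp add: power2_eq_square mult.commute mult.left_commute)
  have "gain 0 0 \<le> 7 * e * \<bar>((1 / c) *\<^sub>R e3) \<bullet> cross3 e1 e2\<bar>" by (rule gain_le_volume[OF c])
  also have "\<dots> \<le> 7 * e * (56 * E * m\<^sup>2)" using W e_nonneg by (intro mult_left_mono) auto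
  finally show "gain 0 0 \<le> 392 * e * E * (eta / c)\<^sup>2" by (simp add: m_def)
qed

text \<open>The size of \<open>t\<close> is chosen such that the quadratic term takes half of the linear one.  The two alternatives are the cases that \<open>J\<close> is
  far away and that it is near.\<close>

lemma wedge_not_small:
  assumes P: "P \<subseteq> cball p D" and K: "0 < K" "8 * e * (measure lebesgue (cball p (D + 1)))\<^sup>2 \<le> K"
    and E: "dist H1 H2 \<le> E" "dist T1 T2 \<le> E" "dist T2 H4 \<le> E" "dist T2 H3 \<le> E" "dist H3 H4 \<le> E"
      "dist T1 H1 \<le> E" "dist T1 H2 \<le> E"
  shows "1 \<le> 80 * K * E \<or> 1 \<le> 14112 * K * e * E ^ 3"
proof -
  have var: "t * eta - K * (t * norm e3)\<^sup>2 \<le> gain 0 0" if "0 < t" for t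
    using wedge_variation[OF P that] mult_right_mono[OF K(2), of "(t * norm e3)\<^sup>2"] by simp
  have e3: "0 < norm e3" using e3_nz by simp
  show ?thesis
  proof (cases "\<kappa> * dist H1 H2 \<le> norm e3 / 2")
    case True
    let ?t = "1 / (4 * K * norm e3)"
    have t: "0 < ?t" using K e3 by simp
    have "?t * (norm e3 / 2) \<le> ?t * eta" using eta_far[OF True] t by (intro mult_left_mono) auto
    moreover have "?t * (norm e3 / 2) - K * (?t * norm e3)\<^sup>2 = 1 / (16 * K)"
      using K e3 by (simp add: power2_eq_square field_simps)
    moreover have "gain 0 0 \<le> 5 * E"
      unfolding gain_eq using E zero_le_dist[of H1 H2] zero_le_dist[of H3 H4] zero_le_dist[of H4 H1] zero_le_dist[of H3 H2] by linarith
    ultimately have "1 / (16 * K) \<le> 5 * E" using var[OF t] by linarith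
    then have "1 \<le> 80 * K * E" using K by (simp add: pos_divide_le_eq mult.commute mult.left_commute)
    then show ?thesis ..
  next
    case False
    then have near: "norm e3 / 2 < \<kappa> * dist H1 H2" by simp
    have "0 < \<kappa> * dist H1 H2" using near e3 by linarith
    then have "c \<noteq> 0" by (auto simp: \<kappa>_def)
    then have c: "0 < c" using c_range by simp
    note N = extended_wedge_bounds[OF c near E(1-5)]
    let ?t = "eta / (2 * K * (norm e3)\<^sup>2)"
    have t: "0 < ?t" using N K e3 by simp
    have "?t * eta - K * (?t * norm e3)\<^sup>2 = eta\<^sup>2 / (4 * K * (norm e3)\<^sup>2)"
      using K e3 by (simp add: power2_eq_square field_simps)
    then have "eta\<^sup>2 / (4 * K * (norm e3)\<^sup>2) \<le> 392 * e * E * (eta / c)\<^sup>2" using var[OF t] N(3) by linarith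
    then have "eta\<^sup>2 \<le> (392 * e * E * (eta / c)\<^sup>2) * (4 * K * (norm e3)\<^sup>2)"
      using K e3 by (simp add: pos_divide_le_eq)
    also have "\<dots> = eta\<^sup>2 * (1568 * K * e * E * (norm e3 / c)\<^sup>2)" by (simp add: power_divide)
    finally have "eta\<^sup>2 * 1 \<le> eta\<^sup>2 * (1568 * K * e * E * (norm e3 / c)\<^sup>2)" by simp
    moreover have "0 < eta\<^sup>2" using N by simp
    ultimately have "1 \<le> 1568 * K * e * E * (norm e3 / c)\<^sup>2" by (simp only: mult_le_cancel_left_pos)
    also have "\<dots> \<le> 1568 * K * e * E * (3 * E)\<^sup>2"
    proof (rule mult_left_mono)
      show "(norm e3 / c)\<^sup>2 \<le> (3 * E)\<^sup>2" using N(2) c by (intro power_mono) auto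
      have "0 \<le> E" using E(1) zero_le_dist[of H1 H2] by linarith
      then show "0 \<le> 1568 * K * e * E" using K e_nonneg by simp
    qed
    also have "\<dots> = 14112 * K * e * E ^ 3" by (simp add: power2_eq_square power3_eq_cube)
    finally show ?thesis ..
  qed
qed

end

section \<open>Halfspaces of a protruding wedge\<close>

text \<open>Both planes are the affine hull of \<open>X\<close>, and both halfspaces contain an interior point of \<open>P\<close>.\<close>

lemma supporting_halfspace_unique:
  assumes P: "convex_polyhedron P" and a: "a \<noteq> 0" "P \<subseteq> {x. a \<bullet> x \<le> b}" and a': "a' \<noteq> 0" "P \<subseteq> {x. a' \<bullet> x \<le> b'}"
    and X: "aff_dim X = 2" "X \<subseteq> {x. a \<bullet> x = b}" "X \<subseteq> {x. a' \<bullet> x = b'}"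
  shows "{x. a \<bullet> x \<le> b} = {x. a' \<bullet> x \<le> b'}" "{x. a \<bullet> x = b} = {x. a' \<bullet> x = b'}"
proof -
  obtain z where z: "z \<in> interior P" using convex_polyhedronD(8)[OF P] by blast
  have H: "affine hull X = {x. c \<bullet> x = e}" if "c \<noteq> 0" "X \<subseteq> {x. c \<bullet> x = e}" for c :: pt and e
  proof (rule affine_dim_equal)
    show "affine hull X \<noteq> {}" using X(1) by force
    show "affine hull X \<subseteq> {x. c \<bullet> x = e}" using that(2) by (intro hull_minimal affine_hyperplane)
    show "aff_dim (affine hull X) = aff_dim {x. c \<bullet> x = e}" using X(1) that(1) by (simp add: aff_dim_hyperplane)
  qed (simp_all add: affine_hyperplane)
  show eq: "{x. a \<bullet> x = b} = {x. a' \<bullet> x = b'}" using H[OF a(1) X(2)] H[OF a'(1) X(3)] by simp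
  have sub: "c' \<bullet> x \<le> e'" if c: "c \<bullet> z < e" "c' \<bullet> z < e'" "{x. c \<bullet> x = e} = {x. c' \<bullet> x = e'}" "c \<bullet> x \<le> e"
    for c c' x :: pt and e e'
  proof (rule ccontr)
    assume "\<not> c' \<bullet> x \<le> e'"
    then have g: "0 < c' \<bullet> x - c' \<bullet> z" "e' - c' \<bullet> z < c' \<bullet> x - c' \<bullet> z" using c(2) by auto
    define t where "t = (e' - c' \<bullet> z) / (c' \<bullet> x - c' \<bullet> z)"
    have t: "0 < t" "t < 1" "t * (c' \<bullet> x - c' \<bullet> z) = e' - c' \<bullet> z" using g c(2) by (simp_all add: t_def)
    have "c' \<bullet> ((1 - t) *\<^sub>R z + t *\<^sub>R x) = e'" using t(3) by (simp add: inner_add_right algebra_simps)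
    then have "c \<bullet> ((1 - t) *\<^sub>R z + t *\<^sub>R x) = e" using c(3) by blast
    moreover have "(1 - t) * (c \<bullet> z) < (1 - t) * e" "t * (c \<bullet> x) \<le> t * e" using t c by simp_all
    ultimately show False by (simp add: inner_add_right algebra_simps)
  qed
  show "{x. a \<bullet> x \<le> b} = {x. a' \<bullet> x \<le> b'}"
    using sub[OF interior_strict[OF z a(2,1)] interior_strict[OF z a'(2,1)] eq]
      sub[OF interior_strict[OF z a'(2,1)] interior_strict[OF z a(2,1)] eq[symmetric]] by auto
qed

locale facet_normals =
  fixes P :: "pt set" and a :: "pt set \<Rightarrow> pt" and b :: "pt set \<Rightarrow> real"
  assumes P: "convex_polyhedron P"
    and a: "\<And>X. X facet_of P \<Longrightarrow> a X \<noteq> 0" "\<And>X. X facet_of P \<Longrightarrow> P \<subseteq> {x. a X \<bullet> x \<le> b X}"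
      "\<And>X. X facet_of P \<Longrightarrow> X = P \<inter> {x. a X \<bullet> x = b X}"
begin

lemma facet_iff: "X facet_of P \<Longrightarrow> x \<in> X \<longleftrightarrow> x \<in> P \<and> a X \<bullet> x = b X"
  using arg_cong[OF a(3)[of X], of "\<lambda>S. x \<in> S"] by (simp only: Int_iff mem_Collect_eq)

text \<open>A relatively inner point of a facet lies in no other facet: otherwise one facet would be contained in the other.\<close>

lemma facet_interior_point:
  assumes X: "X facet_of P"
  shows "\<exists>x\<in>X. \<forall>Y. Y facet_of P \<longrightarrow> Y \<noteq> X \<longrightarrow> a Y \<bullet> x < b Y"
proof -
  have fX: "X face_of P" by (rule facet_of_imp_face_of[OF X])
  have cX: "convex X" by (rule face_of_imp_convex[OF fX])
  have "X \<noteq> {}" using facet_dim[OF P X] by force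
  then obtain x where x: "x \<in> rel_interior X" using rel_interior_eq_empty[OF cX] by blast
  have xX: "x \<in> X" using x rel_interior_subset[of X] by blast
  have "a Y \<bullet> x < b Y" if Y: "Y facet_of P" "Y \<noteq> X" for Y
  proof (rule ccontr)
    assume "\<not> a Y \<bullet> x < b Y"
    moreover have "x \<in> P" using xX face_of_imp_subset[OF fX] by blast
    moreover have "a Y \<bullet> x \<le> b Y" using a(2)[OF Y(1)] \<open>x \<in> P\<close> by blast
    ultimately have "x \<in> Y" using facet_iff[OF Y(1), of x] by linarith
    then have "X \<subseteq> Y"
      using subset_of_face_of[OF facet_of_imp_face_of[OF Y(1)] face_of_imp_subset[OF fX]] x by blast
    then have "X face_of Y"
      using face_of_subset[OF fX] face_of_imp_subset[OF facet_of_imp_face_of[OF Y(1)]] by blast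
    then have "aff_dim X < aff_dim Y"
      using face_of_aff_dim_lt face_of_imp_convex[OF facet_of_imp_face_of[OF Y(1)]] Y(2) by blast
    then show False using facet_dim[OF P X] facet_dim[OF P Y(1)] by simp
  qed
  then show ?thesis using xX by blast
qed

lemma drop_face_eq:
  "drop_face P F = cap ({X. X facet_of P} - {F}) a b"
proof (intro equalityI subsetI)
  fix x assume x: "x \<in> drop_face P F"
  show "x \<in> cap ({X. X facet_of P} - {F}) a b"
    unfolding cap_def
  proof (intro CollectI ballI)
    fix X assume "X \<in> {X. X facet_of P} - {F}"
    then have X: "X facet_of P" "X \<noteq> F" by auto
    have "{x. a X \<bullet> x \<le> b X} \<in> {{x. a \<bullet> x \<le> b} | a b. a \<noteq> 0 \<and> P \<subseteq> {x. a \<bullet> x \<le> b} \<and>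
      (P \<inter> {x. a \<bullet> x = b}) facet_of P \<and> P \<inter> {x. a \<bullet> x = b} \<noteq> F}"
      using a(1,2)[OF X(1)] X a(3)[OF X(1), symmetric] by (intro CollectI exI[of _ "a X"] exI[of _ "b X"]) simp
    then show "a X \<bullet> x \<le> b X" using x unfolding drop_face_def by blast
  qed
next
  fix x assume x: "x \<in> cap ({X. X facet_of P} - {F}) a b"
  show "x \<in> drop_face P F"
    unfolding drop_face_def
  proof (rule InterI)
    fix S assume "S \<in> {{x. a \<bullet> x \<le> b} | a b. a \<noteq> 0 \<and> P \<subseteq> {x. a \<bullet> x \<le> b} \<and>
      (P \<inter> {x. a \<bullet> x = b}) facet_of P \<and> P \<inter> {x. a \<bullet> x = b} \<noteq> F}"
    then obtain a' b' where S: "S = {x. a' \<bullet> x \<le> b'}" "a' \<noteq> 0" "P \<subseteq> {x. a' \<bullet> x \<le> b'}"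
      "(P \<inter> {x. a' \<bullet> x = b'}) facet_of P" "P \<inter> {x. a' \<bullet> x = b'} \<noteq> F" by blast
    let ?X = "P \<inter> {x. a' \<bullet> x = b'}"
    have "{x. a ?X \<bullet> x \<le> b ?X} = {x. a' \<bullet> x \<le> b'}"
      by (rule supporting_halfspace_unique(1)[OF P a(1)[OF S(4)] a(2)[OF S(4)] S(2,3) facet_dim[OF P S(4)]])
        (use facet_iff[OF S(4)] in blast)+
    moreover have "a ?X \<bullet> x \<le> b ?X" using x S(4,5) unfolding cap_def by blast
    ultimately show "x \<in> S" using S(1) by blast
  qed
qed

lemma cap_eq:
  assumes F: "F facet_of P"
  shows "P = cap ({X. X facet_of P} - {F}) a b \<inter> {x. a F \<bullet> x \<le> b F}"
proof (intro equalityI subsetI)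
  fix x assume "x \<in> P"
  then show "x \<in> cap ({X. X facet_of P} - {F}) a b \<inter> {x. a F \<bullet> x \<le> b F}"
    using a(2) F by (auto simp: cap_def)
next
  fix x assume x: "x \<in> cap ({X. X facet_of P} - {F}) a b \<inter> {x. a F \<bullet> x \<le> b F}"
  show "x \<in> P"
  proof (rule polyhedron_eq_facet_halfspaces[OF P a])
    fix X assume "X facet_of P"
    then show "a X \<bullet> x \<le> b X" using x by (cases "X = F") (simp_all add: cap_def)
  qed
qed

text \<open>A point of the base is a limit of points above it on a segment to some point above the base.\<close>

lemma protruding_eq:
  assumes F: "F facet_of P" and ne: "protruding_polyhedron P F \<noteq> {}"
  shows "protruding_polyhedron P F = cap ({X. X facet_of P} - {F}) a b \<inter> {x. b F \<le> a F \<bullet> x}"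
proof -
  let ?C = "cap ({X. X facet_of P} - {F}) a b"
  have D: "drop_face P F - P = ?C \<inter> {x. b F < a F \<bullet> x}"
  proof -
    have "x \<in> P \<longleftrightarrow> x \<in> ?C \<and> a F \<bullet> x \<le> b F" for x
      using arg_cong[OF cap_eq[OF F], of "\<lambda>S. x \<in> S"] by (simp only: Int_iff mem_Collect_eq)
    then have "x \<in> drop_face P F - P \<longleftrightarrow> x \<in> ?C \<inter> {x. b F < a F \<bullet> x}" for x
      unfolding drop_face_eq by (simp only: Diff_iff Int_iff mem_Collect_eq) linarith
    then show ?thesis by blast
  qed
  have pr: "protruding_polyhedron P F = closure (?C \<inter> {x. b F < a F \<bullet> x})"
    by (simp only: protruding_polyhedron_def D)
  show ?thesis
    unfolding pr
  proof (intro equalityI subsetI)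
    fix x assume "x \<in> closure (?C \<inter> {x. b F < a F \<bullet> x})"
    moreover have "closure (?C \<inter> {x. b F < a F \<bullet> x}) \<subseteq> ?C \<inter> {x. b F \<le> a F \<bullet> x}"
    proof (rule closure_minimal)
      show "?C \<inter> {x. b F < a F \<bullet> x} \<subseteq> ?C \<inter> {x. b F \<le> a F \<bullet> x}" by (auto intro: less_imp_le)
      show "closed (?C \<inter> {x. b F \<le> a F \<bullet> x})" by (intro closed_Int closed_cap closed_halfspace_ge)
    qed
    ultimately show "x \<in> ?C \<inter> {x. b F \<le> a F \<bullet> x}" by blast
  next
    fix x assume x: "x \<in> ?C \<inter> {x. b F \<le> a F \<bullet> x}"
    have "?C \<inter> {x. b F < a F \<bullet> x} \<noteq> {}" using ne unfolding pr by (simp only: closure_eq_empty not_False_eq_True)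
    then obtain y where y: "y \<in> ?C" "b F < a F \<bullet> y" by blast
    have "((\<lambda>t. (1 - t) *\<^sub>R x + t *\<^sub>R y) \<longlongrightarrow> (1 - 0) *\<^sub>R x + 0 *\<^sub>R y) (at_right 0)" by (intro tendsto_intros)
    then have lim: "((\<lambda>t. (1 - t) *\<^sub>R x + t *\<^sub>R y) \<longlongrightarrow> x) (at_right 0)" by simp
    show "x \<in> closure (?C \<inter> {x. b F < a F \<bullet> x})"
    proof (rule Lim_in_closed_set[OF closed_closure _ trivial_limit_at_right_real lim])
      have "\<forall>\<^sub>F t :: real in at_right 0. 0 < t \<and> t < 1"
        by (rule eventually_at_rightI[of 0 1]) simp_all
      then show "\<forall>\<^sub>F t in at_right 0. (1 - t) *\<^sub>R x + t *\<^sub>R y \<in> closure (?C \<inter> {x. b F < a F \<bullet> x})"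
      proof eventually_elim
        case (elim t)
        have "(1 - t) *\<^sub>R x + t *\<^sub>R y \<in> ?C" using convexD[OF convex_cap, of x _ a b y "1 - t" t] x y elim by auto
        moreover have "(1 - t) * b F + t * b F < (1 - t) * (a F \<bullet> x) + t * (a F \<bullet> y)"
          using x y elim by (intro add_le_less_mono mult_left_mono mult_strict_left_mono) auto
        then have "b F < a F \<bullet> ((1 - t) *\<^sub>R x + t *\<^sub>R y)" by (simp add: inner_add_right algebra_simps)
        ultimately have "(1 - t) *\<^sub>R x + t *\<^sub>R y \<in> ?C \<inter> {x. b F < a F \<bullet> x}" by simp
        then show ?case by (rule subsetD[OF closure_subset])
      qed
    qed
  qed
qed

end

lemma extreme_point_not_in_hull:
  assumes "x extreme_point_of W" "convex hull S \<subseteq> W" "x \<notin> S"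
  shows "x \<notin> convex hull S"
proof
  assume "x \<in> convex hull S"
  then have "x extreme_point_of (convex hull S)" using assms(1,2) unfolding extreme_point_of_def by blast
  then show False using extreme_point_of_convex_hull assms(3) by blast
qed

context facet_normals
begin

text \<open>The side faces of the wedge are facets of the intersection of \<open>cap I a b\<close> with \<open>{x. b F \<le> a F \<bullet> x}\<close>, so each lies on the plane of
  a face of \<open>P\<close>.  Conversely, a face of \<open>P\<close> whose plane meets the part of the cap above the base meets it in a facet of the
  wedge.  If the first top vertex is the higher one, the labels are rotated by two steps.\<close>

lemma acute_wedge_exists:
  fixes F H T
  defines "I \<equiv> {X. X facet_of P} - {F}"
  assumes good: "good_protruding_wedge P F H T" and vol: "measure lebesgue P = 1"
    and min: "\<And>R. convex_polyhedron R \<Longrightarrow> num_faces R \<le> num_faces P \<Longrightarrow> melzak P \<le> melzak R"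
  shows "\<exists>iA iB iC iD.
    (a F \<bullet> T 1 \<le> a F \<bullet> T 2 \<longrightarrow> acute_wedge I a b (a F) (b F) iA iB iC iD (H 1) (H 2) (H 3) (H 4) (T 1) (T 2) P (total_edge_length P)) \<and>
    (a F \<bullet> T 2 \<le> a F \<bullet> T 1 \<longrightarrow> acute_wedge I a b (a F) (b F) iC iD iA iB (H 3) (H 4) (H 1) (H 2) (T 2) (T 1) P (total_edge_length P))"
proof -
  let ?n = "a F" and ?d = "b F" and ?C = "cap I a b"
  define W where "W = wedge_body H T"
  have F: "F facet_of P" and gw: "good_wedge H T" and HF: "convex hull (range H) = F" and Wp: "W = protruding_polyhedron P F"
    using good by (auto simp: good_protruding_wedge_def quadrilateral_face_def W_def)
  have w: "convex_polyhedron W" "distinct_labels H T" "vertices W = range H \<union> range T"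
      "{Y. Y facet_of W} = {convex hull (range H), convex hull {H 1, H 2, T 1}, convex hull {H 2, H 3, T 2, T 1},
        convex hull {H 3, H 4, T 2}, convex hull {H 4, H 1, T 1, T 2}}"
    using gw by (auto simp: good_wedge_def wedge_def W_def)
  have acute: "dihedral_angle (H k) (H (k + 1)) (H (k + 2)) (T (top_at k)) < pi / 2" for k
    using gw by (simp add: good_wedge_def)
  note DW = convex_polyhedronD[OF w(1)]
  have W_eq: "W = ?C \<inter> {x. ?d \<le> ?n \<bullet> x}"
    using protruding_eq[OF F] DW(9) unfolding Wp I_def by simp
  have P_eq: "P = ?C \<inter> {x. ?n \<bullet> x \<le> ?d}" using cap_eq[OF F] unfolding I_def .
  have Fi: "x \<in> F \<longleftrightarrow> x \<in> P \<and> ?n \<bullet> x = ?d" for x by (rule facet_iff[OF F])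
  have Pi: "x \<in> P \<longleftrightarrow> x \<in> ?C \<and> ?n \<bullet> x \<le> ?d" for x
    using arg_cong[OF P_eq, of "\<lambda>S. x \<in> S"] by (simp only: Int_iff mem_Collect_eq)
  have Wi: "x \<in> W \<longleftrightarrow> x \<in> ?C \<and> ?d \<le> ?n \<bullet> x" for x
    using arg_cong[OF W_eq, of "\<lambda>S. x \<in> S"] by (simp only: Int_iff mem_Collect_eq)
  have rH: "range H = {H 1, H 2, H 3, H 4}" and rT: "range T = {T 1, T 2}"
    by (auto simp: UNIV_4 UNIV_2)
  define V where "V = {H 1, H 2, H 3, H 4, T 1, T 2}"
  have V: "V = range H \<union> range T" by (auto simp: rH rT V_def)
  have inj: "inj H" "inj T" "range H \<inter> range T = {}" using w(2) by (auto simp: distinct_labels_def)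
  have dis: "H 1 \<noteq> H 2" "H 1 \<noteq> H 3" "H 1 \<noteq> H 4" "H 2 \<noteq> H 3" "H 2 \<noteq> H 4" "H 3 \<noteq> H 4" "T 1 \<noteq> T 2"
    using inj(1,2) by (simp_all add: inj_eq)
  have disT: "H k \<noteq> T t" for k t using inj(3) by blast
  have ext: "x extreme_point_of W" if "x \<in> V" for x
    using w(3) that unfolding vertices_def V by blast
  have VW: "V \<subseteq> W" using ext by (auto simp: extreme_point_of_def)
  have base: "?n \<bullet> H k = ?d" for k
  proof -
    have "H k \<in> convex hull (range H)" by (intro hull_inc) simp
    then show ?thesis using HF Fi by blast
  qed
  have FW: "F \<subseteq> W" using Fi Pi Wi by auto
  have top: "?d < ?n \<bullet> T t" for t
  proof (rule ccontr)
    assume "\<not> ?d < ?n \<bullet> T t"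
    moreover have "T t \<in> W" using VW V by blast
    ultimately have "T t \<in> F" using Wi Pi Fi by auto
    moreover have "T t \<notin> range H" "T t \<in> V" using inj(3) V by blast+
    then have "T t \<notin> convex hull (range H)"
      using extreme_point_not_in_hull[OF ext, of "T t" "range H"] FW HF by blast
    ultimately show False using HF by simp
  qed
  have finI: "finite I" using convex_polyhedronD(11)[OF P] by (simp add: I_def)
  have normal: "a i \<noteq> 0" if "i \<in> I" for i using a(1) that by (simp add: I_def)
  have n0: "?n \<noteq> 0" by (rule a(1)[OF F])
  have le: "a i \<bullet> x \<le> b i" if "i \<in> I" "x \<in> W" for i x using that Wi by (simp add: cap_def)
  let ?J = "insert None (Some ` I)"
  define a' where "a' = (\<lambda>j. case j of None \<Rightarrow> - ?n | Some i \<Rightarrow> a i)"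
  define b' where "b' = (\<lambda>j. case j of None \<Rightarrow> - ?d | Some i \<Rightarrow> b i)"
  have WJ: "W = {x. \<forall>j\<in>?J. a' j \<bullet> x \<le> b' j}" unfolding W_eq by (auto simp: cap_def a'_def b'_def)
  have pick: "\<exists>i. i \<in> I \<and> (\<forall>x\<in>S. a i \<bullet> x = b i) \<and> (\<forall>x\<in>V - S. a i \<bullet> x < b i) \<and> convex hull S = W \<inter> {x. a i \<bullet> x = b i}"
    if Y: "(convex hull S) facet_of W" and S: "S \<subseteq> V" and k: "H k \<notin> S" for S k
  proof -
    have sub: "convex hull S \<subseteq> W" by (rule facet_of_imp_subset[OF Y])
    have out: "x \<notin> convex hull S" if "x \<in> V" "x \<notin> S" for x
      by (rule extreme_point_not_in_hull[OF ext[OF that(1)] sub that(2)])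
    have "\<exists>j\<in>?J. convex hull S = W \<inter> {x. a' j \<bullet> x = b' j}"
      by (rule facet_of_halfspaces[OF _ WJ _ DW(8) Y]) (use finI normal n0 in \<open>auto simp: a'_def\<close>)
    then obtain j where j: "j \<in> ?J" "convex hull S = W \<inter> {x. a' j \<bullet> x = b' j}" by blast
    have "j \<noteq> None"
    proof
      assume "j = None"
      \<comment> \<open>The base plane contains all \<open>H k\<close>, one of which is not a vertex of this face.\<close>
      then have "H k \<in> convex hull S" using j(2) base[of k] VW V by (auto simp: a'_def b'_def)
      then show False using out[of "H k"] k V by blast
    qed
    then obtain i where i: "i \<in> I" "convex hull S = W \<inter> {x. a i \<bullet> x = b i}"
      using j by (auto simp: a'_def b'_def)
    have "a i \<bullet> x = b i" if "x \<in> S" for x using i(2) hull_inc[OF that, of convex] by blast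
    moreover have "a i \<bullet> x < b i" if "x \<in> V - S" for x
      using out[of x] le[OF i(1), of x] i(2) that VW by force
    ultimately show ?thesis using i by blast
  qed
  have facets: "(convex hull {H 1, H 2, T 1}) facet_of W" "(convex hull {H 4, H 1, T 1, T 2}) facet_of W"
    "(convex hull {H 3, H 4, T 2}) facet_of W" "(convex hull {H 2, H 3, T 2, T 1}) facet_of W"
    using w(4) by blast+
  obtain iA where iA: "iA \<in> I" "\<forall>x\<in>{H 1, H 2, T 1}. a iA \<bullet> x = b iA" "\<forall>x\<in>V - {H 1, H 2, T 1}. a iA \<bullet> x < b iA"
    "convex hull {H 1, H 2, T 1} = W \<inter> {x. a iA \<bullet> x = b iA}"
    using pick[OF facets(1), of 3] dis disT by (auto simp: V_def)
  obtain iB where iB: "iB \<in> I" "\<forall>x\<in>{H 4, H 1, T 1, T 2}. a iB \<bullet> x = b iB" "\<forall>x\<in>V - {H 4, H 1, T 1, T 2}. a iB \<bullet> x < b iB"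
    "convex hull {H 4, H 1, T 1, T 2} = W \<inter> {x. a iB \<bullet> x = b iB}"
    using pick[OF facets(2), of 3] dis disT by (auto simp: V_def)
  obtain iC where iC: "iC \<in> I" "\<forall>x\<in>{H 3, H 4, T 2}. a iC \<bullet> x = b iC" "\<forall>x\<in>V - {H 3, H 4, T 2}. a iC \<bullet> x < b iC"
    "convex hull {H 3, H 4, T 2} = W \<inter> {x. a iC \<bullet> x = b iC}"
    using pick[OF facets(3), of 1] dis disT by (auto simp: V_def)
  obtain iD where iD: "iD \<in> I" "\<forall>x\<in>{H 2, H 3, T 2, T 1}. a iD \<bullet> x = b iD" "\<forall>x\<in>V - {H 2, H 3, T 2, T 1}. a iD \<bullet> x < b iD"
    "convex hull {H 2, H 3, T 2, T 1} = W \<inter> {x. a iD \<bullet> x = b iD}"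
    using pick[OF facets(4), of 1] dis disT by (auto simp: V_def)
  have eqA: "a iA \<bullet> H 1 = b iA" "a iA \<bullet> H 2 = b iA" "a iA \<bullet> T 1 = b iA"
      "a iA \<bullet> H 3 < b iA" "a iA \<bullet> H 4 < b iA" "a iA \<bullet> T 2 < b iA"
    using iA(2,3) dis disT disT[symmetric] by (auto simp: V_def)
  have eqB: "a iB \<bullet> H 4 = b iB" "a iB \<bullet> H 1 = b iB" "a iB \<bullet> T 1 = b iB" "a iB \<bullet> T 2 = b iB"
      "a iB \<bullet> H 2 < b iB" "a iB \<bullet> H 3 < b iB"
    using iB(2,3) dis disT by (auto simp: V_def)
  have eqC: "a iC \<bullet> H 3 = b iC" "a iC \<bullet> H 4 = b iC" "a iC \<bullet> T 2 = b iC"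
      "a iC \<bullet> H 1 < b iC" "a iC \<bullet> H 2 < b iC" "a iC \<bullet> T 1 < b iC"
    using iC(2,3) dis disT disT[symmetric] by (auto simp: V_def)
  have eqD: "a iD \<bullet> H 2 = b iD" "a iD \<bullet> H 3 = b iD" "a iD \<bullet> T 1 = b iD" "a iD \<bullet> T 2 = b iD"
      "a iD \<bullet> H 1 < b iD" "a iD \<bullet> H 4 < b iD"
    using iD(2,3) dis disT by (auto simp: V_def)
  have idx: "iA \<noteq> iB" "iA \<noteq> iC" "iA \<noteq> iD" "iB \<noteq> iC" "iB \<noteq> iD" "iC \<noteq> iD"
    using eqA eqB eqC eqD by auto
  have others: "a i \<bullet> x < b i" if i: "i \<in> I" "i \<notin> {iA, iB, iC, iD}" and x: "x \<in> ?C" "?d < ?n \<bullet> x" for i x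
  proof (rule ccontr)
    assume "\<not> a i \<bullet> x < b i"
    then have ax: "a i \<bullet> x = b i" using x(1) i(1) by (force simp: cap_def)
    let ?S = "?C \<inter> {x. a i \<bullet> x = b i}"
    have fi: "i facet_of P" using i by (simp add: I_def)
    have iS: "i \<subseteq> ?S" using facet_iff[OF fi] Pi by blast
    \<comment> \<open>The face \<open>i\<close> has dimension 2, and so has the part of its plane section that lies above the base.\<close>
    have "2 \<le> aff_dim ?S" using aff_dim_subset[OF iS] facet_dim[OF P fi] by simp
    moreover have "aff_dim (?S \<inter> {x. ?d < ?n \<bullet> x}) = aff_dim ?S"
      by (rule aff_dim_convex_Int_open) (use x ax in \<open>auto intro: convex_Int convex_cap convex_hyperplane open_halfspace_gt\<close>)
    moreover have "?S \<inter> {x. ?d < ?n \<bullet> x} \<subseteq> W \<inter> {x. a i \<bullet> x = b i}" unfolding W_eq by auto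
    from aff_dim_subset[OF this]
    have "aff_dim (?S \<inter> {x. ?d < ?n \<bullet> x}) \<le> aff_dim (W \<inter> {x. a i \<bullet> x = b i})" .
    moreover have "W \<inter> {x. a i \<bullet> x = b i} \<subseteq> {x. a i \<bullet> x = b i}" by blast
    from aff_dim_subset[OF this] have "aff_dim (W \<inter> {x. a i \<bullet> x = b i}) \<le> 2"
      using normal[OF i(1)] by (simp add: aff_dim_hyperplane)
    ultimately have dim: "aff_dim (W \<inter> {x. a i \<bullet> x = b i}) = 2" by simp
    have "(W \<inter> {x. a i \<bullet> x = b i}) face_of W"
      by (rule face_of_Int_supporting_hyperplane_le[OF DW(3)]) (rule le[OF i(1)])
    then have "(W \<inter> {x. a i \<bullet> x = b i}) facet_of W"
      using dim DW(7) by (auto simp: facet_of_def)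
    then have mem: "W \<inter> {x. a i \<bullet> x = b i} \<in> {convex hull (range H), convex hull {H 1, H 2, T 1}, convex hull {H 2, H 3, T 2, T 1},
        convex hull {H 3, H 4, T 2}, convex hull {H 4, H 1, T 1, T 2}}"
      unfolding w(4)[symmetric] by (rule CollectI)
    have "x \<in> W \<inter> {x. a i \<bullet> x = b i}" using x ax Wi by auto
    moreover have "x \<notin> convex hull (range H)" using x(2) unfolding HF Fi by auto
    ultimately have "W \<inter> {x. a i \<bullet> x = b i} \<noteq> convex hull (range H)" by metis
    with mem have "W \<inter> {x. a i \<bullet> x = b i} = W \<inter> {x. a iA \<bullet> x = b iA} \<or> W \<inter> {x. a i \<bullet> x = b i} = W \<inter> {x. a iD \<bullet> x = b iD} \<or>
      W \<inter> {x. a i \<bullet> x = b i} = W \<inter> {x. a iC \<bullet> x = b iC} \<or> W \<inter> {x. a i \<bullet> x = b i} = W \<inter> {x. a iB \<bullet> x = b iB}"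
      unfolding iA(4) iB(4) iC(4) iD(4) insert_iff by (simp only: empty_iff simp_thms)
    then have "\<exists>i'\<in>{iA, iB, iC, iD}. W \<inter> {x. a i \<bullet> x = b i} = W \<inter> {x. a i' \<bullet> x = b i'}"
      by (elim disjE) (rule bexI, assumption, simp)+
    then obtain i' where i': "i' \<in> {iA, iB, iC, iD}" "W \<inter> {x. a i \<bullet> x = b i} = W \<inter> {x. a i' \<bullet> x = b i'}" by blast
    have i'I: "i' \<in> I" using i'(1) iA(1) iB(1) iC(1) iD(1) by auto
    have "{x. a i \<bullet> x = b i} = {x. a i' \<bullet> x = b i'}"
      by (rule supporting_halfspace_unique(2)[OF w(1) normal[OF i(1)] _ normal[OF i'I] _ dim])
        (use le i(1) i'I i'(2) in blast)+
    then have "x \<in> i \<longleftrightarrow> x \<in> i'" for x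
      using facet_iff[of i] facet_iff[of i'] i(1) i'I unfolding I_def by blast
    then have "i = i'" by blast
    then show False using i(2) i'(1) by blast
  qed
  have bd: "bounded ?C"
  proof (rule bounded_subset)
    show "bounded (P \<union> W)" using convex_polyhedronD(5)[OF P] DW(5) by simp
    show "?C \<subseteq> P \<union> W" using Pi Wi by force
  qed
  have in_cap: "x \<in> ?C" if "x \<in> V" for x using VW Wi that by blast
  have inner: "\<exists>x. a i \<bullet> x = b i \<and> (\<forall>j\<in>I - {i}. a j \<bullet> x < b j) \<and> ?n \<bullet> x < ?d" if i: "i \<in> I" for i
  proof -
    have fi: "i facet_of P" "F \<noteq> i" using i by (auto simp: I_def)
    obtain x where "x \<in> i" "\<And>Y. Y facet_of P \<Longrightarrow> Y \<noteq> i \<Longrightarrow> a Y \<bullet> x < b Y" using facet_interior_point[OF fi(1)] by blast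
    then show ?thesis using facet_iff[OF fi(1)] F fi(2) by (intro exI[of _ x]) (simp add: I_def)
  qed
  have base_inner: "\<exists>x. ?n \<bullet> x = ?d \<and> (\<forall>i\<in>I. a i \<bullet> x < b i)"
  proof -
    obtain x where "x \<in> F" "\<And>Y. Y facet_of P \<Longrightarrow> Y \<noteq> F \<Longrightarrow> a Y \<bullet> x < b Y" using facet_interior_point[OF F] by blast
    then show ?thesis using Fi by (intro exI[of _ x]) (simp add: I_def)
  qed
  have card: "Suc (card I) = num_faces P"
    unfolding num_faces_def I_def using card_Suc_Diff1[OF convex_polyhedronD(11)[OF P]] F by simp
  have min': "melzak P \<le> melzak R" if "convex_polyhedron R" "num_faces R \<le> Suc (card I)" for R
    using min that card by simp
  have edges: "(\<Sum>i\<in>I. girth (side I a b i \<inter> {x. ?n \<bullet> x \<le> ?d})) + girth (?C \<inter> {x. ?n \<bullet> x = ?d}) = 2 * total_edge_length P"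
  proof -
    have "side I a b i \<inter> {x. ?n \<bullet> x \<le> ?d} = i" if "i \<in> I" for i
    proof -
      have "x \<in> side I a b i \<inter> {x. ?n \<bullet> x \<le> ?d} \<longleftrightarrow> x \<in> i" for x
        using facet_iff[of i x] that Pi[of x] by (auto simp: side_def I_def)
      then show ?thesis by blast
    qed
    then have "(\<Sum>i\<in>I. girth (side I a b i \<inter> {x. ?n \<bullet> x \<le> ?d})) = (\<Sum>i\<in>I. girth i)" by simp
    moreover have "?C \<inter> {x. ?n \<bullet> x = ?d} = F" using Fi Pi by auto
    ultimately show ?thesis
      using total_edge_length_girth[OF P] sum.remove[OF convex_polyhedronD(11)[OF P], of F girth] F by (simp add: I_def)
  qed
  have num: "(5 :: 4) = 1" "(6 :: 4) = 2" by simp_all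
  have ac: "dihedral_angle (H 3) (H 4) (H 1) (T 2) < pi / 2" "dihedral_angle (H 4) (H 1) (H 2) (T 2) < pi / 2"
    "dihedral_angle (H 2) (H 3) (H 4) (T 1) < pi / 2" "dihedral_angle (H 1) (H 2) (H 3) (T 1) < pi / 2"
    using acute[of 3] acute[of 4] acute[of 2] acute[of 1] num by (simp_all add: top_at_def)
  have ac': "dihedral_angle (H 1) (H 2) (H 3) (T 1) < pi / 2" "dihedral_angle (H 2) (H 3) (H 4) (T 1) < pi / 2"
    "dihedral_angle (H 4) (H 1) (H 2) (T 2) < pi / 2" by (fact ac)+
  have cp: "H 1 \<in> ?C" "H 2 \<in> ?C" "H 3 \<in> ?C" "H 4 \<in> ?C" "T 1 \<in> ?C" "T 2 \<in> ?C"
    using in_cap by (auto simp: V_def)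
  have "acute_wedge I a b ?n ?d iA iB iC iD (H 1) (H 2) (H 3) (H 4) (T 1) (T 2) P (total_edge_length P)"
    if "?n \<bullet> T 1 \<le> ?n \<bullet> T 2"
  proof unfold_locales
    show "a i \<bullet> x < b i" if "i \<in> I - {iA, iB, iC, iD}" "x \<in> ?C" "?d < ?n \<bullet> x" for i x using others that by blast
  qed (fact finI bd iA(1) iB(1) iC(1) iD(1) idx eqA eqB eqC eqD base top that cp normal inner base_inner P_eq P vol min' refl edges ac | rule refl)+
  moreover have "acute_wedge I a b ?n ?d iC iD iA iB (H 3) (H 4) (H 1) (H 2) (T 2) (T 1) P (total_edge_length P)"
    if "?n \<bullet> T 2 \<le> ?n \<bullet> T 1"
  proof unfold_locales
    show "a i \<bullet> x < b i" if "i \<in> I - {iC, iD, iA, iB}" "x \<in> ?C" "?d < ?n \<bullet> x" for i x using others that by blast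
  qed (fact finI bd iA(1) iB(1) iC(1) iD(1) idx idx[symmetric] eqA eqB eqC eqD base top that cp normal inner base_inner P_eq P vol min' refl edges ac | rule refl)+
  ultimately show ?thesis by blast
qed

end

lemma good_wedge_not_small:
  assumes P: "convex_polyhedron P" and vol: "measure lebesgue P = 1"
    and min: "\<And>R. convex_polyhedron R \<Longrightarrow> num_faces R \<le> num_faces P \<Longrightarrow> melzak P \<le> melzak R"
    and good: "good_protruding_wedge P F H T"
    and D: "P \<subseteq> cball p D" and K: "0 < K" "8 * total_edge_length P * (measure lebesgue (cball p (D + 1)))\<^sup>2 \<le> K"
    and E: "\<And>x y. x \<in> range H \<union> range T \<Longrightarrow> y \<in> range H \<union> range T \<Longrightarrow> dist x y \<le> E"
  shows "1 \<le> 80 * K * E \<or> 1 \<le> 14112 * K * total_edge_length P * E ^ 3"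
proof -
  obtain a b where "\<forall>X. X facet_of P \<longrightarrow> a X \<noteq> 0 \<and> P \<subseteq> {x. a X \<bullet> x \<le> b X} \<and> X = P \<inter> {x. a X \<bullet> x = b X}"
    using facet_halfspaces[OF P] by blast
  then interpret facet_normals P a b using P by unfold_locales blast+
  obtain iA iB iC iD where w:
    "a F \<bullet> T 1 \<le> a F \<bullet> T 2 \<Longrightarrow> acute_wedge ({X. X facet_of P} - {F}) a b (a F) (b F) iA iB iC iD (H 1) (H 2) (H 3) (H 4) (T 1) (T 2) P (total_edge_length P)"
    "a F \<bullet> T 2 \<le> a F \<bullet> T 1 \<Longrightarrow> acute_wedge ({X. X facet_of P} - {F}) a b (a F) (b F) iC iD iA iB (H 3) (H 4) (H 1) (H 2) (T 2) (T 1) P (total_edge_length P)"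
    using acute_wedge_exists[OF good vol min] by blast
  show ?thesis
  proof (cases "a F \<bullet> T 1 \<le> a F \<bullet> T 2")
    case True
    show ?thesis by (rule acute_wedge.wedge_not_small[OF w(1)[OF True] D K]; rule E; blast)
  next
    case False
    then have le: "a F \<bullet> T 2 \<le> a F \<bullet> T 1" by simp
    show ?thesis by (rule acute_wedge.wedge_not_small[OF w(2)[OF le] D K]; rule E; blast)
  qed
qed

section \<open>Scaling and limits\<close>

lemma scaling_invariance:
  assumes Q: "convex_polyhedron Q" and c: "0 < c" and P: "P = (\<lambda>x. c *\<^sub>R x) ` Q"
  shows "convex_polyhedron P" "num_faces P = num_faces Q" "melzak P = melzak Q"
proof -
  let ?f = "\<lambda>x :: pt. c *\<^sub>R x"
  have lin: "linear ?f" by (rule linearI) (simp_all add: scaleR_add_right)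
  have inj: "inj ?f" using c by (auto intro!: injI)
  note DQ = convex_polyhedronD[OF Q]
  have "interior P = ?f ` interior Q" unfolding P by (rule interior_injective_linear_image[OF lin inj])
  then show cP: "convex_polyhedron P"
    unfolding convex_polyhedron_def using polytope_linear_image[OF lin DQ(1)] DQ(8) by (simp add: P)
  have faces: "\<exists>Y. X = ?f ` Y \<and> Y face_of Q" if "X face_of P" for X
  proof -
    have "X \<subseteq> ?f ` Q" using face_of_imp_subset[OF that] by (simp only: P)
    then obtain Y where Y: "X = ?f ` Y" using subset_imageE by metis
    have "Y face_of Q" using that unfolding P Y by (simp only: face_of_linear_image[OF lin inj])
    then show ?thesis using Y by blast
  qed
  have dim: "aff_dim (?f ` Y) = aff_dim Y" for Y by (rule aff_dim_injective_linear_image[OF lin inj])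
  have injI: "inj_on ((`) ?f) A" for A using inj by (intro inj_onI) (simp add: inj_image_eq_iff)
  have fac: "{X. X facet_of P} = (`) ?f ` {Y. Y facet_of Q}"
  proof (intro equalityI subsetI)
    fix X assume X: "X \<in> {X. X facet_of P}"
    then obtain Y where Y: "X = ?f ` Y" "Y face_of Q" using faces[of X] facet_of_imp_face_of[of X P] by blast
    have "Y facet_of Q" using X Y dim[of Y] dim[of Q] by (auto simp: facet_of_def P)
    then show "X \<in> (`) ?f ` {Y. Y facet_of Q}" using Y(1) by blast
  next
    fix X assume "X \<in> (`) ?f ` {Y. Y facet_of Q}"
    then obtain Y where Y: "X = ?f ` Y" "Y facet_of Q" by blast
    then show "X \<in> {X. X facet_of P}"
      using dim[of Y] dim[of Q] by (auto simp: facet_of_def P face_of_linear_image[OF lin inj])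
  qed
  show "num_faces P = num_faces Q" unfolding num_faces_def fac by (rule card_image[OF injI])
  have edg: "{L. L edge_of P} = (`) ?f ` {L. L edge_of Q}"
  proof (intro equalityI subsetI)
    fix X assume X: "X \<in> {X. X edge_of P}"
    then obtain Y where Y: "X = ?f ` Y" "Y face_of Q" using faces[of X] by (auto simp: edge_of_def)
    have "Y edge_of Q" using X Y dim[of Y] by (auto simp: edge_of_def)
    then show "X \<in> (`) ?f ` {Y. Y edge_of Q}" using Y(1) by blast
  next
    fix X assume "X \<in> (`) ?f ` {Y. Y edge_of Q}"
    then obtain Y where Y: "X = ?f ` Y" "Y edge_of Q" by blast
    then show "X \<in> {X. X edge_of P}"
      using dim[of Y] by (auto simp: edge_of_def P face_of_linear_image[OF lin inj])
  qed
  have "total_edge_length P = (\<Sum>L | L edge_of Q. diameter (?f ` L))"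
    unfolding total_edge_length_def edg by (simp add: sum.reindex[OF injI])
  also have "\<dots> = (\<Sum>L | L edge_of Q. c * diameter L)"
  proof (rule sum.cong[OF refl])
    fix L assume "L \<in> {L. L edge_of Q}"
    then obtain x y where L: "L = closed_segment x y" using edge_segment[of L Q, OF _ DQ(1)] by blast
    have "?f ` L = closed_segment (c *\<^sub>R x) (c *\<^sub>R y)" unfolding L by (simp only: closed_segment_linear_image[OF lin])
    then show "diameter (?f ` L) = c * diameter L"
      using c by (simp add: L diameter_closed_segment dist_norm scaleR_diff_right[symmetric])
  qed
  finally have e: "total_edge_length P = c * total_edge_length Q" by (simp add: total_edge_length_def sum_distrib_left)
  have v: "measure lebesgue P = c ^ 3 * measure lebesgue Q"
    unfolding P using measure_lebesgue_affine[of c 0 Q] c by simp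
  show "melzak P = melzak Q" unfolding melzak_def e v using c by (simp add: power_mult_distrib)
qed

lemma rigid_motion_dist: "rigid_motion g \<Longrightarrow> dist (g x) (g y) = dist x y"
proof -
  assume "rigid_motion g"
  then obtain a f where f: "orthogonal_transformation f" "g = (\<lambda>x. a + f x)" by (auto simp: rigid_motion_def)
  have "f x - f y = f (x - y)" using linear_diff[OF orthogonal_transformation_linear[OF f(1)]] by simp
  then show ?thesis using orthogonal_transformation_norm[OF f(1), of "x - y"] by (simp add: f(2) dist_norm)
qed

text \<open>Convergent sequences are bounded, and apart from a rigid motion the normalization only divides by the longest base edge.\<close>

lemma normalized_limit_bound:
  assumes lim: "normalized_limit Hs Ts H T u1 u2" and pos: "\<And>i. 0 < longest_base_edge (Hs i)"
  shows "\<exists>S\<ge>0. \<forall>i. \<forall>x\<in>range (Hs i) \<union> range (Ts i). \<forall>y\<in>range (Hs i) \<union> range (Ts i). dist x y \<le> S * longest_base_edge (Hs i)"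
proof -
  obtain g Hn Tn where g: "\<And>i. rigid_motion (g i)"
      and Hn: "\<And>i k. Hn i k = g i (Hs i k /\<^sub>R longest_base_edge (Hs i))"
      and Tn: "\<And>i t. Tn i t = g i (Ts i t /\<^sub>R longest_base_edge (Hs i))"
      and HL: "\<And>k. (\<lambda>i. Hn i k) \<longlonglongrightarrow> H k" and TL: "\<And>t. (\<lambda>i. Tn i t) \<longlonglongrightarrow> T t"
    using lim unfolding normalized_limit_def by blast
  have bnd: "\<exists>B. \<forall>i. norm (f i) \<le> B" if "f \<longlonglongrightarrow> l" for f :: "nat \<Rightarrow> pt" and l
    using convergent_imp_Bseq[OF convergentI[OF that]] by (auto simp: Bseq_def)
  have "\<forall>k. \<exists>B. \<forall>i. norm (Hn i k) \<le> B" using bnd[OF HL] by blast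
  then obtain BH where BH: "\<And>i k. norm (Hn i k) \<le> BH k" by metis
  have "\<forall>t. \<exists>B. \<forall>i. norm (Tn i t) \<le> B" using bnd[OF TL] by blast
  then obtain BT where BT: "\<And>i t. norm (Tn i t) \<le> BT t" by metis
  define S where "S = max (Max (range BH)) (Max (range BT))"
  have SH: "norm (Hn i k) \<le> S" for i k
  proof -
    have "BH k \<le> Max (range BH)" by (rule Max_ge) simp_all
    moreover have "Max (range BH) \<le> S" by (simp add: S_def)
    ultimately show ?thesis using BH[of i k] by linarith
  qed
  have ST: "norm (Tn i t) \<le> S" for i t
  proof -
    have "BT t \<le> Max (range BT)" by (rule Max_ge) simp_all
    moreover have "Max (range BT) \<le> S" by (simp add: S_def)
    ultimately show ?thesis using BT[of i t] by linarith
  qed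
  have S0: "0 \<le> S" using SH[of 0 1] norm_ge_zero[of "Hn 0 1"] by linarith
  have "dist x y \<le> (2 * S) * longest_base_edge (Hs i)"
    if xy: "x \<in> range (Hs i) \<union> range (Ts i)" "y \<in> range (Hs i) \<union> range (Ts i)" for i x y
  proof -
    let ?l = "longest_base_edge (Hs i)"
    have n: "norm (g i (z /\<^sub>R ?l)) \<le> S" if "z \<in> range (Hs i) \<union> range (Ts i)" for z
      using that SH[of i] ST[of i] unfolding Hn Tn by blast
    have "dist (x /\<^sub>R ?l) (y /\<^sub>R ?l) = dist (g i (x /\<^sub>R ?l)) (g i (y /\<^sub>R ?l))" by (simp only: rigid_motion_dist[OF g])
    also have "\<dots> \<le> norm (g i (x /\<^sub>R ?l)) + norm (g i (y /\<^sub>R ?l))" unfolding dist_norm by (rule norm_triangle_ineq4)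
    also have "\<dots> \<le> 2 * S" using n[OF xy(1)] n[OF xy(2)] by simp
    finally have "dist x y / ?l \<le> 2 * S"
      using pos[of i] by (simp add: dist_norm scaleR_diff_right[symmetric] divide_inverse mult.commute)
    then show ?thesis using pos[of i] by (simp add: pos_divide_le_eq)
  qed
  then show ?thesis using S0 by (intro exI[of _ "2 * S"]) simp
qed

lemma longest_base_edge_bounds:
  assumes "inj H" "bounded F" "range H \<subseteq> F"
  shows "0 < longest_base_edge H" "longest_base_edge H \<le> diameter F"
proof -
  have "dist (H 1) (H (1 + 1)) \<le> longest_base_edge H"
    unfolding longest_base_edge_def by (rule Max_ge) (simp, rule rangeI)
  moreover have "0 < dist (H 1) (H (1 + 1))" using assms(1) by (simp add: inj_eq)
  ultimately show "0 < longest_base_edge H" by linarith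
  have "longest_base_edge H \<in> range (\<lambda>k. dist (H k) (H (k + 1)))"
    unfolding longest_base_edge_def by (rule Max_in) auto
  then obtain k where "longest_base_edge H = dist (H k) (H (k + 1))" by blast
  then show "longest_base_edge H \<le> diameter F"
    using diameter_bounded_bound[OF assms(2)] assms(3) by (metis rangeI subsetD)
qed

text \<open>At unit volume the cube of the total edge length is the Melzak ratio, so that the constants of \<open>good_wedge_not_small\<close> can be chosen
  independently of \<open>i\<close>, while the wedges shrink to points.\<close>

lemma minimizer_has_no_small_wedges:
  fixes Q P F :: "nat \<Rightarrow> (real^3) set"
    and r :: "nat \<Rightarrow> nat"
    and Hs :: "nat \<Rightarrow> 4 \<Rightarrow> real^3" and Ts :: "nat \<Rightarrow> 2 \<Rightarrow> real^3"
  assumes Q_poly: "\<And>n. convex_polyhedron (Q n)"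
    and Q_bounded: "Bseq (\<lambda>n. melzak (Q n))"
    and Q_min: "\<And>n R. convex_polyhedron R \<Longrightarrow> num_faces R = num_faces (Q n) \<Longrightarrow> melzak (Q n) \<le> melzak R"
    and P_def: "\<And>i. \<exists>c>0. P i = (\<lambda>x. c *\<^sub>R x) ` Q (r i)"
    and P_vol: "\<And>i. measure lebesgue (P i) = 1"
    and F_wedge: "\<And>i. good_protruding_wedge (P i) (F i) (Hs i) (Ts i)"
    and F_size: "(\<lambda>i. diameter (F i)) \<longlonglongrightarrow> 0"
    and limit: "normalized_limit Hs Ts H T u1 u2"
  shows False
proof -
  have PQ: "convex_polyhedron (P i)" "num_faces (P i) = num_faces (Q (r i))" "melzak (P i) = melzak (Q (r i))" for i
    using P_def[of i] scaling_invariance[OF Q_poly[of "r i"]] by blast+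
  let ?e = "\<lambda>i. total_edge_length (P i)"
  obtain M where M: "\<And>n. norm (melzak (Q n)) \<le> M" using Q_bounded by (auto simp: Bseq_def)
  define D where "D = max 1 M"
  have eD: "?e i \<le> D" for i
  proof (rule ccontr)
    assume "\<not> ?e i \<le> D"
    then have e: "1 \<le> ?e i" "M < ?e i" by (auto simp: D_def)
    have "?e i \<le> ?e i ^ 3" by (rule self_le_power[OF e(1)]) simp
    also have "\<dots> = melzak (P i)" using P_vol by (simp add: melzak_def)
    also have "\<dots> \<le> M" using M[of "r i"] unfolding PQ(3) by simp
    finally show False using e(2) by simp
  qed
  have D1: "1 \<le> D" by (simp add: D_def)
  define V where "V = measure lebesgue (cball (0 :: pt) (D + 1))"
  define K where "K = 8 * D * V\<^sup>2 + 1"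
  have K: "0 < K" using D1 by (simp add: K_def add_nonneg_pos)
  have lab: "inj (Hs i)" "range (Hs i) \<subseteq> F i" "bounded (F i)" for i
  proof -
    have W: "good_wedge (Hs i) (Ts i)" "convex hull (range (Hs i)) = F i" "F i facet_of P i"
      using F_wedge[of i] by (auto simp: good_protruding_wedge_def quadrilateral_face_def)
    show "inj (Hs i)" using W(1) by (simp add: good_wedge_def wedge_def distinct_labels_def)
    show "range (Hs i) \<subseteq> F i" unfolding W(2)[symmetric] by (rule hull_subset)
    show "bounded (F i)" using bounded_subset[OF convex_polyhedronD(5)[OF PQ(1)[of i]] facet_of_imp_subset[OF W(3)]] .
  qed
  note l = longest_base_edge_bounds[OF lab(1,3,2)]
  obtain S where S: "0 \<le> S" "\<And>i x y. x \<in> range (Hs i) \<union> range (Ts i) \<Longrightarrow> y \<in> range (Hs i) \<union> range (Ts i) \<Longrightarrow>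
      dist x y \<le> S * longest_base_edge (Hs i)"
    using normalized_limit_bound[OF limit l(1)] by blast
  have alt: "1 \<le> 80 * K * (S * diameter (F i)) \<or> 1 \<le> 14112 * K * D * (S * diameter (F i)) ^ 3" for i
  proof -
    obtain p where p: "p \<in> P i" using convex_polyhedronD(9)[OF PQ(1)] by blast
    have e0: "0 \<le> ?e i" using diameter_le_total_edge_length[OF PQ(1) p p] by simp
    have sub: "P i \<subseteq> cball p D"
      using diameter_le_total_edge_length[OF PQ(1) p] eD[of i] by (fastforce simp: dist_norm)
    have "cball p (D + 1) = (+) p ` cball 0 (D + 1)" by (simp add: image_add_cball)
    then have V: "measure lebesgue (cball p (D + 1)) = V" by (simp only: V_def measure_translation)
    have "8 * ?e i * V\<^sup>2 \<le> 8 * D * V\<^sup>2" using eD[of i] by (intro mult_right_mono) auto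
    then have K2: "8 * ?e i * (measure lebesgue (cball p (D + 1)))\<^sup>2 \<le> K" by (simp add: V K_def)
    have min: "melzak (P i) \<le> melzak R" if "convex_polyhedron R" "num_faces R \<le> num_faces (P i)" for R
      by (rule minimizer_fewer_faces[OF _ that]) (use Q_min PQ in auto)
    have d: "S * longest_base_edge (Hs i) \<le> S * diameter (F i)" using l(2)[of i] S(1) by (rule mult_left_mono)
    have "1 \<le> 80 * K * (S * diameter (F i)) \<or> 1 \<le> 14112 * K * ?e i * (S * diameter (F i)) ^ 3"
      by (rule good_wedge_not_small[OF PQ(1) P_vol min F_wedge sub K K2]) (use S(2) d in \<open>blast intro: order_trans\<close>)+
    moreover have "14112 * K * ?e i * (S * diameter (F i)) ^ 3 \<le> 14112 * K * D * (S * diameter (F i)) ^ 3"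
    proof (rule mult_right_mono)
      show "14112 * K * ?e i \<le> 14112 * K * D" using eD[of i] K by (intro mult_left_mono) auto
      have "0 \<le> diameter (F i)" using l[of i] by linarith
      then show "0 \<le> (S * diameter (F i)) ^ 3" using S(1) by simp
    qed
    ultimately show ?thesis by linarith
  qed
  have "(\<lambda>i. 80 * K * (S * diameter (F i))) \<longlonglongrightarrow> 80 * K * (S * 0)" by (intro tendsto_intros F_size)
  then have "\<forall>\<^sub>F i in sequentially. 80 * K * (S * diameter (F i)) < 1" by (rule order_tendstoD) simp
  moreover have "(\<lambda>i. 14112 * K * D * (S * diameter (F i)) ^ 3) \<longlonglongrightarrow> 14112 * K * D * (S * 0) ^ 3" by (intro tendsto_intros F_size)
  then have "\<forall>\<^sub>F i in sequentially. 14112 * K * D * (S * diameter (F i)) ^ 3 < 1" by (rule order_tendstoD) simp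
  ultimately have "\<forall>\<^sub>F i :: nat in sequentially. False"
  proof eventually_elim
    case (elim i)
    then show False using alt[of i] by linarith
  qed
  then show False by simp
qed

theorem theorem3p9:
  fixes Q P F :: "nat \<Rightarrow> (real^3) set"
    and r :: "nat \<Rightarrow> nat"
    and Hs :: "nat \<Rightarrow> 4 \<Rightarrow> real^3" and Ts :: "nat \<Rightarrow> 2 \<Rightarrow> real^3"
    and H u1 u2 :: "4 \<Rightarrow> real^3" and T :: "2 \<Rightarrow> real^3"
  assumes Q_poly: "\<And>n. convex_polyhedron (Q n)"
    and Q_inf: "(\<lambda>n. melzak (Q n)) \<longlonglongrightarrow> (INF R \<in> {R. convex_polyhedron R}. melzak R)"
    and Q_faces: "\<And>n. \<not> same_up_to_scaling (Q n) (Q (Suc n)) \<Longrightarrow>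
          num_faces (Q n) < num_faces (Q (Suc n))"
    and Q_min: "\<And>n R. convex_polyhedron R \<Longrightarrow> num_faces R = num_faces (Q n) \<Longrightarrow>
          melzak (Q n) \<le> melzak R"
    and unbounded: "\<not> bdd_above (range (\<lambda>n. num_good_faces (Q n)))"
    and subseq: "strict_mono r"
    and P_def: "\<And>i. \<exists>c>0. P i = (\<lambda>x. c *\<^sub>R x) ` Q (r i)"
    and P_vol: "\<And>i. measure lebesgue (P i) = 1"
    and P_good: "strict_mono (\<lambda>i. num_good_faces (P i))"
    and F_wedge: "\<And>i. good_protruding_wedge (P i) (F i) (Hs i) (Ts i)"
    and F_size: "(\<lambda>i. diameter (F i)) \<longlonglongrightarrow> 0"
    and F_curv: "(\<lambda>i. associated_curvature (P i) (F i)) \<longlonglongrightarrow> 0"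
    and limit: "normalized_limit Hs Ts H T u1 u2"
  shows "(degenerate_wedge H T \<and> wedge_height H T = 0 \<and>
            wedge_body H T \<subseteq> affine hull (range H)) \<and>
         (\<forall>k. norm (side_vec H T k) - side_vec H T k \<bullet> (u1 k + u2 k)
            + norm (side_vec H T (k + 1)) - side_vec H T (k + 1) \<bullet> (u1 (k + 1) + u2 (k + 1)) = 0) \<and>
         T 1 = T 2"
proof -
  have "Bseq (\<lambda>n. melzak (Q n))" by (rule convergent_imp_Bseq[OF convergentI[OF Q_inf]])
  from minimizer_has_no_small_wedges[OF Q_poly this Q_min P_def P_vol F_wedge F_size limit]
  have False .
  then show ?thesis ..
qed

end
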